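(* Let $(A,H,\blacktriangleright,\rho,\chi,\psi)$ be a cocycle linked pair of Hopf algebras, where $A$ and $H$ are compact quantum groups and $\chi$ and $\psi$ are convolution invertible. Consider the map $\gamma:H\to A$ defined by $\gamma(x)=\sum\chi^{-1}\big(x_2,\mathcal S^{-1}(x_1)\big)$ for all $x\in H$. Let $\varphi_A$ and $\varphi_H$ be the normal integrals of $A$ and $H$ and let $\Phi:A^\psi\#_\chi H\to\mathbb C$ be the normal integral given by $\Phi(a\#x)=\varphi_A(a)\varphi_H(x)$. Assume that $\Phi$ is central, i.e. $\Phi((a\#x)(b\#y))=\Phi((b\#y)(a\#x))$ for all $a,b\in A$, $x,y\in H$. Suppose that the following hold for all $a\in A$, $x,y\in H$: (i) $\sum\gamma(x_2^* )\big(x_3^*\blacktriangleright\gamma(x_1)^*\big)=\varepsilon(x^* )1$; (ii) $\sum\gamma(x_2^* )\big(x_3^*\blacktriangleright(x_1\blacktriangleright a)^*\big)=a^*\gamma(x^* )$; (iii) $\sum\gamma(y_1^* )\big(y_2^*\blacktriangleright\gamma(x_1^* )\big)\chi(y_3^*,x_2^* )=\sum\gamma(y_2^*x_2^* )\big((y_3^*x_3^* )\blacktriangleright\chi(x_1,y_1)^*\big)$; (iv) $\sum(x_2^* )_H\otimes\gamma(x_1^* )(x_2^* )_A=\sum\big((x_1)_H\big)^*\otimes\gamma(x_2^* )\big(x_3^*\blacktriangleright((x_1)_A)^*\big)$; (v) $\sum\big(\gamma(x_1^* )\big)_1(x_2^* )_I\otimes\big(\gamma(x_1^* )\big)_2(x_2^*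 )_{II}=\sum\gamma\big(((x_2)_H)^*\big)\Big(((x_3)_H)^*\blacktriangleright((x_1)_I)^*\Big)\otimes\gamma(x_4^* )\Big(x_5^*\blacktriangleright\big((x_1)_{II}(x_2)_A(x_3)_A\big)^*\Big)$. Then $A^\psi\#_\chi H$ with the $*$-structure $(a\#x)^*=\sum\gamma(x_1^* )(x_2^*\blacktriangleright a^* )\#x_3^*$ is a compact quantum group.
   Context: All vector spaces are over $\mathbb C$; Sweedler notation is used; $\chi^{-1}$ is the convolution inverse of $\chi$; $\mathcal S$ is the antipode. A $*$-Hopf algebra is a Hopf algebra with a conjugate linear involution $*$ that is antimultiplicative and comultiplicative ($\Delta(x^* )=\sum x_1^*\otimes x_2^*$). A compact quantum group (CQG) is a $*$-Hopf algebra such that every right comodule $V$ admits an inner product (linear in the first variable) with $\sum\langle u_0,v\rangle\mathcal S(u_1)=\sum\langle u,v_0\rangle v_1^*$ for all $u,v\in V$. A normal integral on a Hopf algebra $K$ is a linear functional $\varphi$ with $\varphi(1)=1$ and $\sum\varphi(x_1)x_2=\varphi(x)1=\sum x_1\varphi(x_2)$ for all $x\in K$; every CQG has a unique one. A cocycle linked pair of bialgebras (of Hopf algebras) is a sextuple $(A,H,\blacktriangleright,\rho,\chi,\psi)$ with $A,H$ bialgebras (Hopf algebras) and linear maps $\blacktriangleright:H\otimes A\to A$; $\rho:H\to H\otimes A$, $\rho(x)=\sum x_H\otimes x_A$; $\chi:H\otimes H\to A$; $\psi:H\to A\otimes A$, $\psi(x)=\sum x_I\otimes x_{II}$, such that for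 all $x,y,z\in H$, $a,b\in A$ (notation: $x_{1H}=(x_1)_H$, $x_{H1}=(x_H)_1$, $x_{HA}=(x_H)_A$, $x_{I1}=(x_I)_1$, etc.): (1) $x\blacktriangleright1=\varepsilon(x)1$; $x\blacktriangleright ab=\sum(x_1\blacktriangleright a)(x_2\blacktriangleright b)$; $1\blacktriangleright a=a$; $\sum\big(x_1\blacktriangleright(y_1\blacktriangleright a)\big)\chi(x_2,y_2)=\sum\chi(x_1,y_1)\big((x_2y_2)\blacktriangleright a\big)$; $\sum\big(x_1\blacktriangleright\chi(y_1,z_1)\big)\chi(x_2,y_2z_2)=\sum\chi(x_1,y_1)\chi(x_2y_2,z)$; $\chi(x,1)=\chi(1,x)=\varepsilon(x)1$. (2) $\sum\varepsilon(x_H)x_A=\varepsilon(x)1$; $\sum x_{H1}\otimes x_{H2}\otimes x_A=\sum x_{1H}\otimes x_{2H}\otimes x_{1A}x_{2A}$; $\sum x_H\varepsilon(x_A)=x$; $\sum x_{2HH}\otimes x_{1I}x_{2HA}\otimes x_{1II}x_{2A}=\sum x_{1H}\otimes x_{1A1}x_{2I}\otimes x_{1A2}x_{2II}$; $\sum x_{1I1}x_{2HI}\otimes x_{1I2}x_{2HII}\otimes x_{1II}x_{2A}=\sum x_{1I}\otimes x_{1II1}x_{2I}\otimes x_{1II2}x_{2II}$; $\sum\varepsilon(x_I)x_{II}=\sum x_I\varepsilon(x_{II})=\varepsilon(x)1$. (3) $\varepsilon(x\blacktriangleright a)=\varepsilon(x)\varepsilon(a)$; $\rho(1)=1\otimes1$;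 $\varepsilon(\chi(x,y))=\varepsilon(x)\varepsilon(y)$; $\psi(1)=1\otimes1$; $\sum(x_1\blacktriangleright a)_1x_{2I}\otimes(x_1\blacktriangleright a)_2x_{2II}=\sum x_{1I}(x_{2H}\blacktriangleright a_1)\otimes x_{1II}x_{2A}(x_3\blacktriangleright a_2)$; $\sum(x_2y_2)_H\otimes\chi(x_1,y_1)(x_2y_2)_A=\sum x_{1H}y_{1H}\otimes x_{1A}(x_2\blacktriangleright y_{1A})\chi(x_3,y_2)$; $\sum x_{2H}\otimes(x_1\blacktriangleright a)x_{2A}=\sum x_{1H}\otimes x_{1A}(x_2\blacktriangleright a)$; $\sum\chi(x_1,y_1)_1(x_2y_2)_I\otimes\chi(x_1,y_1)_2(x_2y_2)_{II}=\sum x_{1I}(x_{2H}\blacktriangleright y_{1I})\chi(x_{4H},y_{2H})\otimes x_{1II}x_{2A}(x_3\blacktriangleright y_{1II})x_{4A}(x_5\blacktriangleright y_{2A})\chi(x_6,y_3)$. The cocycle bismash product $A^\psi\#_\chi H$ is the vector space $A\otimes H$ (elements $a\#x$) with product $(a\#x)(b\#y)=\sum a(x_1\blacktriangleright b)\chi(x_2,y_1)\#x_3y_2$, unit $1\#1$, coproduct $\Delta(a\#x)=\sum a_1x_{1I}\#x_{2H}\otimes a_2x_{1II}x_{2A}\#x_3$ and counit $\varepsilon\otimes\varepsilon$; it is a bialgebra, and a Hopf algebra when $A,H$ are Hopf algebras and $\chi,\psi$ are convolution invertible. *)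

theory Defs
  imports Complex_Main "HOL-Library.Poly_Mapping"
begin

section \<open>Complex vector spaces\<close>

class complex_vector = ab_group_add +
  fixes scaleC :: "complex \<Rightarrow> 'a \<Rightarrow> 'a" (infixr \<open>*\<^sub>C\<close> 75)
  assumes scaleC_add_right: "a *\<^sub>C (x + y) = a *\<^sub>C x + a *\<^sub>C y"
    and scaleC_add_left: "(a + b) *\<^sub>C x = a *\<^sub>C x + b *\<^sub>C x"
    and scaleC_scaleC: "a *\<^sub>C b *\<^sub>C x = (a * b) *\<^sub>C x"
    and scaleC_one: "1 *\<^sub>C x = x"

global_interpretation cvec: vector_space "scaleC :: complex \<Rightarrow> 'a \<Rightarrow> 'a :: complex_vector"
  by unfold_locales (simp_all add: scaleC_add_right scaleC_add_left scaleC_scaleC scaleC_one)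

abbreviation clinear :: "('a::complex_vector \<Rightarrow> 'b::complex_vector) \<Rightarrow> bool"
  where "clinear \<equiv> Vector_Spaces.linear scaleC scaleC"

definition conj_linear :: "('a::complex_vector \<Rightarrow> 'b::complex_vector) \<Rightarrow> bool"
  where "conj_linear f \<longleftrightarrow>
    (\<forall>x y. f (x + y) = f x + f y) \<and> (\<forall>c x. f (c *\<^sub>C x) = cnj c *\<^sub>C f x)"

lemma clinear_iff:
  "clinear f \<longleftrightarrow> (\<forall>x y. f (x + y) = f x + f y) \<and> (\<forall>c x. f (c *\<^sub>C x) = c *\<^sub>C f x)"
  by (auto simp: Vector_Spaces.linear_def module_hom_def module_hom_axioms_def
      cvec.module_axioms cvec.vector_space_axioms)

definition cbilinear ::
  "('a::complex_vector \<Rightarrow> 'b::complex_vector \<Rightarrow> 'c::complex_vector) \<Rightarrow> bool"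
  where "cbilinear f \<longleftrightarrow> (\<forall>x. clinear (f x)) \<and> (\<forall>y. clinear (\<lambda>x. f x y))"

instantiation complex :: complex_vector
begin

definition scaleC_complex :: "complex \<Rightarrow> complex \<Rightarrow> complex"
  where "scaleC_complex c z = c * z"

instance by standard (simp_all add: scaleC_complex_def algebra_simps)

end

instantiation poly_mapping :: (type, complex_vector) complex_vector
begin

lift_definition scaleC_poly_mapping :: "complex \<Rightarrow> ('a \<Rightarrow>\<^sub>0 'b) \<Rightarrow> 'a \<Rightarrow>\<^sub>0 'b"
  is "\<lambda>c f k. c *\<^sub>C f k"
  by (erule finite_subset[rotated]) auto

instance
  by standard (transfer, simp add: fun_eq_iff scaleC_add_right scaleC_add_left scaleC_scaleC scaleC_one)+

end

lemma lookup_scaleC: "Poly_Mapping.lookup (c *\<^sub>C p) k = c *\<^sub>C Poly_Mapping.lookup p k"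
  by transfer simp


section \<open>The algebraic tensor product\<close>

definition tensor_relations ::
  "(('a::complex_vector \<times> 'b::complex_vector) \<Rightarrow>\<^sub>0 complex) set"
  where "tensor_relations =
    {Poly_Mapping.single (u + u', v) 1 - Poly_Mapping.single (u, v) 1
       - Poly_Mapping.single (u', v) 1 |u u' v. True} \<union>
    {Poly_Mapping.single (u, v + v') 1 - Poly_Mapping.single (u, v) 1
       - Poly_Mapping.single (u, v') 1 |u v v'. True} \<union>
    {Poly_Mapping.single (c *\<^sub>C u, v) 1 - c *\<^sub>C Poly_Mapping.single (u, v) 1 |c u v. True} \<union>
    {Poly_Mapping.single (u, c *\<^sub>C v) 1 - c *\<^sub>C Poly_Mapping.single (u, v) 1 |c u v. True}"

definition tensor_equiv ::
  "(('a::complex_vector \<times> 'b::complex_vector) \<Rightarrow>\<^sub>0 complex) \<Rightarrow> ('a \<times> 'b \<Rightarrow>\<^sub>0 complex) \<Rightarrow> bool"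
  where "tensor_equiv p q \<longleftrightarrow> p - q \<in> cvec.span tensor_relations"

lemma equivp_tensor_equiv:
  "equivp (tensor_equiv :: (('a::complex_vector \<times> 'b::complex_vector) \<Rightarrow>\<^sub>0 complex) \<Rightarrow> _)"
    (is "equivp ?R")
proof (rule equivpI)
  show "reflp ?R"
    by (rule reflpI) (simp add: tensor_equiv_def cvec.span_zero)
  show "symp ?R"
  proof (rule sympI)
    fix p q :: "('a \<times> 'b) \<Rightarrow>\<^sub>0 complex"
    assume "tensor_equiv p q"
    then show "tensor_equiv q p"
      using cvec.span_neg[of "p - q"] unfolding tensor_equiv_def by simp
  qed
  show "transp ?R"
  proof (rule transpI)
    fix p q r :: "('a \<times> 'b) \<Rightarrow>\<^sub>0 complex"
    assume "tensor_equiv p q" "tensor_equiv q r"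
    then have "(p - q) + (q - r) \<in> cvec.span tensor_relations"
      unfolding tensor_equiv_def by (rule cvec.span_add)
    then show "tensor_equiv p r"
      by (simp add: tensor_equiv_def)
  qed
qed

quotient_type (overloaded) ('a, 'b) tensor (infixr \<open>\<otimes>\<close> 71) =
    "('a::complex_vector \<times> 'b::complex_vector) \<Rightarrow>\<^sub>0 complex" / tensor_equiv
  by (rule equivp_tensor_equiv)

instantiation tensor :: (complex_vector, complex_vector) complex_vector
begin

lift_definition zero_tensor :: "'a \<otimes> 'b" is 0 .

lift_definition plus_tensor :: "'a \<otimes> 'b \<Rightarrow> 'a \<otimes> 'b \<Rightarrow> 'a \<otimes> 'b" is "(+)"
  unfolding tensor_equiv_def by (metis add_diff_add cvec.span_add)

lift_definition uminus_tensor :: "'a \<otimes> 'b \<Rightarrow> 'a \<otimes> 'b" is uminus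
  unfolding tensor_equiv_def by (metis cvec.span_neg minus_diff_minus)

lift_definition minus_tensor :: "'a \<otimes> 'b \<Rightarrow> 'a \<otimes> 'b \<Rightarrow> 'a \<otimes> 'b" is "(-)"
  unfolding tensor_equiv_def
proof -
  fix p p' q q' :: "('a \<times> 'b) \<Rightarrow>\<^sub>0 complex"
  assume "p - p' \<in> cvec.span tensor_relations" "q - q' \<in> cvec.span tensor_relations"
  then have "(p - p') - (q - q') \<in> cvec.span tensor_relations"
    by (rule cvec.span_diff)
  then show "(p - q) - (p' - q') \<in> cvec.span tensor_relations"
    by (simp add: algebra_simps)
qed

lift_definition scaleC_tensor :: "complex \<Rightarrow> 'a \<otimes> 'b \<Rightarrow> 'a \<otimes> 'b" is scaleC
  unfolding tensor_equiv_def
  by (metis cvec.scale_right_diff_distrib cvec.span_scale)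

instance
proof
  fix a b c :: "'a \<otimes> 'b" and s t :: complex
  note refl = equivp_reflp[OF equivp_tensor_equiv]
  show "a + b + c = a + (b + c)" by transfer (simp add: refl add.assoc)
  show "a + b = b + a" by transfer (simp add: refl add.commute)
  show "0 + a = a" by transfer (simp add: refl)
  show "- a + a = 0" by transfer (simp add: refl)
  show "a - b = a + - b" by transfer (simp add: refl)
  show "s *\<^sub>C (a + b) = s *\<^sub>C a + s *\<^sub>C b" by transfer (simp add: refl scaleC_add_right)
  show "(s + t) *\<^sub>C a = s *\<^sub>C a + t *\<^sub>C a" by transfer (simp add: refl scaleC_add_left)
  show "s *\<^sub>C t *\<^sub>C a = (s * t) *\<^sub>C a" by transfer (simp add: refl scaleC_scaleC)
  show "1 *\<^sub>C a = a" by transfer (simp add: refl scaleC_one)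
qed

end

lift_definition tens :: "'a::complex_vector \<Rightarrow> 'b::complex_vector \<Rightarrow> 'a \<otimes> 'b" (infixr \<open>\<otimes>\<close> 66)
  is "\<lambda>u v. Poly_Mapping.single (u, v) 1" .

lemma tens_add_left: "(u + u') \<otimes> v = (u \<otimes> v) + (u' \<otimes> v)"
  by transfer (unfold tensor_equiv_def, rule cvec.span_base,
      unfold tensor_relations_def diff_diff_eq, blast)

lemma tens_add_right: "u \<otimes> (v + v') = (u \<otimes> v) + (u \<otimes> v')"
  by transfer (unfold tensor_equiv_def, rule cvec.span_base,
      unfold tensor_relations_def diff_diff_eq, blast)

lemma tens_scale_left: "(c *\<^sub>C u) \<otimes> v = c *\<^sub>C (u \<otimes> v)"
  by transfer (unfold tensor_equiv_def, rule cvec.span_base, unfold tensor_relations_def, blast)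

lemma tens_scale_right: "u \<otimes> (c *\<^sub>C v) = c *\<^sub>C (u \<otimes> v)"
  by transfer (unfold tensor_equiv_def, rule cvec.span_base, unfold tensor_relations_def, blast)

lemma cbilinear_tens: "cbilinear (\<otimes>)"
  by (simp add: cbilinear_def clinear_iff tens_add_left tens_add_right
      tens_scale_left tens_scale_right)

(* Sweedler sums: tsum t f is the sum of f u v over a decomposition of t into simple tensors
   u \<otimes> v. The coefficients are absorbed into the first factor, so that the value does not depend
   on the decomposition as soon as f is balanced in the sense below. This covers bilinear
   f, and also f that are conjugate linear in both arguments, as needed for formulas
   with stars. *)
definition tsum ::
  "'a::complex_vector \<otimes> 'b::complex_vector \<Rightarrow> ('a \<Rightarrow> 'b \<Rightarrow> 'c::ab_group_add) \<Rightarrow> 'c"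
  where "tsum t f = (\<Sum>k \<in> Poly_Mapping.keys (rep_tensor t).
    f (Poly_Mapping.lookup (rep_tensor t) k *\<^sub>C fst k) (snd k))"

definition balanced ::
  "('a::complex_vector \<Rightarrow> 'b::complex_vector \<Rightarrow> 'c::ab_group_add) \<Rightarrow> bool"
  where "balanced f \<longleftrightarrow>
    (\<forall>u u' v. f (u + u') v = f u v + f u' v) \<and>
    (\<forall>u v v'. f u (v + v') = f u v + f u v') \<and>
    (\<forall>c u v. f (c *\<^sub>C u) v = f u (c *\<^sub>C v))"

context
  fixes f :: "'a::complex_vector \<Rightarrow> 'b::complex_vector \<Rightarrow> 'c::ab_group_add"
  assumes f: "balanced f"
begin

private definition g :: "('a \<times> 'b \<Rightarrow>\<^sub>0 complex) \<Rightarrow> 'c"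
  where "g p = (\<Sum>k \<in> Poly_Mapping.keys p. f (Poly_Mapping.lookup p k *\<^sub>C fst k) (snd k))"

private lemma f_add: "f (u + u') v = f u v + f u' v" "f u (v + v') = f u v + f u v'"
  and f_scale: "f u (c *\<^sub>C v) = f (c *\<^sub>C u) v"
  using f by (simp_all add: balanced_def)

private lemma f_zero: "f 0 v = 0"
  using f_add(1)[of 0 0 v] by simp

private lemma g_add: "g (p + q) = g p + g q"
  unfolding g_def
  by (rule setsum_keys_plus_distrib[where f = "\<lambda>k a. f (a *\<^sub>C fst k) (snd k)"])
    (simp_all add: f_zero f_add scaleC_add_left)

private lemma g_diff: "g (p - q) = g p - g q"
  using g_add[of "p - q" q] by simp

private lemma g_single: "g (Poly_Mapping.single (u, v) a) = f (a *\<^sub>C u) v"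
  by (cases "a = 0") (simp_all add: g_def f_zero)

private lemma scaleC_single:
  "c *\<^sub>C Poly_Mapping.single k (a :: complex) = Poly_Mapping.single k (c * a)"
  by (rule poly_mapping_eqI) (simp add: lookup_scaleC lookup_single scaleC_complex_def when_def)

private lemma g_span: "p \<in> cvec.span tensor_relations \<Longrightarrow> \<forall>c. g (c *\<^sub>C p) = 0"
proof (induction rule: cvec.span_induct)
  case base
  show ?case
    by (auto simp: cvec.subspace_def g_add scaleC_add_right) (simp_all add: g_def)
next
  case (step p)
  then show ?case
    unfolding tensor_relations_def
    by (auto simp: cvec.scale_right_diff_distrib scaleC_single g_diff g_single f_add
        f_scale scaleC_add_right mult.commute)
qed

private lemma g_equiv: "tensor_equiv p q \<Longrightarrow> g p = g q"
  using g_span[of "p - q"] g_diff[of p q]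
  unfolding tensor_equiv_def by (metis eq_iff_diff_eq_0 scaleC_one)

private lemma tsum_abs: "tsum (abs_tensor p) f = g p"
proof -
  have "tensor_equiv (rep_tensor (abs_tensor p)) p"
    by (rule Quotient3_rep_abs[OF Quotient3_tensor]) (rule equivp_reflp[OF equivp_tensor_equiv])
  from g_equiv[OF this] show ?thesis by (simp add: tsum_def g_def)
qed

lemma tsum_tens: "tsum (u \<otimes> v) f = f u v"
  by (simp add: tens.abs_eq tsum_abs g_single)

lemma tsum_add: "tsum (s + t) f = tsum s f + tsum t f"
  by (induction s; induction t) (simp add: plus_tensor.abs_eq tsum_abs g_add)

end

lemma balanced_scale: "balanced f \<Longrightarrow> balanced (\<lambda>u v. f (c *\<^sub>C u) v)"
  by (simp add: balanced_def scaleC_add_right scaleC_scaleC mult.commute)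

lemma tsum_zero: "balanced f \<Longrightarrow> tsum 0 f = 0"
  using tsum_add[of f 0 0] by simp

lemma tsum_uminus: "balanced f \<Longrightarrow> tsum (- t) f = - tsum t f"
  using tsum_add[of f t "- t"] tsum_zero[of f] by (simp add: eq_neg_iff_add_eq_0 add.commute)

lemma tensor_induct [case_names zero add]:
  assumes "P 0" and step: "\<And>u v t. P t \<Longrightarrow> P ((u \<otimes> v) + t)"
  shows "P t"
proof -
  obtain p where p: "t = abs_tensor p"
    by (metis Quotient3_abs_rep Quotient3_tensor)
  have "P (abs_tensor p + t)" if "P t" for t
    using that
  proof (induction p arbitrary: t rule: update_induct)
    case const
    then show ?case by (simp flip: zero_tensor.abs_eq)
  next
    case (update q k c)
    obtain u v where k: "k = (u, v)" by (cases k)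
    have "Poly_Mapping.update k c q = Poly_Mapping.single k c + q"
      using update by (auto intro!: poly_mapping_eqI
        simp: lookup_update lookup_add lookup_single in_keys_iff when_def)
    moreover have "Poly_Mapping.single k c = c *\<^sub>C Poly_Mapping.single (u, v) 1"
      by (rule poly_mapping_eqI) (simp add: k lookup_scaleC lookup_single scaleC_complex_def when_def)
    ultimately have "abs_tensor (Poly_Mapping.update k c q) + t
        = ((c *\<^sub>C u) \<otimes> v) + (abs_tensor q + t)"
      by (simp add: tens_scale_left add.assoc plus_tensor.abs_eq[symmetric]
          scaleC_tensor.abs_eq[symmetric] tens.abs_eq[symmetric])
    then show ?case using update step by (simp add: add.assoc)
  qed
  from this[OF assms(1)] p show ?thesis by simp
qed

lemma cbilinear_imp_balanced: "cbilinear f \<Longrightarrow> balanced f"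
  by (simp add: cbilinear_def clinear_iff balanced_def)

lemma tsum_scaleC:
  assumes "balanced f"
  shows "tsum (c *\<^sub>C t) f = tsum t (\<lambda>u v. f (c *\<^sub>C u) v)"
proof (induction t rule: tensor_induct)
  case (add u v t)
  then show ?case
    by (simp add: scaleC_add_right tsum_add tsum_tens assms balanced_scale flip: tens_scale_left)
qed (simp add: tsum_zero assms balanced_scale)

lemma clinear_tsum:
  assumes "cbilinear f"
  shows "clinear (\<lambda>t. tsum t f)"
proof -
  note bal = cbilinear_imp_balanced[OF assms]
  have "tsum (c *\<^sub>C t) f = c *\<^sub>C tsum t f" for c t
    using assms
    by (induction t rule: tensor_induct)
      (simp_all add: bal tsum_zero tsum_add tsum_tens scaleC_add_right cbilinear_def clinear_iff
        flip: tens_scale_left)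
  then show ?thesis by (simp add: clinear_iff tsum_add bal)
qed

lemma tsum_unique:
  assumes "cbilinear f" "clinear g" "\<And>u v. g (u \<otimes> v) = f u v"
  shows "g t = tsum t f"
proof (induction t rule: tensor_induct)
  case zero
  have "g (0 + 0) = g 0 + g 0" using assms(2) unfolding clinear_iff by blast
  then show ?case by (simp add: tsum_zero cbilinear_imp_balanced assms)
next
  case (add u v t)
  then show ?case
    using assms by (simp add: clinear_iff tsum_add tsum_tens cbilinear_imp_balanced)
qed


section \<open>Bialgebras and Hopf algebras\<close>

record (overloaded) ('a::complex_vector) bialg =
  mul :: "'a \<Rightarrow> 'a \<Rightarrow> 'a" (infixl \<open>\<cdot>\<index>\<close> 70)
  unity :: "'a" (\<open>\<one>\<index>\<close>)
  comul :: "'a \<Rightarrow> 'a \<otimes> 'a"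
  counit :: "'a \<Rightarrow> complex" (\<open>\<epsilon>\<index>\<close>)

(* sw2 K x (\<lambda>x1 x2. f x1 x2) is the Sweedler sum of f over the coproduct of x in K,
   sw3, sw4, ... use the iterated coproduct. *)
definition sw2 :: "'k::complex_vector bialg \<Rightarrow> 'k \<Rightarrow> ('k \<Rightarrow> 'k \<Rightarrow> 'c::ab_group_add) \<Rightarrow> 'c"
  where "sw2 K x f = tsum (comul K x) f"

definition sw3 :: "'k::complex_vector bialg \<Rightarrow> 'k \<Rightarrow> ('k \<Rightarrow> 'k \<Rightarrow> 'k \<Rightarrow> 'c::ab_group_add) \<Rightarrow> 'c"
  where "sw3 K x f = sw2 K x (\<lambda>x1 y. sw2 K y (f x1))"

definition sw4 ::
  "'k::complex_vector bialg \<Rightarrow> 'k \<Rightarrow> ('k \<Rightarrow> 'k \<Rightarrow> 'k \<Rightarrow> 'k \<Rightarrow> 'c::ab_group_add) \<Rightarrow> 'c"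
  where "sw4 K x f = sw2 K x (\<lambda>x1 y. sw3 K y (f x1))"

definition sw5 ::
  "'k::complex_vector bialg \<Rightarrow> 'k \<Rightarrow> ('k \<Rightarrow> 'k \<Rightarrow> 'k \<Rightarrow> 'k \<Rightarrow> 'k \<Rightarrow> 'c::ab_group_add) \<Rightarrow> 'c"
  where "sw5 K x f = sw2 K x (\<lambda>x1 y. sw4 K y (f x1))"

definition sw6 ::
  "'k::complex_vector bialg \<Rightarrow> 'k \<Rightarrow>
    ('k \<Rightarrow> 'k \<Rightarrow> 'k \<Rightarrow> 'k \<Rightarrow> 'k \<Rightarrow> 'k \<Rightarrow> 'c::ab_group_add) \<Rightarrow> 'c"
  where "sw6 K x f = sw2 K x (\<lambda>x1 y. sw5 K y (f x1))"

locale bialgebra =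
  fixes K :: "'k::complex_vector bialg" (structure)
  assumes cbilinear_mul: "cbilinear (mul K)"
    and mul_assoc: "(x \<cdot> y) \<cdot> z = x \<cdot> (y \<cdot> z)"
    and mul_unity_left: "\<one> \<cdot> x = x"
    and mul_unity_right: "x \<cdot> \<one> = x"
    and clinear_comul: "clinear (comul K)"
    and clinear_counit: "clinear (counit K)"
    and coassoc: "sw2 K x (\<lambda>x1 x2. sw2 K x1 (\<lambda>x11 x12. x11 \<otimes> x12 \<otimes> x2)) =
      sw2 K x (\<lambda>x1 x2. sw2 K x2 (\<lambda>x21 x22. x1 \<otimes> x21 \<otimes> x22))"
    and counit_left: "sw2 K x (\<lambda>x1 x2. \<epsilon> x1 *\<^sub>C x2) = x"
    and counit_right: "sw2 K x (\<lambda>x1 x2. \<epsilon> x2 *\<^sub>C x1) = x"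
    and comul_mul: "comul K (x \<cdot> y) =
      sw2 K x (\<lambda>x1 x2. sw2 K y (\<lambda>y1 y2. (x1 \<cdot> y1) \<otimes> (x2 \<cdot> y2)))"
    and comul_unity: "comul K \<one> = \<one> \<otimes> \<one>"
    and counit_mul: "\<epsilon> (x \<cdot> y) = \<epsilon> x * \<epsilon> y"
    and counit_unity: "\<epsilon> \<one> = 1"

definition is_antipode :: "'k::complex_vector bialg \<Rightarrow> ('k \<Rightarrow> 'k) \<Rightarrow> bool"
  where "is_antipode K S \<longleftrightarrow> clinear S \<and>
    (\<forall>x. sw2 K x (\<lambda>x1 x2. S x1 \<cdot>\<^bsub>K\<^esub> x2) = \<epsilon>\<^bsub>K\<^esub> x *\<^sub>C \<one>\<^bsub>K\<^esub>) \<and>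
    (\<forall>x. sw2 K x (\<lambda>x1 x2. x1 \<cdot>\<^bsub>K\<^esub> S x2) = \<epsilon>\<^bsub>K\<^esub> x *\<^sub>C \<one>\<^bsub>K\<^esub>)"

locale hopf_algebra = bialgebra +
  assumes ex_antipode: "\<exists>S. is_antipode K S"

(* The antipode is unique when it exists, hence independent of the choice made by SOME. *)
definition antipode :: "'k::complex_vector bialg \<Rightarrow> 'k \<Rightarrow> 'k"
  where "antipode K = (SOME S. is_antipode K S)"

locale star_hopf_algebra = hopf_algebra K for K :: "'k::complex_vector bialg" (structure) +
  fixes star :: "'k \<Rightarrow> 'k"
  assumes conj_linear_star: "conj_linear star"
    and star_star: "star (star x) = x"
    and star_mul: "star (x \<cdot> y) = star y \<cdot> star x"
    and comul_star: "comul K (star x) = sw2 K x (\<lambda>x1 x2. star x1 \<otimes> star x2)"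


section \<open>Comodules and compact quantum groups\<close>

definition right_comodule ::
  "'k::complex_vector bialg \<Rightarrow> ('v::complex_vector \<Rightarrow> 'v \<otimes> 'k) \<Rightarrow> bool"
  where "right_comodule K \<delta> \<longleftrightarrow> clinear \<delta> \<and>
    (\<forall>v. tsum (\<delta> v) (\<lambda>v0 v1. tsum (\<delta> v0) (\<lambda>v00 v01. v00 \<otimes> v01 \<otimes> v1)) =
      tsum (\<delta> v) (\<lambda>v0 v1. sw2 K v1 (\<lambda>v11 v12. v0 \<otimes> v11 \<otimes> v12))) \<and>
    (\<forall>v. tsum (\<delta> v) (\<lambda>v0 v1. \<epsilon>\<^bsub>K\<^esub> v1 *\<^sub>C v0) = v)"

definition inner_product :: "('v::complex_vector \<Rightarrow> 'v \<Rightarrow> complex) \<Rightarrow> bool"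
  where "inner_product ip \<longleftrightarrow> (\<forall>v. clinear (\<lambda>u. ip u v)) \<and>
    (\<forall>u v. ip v u = cnj (ip u v)) \<and> (\<forall>u. u \<noteq> 0 \<longrightarrow> 0 < Re (ip u u))"

definition invariant_inner_product ::
  "'k::complex_vector bialg \<Rightarrow> ('k \<Rightarrow> 'k) \<Rightarrow> ('v::complex_vector \<Rightarrow> 'v \<otimes> 'k) \<Rightarrow>
    ('v \<Rightarrow> 'v \<Rightarrow> complex) \<Rightarrow> bool"
  where "invariant_inner_product K star \<delta> ip \<longleftrightarrow> inner_product ip \<and>
    (\<forall>u v. tsum (\<delta> u) (\<lambda>u0 u1. ip u0 v *\<^sub>C antipode K u1) =
      tsum (\<delta> v) (\<lambda>v0 v1. ip u v0 *\<^sub>C star v1))"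

(* A formula of HOL cannot quantify over all vector spaces, so the type carrying the
   comodules is a parameter; compact_quantum_group_universe below shows that the comodules
   carried by the type of K decide the property for every type. *)
definition compact_quantum_group ::
  "'v::complex_vector itself \<Rightarrow> 'k::complex_vector bialg \<Rightarrow> ('k \<Rightarrow> 'k) \<Rightarrow> bool"
  where "compact_quantum_group (_ :: 'v itself) K star \<longleftrightarrow> star_hopf_algebra K star \<and>
    (\<forall>\<delta> :: 'v \<Rightarrow> 'v \<otimes> 'k. right_comodule K \<delta> \<longrightarrow>
      (\<exists>ip. invariant_inner_product K star \<delta> ip))"

definition normal_integral :: "'k::complex_vector bialg \<Rightarrow> ('k \<Rightarrow> complex) \<Rightarrow> bool"
  where "normal_integral K \<phi> \<longleftrightarrow> clinear \<phi> \<and> \<phi> \<one>\<^bsub>K\<^esub> = 1 \<and>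
    (\<forall>x. sw2 K x (\<lambda>x1 x2. \<phi> x1 *\<^sub>C x2) = \<phi> x *\<^sub>C \<one>\<^bsub>K\<^esub>) \<and>
    (\<forall>x. sw2 K x (\<lambda>x1 x2. \<phi> x2 *\<^sub>C x1) = \<phi> x *\<^sub>C \<one>\<^bsub>K\<^esub>)"

lemma tsum_sum_left: "balanced f \<Longrightarrow> tsum (sum h F) f = (\<Sum>k\<in>F. tsum (h k) f)"
  by (induction F rule: infinite_finite_induct) (simp_all add: tsum_zero tsum_add)

lemma tsum_tsum:
  "balanced f \<Longrightarrow> tsum (tsum t g) f = tsum t (\<lambda>u v. tsum (g u v) f)"
  by (simp add: tsum_def[of t] tsum_sum_left)

lemma tsum_sum: "tsum t (\<lambda>u v. \<Sum>k\<in>F. f k u v) = (\<Sum>k\<in>F. tsum t (f k))"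
  unfolding tsum_def by (rule sum.swap)

lemma clinear_sum:
  assumes "clinear h"
  shows "h (sum g F) = (\<Sum>k\<in>F. h (g k))"
proof -
  have "h 0 = 0" using assms unfolding clinear_iff by (metis add_cancel_right_right)
  then show ?thesis
    using assms by (induction F rule: infinite_finite_induct) (simp_all add: clinear_iff)
qed

lemma clinear_tsum_map: "clinear h \<Longrightarrow> h (tsum t f) = tsum t (\<lambda>u v. h (f u v))"
  by (simp add: tsum_def clinear_sum)

lemma (in hopf_algebra) is_antipode_antipode: "is_antipode K (antipode K)"
  unfolding antipode_def using ex_antipode by (rule someI_ex)


theorem compact_quantum_group_universe:
  fixes K :: "'k::complex_vector bialg"
  assumes "compact_quantum_group TYPE('k) K star"
  shows "compact_quantum_group TYPE('v::complex_vector) K star"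
  unfolding compact_quantum_group_def
proof (intro conjI allI impI)
  from assms show "star_hopf_algebra K star" by (simp add: compact_quantum_group_def)
  then interpret star_hopf_algebra K star .
  have "right_comodule K (comul K)"
    using coassoc counit_right clinear_comul by (simp add: right_comodule_def sw2_def)
  with assms obtain ip where "invariant_inner_product K star (comul K) ip"
    unfolding compact_quantum_group_def by blast
  then have ip: "inner_product ip"
    and inv: "sw2 K x (\<lambda>x0 x1. ip x0 y *\<^sub>C antipode K x1) = sw2 K y (\<lambda>y0 y1. ip x y0 *\<^sub>C star y1)"
    for x y
    by (simp_all add: invariant_inner_product_def sw2_def)
  have ip_l: "clinear (\<lambda>u. ip u v)" and ip_c: "ip v u = cnj (ip u v)"
    and ip_pos: "u \<noteq> 0 \<Longrightarrow> 0 < Re (ip u u)" for u v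
    using ip unfolding inner_product_def by blast+
  have ip_add: "ip (x + x') y = ip x y + ip x' y" and ip_scale: "ip (c *\<^sub>C x) y = c * ip x y" for x x' y c
    using ip_l[of y] by (simp_all add: clinear_iff scaleC_complex_def)
  have ip_add2: "ip y (x + x') = ip y x + ip y x'" for x x' y
    using ip_c[of y] by (metis complex_cnj_add ip_add)
  have ip_scale2: "ip y (c *\<^sub>C x) = cnj c * ip y x" for x y c
    using ip_c[of y] by (metis complex_cnj_mult ip_scale)
  have ip_0: "ip 0 y = 0" "ip y 0 = 0" for y
    using ip_add[of 0 0 y] ip_add2[of y 0 0] by simp_all
  have S: "clinear (antipode K)"
    using is_antipode_antipode by (simp add: is_antipode_def)
  fix \<delta> :: "'v \<Rightarrow> 'v \<otimes> 'k"
  assume "right_comodule K \<delta>"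
  then have d: "clinear \<delta>"
    and d_coassoc: "tsum (\<delta> v) (\<lambda>v0 v1. tsum (\<delta> v0) (\<lambda>v00 v01. v00 \<otimes> v01 \<otimes> v1)) =
      tsum (\<delta> v) (\<lambda>v0 v1. sw2 K v1 (\<lambda>v11 v12. v0 \<otimes> v11 \<otimes> v12))"
    and d_counit: "tsum (\<delta> v) (\<lambda>v0 v1. \<epsilon>\<^bsub>K\<^esub> v1 *\<^sub>C v0) = v" for v
    unfolding right_comodule_def by blast+
  obtain B :: "'v set" where B: "cvec.independent B" "cvec.span B = UNIV"
    using cvec.independent_extend_basis[OF cvec.independent_empty]
      cvec.span_extend_basis[OF cvec.independent_empty] by blast
  define r where "r v b = cvec.representation B v b" for v b
  have r_add: "r (u + v) b = r u b + r v b" and r_scale: "r (c *\<^sub>C u) b = c * r u b" for u v b c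
    using B by (simp_all add: r_def cvec.representation_add cvec.representation_scale)
  have r_fin: "finite {b. r v b \<noteq> 0}" for v
    unfolding r_def by (rule cvec.finite_representation)
  have r_eq0: "v = 0" if "\<And>b. r v b = 0" for v
    using cvec.sum_nonzero_representation_eq[OF B(1), of v] B(2) that by (simp add: r_def)
  define a where "a b v = tsum (\<delta> v) (\<lambda>v0 v1. r v0 b *\<^sub>C v1)" for b v
  have bil: "cbilinear (\<lambda>v0 (v1 :: 'k). r v0 b *\<^sub>C v1)" for b
    by (simp add: cbilinear_def clinear_iff r_add r_scale scaleC_add_left scaleC_add_right
        scaleC_scaleC mult.commute)
  have a_lin: "a b (u + v) = a b u + a b v" "a b (c *\<^sub>C u) = c *\<^sub>C a b u" for b u v c
    using d clinear_tsum[OF bil[of b]] by (simp_all add: a_def clinear_iff)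
  have a_fin: "finite {b. a b v \<noteq> 0}" for v
  proof -
    have "finite {b. tsum t (\<lambda>v0 v1. r v0 b *\<^sub>C v1) \<noteq> 0}" for t :: "'v \<otimes> 'k"
    proof (induction t rule: tensor_induct)
      case zero
      then show ?case by (simp add: tsum_zero bil cbilinear_imp_balanced)
    next
      case (add u w t)
      show ?case
        by (rule finite_subset[OF _ finite_UnI[OF r_fin[of u] add]])
          (auto simp: tsum_add tsum_tens bil cbilinear_imp_balanced)
    qed
    then show ?thesis by (simp add: a_def)
  qed
  have comul_a: "comul K (a b v) = tsum (\<delta> v) (\<lambda>v0 v1. a b v0 \<otimes> v1)" for b v
  proof -
    let ?h = "\<lambda>(x::'v) (y :: 'k \<otimes> 'k). r x b *\<^sub>C y"
    have h: "cbilinear ?h"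
      by (simp add: cbilinear_def clinear_iff r_add r_scale scaleC_add_left scaleC_add_right
        scaleC_scaleC mult.commute)
    note h' = cbilinear_imp_balanced[OF h]
    have "tsum (\<delta> v) (\<lambda>v0 v1. a b v0 \<otimes> v1)
        = tsum (tsum (\<delta> v) (\<lambda>v0 v1. tsum (\<delta> v0) (\<lambda>v00 v01. v00 \<otimes> v01 \<otimes> v1))) ?h"
      unfolding a_def tsum_tsum[OF h'] tsum_tens[OF h']
      by (subst clinear_tsum_map[where h = "\<lambda>x. x \<otimes> _"])
        (simp_all add: clinear_iff tens_add_left tens_scale_left)
    also have "\<dots> = tsum (\<delta> v) (\<lambda>v0 v1. r v0 b *\<^sub>C comul K v1)"
    proof -
      have "tsum (comul K y) (\<lambda>y1 y2. r x b *\<^sub>C (y1 \<otimes> y2)) = r x b *\<^sub>C comul K y" for x y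
        using tsum_unique[of "\<lambda>y1 y2. r x b *\<^sub>C (y1 \<otimes> y2)" "\<lambda>t. r x b *\<^sub>C t" "comul K y"]
        by (simp add: cbilinear_def clinear_iff tens_add_left tens_add_right tens_scale_left
          tens_scale_right scaleC_add_right scaleC_scaleC mult.commute)
      then show ?thesis
        unfolding d_coassoc sw2_def tsum_tsum[OF h'] tsum_tens[OF h'] by simp
    qed
    also have "\<dots> = comul K (a b v)"
      unfolding a_def clinear_tsum_map[OF clinear_comul]
      using clinear_comul by (simp add: clinear_iff)
    finally show ?thesis by simp
  qed
  have counit_a: "counit K (a b v) = r v b" for b v
  proof -
    have "clinear (\<lambda>v. r v b)" by (simp add: clinear_iff r_add r_scale scaleC_complex_def)
    from clinear_tsum_map[OF this, of "\<delta> v" "\<lambda>v0 v1. \<epsilon>\<^bsub>K\<^esub> v1 *\<^sub>C v0"]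
    have "r v b = tsum (\<delta> v) (\<lambda>v0 v1. counit K v1 * r v0 b)"
      by (simp add: d_counit r_scale)
    also have "\<dots> = counit K (a b v)"
      unfolding a_def clinear_tsum_map[OF clinear_counit]
      using clinear_counit by (simp add: clinear_iff scaleC_complex_def mult.commute)
    finally show ?thesis by simp
  qed
  define q where "q u v = (\<Sum>b\<in>{b. a b u \<noteq> 0}. ip (a b u) (a b v))" for u v
  have q_eq: "q u v = (\<Sum>b\<in>F. ip (a b u) (a b v))"
    if "finite F" "\<And>b. b \<notin> F \<Longrightarrow> a b u = 0 \<or> a b v = 0" for u v F
  proof -
    have "q u v = (\<Sum>b\<in>{b. a b u \<noteq> 0} \<union> F. ip (a b u) (a b v))"
      unfolding q_def by (rule sum.mono_neutral_left) (auto simp: that a_fin ip_0)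
    also have "\<dots> = (\<Sum>b\<in>F. ip (a b u) (a b v))"
      by (rule sum.mono_neutral_right) (use that a_fin in \<open>auto dest!: that(2) simp: ip_0\<close>)
    finally show ?thesis .
  qed
  have "inner_product q"
    unfolding inner_product_def
  proof (intro conjI allI impI)
    fix v
    have q1: "q u v = (\<Sum>b\<in>{b. a b v \<noteq> 0}. ip (a b u) (a b v))" for u
      by (rule q_eq) (auto simp: a_fin)
    show "clinear (\<lambda>u. q u v)"
      by (simp add: clinear_iff q1 a_lin ip_add ip_scale sum.distrib sum_distrib_left scaleC_complex_def)
  next
    fix u v
    have "q u v = (\<Sum>b\<in>{b. a b v \<noteq> 0}. ip (a b u) (a b v))"
      by (rule q_eq) (auto simp: a_fin)
    then show "q v u = cnj (q u v)" by (simp add: q_def flip: ip_c)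
  next
    fix u :: 'v
    assume "u \<noteq> 0"
    then obtain b where "r u b \<noteq> 0" using r_eq0 by blast
    then have "a b u \<noteq> 0" using counit_a[of b u] clinear_counit
      by (metis clinear_iff add_cancel_right_right)
    then show "0 < Re (q u u)"
      unfolding q_def Re_sum by (intro sum_pos) (auto simp: a_fin intro: ip_pos)
  qed
  moreover have "tsum (\<delta> u) (\<lambda>u0 u1. q u0 v *\<^sub>C antipode K u1) =
      tsum (\<delta> v) (\<lambda>v0 v1. q u v0 *\<^sub>C star v1)" for u v
  proof -
    define F where "F = {b. a b u \<noteq> 0} \<union> {b. a b v \<noteq> 0}"
    have F: "q u' v = (\<Sum>b\<in>F. ip (a b u') (a b v))" "q u v' = (\<Sum>b\<in>F. ip (a b u) (a b v'))" for u' v'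
      by (rule q_eq; auto simp: F_def a_fin)+
    have "tsum (\<delta> u) (\<lambda>u0 u1. ip (a b u0) (a b v) *\<^sub>C antipode K u1) =
        sw2 K (a b u) (\<lambda>x0 x1. ip x0 (a b v) *\<^sub>C antipode K x1)" for b
    proof -
      have "balanced (\<lambda>x0 x1. ip x0 (a b v) *\<^sub>C antipode K x1)"
        using S by (simp add: balanced_def ip_add ip_scale clinear_iff scaleC_add_left scaleC_add_right
           scaleC_scaleC mult.commute)
      then show ?thesis by (simp add: sw2_def comul_a tsum_tsum tsum_tens)
    qed
    moreover have "tsum (\<delta> v) (\<lambda>v0 v1. ip (a b u) (a b v0) *\<^sub>C star v1) =
        sw2 K (a b v) (\<lambda>y0 y1. ip (a b u) y0 *\<^sub>C star y1)" for b
    proof -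
      have "balanced (\<lambda>y0 y1. ip (a b u) y0 *\<^sub>C star y1)"
        using conj_linear_star
        by (simp add: balanced_def ip_add2 ip_scale2 conj_linear_def scaleC_add_left scaleC_add_right
           scaleC_scaleC mult.commute)
      then show ?thesis by (simp add: sw2_def comul_a tsum_tsum tsum_tens)
    qed
    ultimately show ?thesis
      by (simp add: F cvec.scale_sum_left tsum_sum inv)
  qed
  ultimately show "\<exists>ip. invariant_inner_product K star \<delta> ip"
    unfolding invariant_inner_product_def by blast
qed


section \<open>Cocycle linked pairs\<close>

(* Variable names record the Sweedler legs: x2HA stands for ((x2)_H)_A, with \<rho>(x) = x_H \<otimes> x_A
   and \<psi>(x) = x_I \<otimes> x_II. *)
locale cocycle_linked_pair =
  A: bialgebra A + H: bialgebra H
  for A :: "'a::complex_vector bialg" and H :: "'h::complex_vector bialg" +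
  fixes act :: "'h \<Rightarrow> 'a \<Rightarrow> 'a" (infixr \<open>\<triangleright>\<close> 72)
    and \<rho> :: "'h \<Rightarrow> 'h \<otimes> 'a"
    and \<chi> :: "'h \<Rightarrow> 'h \<Rightarrow> 'a"
    and \<psi> :: "'h \<Rightarrow> 'a \<otimes> 'a"
  assumes cbilinear_act: "cbilinear (\<triangleright>)"
    and clinear_rho: "clinear \<rho>"
    and cbilinear_chi: "cbilinear \<chi>"
    and clinear_psi: "clinear \<psi>"

    and act_unity: "x \<triangleright> \<one>\<^bsub>A\<^esub> = \<epsilon>\<^bsub>H\<^esub> x *\<^sub>C \<one>\<^bsub>A\<^esub>"
    and act_mul: "x \<triangleright> (a \<cdot>\<^bsub>A\<^esub> b) = sw2 H x (\<lambda>x1 x2. (x1 \<triangleright> a) \<cdot>\<^bsub>A\<^esub> (x2 \<triangleright> b))"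
    and unity_act: "\<one>\<^bsub>H\<^esub> \<triangleright> a = a"
    and twisted_module:
      "sw2 H x (\<lambda>x1 x2. sw2 H y (\<lambda>y1 y2. (x1 \<triangleright> (y1 \<triangleright> a)) \<cdot>\<^bsub>A\<^esub> \<chi> x2 y2)) =
       sw2 H x (\<lambda>x1 x2. sw2 H y (\<lambda>y1 y2. \<chi> x1 y1 \<cdot>\<^bsub>A\<^esub> ((x2 \<cdot>\<^bsub>H\<^esub> y2) \<triangleright> a)))"
    and cocycle:
      "sw2 H x (\<lambda>x1 x2. sw2 H y (\<lambda>y1 y2. sw2 H z (\<lambda>z1 z2.
         (x1 \<triangleright> \<chi> y1 z1) \<cdot>\<^bsub>A\<^esub> \<chi> x2 (y2 \<cdot>\<^bsub>H\<^esub> z2)))) =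
       sw2 H x (\<lambda>x1 x2. sw2 H y (\<lambda>y1 y2. \<chi> x1 y1 \<cdot>\<^bsub>A\<^esub> \<chi> (x2 \<cdot>\<^bsub>H\<^esub> y2) z))"
    and chi_unity_right: "\<chi> x \<one>\<^bsub>H\<^esub> = \<epsilon>\<^bsub>H\<^esub> x *\<^sub>C \<one>\<^bsub>A\<^esub>"
    and chi_unity_left: "\<chi> \<one>\<^bsub>H\<^esub> x = \<epsilon>\<^bsub>H\<^esub> x *\<^sub>C \<one>\<^bsub>A\<^esub>"

    and counit_rho: "tsum (\<rho> x) (\<lambda>xH xA. \<epsilon>\<^bsub>H\<^esub> xH *\<^sub>C xA) = \<epsilon>\<^bsub>H\<^esub> x *\<^sub>C \<one>\<^bsub>A\<^esub>"
    and comul_rho: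
      "tsum (\<rho> x) (\<lambda>xH xA. sw2 H xH (\<lambda>xH1 xH2. xH1 \<otimes> xH2 \<otimes> xA)) =
       sw2 H x (\<lambda>x1 x2. tsum (\<rho> x1) (\<lambda>x1H x1A. tsum (\<rho> x2) (\<lambda>x2H x2A.
         x1H \<otimes> x2H \<otimes> (x1A \<cdot>\<^bsub>A\<^esub> x2A))))"
    and rho_counit: "tsum (\<rho> x) (\<lambda>xH xA. \<epsilon>\<^bsub>A\<^esub> xA *\<^sub>C xH) = x"
    and twisted_comodule:
      "sw2 H x (\<lambda>x1 x2. tsum (\<psi> x1) (\<lambda>x1I x1II. tsum (\<rho> x2) (\<lambda>x2H x2A.
         tsum (\<rho> x2H) (\<lambda>x2HH x2HA. x2HH \<otimes> (x1I \<cdot>\<^bsub>A\<^esub> x2HA) \<otimes> (x1II \<cdot>\<^bsub>A\<^esub> x2A))))) =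
       sw2 H x (\<lambda>x1 x2. tsum (\<rho> x1) (\<lambda>x1H x1A. sw2 A x1A (\<lambda>x1A1 x1A2.
         tsum (\<psi> x2) (\<lambda>x2I x2II. x1H \<otimes> (x1A1 \<cdot>\<^bsub>A\<^esub> x2I) \<otimes> (x1A2 \<cdot>\<^bsub>A\<^esub> x2II)))))"
    and dual_cocycle:
      "sw2 H x (\<lambda>x1 x2. tsum (\<psi> x1) (\<lambda>x1I x1II. sw2 A x1I (\<lambda>x1I1 x1I2.
         tsum (\<rho> x2) (\<lambda>x2H x2A. tsum (\<psi> x2H) (\<lambda>x2HI x2HII.
           (x1I1 \<cdot>\<^bsub>A\<^esub> x2HI) \<otimes> (x1I2 \<cdot>\<^bsub>A\<^esub> x2HII) \<otimes> (x1II \<cdot>\<^bsub>A\<^esub> x2A)))))) =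
       sw2 H x (\<lambda>x1 x2. tsum (\<psi> x1) (\<lambda>x1I x1II. sw2 A x1II (\<lambda>x1II1 x1II2.
         tsum (\<psi> x2) (\<lambda>x2I x2II. x1I \<otimes> (x1II1 \<cdot>\<^bsub>A\<^esub> x2I) \<otimes> (x1II2 \<cdot>\<^bsub>A\<^esub> x2II)))))"
    and counit_psi_left: "tsum (\<psi> x) (\<lambda>xI xII. \<epsilon>\<^bsub>A\<^esub> xI *\<^sub>C xII) = \<epsilon>\<^bsub>H\<^esub> x *\<^sub>C \<one>\<^bsub>A\<^esub>"
    and counit_psi_right: "tsum (\<psi> x) (\<lambda>xI xII. \<epsilon>\<^bsub>A\<^esub> xII *\<^sub>C xI) = \<epsilon>\<^bsub>H\<^esub> x *\<^sub>C \<one>\<^bsub>A\<^esub>"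

    and counit_act: "\<epsilon>\<^bsub>A\<^esub> (x \<triangleright> a) = \<epsilon>\<^bsub>H\<^esub> x * \<epsilon>\<^bsub>A\<^esub> a"
    and rho_unity: "\<rho> \<one>\<^bsub>H\<^esub> = \<one>\<^bsub>H\<^esub> \<otimes> \<one>\<^bsub>A\<^esub>"
    and counit_chi: "\<epsilon>\<^bsub>A\<^esub> (\<chi> x y) = \<epsilon>\<^bsub>H\<^esub> x * \<epsilon>\<^bsub>H\<^esub> y"
    and psi_unity: "\<psi> \<one>\<^bsub>H\<^esub> = \<one>\<^bsub>A\<^esub> \<otimes> \<one>\<^bsub>A\<^esub>"
    and comul_act:
      "sw2 H x (\<lambda>x1 x2. sw2 A (x1 \<triangleright> a) (\<lambda>p1 p2. tsum (\<psi> x2) (\<lambda>x2I x2II.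
         (p1 \<cdot>\<^bsub>A\<^esub> x2I) \<otimes> (p2 \<cdot>\<^bsub>A\<^esub> x2II)))) =
       sw3 H x (\<lambda>x1 x2 x3. sw2 A a (\<lambda>a1 a2. tsum (\<psi> x1) (\<lambda>x1I x1II. tsum (\<rho> x2) (\<lambda>x2H x2A.
         (x1I \<cdot>\<^bsub>A\<^esub> (x2H \<triangleright> a1)) \<otimes> (x1II \<cdot>\<^bsub>A\<^esub> x2A \<cdot>\<^bsub>A\<^esub> (x3 \<triangleright> a2))))))"
    and rho_mul:
      "sw2 H x (\<lambda>x1 x2. sw2 H y (\<lambda>y1 y2. tsum (\<rho> (x2 \<cdot>\<^bsub>H\<^esub> y2)) (\<lambda>pH pA.
         pH \<otimes> (\<chi> x1 y1 \<cdot>\<^bsub>A\<^esub> pA)))) =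
       sw3 H x (\<lambda>x1 x2 x3. sw2 H y (\<lambda>y1 y2.
         tsum (\<rho> x1) (\<lambda>x1H x1A. tsum (\<rho> y1) (\<lambda>y1H y1A.
           (x1H \<cdot>\<^bsub>H\<^esub> y1H) \<otimes> (x1A \<cdot>\<^bsub>A\<^esub> (x2 \<triangleright> y1A) \<cdot>\<^bsub>A\<^esub> \<chi> x3 y2)))))"
    and rho_act:
      "sw2 H x (\<lambda>x1 x2. tsum (\<rho> x2) (\<lambda>x2H x2A. x2H \<otimes> ((x1 \<triangleright> a) \<cdot>\<^bsub>A\<^esub> x2A))) =
       sw2 H x (\<lambda>x1 x2. tsum (\<rho> x1) (\<lambda>x1H x1A. x1H \<otimes> (x1A \<cdot>\<^bsub>A\<^esub> (x2 \<triangleright> a))))"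
    and comul_chi:
      "sw2 H x (\<lambda>x1 x2. sw2 H y (\<lambda>y1 y2. sw2 A (\<chi> x1 y1) (\<lambda>p1 p2.
         tsum (\<psi> (x2 \<cdot>\<^bsub>H\<^esub> y2)) (\<lambda>qI qII. (p1 \<cdot>\<^bsub>A\<^esub> qI) \<otimes> (p2 \<cdot>\<^bsub>A\<^esub> qII))))) =
       sw6 H x (\<lambda>x1 x2 x3 x4 x5 x6. sw3 H y (\<lambda>y1 y2 y3.
         tsum (\<psi> x1) (\<lambda>x1I x1II. tsum (\<rho> x2) (\<lambda>x2H x2A. tsum (\<rho> x4) (\<lambda>x4H x4A.
         tsum (\<psi> y1) (\<lambda>y1I y1II. tsum (\<rho> y2) (\<lambda>y2H y2A.
           (x1I \<cdot>\<^bsub>A\<^esub> (x2H \<triangleright> y1I) \<cdot>\<^bsub>A\<^esub> \<chi> x4H y2H) \<otimes>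
           (x1II \<cdot>\<^bsub>A\<^esub> x2A \<cdot>\<^bsub>A\<^esub> (x3 \<triangleright> y1II) \<cdot>\<^bsub>A\<^esub> x4A \<cdot>\<^bsub>A\<^esub> (x5 \<triangleright> y2A) \<cdot>\<^bsub>A\<^esub> \<chi> x6 y3))))))))"

(* Convolution inverses in Hom(H \<otimes> H, A) and Hom(H, A \<otimes> A), for the tensor product
   coalgebra H \<otimes> H and the tensor product algebra A \<otimes> A. *)
definition is_chi_inverse ::
  "'a::complex_vector bialg \<Rightarrow> 'h::complex_vector bialg \<Rightarrow>
    ('h \<Rightarrow> 'h \<Rightarrow> 'a) \<Rightarrow> ('h \<Rightarrow> 'h \<Rightarrow> 'a) \<Rightarrow> bool"
  where "is_chi_inverse A H \<chi> \<chi>' \<longleftrightarrow> cbilinear \<chi>' \<and>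
    (\<forall>x y. sw2 H x (\<lambda>x1 x2. sw2 H y (\<lambda>y1 y2. \<chi> x1 y1 \<cdot>\<^bsub>A\<^esub> \<chi>' x2 y2)) =
      (\<epsilon>\<^bsub>H\<^esub> x * \<epsilon>\<^bsub>H\<^esub> y) *\<^sub>C \<one>\<^bsub>A\<^esub>) \<and>
    (\<forall>x y. sw2 H x (\<lambda>x1 x2. sw2 H y (\<lambda>y1 y2. \<chi>' x1 y1 \<cdot>\<^bsub>A\<^esub> \<chi> x2 y2)) =
      (\<epsilon>\<^bsub>H\<^esub> x * \<epsilon>\<^bsub>H\<^esub> y) *\<^sub>C \<one>\<^bsub>A\<^esub>)"

definition tensor_mul :: "'a::complex_vector bialg \<Rightarrow> 'a \<otimes> 'a \<Rightarrow> 'a \<otimes> 'a \<Rightarrow> 'a \<otimes> 'a"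
  where "tensor_mul A s t =
    tsum s (\<lambda>a b. tsum t (\<lambda>a' b'. (a \<cdot>\<^bsub>A\<^esub> a') \<otimes> (b \<cdot>\<^bsub>A\<^esub> b')))"

definition is_psi_inverse ::
  "'a::complex_vector bialg \<Rightarrow> 'h::complex_vector bialg \<Rightarrow>
    ('h \<Rightarrow> 'a \<otimes> 'a) \<Rightarrow> ('h \<Rightarrow> 'a \<otimes> 'a) \<Rightarrow> bool"
  where "is_psi_inverse A H \<psi> \<psi>' \<longleftrightarrow> clinear \<psi>' \<and>
    (\<forall>x. sw2 H x (\<lambda>x1 x2. tensor_mul A (\<psi> x1) (\<psi>' x2)) =
      \<epsilon>\<^bsub>H\<^esub> x *\<^sub>C (\<one>\<^bsub>A\<^esub> \<otimes> \<one>\<^bsub>A\<^esub>)) \<and>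
    (\<forall>x. sw2 H x (\<lambda>x1 x2. tensor_mul A (\<psi>' x1) (\<psi> x2)) =
      \<epsilon>\<^bsub>H\<^esub> x *\<^sub>C (\<one>\<^bsub>A\<^esub> \<otimes> \<one>\<^bsub>A\<^esub>))"

definition chi_invertible ::
  "'a::complex_vector bialg \<Rightarrow> 'h::complex_vector bialg \<Rightarrow> ('h \<Rightarrow> 'h \<Rightarrow> 'a) \<Rightarrow> bool"
  where "chi_invertible A H \<chi> \<longleftrightarrow> (\<exists>\<chi>'. is_chi_inverse A H \<chi> \<chi>')"

definition psi_invertible ::
  "'a::complex_vector bialg \<Rightarrow> 'h::complex_vector bialg \<Rightarrow> ('h \<Rightarrow> 'a \<otimes> 'a) \<Rightarrow> bool"
  where "psi_invertible A H \<psi> \<longleftrightarrow> (\<exists>\<psi>'. is_psi_inverse A H \<psi> \<psi>')"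

(* As with the antipode, the convolution inverse is unique when it exists. *)
definition chi_inverse ::
  "'a::complex_vector bialg \<Rightarrow> 'h::complex_vector bialg \<Rightarrow>
    ('h \<Rightarrow> 'h \<Rightarrow> 'a) \<Rightarrow> 'h \<Rightarrow> 'h \<Rightarrow> 'a"
  where "chi_inverse A H \<chi> = (SOME \<chi>'. is_chi_inverse A H \<chi> \<chi>')"


section \<open>The cocycle bismash product\<close>

(* The element a # x is the simple tensor a \<otimes> x. *)
definition bismash ::
  "'a::complex_vector bialg \<Rightarrow> 'h::complex_vector bialg \<Rightarrow> ('h \<Rightarrow> 'a \<Rightarrow> 'a) \<Rightarrow>
    ('h \<Rightarrow> 'h \<otimes> 'a) \<Rightarrow> ('h \<Rightarrow> 'h \<Rightarrow> 'a) \<Rightarrow> ('h \<Rightarrow> 'a \<otimes> 'a) \<Rightarrow> ('a \<otimes> 'h) bialg"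
  where "bismash A H act \<rho> \<chi> \<psi> =
    \<lparr>mul = (\<lambda>s t. tsum s (\<lambda>a x. tsum t (\<lambda>b y.
       sw3 H x (\<lambda>x1 x2 x3. sw2 H y (\<lambda>y1 y2.
         (a \<cdot>\<^bsub>A\<^esub> act x1 b \<cdot>\<^bsub>A\<^esub> \<chi> x2 y1) \<otimes> (x3 \<cdot>\<^bsub>H\<^esub> y2)))))),
     unity = \<one>\<^bsub>A\<^esub> \<otimes> \<one>\<^bsub>H\<^esub>,
     comul = (\<lambda>t. tsum t (\<lambda>a x. sw2 A a (\<lambda>a1 a2. sw3 H x (\<lambda>x1 x2 x3.
       tsum (\<psi> x1) (\<lambda>x1I x1II. tsum (\<rho> x2) (\<lambda>x2H x2A.
         ((a1 \<cdot>\<^bsub>A\<^esub> x1I) \<otimes> x2H) \<otimes> ((a2 \<cdot>\<^bsub>A\<^esub> x1II \<cdot>\<^bsub>A\<^esub> x2A) \<otimes> x3))))))),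
     counit = (\<lambda>t. tsum t (\<lambda>a x. \<epsilon>\<^bsub>A\<^esub> a * \<epsilon>\<^bsub>H\<^esub> x))\<rparr>"

definition bismash_integral ::
  "('a::complex_vector \<Rightarrow> complex) \<Rightarrow> ('h::complex_vector \<Rightarrow> complex) \<Rightarrow> 'a \<otimes> 'h \<Rightarrow> complex"
  where "bismash_integral \<phi>A \<phi>H t = tsum t (\<lambda>a x. \<phi>A a * \<phi>H x)"

(* inv is the inverse function; the antipode of a Hopf algebra with a star structure is
   bijective. *)
definition gamma_map ::
  "'a::complex_vector bialg \<Rightarrow> 'h::complex_vector bialg \<Rightarrow> ('h \<Rightarrow> 'h \<Rightarrow> 'a) \<Rightarrow> 'h \<Rightarrow> 'a"
  where "gamma_map A H \<chi> x = sw2 H x (\<lambda>x1 x2. chi_inverse A H \<chi> x2 (inv (antipode H) x1))"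

definition bismash_star ::
  "'a::complex_vector bialg \<Rightarrow> ('a \<Rightarrow> 'a) \<Rightarrow> 'h::complex_vector bialg \<Rightarrow> ('h \<Rightarrow> 'h) \<Rightarrow>
    ('h \<Rightarrow> 'a \<Rightarrow> 'a) \<Rightarrow> ('h \<Rightarrow> 'a) \<Rightarrow> 'a \<otimes> 'h \<Rightarrow> 'a \<otimes> 'h"
  where "bismash_star A starA H starH act \<gamma> t = tsum t (\<lambda>a x. sw3 H x (\<lambda>x1 x2 x3.
    (\<gamma> (starH x1) \<cdot>\<^bsub>A\<^esub> act (starH x2) (starA a)) \<otimes> starH x3))"

end

theory Submission
  imports Defs "HOL-Computational_Algebra.Fundamental_Theorem_Algebra"
begin

text \<open>Let $B = A^\psi \#_\chi H$, with the embeddings $i(a) = a \# 1$ and $j(x) = 1 \# x$. The axioms of a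
  cocycle linked pair are identities between convolution products of maps from $H$ or $H \otimes H$ into
  $A$, $B \otimes B$ or $B \otimes B \otimes B$, and so the bialgebra axioms for $B$ reduce to
  rearrangements of such products. The identity of $B$ is the convolution product of
  $a \# x \mapsto \varepsilon(x) a \# 1$ and $a \# x \mapsto \varepsilon(a) 1 \# x$, which are both
  invertible, and this gives the antipode. The star is determined by $i(a)^* = i(a^*)$ and
  $j(x)^* = \sum i(\gamma(x_1^*)) j(x_2^*)$; conditions (i), (ii) and (iii) make it an
  antimultiplicative involution, (iv) and (v) make it comultiplicative.

  A star Hopf algebra is a compact quantum group as soon as $\langle u, v \rangle = \varphi(v^* u)$ is an
  inner product for an integral $\varphi$, because any inner product on a comodule can then be averaged.
  Conversely, on a compact quantum group $r(u, v) = \varphi(u v^*)$ is an inner product: the eigenspaces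
  of $r$ relative to an invariant inner product are spanned by coefficients of unitary
  corepresentations, so that the eigenvalues are positive. Since $\Phi$ is central,
  $\Phi((a \# x)(b \# y)^*)$ can be rewritten until $\gamma$ cancels against $\chi$, which leaves
  $\varphi_A(a b^*) \varphi_H(x y^*)$, an inner product on $A \otimes H$.\<close>

section \<open>Multilinear maps and Sweedler sums\<close>

text \<open>The inverse antipode in \<gamma> is explained by the identity \<open>act_g'\<close>:
  \<gamma> after the antipode is \<open>g'\<close>, the correction that turns j(S x) into a
  convolution inverse of \<open>j\<close>. This identity is used twice, for the antipode of B and,
  as \<open>G_antipode\<close>, for the value of the integral on j(x) times the star of some j(z).
  It comes from the cocycle axiom by carrying factors of \<chi> across as inverses;
  \<open>psi'_antipode_psi\<close> is its dual, obtained in the same way from the dual cocycle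
  axiom.

  Two mismatches of sides shape the end of the proof. The averaging criterion asks for the form that
  evaluates the integral at (star of v) u, whereas the positive forms on A and H evaluate it at u
  (star of v); centrality of the integral of B connects the two. And in the coproduct of a # x only
  the last leg of x stands alone, so that just left invariance of the integral can be read off;
  right invariance is then deduced from uniqueness of integrals and bijectivity of the antipode,
  which itself is a consequence of the star.\<close>

named_theorems lin

text \<open>With the rules \<open>lin\<close>, the simplifier discharges the linearity side conditions of the
  Sweedler calculus.\<close>

lemma clinear_add: "clinear f \<Longrightarrow> f (x + y) = f x + f y"
  by (simp add: clinear_iff)

lemma clinear_scale: "clinear f \<Longrightarrow> f (c *\<^sub>C x) = c *\<^sub>C f x"
  by (simp add: clinear_iff)

lemma clinear_zero: "clinear f \<Longrightarrow> f 0 = 0"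
  by (metis add_cancel_right_right clinear_add)

lemma clinear_diff: "clinear f \<Longrightarrow> f (x - y) = f x - f y"
  by (metis clinear_add diff_add_cancel add_diff_cancel_right')

lemma cbilinear_left: "cbilinear f \<Longrightarrow> clinear (\<lambda>x. f x y)"
  and cbilinear_right: "cbilinear f \<Longrightarrow> clinear (f x)"
  by (simp_all add: cbilinear_def)

lemma clinear_compose: "clinear f \<Longrightarrow> clinear g \<Longrightarrow> clinear (\<lambda>x. f (g x))"
  by (simp add: clinear_iff)

lemma clinear_id [lin]: "clinear (\<lambda>x. x)"
  and clinear_const_zero [lin]: "clinear (\<lambda>x. 0)"
  by (simp_all add: clinear_iff)

lemma clinear_plus [lin]: "clinear f \<Longrightarrow> clinear g \<Longrightarrow> clinear (\<lambda>x. f x + g x)"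
  and clinear_minus [lin]: "clinear f \<Longrightarrow> clinear g \<Longrightarrow> clinear (\<lambda>x. f x - g x)"
  by (auto simp: clinear_iff scaleC_add_right cvec.scale_right_diff_distrib)

lemma clinear_scaleC_right [lin]: "clinear f \<Longrightarrow> clinear (\<lambda>x. c *\<^sub>C f x)"
  and clinear_scaleC_left [lin]: "clinear g \<Longrightarrow> clinear (\<lambda>x. g x *\<^sub>C v)"
  by (simp_all add: clinear_iff scaleC_add_right scaleC_add_left scaleC_scaleC
      scaleC_complex_def mult.commute)

lemma clinear_mult_left [lin]: "clinear f \<Longrightarrow> clinear (\<lambda>x. f x * (c :: complex))"
  and clinear_mult_right [lin]: "clinear f \<Longrightarrow> clinear (\<lambda>x. (c :: complex) * f x)"
  by (simp_all add: clinear_iff scaleC_complex_def algebra_simps)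

lemma clinear_tens_left [lin]: "clinear f \<Longrightarrow> clinear (\<lambda>x. f x \<otimes> v)"
  and clinear_tens_right [lin]: "clinear f \<Longrightarrow> clinear (\<lambda>x. u \<otimes> f x)"
  by (simp_all add: clinear_iff tens_add_left tens_add_right tens_scale_left tens_scale_right)

lemma clinear_tsum_head [lin]:
  "clinear g \<Longrightarrow> cbilinear F \<Longrightarrow> clinear (\<lambda>x. tsum (g x) F)"
  by (rule clinear_compose[OF clinear_tsum])

lemma clinear_tsum_body [lin]:
  assumes "\<And>u v. clinear (\<lambda>x. F x u v)"
  shows "clinear (\<lambda>x. tsum t (F x))"
  using assms by (simp add: clinear_iff tsum_def sum.distrib cvec.scale_sum_right)

lemma cbilinearI [lin]:
  "(\<And>y. clinear (\<lambda>x. f x y)) \<Longrightarrow> (\<And>x. clinear (\<lambda>y. f x y)) \<Longrightarrow> cbilinear f"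
  by (simp add: cbilinear_def)

lemma tsum_tens_bilinear: "cbilinear f \<Longrightarrow> tsum (u \<otimes> v) f = f u v"
  by (simp add: tsum_tens cbilinear_imp_balanced)

lemma tsum_tsum_bilinear:
  "cbilinear f \<Longrightarrow> tsum (tsum t g) f = tsum t (\<lambda>u v. tsum (g u v) f)"
  by (simp add: tsum_tsum cbilinear_imp_balanced)

lemmas tsum_bil = tsum_tens_bilinear tsum_tsum_bilinear

lemma tsum_swap: "tsum s (\<lambda>a b. tsum t (\<lambda>c d. f a b c d)) = tsum t (\<lambda>c d. tsum s (\<lambda>a b. f a b c d))"
  unfolding tsum_def by (rule sum.swap)

lemma tsum_tens_id: "tsum t (\<lambda>u v. u \<otimes> v) = t"
  by (rule tsum_unique[symmetric]) (simp_all add: cbilinear_tens lin)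

lemma tsum_const_zero: "tsum t (\<lambda>u v. 0) = 0"
  by (simp add: tsum_def)

lemma tsum_plus: "tsum t (\<lambda>u v. f u v + g u v) = tsum t f + tsum t g"
  by (simp add: tsum_def sum.distrib)

lemma tsum_scale: "tsum t (\<lambda>u v. c *\<^sub>C f u v) = c *\<^sub>C tsum t f"
  by (simp add: tsum_def cvec.scale_sum_right)

lemma tsum_tens_right: "tsum t (\<lambda>u v. c \<otimes> f u v) = c \<otimes> tsum t f"
  by (simp add: clinear_tsum_map[where h = "\<lambda>x. c \<otimes> x"] lin)

lemma tensor_ext:
  assumes "clinear f" "clinear g" "\<And>u v. f (u \<otimes> v) = g (u \<otimes> v)"
  shows "f t = g t"
  by (induction t rule: tensor_induct) (simp_all add: assms clinear_zero clinear_add)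

definition tmap :: "('a::complex_vector \<Rightarrow> 'c::complex_vector) \<Rightarrow>
    ('b::complex_vector \<Rightarrow> 'd::complex_vector) \<Rightarrow> 'a \<otimes> 'b \<Rightarrow> 'c \<otimes> 'd"
  where "tmap f g t = tsum t (\<lambda>u v. f u \<otimes> g v)"

lemma clinear_tmap: "clinear f \<Longrightarrow> clinear g \<Longrightarrow> clinear (tmap f g)"
  unfolding tmap_def[abs_def] by (simp add: lin)

lemma clinear_tmap_comp [lin]:
  "clinear f \<Longrightarrow> clinear g \<Longrightarrow> clinear h \<Longrightarrow> clinear (\<lambda>x. tmap f g (h x))"
  using clinear_compose[OF clinear_tmap] by blast

lemma tmap_tens: "clinear f \<Longrightarrow> clinear g \<Longrightarrow> tmap f g (u \<otimes> v) = f u \<otimes> g v"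
  unfolding tmap_def by (simp add: tsum_tens_bilinear lin)

text \<open>The product is a parameter and not a type class because one type carries several: A
  \<otimes> H has the componentwise product \<open>AH\<close> and the product \<open>mulB\<close>,
  and opposite products are needed too.\<close>

locale algebra =
  fixes m :: "'r::complex_vector \<Rightarrow> 'r \<Rightarrow> 'r" (infixl \<open>\<odot>\<close> 70) and e :: 'r
  assumes bilinear: "cbilinear (\<odot>)"
    and assoc: "(x \<odot> y) \<odot> z = x \<odot> (y \<odot> z)"
    and unit_left: "e \<odot> x = x"
    and unit_right: "x \<odot> e = x"
begin

lemma lin_left [lin]: "clinear f \<Longrightarrow> clinear (\<lambda>x. f x \<odot> c)"
  using clinear_compose[OF cbilinear_left[OF bilinear]] by blast

lemma lin_right [lin]: "clinear f \<Longrightarrow> clinear (\<lambda>x. c \<odot> f x)"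
  using clinear_compose[OF cbilinear_right[OF bilinear]] by blast

lemma tsum_left: "tsum t (\<lambda>u v. f u v \<odot> c) = tsum t f \<odot> c"
  by (rule clinear_tsum_map[symmetric]) (simp add: lin)

lemma tsum_right: "tsum t (\<lambda>u v. c \<odot> f u v) = c \<odot> tsum t f"
  by (rule clinear_tsum_map[symmetric]) (simp add: lin)

lemma scale_left: "(c *\<^sub>C x) \<odot> y = c *\<^sub>C (x \<odot> y)"
  by (rule clinear_scale) (simp add: lin)

lemma scale_right: "x \<odot> (c *\<^sub>C y) = c *\<^sub>C (x \<odot> y)"
  by (rule clinear_scale) (simp add: lin)

end

definition tmul :: "('a::complex_vector \<Rightarrow> 'a \<Rightarrow> 'a) \<Rightarrow> ('b::complex_vector \<Rightarrow> 'b \<Rightarrow> 'b) \<Rightarrow>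
    'a \<otimes> 'b \<Rightarrow> 'a \<otimes> 'b \<Rightarrow> 'a \<otimes> 'b"
  where "tmul m n s t = tsum s (\<lambda>a b. tsum t (\<lambda>a' b'. m a a' \<otimes> n b b'))"

context
  fixes m e n d
  assumes m: "algebra m e" and n: "algebra n d"
begin

private lemma lins:
    "clinear f \<Longrightarrow> clinear (\<lambda>x. m (f x) c)" "clinear f \<Longrightarrow> clinear (\<lambda>x. m c (f x))"
    "clinear f' \<Longrightarrow> clinear (\<lambda>x. n (f' x) c')" "clinear f' \<Longrightarrow> clinear (\<lambda>x. n c' (f' x))"
  using algebra.lin_left[OF m] algebra.lin_right[OF m] algebra.lin_left[OF n] algebra.lin_right[OF n]
  by blast+

lemma cbilinear_tmul: "cbilinear (tmul m n)"
  unfolding tmul_def[abs_def] by (simp add: lin lins)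

private lemmas tlin =
  clinear_compose[OF cbilinear_left[OF cbilinear_tmul]]
  clinear_compose[OF cbilinear_right[OF cbilinear_tmul]]

lemma tmul_tens: "tmul m n (a \<otimes> b) (a' \<otimes> b') = m a a' \<otimes> n b b'"
  unfolding tmul_def by (simp add: tsum_bil lin lins)

lemma algebra_tmul: "algebra (tmul m n) (e \<otimes> d)"
proof
  show "cbilinear (tmul m n)" by (rule cbilinear_tmul)
  show "tmul m n (tmul m n r s) t = tmul m n r (tmul m n s t)" for r s t
  proof (rule tensor_ext[where t = t])
    show "tmul m n (tmul m n r s) (u \<otimes> v) = tmul m n r (tmul m n s (u \<otimes> v))" for u v
    proof (rule tensor_ext[where t = s])
      show "tmul m n (tmul m n r (u' \<otimes> v')) (u \<otimes> v) = tmul m n r (tmul m n (u' \<otimes> v') (u \<otimes> v))" for u' v'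
        by (rule tensor_ext[where t = r])
          (simp_all add: lin lins tlin tmul_tens algebra.assoc[OF m] algebra.assoc[OF n])
    qed (simp_all add: lin lins tlin)
  qed (simp_all add: lin lins tlin)
  show "tmul m n (e \<otimes> d) t = t" "tmul m n t (e \<otimes> d) = t" for t
    by (rule tensor_ext[where t = t and g = "\<lambda>t. t"],
        simp_all add: lin lins tlin tmul_tens algebra.unit_left[OF m] algebra.unit_left[OF n]
          algebra.unit_right[OF m] algebra.unit_right[OF n])+
qed

end

definition algebra_hom where
  "algebra_hom m n f \<longleftrightarrow> clinear f \<and> (\<forall>x y. f (m x y) = n (f x) (f y))"

locale coalgebra =
  fixes C :: "'k::complex_vector bialg"
  assumes clinear_comul: "clinear (comul C)"
    and clinear_counit: "clinear (counit C)"
    and coassoc: "sw2 C x (\<lambda>x1 x2. sw2 C x1 (\<lambda>x11 x12. x11 \<otimes> x12 \<otimes> x2)) =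
      sw2 C x (\<lambda>x1 x2. sw2 C x2 (\<lambda>x21 x22. x1 \<otimes> x21 \<otimes> x22))"
    and counit_left: "sw2 C x (\<lambda>x1 x2. counit C x1 *\<^sub>C x2) = x"
    and counit_right: "sw2 C x (\<lambda>x1 x2. counit C x2 *\<^sub>C x1) = x"
begin

lemma lin_counit [lin]: "clinear f \<Longrightarrow> clinear (\<lambda>x. counit C (f x))"
  by (rule clinear_compose[OF clinear_counit])

lemma lin_comul [lin]: "clinear f \<Longrightarrow> clinear (\<lambda>x. comul C (f x))"
  by (rule clinear_compose[OF clinear_comul])

lemma lin_sw2_head [lin]: "clinear f \<Longrightarrow> cbilinear F \<Longrightarrow> clinear (\<lambda>x. sw2 C (f x) F)"
  unfolding sw2_def by (simp add: lin)

end

lemma lin_sw2_body [lin]: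
  "(\<And>u v. clinear (\<lambda>x. F x u v)) \<Longrightarrow> clinear (\<lambda>x. sw2 C t (F x))"
  unfolding sw2_def by (simp add: lin)

lemma sw2_swap: "sw2 C x (\<lambda>a b. sw2 D y (\<lambda>c d. f a b c d)) = sw2 D y (\<lambda>c d. sw2 C x (\<lambda>a b. f a b c d))"
  unfolding sw2_def by (rule tsum_swap)

lemma sw2_map: "clinear h \<Longrightarrow> h (sw2 C x f) = sw2 C x (\<lambda>u v. h (f u v))"
  unfolding sw2_def by (rule clinear_tsum_map)

context coalgebra
begin

text \<open>Apply to \<open>coassoc\<close> the linear map that sends a simple tensor of u, v, w to
  F u v w. Used as a rewrite rule this nests all iterated coproducts to the right, so that two
  groupings of the same legs are compared by normalising both.\<close>

lemma sw2_assoc: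
  assumes [lin]: "\<And>v w. clinear (\<lambda>u. F u v w)" "\<And>u w. clinear (\<lambda>v. F u v w)" "\<And>u v. clinear (F u v)"
  shows "sw2 C x (\<lambda>x1 x2. sw2 C x1 (\<lambda>u v. F u v x2)) = sw2 C x (\<lambda>u y. sw2 C y (\<lambda>v w. F u v w))"
proof -
  define h where "h t = tsum t (\<lambda>u r. tsum r (\<lambda>v w. F u v w))" for t
  have h: "clinear h" unfolding h_def by (simp add: lin)
  have ht: "h (u \<otimes> v \<otimes> w) = F u v w" for u v w
    unfolding h_def by (simp add: tsum_bil lin)
  show ?thesis
    using arg_cong[OF coassoc, of h x] by (simp add: sw2_map[OF h] ht)
qed

lemma sw2_counit_left: "clinear f \<Longrightarrow> sw2 C x (\<lambda>u v. counit C u *\<^sub>C f v) = f x"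
  using arg_cong[OF counit_left, of f x] by (simp add: sw2_map clinear_scale)

lemma sw2_counit_right: "clinear f \<Longrightarrow> sw2 C x (\<lambda>u v. counit C v *\<^sub>C f u) = f x"
  using arg_cong[OF counit_right, of f x] by (simp add: sw2_map clinear_scale)

end

section \<open>Convolution\<close>

definition conv where
  "conv C m f g x = sw2 C x (\<lambda>x1 x2. m (f x1) (g x2))"

lemma sw2_scale: "sw2 C x (\<lambda>u v. c *\<^sub>C f u v) = c *\<^sub>C sw2 C x f"
  unfolding sw2_def by (rule tsum_scale)

text \<open>Convolution of maps out of C \<otimes> C, kept curried so that no element of a tensor
  power of C ever has to be decomposed; \<open>conv3\<close> does the same for three
  factors.\<close>

definition conv2 where
  "conv2 C m f g x y = sw2 C x (\<lambda>x1 x2. sw2 C y (\<lambda>y1 y2. m (f x1 y1) (g x2 y2)))"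

definition conv3 where
  "conv3 C m f g x y z = sw2 C x (\<lambda>x1 x2. conv2 C m (f x1) (g x2) y z)"

definition ctrilinear where
  "ctrilinear f \<longleftrightarrow> (\<forall>y z. clinear (\<lambda>x. f x y z)) \<and> (\<forall>x z. clinear (\<lambda>y. f x y z)) \<and>
    (\<forall>x y. clinear (\<lambda>z. f x y z))"

lemma ctrilinearI [lin]:
  "(\<And>y z. clinear (\<lambda>x. f x y z)) \<Longrightarrow> (\<And>x z. clinear (\<lambda>y. f x y z)) \<Longrightarrow>
    (\<And>x y. clinear (\<lambda>z. f x y z)) \<Longrightarrow> ctrilinear f"
  by (simp add: ctrilinear_def)

lemma algebra_opposite: "algebra m e \<Longrightarrow> algebra (\<lambda>x y. m y x) e"
  by (auto simp: algebra_def cbilinear_def)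

locale convolution = coalgebra C + algebra m e
  for C :: "'c::complex_vector bialg" and m :: "'r::complex_vector \<Rightarrow> 'r \<Rightarrow> 'r" (infixl \<open>\<odot>\<close> 70)
    and e :: 'r
begin

lemma sw2_left: "sw2 D t (\<lambda>u v. f u v \<odot> c) = sw2 D t f \<odot> c"
  and sw2_right: "sw2 D t (\<lambda>u v. c \<odot> f u v) = c \<odot> sw2 D t f"
  unfolding sw2_def by (rule tsum_left tsum_right)+

lemma clinear_conv:
  assumes "clinear f" "clinear g"
  shows "clinear (conv C (\<odot>) f g)"
  using assms unfolding conv_def[abs_def] by (simp add: lin)

lemma lin_conv [lin]:
  "clinear f \<Longrightarrow> clinear g \<Longrightarrow> clinear h \<Longrightarrow> clinear (\<lambda>x. conv C (\<odot>) f g (h x))"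
  by (rule clinear_compose[OF clinear_conv])

lemma lin_conv_left [lin]:
  "(\<And>x. clinear (\<lambda>p. F p x)) \<Longrightarrow> clinear (\<lambda>p. conv C (\<odot>) (F p) g x)"
  and lin_conv_right [lin]:
  "(\<And>x. clinear (\<lambda>p. G p x)) \<Longrightarrow> clinear (\<lambda>p. conv C (\<odot>) f (G p) x)"
  unfolding conv_def by (simp_all add: lin)

lemma conv_tsum_left: "conv C (\<odot>) (\<lambda>x. tsum t (\<lambda>u v. f u v x)) g x = tsum t (\<lambda>u v. conv C (\<odot>) (f u v) g x)"
  and conv_tsum_right: "conv C (\<odot>) g (\<lambda>x. tsum t (\<lambda>u v. f u v x)) x = tsum t (\<lambda>u v. conv C (\<odot>) g (f u v) x)"
  unfolding conv_def sw2_def tsum_left[symmetric] tsum_right[symmetric] by (rule tsum_swap)+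

lemma conv_sw2_left: "conv C (\<odot>) (\<lambda>x. sw2 D t (\<lambda>u v. f u v x)) g x = sw2 D t (\<lambda>u v. conv C (\<odot>) (f u v) g x)"
  and conv_sw2_right: "conv C (\<odot>) g (\<lambda>x. sw2 D t (\<lambda>u v. f u v x)) x = sw2 D t (\<lambda>u v. conv C (\<odot>) g (f u v) x)"
  unfolding sw2_def[of D t] by (rule conv_tsum_left conv_tsum_right)+

lemma conv_mult_right: "conv C (\<odot>) f (\<lambda>x. g x \<odot> c) x = conv C (\<odot>) f g x \<odot> c"
  and conv_mult_mid: "conv C (\<odot>) f (\<lambda>x. c \<odot> g x) x = conv C (\<odot>) (\<lambda>x. f x \<odot> c) g x"
  unfolding conv_def sw2_left[symmetric] sw2_right[symmetric] by (simp_all add: assoc)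

lemma conv_assoc:
  assumes "clinear f" "clinear g" "clinear h"
  shows "conv C (\<odot>) (conv C (\<odot>) f g) h = conv C (\<odot>) f (conv C (\<odot>) g h)"
  using assms
  by (simp add: fun_eq_iff conv_def sw2_left[symmetric] sw2_right[symmetric] assoc
    sw2_assoc[of "\<lambda>u v w. f u \<odot> (g v \<odot> h w)"] lin)

lemma conv_unit_left: "clinear f \<Longrightarrow> conv C (\<odot>) (\<lambda>x. counit C x *\<^sub>C e) f = f"
  by (simp add: fun_eq_iff conv_def scale_left unit_left sw2_counit_left)

lemma conv_unit_right: "clinear f \<Longrightarrow> conv C (\<odot>) f (\<lambda>x. counit C x *\<^sub>C e) = f"
  by (simp add: fun_eq_iff conv_def scale_right unit_right sw2_counit_right)

lemma conv_inverse_unique: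
  assumes "clinear f" "clinear g" "clinear h"
    and "conv C (\<odot>) f g = (\<lambda>x. counit C x *\<^sub>C e)" "conv C (\<odot>) g h = (\<lambda>x. counit C x *\<^sub>C e)"
  shows "f = h"
  using conv_assoc[OF assms(1-3)] assms by (simp add: conv_unit_left conv_unit_right)

text \<open>Multiply f g = h k by f' on the left and by k' on the right. This is how a cocycle
  identity is turned into one for the inverse of the cocycle.\<close>

lemma conv_cross_inverse:
  assumes "clinear f" "clinear g" "clinear h" "clinear k" "clinear f'" "clinear k'"
    and "conv C (\<odot>) f g = conv C (\<odot>) h k"
    and "conv C (\<odot>) f' f = (\<lambda>x. counit C x *\<^sub>C e)" "conv C (\<odot>) k k' = (\<lambda>x. counit C x *\<^sub>C e)"
  shows "conv C (\<odot>) f' h = conv C (\<odot>) g k'"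
proof -
  have "conv C (\<odot>) f' h = conv C (\<odot>) f' (conv C (\<odot>) (conv C (\<odot>) h k) k')"
    by (simp add: conv_assoc assms(1-6,8,9) conv_unit_right)
  also have "\<dots> = conv C (\<odot>) (conv C (\<odot>) f' f) (conv C (\<odot>) g k')"
    by (simp add: conv_assoc assms(1-6) assms(7)[symmetric] clinear_conv)
  finally show ?thesis
    by (simp add: assms conv_unit_left clinear_conv)
qed

lemma cbilinear_conv2:
  assumes f: "cbilinear f" and g: "cbilinear g"
  shows "cbilinear (conv2 C (\<odot>) f g)"
proof -
  note [lin] = cbilinear_left[OF f] cbilinear_right[OF f] cbilinear_left[OF g] cbilinear_right[OF g]
  show ?thesis unfolding conv2_def[abs_def] by (simp add: lin)
qed

lemma conv2_assoc:
  assumes f: "cbilinear f" and g: "cbilinear g" and h: "cbilinear h"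
  shows "conv2 C (\<odot>) (conv2 C (\<odot>) f g) h = conv2 C (\<odot>) f (conv2 C (\<odot>) g h)"
proof (intro ext)
  fix x y
  note [lin] = cbilinear_left[OF f] cbilinear_right[OF f] cbilinear_left[OF g] cbilinear_right[OF g]
    cbilinear_left[OF h] cbilinear_right[OF h]
  have "conv2 C (\<odot>) (conv2 C (\<odot>) f g) h x y =
      sw2 C x (\<lambda>x1 x2. sw2 C y (\<lambda>y1 y2. sw2 C x1 (\<lambda>u v. sw2 C y1 (\<lambda>p q.
        f u p \<odot> (g v q \<odot> h x2 y2)))))"
    by (simp add: conv2_def sw2_left[symmetric] assoc)
  also have "\<dots> = sw2 C x (\<lambda>x1 x2. sw2 C x1 (\<lambda>u v. sw2 C y (\<lambda>y1 y2. sw2 C y1 (\<lambda>p q.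
        f u p \<odot> (g v q \<odot> h x2 y2)))))"
    by (subst sw2_swap) rule
  also have "\<dots> = sw2 C x (\<lambda>u s. sw2 C s (\<lambda>v w. sw2 C y (\<lambda>p t. sw2 C t (\<lambda>q r.
        f u p \<odot> (g v q \<odot> h w r)))))"
    by (simp add: sw2_assoc[where F = "\<lambda>p q r. f _ p \<odot> (g _ q \<odot> h _ r)"]
      sw2_assoc[where F = "\<lambda>u v w. sw2 C y (\<lambda>p t. sw2 C t (\<lambda>q r. f u p \<odot> (g v q \<odot> h w r)))"] lin)
  also have "\<dots> = sw2 C x (\<lambda>u s. sw2 C y (\<lambda>p t. sw2 C s (\<lambda>v w. sw2 C t (\<lambda>q r.
        f u p \<odot> (g v q \<odot> h w r)))))"
    by (subst sw2_swap) rule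
  finally show "conv2 C (\<odot>) (conv2 C (\<odot>) f g) h x y = conv2 C (\<odot>) f (conv2 C (\<odot>) g h) x y"
    by (simp add: conv2_def sw2_right[symmetric])
qed

lemma conv2_unit_left:
  assumes f: "cbilinear f"
  shows "conv2 C (\<odot>) (\<lambda>x y. (counit C x * counit C y) *\<^sub>C e) f = f"
proof (intro ext)
  fix x y
  note [lin] = cbilinear_left[OF f] cbilinear_right[OF f]
  show "conv2 C (\<odot>) (\<lambda>x y. (counit C x * counit C y) *\<^sub>C e) f x y = f x y"
    by (simp add: conv2_def scale_left unit_left sw2_scale scaleC_scaleC[symmetric] sw2_counit_left lin del: cvec.scale_scale)
qed

lemma conv2_unit_right:
  assumes f: "cbilinear f"
  shows "conv2 C (\<odot>) f (\<lambda>x y. (counit C x * counit C y) *\<^sub>C e) = f"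
proof (intro ext)
  fix x y
  note [lin] = cbilinear_left[OF f] cbilinear_right[OF f]
  show "conv2 C (\<odot>) f (\<lambda>x y. (counit C x * counit C y) *\<^sub>C e) x y = f x y"
    by (simp add: conv2_def scale_right unit_right sw2_scale scaleC_scaleC[symmetric] sw2_counit_right lin del: cvec.scale_scale)
qed

lemma conv2_sw2_left:
  "conv2 C (\<odot>) (\<lambda>y z. sw2 D t (\<lambda>u v. f u v y z)) h y z = sw2 D t (\<lambda>u v. conv2 C (\<odot>) (f u v) h y z)"
  unfolding conv2_def sw2_left[symmetric]
  by (subst (3) sw2_swap, subst (4) sw2_swap) rule

lemma conv2_sw2_right:
  "conv2 C (\<odot>) h (\<lambda>y z. sw2 D t (\<lambda>u v. f u v y z)) y z = sw2 D t (\<lambda>u v. conv2 C (\<odot>) h (f u v) y z)"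
  unfolding conv2_def sw2_right[symmetric]
  by (subst (3) sw2_swap, subst (4) sw2_swap) rule

lemma ctrilinear_conv3:
  assumes f: "ctrilinear f" and g: "ctrilinear g"
  shows "ctrilinear (conv3 C (\<odot>) f g)"
proof -
  note [lin] = f[unfolded ctrilinear_def, THEN conjunct1, rule_format]
    f[unfolded ctrilinear_def, THEN conjunct2, THEN conjunct1, rule_format]
    f[unfolded ctrilinear_def, THEN conjunct2, THEN conjunct2, rule_format]
    g[unfolded ctrilinear_def, THEN conjunct1, rule_format]
    g[unfolded ctrilinear_def, THEN conjunct2, THEN conjunct1, rule_format]
    g[unfolded ctrilinear_def, THEN conjunct2, THEN conjunct2, rule_format]
  show ?thesis unfolding conv3_def[abs_def] conv2_def by (simp add: lin)
qed

lemma conv3_assoc: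
  assumes f: "ctrilinear f" and g: "ctrilinear g" and h: "ctrilinear h"
  shows "conv3 C (\<odot>) (conv3 C (\<odot>) f g) h = conv3 C (\<odot>) f (conv3 C (\<odot>) g h)"
proof (intro ext)
  fix x y z
  note [lin] = f[unfolded ctrilinear_def, THEN conjunct1, rule_format]
    f[unfolded ctrilinear_def, THEN conjunct2, THEN conjunct1, rule_format]
    f[unfolded ctrilinear_def, THEN conjunct2, THEN conjunct2, rule_format]
    g[unfolded ctrilinear_def, THEN conjunct1, rule_format]
    g[unfolded ctrilinear_def, THEN conjunct2, THEN conjunct1, rule_format]
    g[unfolded ctrilinear_def, THEN conjunct2, THEN conjunct2, rule_format]
    h[unfolded ctrilinear_def, THEN conjunct1, rule_format]
    h[unfolded ctrilinear_def, THEN conjunct2, THEN conjunct1, rule_format]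
    h[unfolded ctrilinear_def, THEN conjunct2, THEN conjunct2, rule_format]
  have bil: "cbilinear (f u)" "cbilinear (g u)" "cbilinear (h u)" for u
    by (simp_all add: lin)
  have "conv3 C (\<odot>) (conv3 C (\<odot>) f g) h x y z =
      sw2 C x (\<lambda>x1 x2. sw2 C x1 (\<lambda>u v. conv2 C (\<odot>) (f u) (conv2 C (\<odot>) (g v) (h x2)) y z))"
    unfolding conv3_def conv2_sw2_left by (simp only: conv2_assoc[OF bil(1,2,3)])
  also have "\<dots> = sw2 C x (\<lambda>u s. sw2 C s (\<lambda>v w. conv2 C (\<odot>) (f u) (conv2 C (\<odot>) (g v) (h w)) y z))"
    unfolding conv2_def by (rule sw2_assoc) (simp_all add: lin)
  also have "\<dots> = conv3 C (\<odot>) f (conv3 C (\<odot>) g h) x y z"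
    unfolding conv3_def conv2_sw2_right ..
  finally show "conv3 C (\<odot>) (conv3 C (\<odot>) f g) h x y z = conv3 C (\<odot>) f (conv3 C (\<odot>) g h) x y z" .
qed

end

section \<open>Hopf algebras\<close>

sublocale bialgebra \<subseteq> co: coalgebra K
  by (intro coalgebra.intro clinear_comul clinear_counit coassoc counit_left counit_right)

sublocale bialgebra \<subseteq> al: algebra "mul K" "unity K"
  by (intro algebra.intro cbilinear_mul mul_assoc mul_unity_left mul_unity_right)

lemma convolutionI: "coalgebra C \<Longrightarrow> algebra m e \<Longrightarrow> convolution C m e"
  by (simp add: convolution_def)

context bialgebra
begin

lemma sw2_mul:
  assumes "cbilinear F"
  shows "sw2 K (x \<cdot> y) F = sw2 K x (\<lambda>x1 x2. sw2 K y (\<lambda>y1 y2. F (x1 \<cdot> y1) (x2 \<cdot> y2)))"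
  unfolding sw2_def comul_mul by (simp add: tsum_bil assms)

lemma sw2_unity: "cbilinear F \<Longrightarrow> sw2 K \<one> F = F \<one> \<one>"
  unfolding sw2_def comul_unity by (simp add: tsum_bil)

lemma comul_mul_tmul: "comul K (x \<cdot> y) = tmul (mul K) (mul K) (comul K x) (comul K y)"
  by (simp add: comul_mul tmul_def sw2_def)

lemma algebra_tensor_square: "algebra (tmul (mul K) (mul K)) (\<one> \<otimes> \<one>)"
  using algebra_tmul al.algebra_axioms by blast

end

sublocale bialgebra \<subseteq> id: convolution K "mul K" "unity K"
  by unfold_locales

context hopf_algebra
begin

abbreviation "S \<equiv> antipode K"

lemma clinear_antipode: "clinear S"
  and antipode_left: "sw2 K x (\<lambda>x1 x2. S x1 \<cdot> x2) = \<epsilon> x *\<^sub>C \<one>"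
  and antipode_right: "sw2 K x (\<lambda>x1 x2. x1 \<cdot> S x2) = \<epsilon> x *\<^sub>C \<one>"
  using is_antipode_antipode by (auto simp: is_antipode_def)

lemma lin_antipode [lin]: "clinear f \<Longrightarrow> clinear (\<lambda>x. S (f x))"
  by (rule clinear_compose[OF clinear_antipode])

lemma antipode_unity: "S \<one> = \<one>"
  using antipode_left[of \<one>] by (simp add: sw2_unity lin mul_unity_right counit_unity scaleC_one)

lemma counit_antipode: "\<epsilon> (S x) = \<epsilon> x"
proof -
  have "\<epsilon> x = \<epsilon> (sw2 K x (\<lambda>x1 x2. S x1 \<cdot> x2))"
    by (simp add: antipode_left clinear_scale[OF clinear_counit] scaleC_complex_def counit_unity)
  also have "\<dots> = sw2 K x (\<lambda>x1 x2. \<epsilon> x2 *\<^sub>C \<epsilon> (S x1))"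
    by (simp add: sw2_map[OF clinear_counit] counit_mul scaleC_complex_def mult.commute)
  also have "\<dots> = \<epsilon> (S x)"
    by (rule co.sw2_counit_right) (simp add: lin)
  finally show ?thesis by simp
qed

text \<open>In Hom(K \<otimes> K, K) the left side is a left convolution inverse of the product and
  the right side is a right inverse of it.\<close>

lemma antipode_mul: "S (x \<cdot> y) = S y \<cdot> S x"
proof -
  let ?f = "\<lambda>x y. S (x \<cdot> y)" and ?h = "\<lambda>x y. S y \<cdot> S x"
  let ?c = "conv2 K (\<cdot>)" and ?u = "\<lambda>x y. (\<epsilon> x * \<epsilon> y) *\<^sub>C \<one>"
  have fg: "?c ?f (\<cdot>) = ?u"
    using sw2_mul[of "\<lambda>u v. S u \<cdot> v"]
    by (simp add: fun_eq_iff conv2_def antipode_left counit_mul lin)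
  have gh: "?c (\<cdot>) ?h = ?u"
  proof (intro ext)
    fix x y
    have "?c (\<cdot>) ?h x y = sw2 K x (\<lambda>x1 x2. x1 \<cdot> (sw2 K y (\<lambda>y1 y2. y1 \<cdot> S y2) \<cdot> S x2))"
      by (simp add: conv2_def mul_assoc id.sw2_left[symmetric] id.sw2_right[symmetric])
    also have "\<dots> = ?u x y"
      by (simp add: antipode_right al.scale_left al.scale_right mul_unity_left
        sw2_scale scaleC_scaleC mult.commute)
    finally show "?c (\<cdot>) ?h x y = ?u x y" .
  qed
  have "?f = ?c (?c ?f (\<cdot>)) ?h"
    by (subst id.conv2_assoc) (simp_all add: lin gh id.conv2_unit_right)
  also have "\<dots> = ?h"
    by (simp only: fg) (simp add: id.conv2_unit_left lin)
  finally show ?thesis by (simp add: fun_eq_iff)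
qed

text \<open>Dual argument in Hom(K, K \<otimes> K): one side is a left convolution inverse of the
  coproduct, the other a right inverse.\<close>

lemma comul_antipode: "comul K (S x) = sw2 K x (\<lambda>x1 x2. S x2 \<otimes> S x1)"
proof -
  let ?T = "tmul (\<cdot>) (\<cdot>)"
  interpret T: convolution K ?T "\<one> \<otimes> \<one>"
    using algebra_tensor_square by (intro convolutionI co.coalgebra_axioms)
  let ?h = "\<lambda>x. sw2 K x (\<lambda>x1 x2. S x2 \<otimes> S x1)"
  have "(\<lambda>x. comul K (S x)) = ?h"
  proof (rule T.conv_inverse_unique)
    show "conv K ?T (\<lambda>x. comul K (S x)) (comul K) = (\<lambda>x. \<epsilon> x *\<^sub>C (\<one> \<otimes> \<one>))"
      by (simp add: fun_eq_iff conv_def comul_mul_tmul[symmetric] sw2_map[OF clinear_comul, symmetric]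
        antipode_left clinear_scale[OF clinear_comul] comul_unity)
    show "conv K ?T (comul K) ?h = (\<lambda>x. \<epsilon> x *\<^sub>C (\<one> \<otimes> \<one>))"
    proof
      fix x
      have "conv K ?T (comul K) ?h x = sw2 K x (\<lambda>x1 x2. sw2 K x1 (\<lambda>p q. sw2 K x2 (\<lambda>u v.
          (p \<cdot> S v) \<otimes> (q \<cdot> S u))))"
        by (simp add: conv_def tmul_def sw2_def tsum_bil lin)
      also have "\<dots> = sw2 K x (\<lambda>p r. sw2 K r (\<lambda>q s. sw2 K s (\<lambda>u v. (p \<cdot> S v) \<otimes> (q \<cdot> S u))))"
        by (rule co.sw2_assoc) (simp_all add: lin)
      also have "\<dots> = sw2 K x (\<lambda>p r. sw2 K r (\<lambda>w v. sw2 K w (\<lambda>q u. (p \<cdot> S v) \<otimes> (q \<cdot> S u))))"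
        by (subst co.sw2_assoc) (simp_all add: lin)
      also have "\<dots> = \<epsilon> x *\<^sub>C (\<one> \<otimes> \<one>)"
        by (simp add: sw2_map[where h = "\<lambda>z. _ \<otimes> z", symmetric] lin antipode_right tens_scale_right
          co.sw2_counit_left[where f = "\<lambda>v. (_ \<cdot> S v) \<otimes> \<one>"]
          sw2_map[where h = "\<lambda>z. z \<otimes> _", symmetric] tens_scale_left)
      finally show "conv K ?T (comul K) ?h x = \<epsilon> x *\<^sub>C (\<one> \<otimes> \<one>)" .
    qed
  qed (simp_all add: lin clinear_comul)
  then show ?thesis by (simp add: fun_eq_iff)
qed

lemma sw2_antipode: "cbilinear F \<Longrightarrow> sw2 K (S x) F = sw2 K x (\<lambda>x1 x2. F (S x2) (S x1))"
  by (simp add: sw2_def comul_antipode tsum_bil)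

end

section \<open>Hopf algebras with an involution\<close>

text \<open>A Sweedler sum is a finite sum, so additivity is enough. This lets the conjugate linear
  stars pass through.\<close>

lemma additive_tsum:
  assumes "\<And>x y. h (x + y) = h x + h y"
  shows "h (tsum t f) = tsum t (\<lambda>u v. h (f u v))"
proof -
  have "h 0 = 0" using assms[of 0 0] by simp
  then show ?thesis
    unfolding tsum_def by (subst sum_comp_morphism[of h, unfolded o_def, symmetric]) (simp_all add: assms)
qed

lemma additive_sw2: "(\<And>x y. h (x + y) = h x + h y) \<Longrightarrow> h (sw2 K t f) = sw2 K t (\<lambda>u v. h (f u v))"
  unfolding sw2_def by (rule additive_tsum)

lemma conj_linear_add: "conj_linear f \<Longrightarrow> f (x + y) = f x + f y"
  and conj_linear_scale: "conj_linear f \<Longrightarrow> f (c *\<^sub>C x) = cnj c *\<^sub>C f x"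
  by (simp_all add: conj_linear_def)

context star_hopf_algebra
begin

lemmas star_add = conj_linear_add[OF conj_linear_star]
  and star_scale = conj_linear_scale[OF conj_linear_star]
  and star_sw2 = additive_sw2[where h = star, OF conj_linear_add[OF conj_linear_star]]
  and star_tsum = additive_tsum[where h = star, OF conj_linear_add[OF conj_linear_star]]

lemma star_zero: "star 0 = 0"
  using star_add[of 0 0] by simp

lemma star_inject: "star x = star y \<longleftrightarrow> x = y"
  by (metis star_star)

lemma star_unity: "star \<one> = \<one>"
  by (metis mul_unity_left star_mul star_star)

lemma sw2_star: "balanced F \<Longrightarrow> sw2 K (star x) F = sw2 K x (\<lambda>u v. F (star u) (star v))"
  unfolding sw2_def comul_star[unfolded sw2_def] by (simp add: tsum_tsum tsum_tens)

text \<open>The linear map x -> cnj (\<epsilon> (star x)) is again a left counit, and a left counit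
  agrees with the right counit \<epsilon>.\<close>

lemma counit_star: "\<epsilon> (star x) = cnj (\<epsilon> x)"
proof -
  have lin': "clinear (\<lambda>x. cnj (\<epsilon> (star x)))"
    using clinear_add[OF clinear_counit] clinear_scale[OF clinear_counit]
    by (simp add: clinear_iff star_add star_scale scaleC_complex_def)
  have "sw2 K (star x) (\<lambda>u v. \<epsilon> u *\<^sub>C v) = sw2 K x (\<lambda>u v. \<epsilon> (star u) *\<^sub>C star v)"
    by (rule sw2_star) (simp add: cbilinear_imp_balanced lin)
  then have "star (sw2 K (star x) (\<lambda>u v. \<epsilon> u *\<^sub>C v)) = sw2 K x (\<lambda>u v. cnj (\<epsilon> (star u)) *\<^sub>C v)"
    by (simp add: star_sw2 star_scale star_star)
  then have "sw2 K x (\<lambda>u v. cnj (\<epsilon> (star u)) *\<^sub>C v) = x"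
    by (simp add: counit_left star_star)
  from arg_cong[OF this, of \<epsilon>] have "\<epsilon> x = sw2 K x (\<lambda>u v. \<epsilon> v *\<^sub>C cnj (\<epsilon> (star u)))"
    by (simp add: sw2_map[OF clinear_counit] clinear_scale[OF clinear_counit] scaleC_complex_def mult.commute)
  also have "\<dots> = cnj (\<epsilon> (star x))"
    using lin' by (rule co.sw2_counit_right)
  finally show ?thesis by simp
qed

text \<open>T = star S star is an antipode for the opposite product: T(x2) x1 sums to \<epsilon>(x)
  1. Hence T S and the identity are both convolution inverses of S, and S T and the identity are
  both inverses of T for the opposite product. Bijectivity of S follows, which gives meaning to the
  inverse function in \<open>gamma_map\<close>.\<close>

lemma antipode_star_antipode_star: "S (star (S (star x))) = x"
  and star_antipode_star_antipode: "star (S (star (S x))) = x"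
proof -
  define T where "T x = star (S (star x))" for x
  have T_lin: "clinear T"
    by (simp add: T_def[abs_def] clinear_iff star_add star_scale clinear_add[OF clinear_antipode]
      clinear_scale[OF clinear_antipode])
  note [lin] = clinear_compose[OF T_lin]
  have counit_T: "\<epsilon> (T x) = \<epsilon> x" for x
    by (simp add: T_def counit_star counit_antipode)
  have T_left: "sw2 K x (\<lambda>x1 x2. T x2 \<cdot> x1) = \<epsilon> x *\<^sub>C \<one>" for x
  proof -
    have "sw2 K x (\<lambda>x1 x2. star x1 \<cdot> S (star x2)) = \<epsilon> (star x) *\<^sub>C \<one>"
      using antipode_right[of "star x"] by (subst (asm) sw2_star) (simp_all add: cbilinear_imp_balanced lin)
    then have "star (sw2 K x (\<lambda>x1 x2. star x1 \<cdot> S (star x2))) = \<epsilon> x *\<^sub>C \<one>"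
      by (simp add: star_scale star_unity counit_star)
    then show ?thesis
      by (simp add: star_sw2 star_mul star_star T_def)
  qed
  have comul_T: "sw2 K (T x) F = sw2 K x (\<lambda>x1 x2. F (T x2) (T x1))" if F: "cbilinear F" for x and F :: "'k \<Rightarrow> 'k \<Rightarrow> 'k"
  proof -
    note F_simps = clinear_add[OF cbilinear_left[OF F]] clinear_add[OF cbilinear_right[OF F]]
      clinear_scale[OF cbilinear_left[OF F]] clinear_scale[OF cbilinear_right[OF F]]
    have "sw2 K (T x) F = sw2 K (S (star x)) (\<lambda>u v. F (star u) (star v))"
      unfolding T_def using F by (simp add: sw2_star cbilinear_imp_balanced)
    also have "\<dots> = sw2 K (star x) (\<lambda>x1 x2. F (star (S x2)) (star (S x1)))"
      unfolding sw2_def comul_antipode[unfolded sw2_def]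
      by (subst tsum_tsum)
        (simp_all add: tsum_tens balanced_def star_add star_scale F_simps)
    also have "\<dots> = sw2 K x (\<lambda>x1 x2. F (T x2) (T x1))"
      unfolding T_def
      by (subst sw2_star)
        (simp_all add: balanced_def star_add star_scale F_simps
          clinear_add[OF clinear_antipode] clinear_scale[OF clinear_antipode])
    finally show ?thesis .
  qed
  interpret op: convolution K "\<lambda>x y. y \<cdot> x" \<one>
    by (rule convolutionI[OF co.coalgebra_axioms algebra_opposite[OF al.algebra_axioms]])
  have "(\<lambda>x. T (S x)) = (\<lambda>x. x)"
  proof (rule id.conv_inverse_unique[where g = S])
    show "conv K (\<cdot>) (\<lambda>x. T (S x)) S = (\<lambda>x. \<epsilon> x *\<^sub>C \<one>)"
      using T_left[of "S _"] by (simp add: fun_eq_iff conv_def sw2_antipode lin counit_antipode)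
  qed (simp_all add: lin conv_def[abs_def] antipode_left clinear_antipode)
  then show "star (S (star (S x))) = x" by (simp add: T_def fun_eq_iff)
  have "(\<lambda>x. x) = (\<lambda>x. S (T x))"
  proof (rule op.conv_inverse_unique[where g = T])
    show "conv K (\<lambda>x y. y \<cdot> x) T (\<lambda>x. S (T x)) = (\<lambda>x. \<epsilon> x *\<^sub>C \<one>)"
      using antipode_left[of "T _"]
      by (simp add: fun_eq_iff conv_def comul_T lin counit_T)
  qed (simp_all add: lin conv_def[abs_def] T_left T_lin)
  then show "S (star (S (star x))) = x" by (simp add: T_def fun_eq_iff)
qed

lemma bij_antipode: "bij S"
  by (rule bijI') (metis star_antipode_star_antipode, metis antipode_star_antipode_star)

lemma clinear_inv_antipode: "clinear (inv S)"
proof -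
  have inv: "inv S y = x" if "S x = y" for x y
    using bij_inv_eq_iff[OF bij_antipode, of x y] that by simp
  have S_inv: "S (inv S x) = x" for x
    by (simp add: bij_antipode bij_is_surj surj_f_inv_f)
  show ?thesis
    unfolding clinear_iff
    by (intro conjI allI; rule inv)
      (simp_all add: clinear_add[OF clinear_antipode] clinear_scale[OF clinear_antipode] S_inv)
qed

end

section \<open>The algebra structure of the bismash product\<close>

sublocale cocycle_linked_pair \<subseteq> HA: convolution H "mul A" "unity A"
  by (rule convolutionI[OF H.co.coalgebra_axioms A.al.algebra_axioms])

sublocale cocycle_linked_pair \<subseteq> AH: convolution H "tmul (mul A) (mul H)" "unity A \<otimes> unity H"
  by (rule convolutionI[OF H.co.coalgebra_axioms algebra_tmul[OF A.al.algebra_axioms H.al.algebra_axioms]])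

context cocycle_linked_pair
begin

abbreviation mulA (infixl \<open>\<odot>\<close> 70) where "mulA \<equiv> mul A"
abbreviation mulH (infixl \<open>\<bullet>\<close> 70) where "mulH \<equiv> mul H"
abbreviation "AH \<equiv> tmul mulA mulH"
abbreviation "B \<equiv> bismash A H (\<triangleright>) \<rho> \<chi> \<psi>"
abbreviation mulB (infixl \<open>\<diamondop>\<close> 70) where "mulB \<equiv> mul B"
abbreviation "\<epsilon>H \<equiv> counit H"
abbreviation "\<epsilon>A \<equiv> counit A"
abbreviation "i (a :: 'a) \<equiv> a \<otimes> \<one>\<^bsub>H\<^esub>"
abbreviation "j (x :: 'h) \<equiv> \<one>\<^bsub>A\<^esub> \<otimes> x"

lemmas [lin] =
  clinear_compose[OF cbilinear_left[OF cbilinear_act]]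
  clinear_compose[OF cbilinear_right[OF cbilinear_act]]
  clinear_compose[OF cbilinear_left[OF cbilinear_chi]]
  clinear_compose[OF cbilinear_right[OF cbilinear_chi]]
  clinear_compose[OF clinear_rho] clinear_compose[OF clinear_psi]

lemma AH_tens: "AH (a \<otimes> x) (b \<otimes> y) = (a \<odot> b) \<otimes> (x \<bullet> y)"
  by (rule tmul_tens[OF A.al.algebra_axioms H.al.algebra_axioms])

text \<open>This is (1 # x)(1 # y), written out before any property of \<open>mulB\<close> is
  available.\<close>

definition K :: "'h \<Rightarrow> 'h \<Rightarrow> 'a \<otimes> 'h" where
  "K x y = sw2 H x (\<lambda>x1 x2. sw2 H y (\<lambda>y1 y2. \<chi> x1 y1 \<otimes> (x2 \<bullet> y2)))"

text \<open>Left multiplication by 1 # x, written with the componentwise product \<open>AH\<close>,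
  whose associativity is already known. By \<open>mulB_eq\<close> the whole product is recovered
  from it.\<close>

definition J :: "'h \<Rightarrow> 'a \<otimes> 'h \<Rightarrow> 'a \<otimes> 'h" where
  "J x t = tsum t (\<lambda>b y. sw2 H x (\<lambda>x1 x2. AH (i (x1 \<triangleright> b)) (K x2 y)))"

lemma lin_K [lin]:
  "clinear f \<Longrightarrow> clinear (\<lambda>x. K (f x) y)" "clinear f \<Longrightarrow> clinear (\<lambda>x. K y (f x))"
  unfolding K_def by (simp_all add: lin)

lemma lin_J [lin]:
  "clinear f \<Longrightarrow> clinear (\<lambda>x. J (f x) t)" "clinear g \<Longrightarrow> clinear (\<lambda>x. J y (g x))"
  unfolding J_def by (simp_all add: lin)

lemma J_tens: "J x (b \<otimes> y) = sw2 H x (\<lambda>x1 x2. AH (i (x1 \<triangleright> b)) (K x2 y))"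
  unfolding J_def by (simp add: tsum_bil lin)

lemma mulB_eq: "s \<diamondop> t = tsum s (\<lambda>a x. AH (i a) (J x t))"
  unfolding bismash_def J_def K_def sw3_def
  by (simp add: AH.tsum_right[symmetric] AH.sw2_right[symmetric] AH_tens A.mul_assoc H.mul_unity_left)

lemma lin_mulB [lin]:
  "clinear f \<Longrightarrow> clinear (\<lambda>x. f x \<diamondop> t)" "clinear f \<Longrightarrow> clinear (\<lambda>x. t \<diamondop> f x)"
  unfolding mulB_eq by (simp_all add: lin)

lemma tens_mulB: "(a \<otimes> x) \<diamondop> t = AH (i a) (J x t)"
  unfolding mulB_eq by (simp add: tsum_bil lin)

lemma i_mul_AH: "AH (i (a \<odot> b)) t = AH (i a) (AH (i b) t)"
  by (simp add: AH.assoc[symmetric] AH_tens H.mul_unity_left)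

lemma J_i: "J x (AH (i b) t) = sw2 H x (\<lambda>x1 x2. AH (i (x1 \<triangleright> b)) (J x2 t))"
proof (rule tensor_ext[where t = t])
  fix c z
  have "J x (AH (i b) (c \<otimes> z)) = sw2 H x (\<lambda>x1 x2. sw2 H x1 (\<lambda>u v. AH (i (u \<triangleright> b)) (AH (i (v \<triangleright> c)) (K x2 z))))"
    by (simp add: AH_tens H.mul_unity_left J_tens act_mul i_mul_AH[symmetric] sw2_map[where h = "\<lambda>p. AH (i p) _", symmetric] lin)
  also have "\<dots> = sw2 H x (\<lambda>x1 x2. AH (i (x1 \<triangleright> b)) (J x2 (c \<otimes> z)))"
    by (subst H.co.sw2_assoc) (simp_all add: lin J_tens AH.sw2_right)
  finally show "J x (AH (i b) (c \<otimes> z)) = sw2 H x (\<lambda>x1 x2. AH (i (x1 \<triangleright> b)) (J x2 (c \<otimes> z)))" .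
qed (simp_all add: lin)

text \<open>Here the cocycle axiom enters: in a convolution product of three factors on H \<otimes>
  H \<otimes> H it exchanges the first two, and the third, the product of H, is only
  reassociated.\<close>

lemma J_K: "J x (K y z) = sw2 H x (\<lambda>x1 x2. sw2 H y (\<lambda>y1 y2. AH (i (\<chi> x1 y1)) (K (x2 \<bullet> y2) z)))"
proof -
  \<comment> \<open>The counit of z in \<open>?l\<close> pads \<chi> to a map of three arguments, as
    \<open>conv3\<close> requires.\<close>
  let ?c = "conv3 H AH" and ?f = "\<lambda>x y z. i (x \<triangleright> \<chi> y z)" and ?g = "\<lambda>x y z. i (\<chi> x (y \<bullet> z))"
    and ?h = "\<lambda>x y z. \<one>\<^bsub>A\<^esub> \<otimes> (x \<bullet> (y \<bullet> z))" and ?k = "\<lambda>x y z. i (\<chi> (x \<bullet> y) z)"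
    and ?l = "\<lambda>x y z. i (\<epsilon>H z *\<^sub>C \<chi> x y)"
  have "J x (K y z) = sw2 H y (\<lambda>y1 y2. sw2 H z (\<lambda>z1 z2. sw2 H x (\<lambda>x1 x2.
      AH (i (x1 \<triangleright> \<chi> y1 z1)) (K x2 (y2 \<bullet> z2)))))"
    by (subst (1) K_def) (simp add: sw2_map[where h = "J x"] lin J_tens)
  also have "\<dots> = ?c ?f (?c ?g ?h) x y z"
    by (simp add: conv3_def conv2_def K_def H.sw2_mul lin AH_tens A.mul_unity_right H.mul_unity_left
        sw2_swap[of H z H x] sw2_swap[of H y H x])
  also have "\<dots> = ?c (?c ?f ?g) ?h x y z"
    by (simp add: AH.conv3_assoc lin)
  also have "?c ?f ?g = ?c ?l ?k"
  proof (intro ext)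
    fix x y z
    have "?c ?f ?g x y z = i (sw2 H x (\<lambda>x1 x2. sw2 H y (\<lambda>y1 y2. sw2 H z (\<lambda>z1 z2.
         (x1 \<triangleright> \<chi> y1 z1) \<odot> \<chi> x2 (y2 \<bullet> z2)))))"
      by (simp add: conv3_def conv2_def AH_tens H.mul_unity_left sw2_map[where h = "\<lambda>p. i p"] lin)
    also have "\<dots> = ?c ?l ?k x y z"
      by (simp add: cocycle conv3_def conv2_def AH_tens H.mul_unity_left sw2_map[where h = "\<lambda>p. i p"] lin
        AH.scale_left tens_scale_left H.co.sw2_counit_left lin)
    finally show "?c ?f ?g x y z = ?c ?l ?k x y z" .
  qed
  also have "?c (?c ?l ?k) ?h x y z = ?c ?l (?c ?k ?h) x y z"
    by (simp add: AH.conv3_assoc lin)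
  also have "\<dots> = sw2 H x (\<lambda>x1 x2. sw2 H y (\<lambda>y1 y2. AH (i (\<chi> x1 y1)) (K (x2 \<bullet> y2) z)))"
    by (simp add: conv3_def conv2_def tens_scale_left AH.scale_left H.co.sw2_counit_left lin K_def
      H.sw2_mul AH_tens A.mul_unity_right H.mul_unity_left H.mul_assoc)
  finally show ?thesis .
qed

text \<open>Associativity with 1 # x and 1 # y as the two left factors. With \<open>J_K\<close> the
  third convolution factor takes the form required, and the twisted module axiom exchanges the first
  two.\<close>

lemma J_J: "J x (J y t) = sw2 H x (\<lambda>x1 x2. sw2 H y (\<lambda>y1 y2. AH (i (\<chi> x1 y1)) (J (x2 \<bullet> y2) t)))"
proof (rule tensor_ext[where t = t])
  fix c z
  let ?c = "conv2 H AH" and ?f = "\<lambda>x y. i (x \<triangleright> y \<triangleright> c)" and ?g = "\<lambda>x y. i (\<chi> x y)"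
    and ?f' = "\<lambda>x y. i ((x \<bullet> y) \<triangleright> c)" and ?h = "\<lambda>x y. K (x \<bullet> y) z"
  have "J x (J y (c \<otimes> z)) = ?c ?f (?c ?g ?h) x y"
    by (simp add: J_tens sw2_map[where h = "J x"] lin J_i conv2_def J_K sw2_swap[of H y])
  also have "\<dots> = ?c (?c ?f ?g) ?h x y"
    by (simp add: AH.conv2_assoc lin)
  also have "?c ?f ?g = ?c ?g ?f'"
    using twisted_module[of _ _ c]
    by (simp add: fun_eq_iff conv2_def AH_tens H.mul_unity_left sw2_map[where h = "\<lambda>p. i p", symmetric] lin)
  also have "?c (?c ?g ?f') ?h x y = ?c ?g (?c ?f' ?h) x y"
    by (simp add: AH.conv2_assoc lin)
  also have "\<dots> = sw2 H x (\<lambda>x1 x2. sw2 H y (\<lambda>y1 y2. AH (i (\<chi> x1 y1)) (J (x2 \<bullet> y2) (c \<otimes> z))))"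
    by (simp add: conv2_def J_tens H.sw2_mul lin)
  finally show "J x (J y (c \<otimes> z)) = sw2 H x (\<lambda>x1 x2. sw2 H y (\<lambda>y1 y2. AH (i (\<chi> x1 y1)) (J (x2 \<bullet> y2) (c \<otimes> z))))" .
qed (simp_all add: lin)

lemma AH_mulB: "AH (i a) s \<diamondop> t = AH (i a) (s \<diamondop> t)"
  by (rule tensor_ext[where t = s]) (simp_all add: lin AH_tens tens_mulB i_mul_AH H.mul_unity_left)

lemma K_unity: "K \<one>\<^bsub>H\<^esub> y = j y" "K y \<one>\<^bsub>H\<^esub> = j y"
  unfolding K_def
  by (simp_all add: H.sw2_unity lin chi_unity_left chi_unity_right tens_scale_left H.mul_unity_left
      H.mul_unity_right H.co.sw2_counit_left)

lemma J_unity: "J \<one>\<^bsub>H\<^esub> t = t"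
  by (rule tensor_ext[where t = t and g = "\<lambda>t. t"])
    (simp_all add: lin J_tens H.sw2_unity unity_act K_unity AH_tens A.mul_unity_right H.mul_unity_left)

lemma mulB_assoc: "(s \<diamondop> t) \<diamondop> r = s \<diamondop> (t \<diamondop> r)"
proof (rule tensor_ext[where t = s])
  fix a x
  show "((a \<otimes> x) \<diamondop> t) \<diamondop> r = (a \<otimes> x) \<diamondop> (t \<diamondop> r)"
  proof (rule tensor_ext[where t = t])
    fix b y
    have "K x y \<diamondop> r = J x (J y r)" for x
      unfolding J_J by (simp add: K_def sw2_map[where h = "\<lambda>z. z \<diamondop> r"] lin tens_mulB)
    then show "((a \<otimes> x) \<diamondop> (b \<otimes> y)) \<diamondop> r = (a \<otimes> x) \<diamondop> ((b \<otimes> y) \<diamondop> r)"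
      by (simp add: tens_mulB J_tens J_i AH_mulB sw2_map[where h = "\<lambda>z. z \<diamondop> r"] lin)
  qed (simp_all add: lin)
qed (simp_all add: lin)

lemma unityB: "unity B = \<one>\<^bsub>A\<^esub> \<otimes> \<one>\<^bsub>H\<^esub>"
  by (simp add: bismash_def)

lemma algebra_B: "algebra mulB (\<one>\<^bsub>A\<^esub> \<otimes> \<one>\<^bsub>H\<^esub>)"
proof
  show "(\<one>\<^bsub>A\<^esub> \<otimes> \<one>\<^bsub>H\<^esub>) \<diamondop> t = t" for t
    by (simp add: tens_mulB J_unity AH.unit_left)
  show "t \<diamondop> (\<one>\<^bsub>A\<^esub> \<otimes> \<one>\<^bsub>H\<^esub>) = t" for t
    by (rule tensor_ext[where t = t and g = "\<lambda>t. t"])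
      (simp_all add: lin tens_mulB J_tens K_unity act_unity tens_scale_left AH_tens A.mul_unity_right
        A.mul_unity_left H.mul_unity_left AH.scale_left H.co.sw2_counit_left)
qed (simp_all add: lin mulB_assoc)

end

sublocale cocycle_linked_pair \<subseteq> HB: convolution H "mul B" "unity A \<otimes> unity H"
  by (rule convolutionI[OF H.co.coalgebra_axioms algebra_B])

sublocale cocycle_linked_pair \<subseteq>
    HT: convolution H "tmul (mul B) (mul B)" "(unity A \<otimes> unity H) \<otimes> (unity A \<otimes> unity H)"
  by (rule convolutionI[OF H.co.coalgebra_axioms algebra_tmul[OF algebra_B algebra_B]])

context cocycle_linked_pair
begin

lemma i_mulB: "i a \<diamondop> t = AH (i a) t"
  by (simp add: tens_mulB J_unity)

lemma i_mulB_tens: "i a \<diamondop> (b \<otimes> y) = (a \<odot> b) \<otimes> y"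
  by (simp add: i_mulB AH_tens H.mul_unity_left)

text \<open>Together with \<open>i_mulB\<close> and \<open>j_j\<close> this determines the product.
  Later computations only move \<open>i\<close> to the left of \<open>j\<close> with these
  rules.\<close>

lemma j_i: "j x \<diamondop> i b = sw2 H x (\<lambda>x1 x2. i (x1 \<triangleright> b) \<diamondop> j x2)"
  unfolding i_mulB by (simp add: tens_mulB J_tens K_unity AH.unit_left)

lemma j_j: "j x \<diamondop> j y = sw2 H x (\<lambda>x1 x2. sw2 H y (\<lambda>y1 y2. i (\<chi> x1 y1) \<diamondop> j (x2 \<bullet> y2)))"
  unfolding i_mulB
  by (simp add: tens_mulB J_tens act_unity tens_scale_left AH.scale_left AH.unit_left AH_tens
      A.mul_unity_right H.mul_unity_left H.co.sw2_counit_left lin K_def)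

end

section \<open>The bialgebra structure of the bismash product\<close>

context cocycle_linked_pair
begin

abbreviation "BB \<equiv> tmul mulB mulB"
abbreviation "eB \<equiv> \<one>\<^bsub>A\<^esub> \<otimes> \<one>\<^bsub>H\<^esub>"
abbreviation conv_T (infixr \<open>\<star>\<close> 65) where "conv_T \<equiv> conv H BB"
abbreviation conv2_T (infixr \<open>\<star>\<^sub>2\<close> 65) where "conv2_T \<equiv> conv2 H BB"

lemma BB_tens: "BB (s \<otimes> t) (s' \<otimes> t') = (s \<diamondop> s') \<otimes> (t \<diamondop> t')"
  by (rule tmul_tens[OF algebra_B algebra_B])

lemma rho_act_map:
  assumes F: "cbilinear F"
  shows "sw2 H x (\<lambda>x1 x2. tsum (\<rho> x2) (\<lambda>h a. F h ((x1 \<triangleright> b) \<odot> a))) =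
    sw2 H x (\<lambda>x1 x2. tsum (\<rho> x1) (\<lambda>h a. F h (a \<odot> (x2 \<triangleright> b))))"
  using arg_cong[OF rho_act[of x b], of "\<lambda>t. tsum t F"]
  by (simp add: sw2_map[where h = "\<lambda>t. tsum t F"] F lin tsum_bil)

lemma comul_rho_map:
  assumes "\<And>v w. clinear (\<lambda>u. F u v w)" "\<And>u w. clinear (\<lambda>v. F u v w)" "\<And>u v. clinear (\<lambda>w. F u v w)"
  shows "tsum (\<rho> x) (\<lambda>h a. sw2 H h (\<lambda>h1 h2. F h1 h2 a)) =
    sw2 H x (\<lambda>x1 x2. tsum (\<rho> x1) (\<lambda>h a. tsum (\<rho> x2) (\<lambda>h' a'. F h h' (a \<odot> a'))))"
proof -
  define G where "G t = tsum t (\<lambda>u s. tsum s (\<lambda>v w. F u v w))" for t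
  have G: "clinear G" "G (u \<otimes> v \<otimes> w) = F u v w" for u v w
    using assms unfolding G_def[abs_def] by (simp_all add: lin tsum_bil)
  show ?thesis
    using arg_cong[OF comul_rho[of x], of G] by (simp add: sw2_map[OF G(1)] clinear_tsum_map[OF G(1)] G(2))
qed

text \<open>The coproduct of $B$ is $\Delta(a \# x) = I_2(\Delta(a)) D(x)$, where $D$ is the convolution product of
  the contributions of $\psi$, of $\rho$ and of the last leg of $x$. The remaining maps record what
  results from moving these factors past each other.\<close>

definition I2 :: "'a \<otimes> 'a \<Rightarrow> ('a \<otimes> 'h) \<otimes> ('a \<otimes> 'h)" where
  "I2 s = tsum s (\<lambda>u v. i u \<otimes> i v)"
definition "Ps x = I2 (\<psi> x)"
definition "R x = tsum (\<rho> x) (\<lambda>h a. j h \<otimes> i a)"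
definition "J2 x = eB \<otimes> j x"
definition "D0 = R \<star> J2"
definition "D = Ps \<star> D0"
text \<open>\<open>M b\<close> arises when \<open>i b\<close> in the second leg passes
  \<open>J2\<close>, and \<open>N b\<close> when \<open>i b\<close> in the first leg passes
  \<open>R\<close>; \<open>U s\<close> combines both for s in A \<otimes> A.\<close>

definition "M b x = eB \<otimes> i (x \<triangleright> b)"
definition "N b x = tsum (\<rho> x) (\<lambda>h a. i (h \<triangleright> b) \<otimes> i a)"
definition "U s x = tsum s (\<lambda>u v. (N u \<star> M v) x)"
text \<open>\<open>Vk\<close> and \<open>Rk\<close> arise when \<open>j k\<close> in the first leg
  passes \<open>R\<close>; together with the \<open>M b\<close> that belongs to the other leg of
  \<rho> they make up \<open>V\<close> and \<open>R'\<close>. \<open>Q\<close> comes from moving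
  \<open>R y\<close> through \<open>J2 x\<close>, and \<open>W\<close> is the cocycle produced by
  two factors \<open>J2\<close>.\<close>

definition "Vk k x = tsum (\<rho> x) (\<lambda>h a. i (\<chi> h k) \<otimes> i a)"
definition "Rk k x = tsum (\<rho> x) (\<lambda>h a. j (h \<bullet> k) \<otimes> i a)"
definition "V x y = tsum (\<rho> y) (\<lambda>k b. (Vk k \<star> M b) x)"
definition "R' x y = tsum (\<rho> y) (\<lambda>k b. (Rk k \<star> M b) x)"
definition "W x y = eB \<otimes> i (\<chi> x y)"
definition "Q x y = tsum (\<rho> y) (\<lambda>k b. j k \<otimes> i (x \<triangleright> b))"
definition "U' x y = (Ps \<star> U (\<psi> y)) x"
definition "IX x y = I2 (comul A (\<chi> x y))"

lemma lin_T0 [lin]: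
  "clinear f \<Longrightarrow> clinear (\<lambda>x. I2 (f x))" "clinear f' \<Longrightarrow> clinear (\<lambda>x. Ps (f' x))"
  "clinear f' \<Longrightarrow> clinear (\<lambda>x. R (f' x))" "clinear f' \<Longrightarrow> clinear (\<lambda>x. J2 (f' x))"
  "clinear f' \<Longrightarrow> clinear (\<lambda>x. M b (f' x))" "clinear g \<Longrightarrow> clinear (\<lambda>x. M (g x) y)"
  "clinear f' \<Longrightarrow> clinear (\<lambda>x. N b (f' x))" "clinear g \<Longrightarrow> clinear (\<lambda>x. N (g x) y)"
  "clinear f' \<Longrightarrow> clinear (\<lambda>x. Vk k (f' x))" "clinear f' \<Longrightarrow> clinear (\<lambda>x. Vk (f' x) y)"
  "clinear f' \<Longrightarrow> clinear (\<lambda>x. Rk k (f' x))" "clinear f' \<Longrightarrow> clinear (\<lambda>x. Rk (f' x) y)"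
  "clinear f' \<Longrightarrow> clinear (\<lambda>x. W k (f' x))" "clinear f' \<Longrightarrow> clinear (\<lambda>x. W (f' x) y)"
  "clinear f' \<Longrightarrow> clinear (\<lambda>x. Q k (f' x))" "clinear f' \<Longrightarrow> clinear (\<lambda>x. Q (f' x) y)"
  "clinear f' \<Longrightarrow> clinear (\<lambda>x. IX k (f' x))" "clinear f' \<Longrightarrow> clinear (\<lambda>x. IX (f' x) y)"
  unfolding I2_def Ps_def R_def J2_def M_def N_def Vk_def Rk_def W_def Q_def IX_def
  by (simp_all add: lin)

lemma lin_T1 [lin]:
  "clinear f' \<Longrightarrow> clinear (\<lambda>x. D0 (f' x))" "clinear f' \<Longrightarrow> clinear (\<lambda>x. D (f' x))"
  "clinear f' \<Longrightarrow> clinear (\<lambda>x. U s (f' x))" "clinear h \<Longrightarrow> clinear (\<lambda>x. U (h x) y)"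
  "clinear f' \<Longrightarrow> clinear (\<lambda>x. V k (f' x))" "clinear f' \<Longrightarrow> clinear (\<lambda>x. V (f' x) y)"
  "clinear f' \<Longrightarrow> clinear (\<lambda>x. R' k (f' x))" "clinear f' \<Longrightarrow> clinear (\<lambda>x. R' (f' x) y)"
  unfolding D0_def D_def U_def V_def R'_def
  by (simp_all add: lin)

lemma lin_U' [lin]:
  "clinear f' \<Longrightarrow> clinear (\<lambda>x. U' k (f' x))" "clinear f' \<Longrightarrow> clinear (\<lambda>x. U' (f' x) y)"
  unfolding U'_def by (simp_all add: lin)

lemma clinear_T:
  "clinear Ps" "clinear R" "clinear J2" "clinear D0" "clinear D" "clinear (M b)" "clinear (N b)"
  "clinear (U s)" "clinear (Vk k)" "clinear (Rk k)"
  by (simp_all add: lin)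

lemma cbilinear_T: "cbilinear W" "cbilinear Q" "cbilinear V" "cbilinear R'" "cbilinear U'" "cbilinear IX"
  by (simp_all add: lin)

lemma I2_tens: "I2 (u \<otimes> v) = i u \<otimes> i v"
  unfolding I2_def by (simp add: tsum_bil lin)

lemma comulB_raw: "comul B (a \<otimes> x) = sw2 A a (\<lambda>a1 a2. sw3 H x (\<lambda>x1 x2 x3.
    tsum (\<psi> x1) (\<lambda>x1I x1II. tsum (\<rho> x2) (\<lambda>x2H x2A.
      ((a1 \<odot> x1I) \<otimes> x2H) \<otimes> ((a2 \<odot> x1II \<odot> x2A) \<otimes> x3)))))"
  unfolding bismash_def by (simp add: tsum_bil lin sw3_def)

lemma comulB_tens: "comul B (a \<otimes> x) = BB (I2 (comul A a)) (D x)"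
proof -
  have "comul B (a \<otimes> x) = sw2 A a (\<lambda>a1 a2. BB (i a1 \<otimes> i a2) (D x))"
    unfolding comulB_raw I2_def D_def D0_def Ps_def R_def J2_def conv_def sw3_def
    by (simp add: HT.tsum_left[symmetric] HT.tsum_right[symmetric] HT.sw2_right[symmetric]
      BB_tens HB.unit_left HB.unit_right i_mulB_tens A.mul_assoc A.mul_unity_right
      tsum_swap[where s = "\<psi> y" and t = "\<rho> z" for y z])
  also have "\<dots> = BB (I2 (comul A a)) (D x)"
    by (simp add: I2_def sw2_def HT.tsum_left)
  finally show ?thesis .
qed

lemma J2_i: "BB (J2 x) (i u \<otimes> eB) = BB (i u \<otimes> eB) (J2 x)"
  by (simp add: J2_def BB_tens HB.unit_left HB.unit_right)

lemma J2_M: "BB (J2 x) (eB \<otimes> i v) = (M v \<star> J2) x"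
  by (simp add: J2_def M_def conv_def BB_tens HB.unit_left)
    (simp add: j_i sw2_map[where h = "\<lambda>z. eB \<otimes> z"] lin)

lemma j_i_rho:
  "BB (R x) (i u \<otimes> eB) = (N u \<star> R) x"
proof -
  have "BB (R x) (i u \<otimes> eB) = tsum (\<rho> x) (\<lambda>h a. sw2 H h (\<lambda>h1 h2. (i (h1 \<triangleright> u) \<diamondop> j h2) \<otimes> i a))"
    by (simp add: R_def HT.tsum_left[symmetric] BB_tens HB.unit_right j_i sw2_map[where h = "\<lambda>z. z \<otimes> _"] lin)
  also have "\<dots> = (N u \<star> R) x"
    by (subst comul_rho_map) (simp_all add: lin conv_def N_def R_def HT.tsum_left[symmetric],
      simp add: HT.tsum_right[symmetric] BB_tens i_mulB_tens A.mul_unity_right)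
  finally show ?thesis .
qed

text \<open>The axiom \<open>rho_act\<close> in convolution form. Leaving the first leg F arbitrary
  makes it serve both \<open>R\<close> and \<open>Rk\<close>.\<close>

lemma rho_act_conv:
  assumes F: "clinear F"
  shows "(\<lambda>x. tsum (\<rho> x) (\<lambda>h a. F h \<otimes> i a)) \<star> M b = M b \<star> (\<lambda>x. tsum (\<rho> x) (\<lambda>h a. F h \<otimes> i a))"
proof -
  note [lin] = clinear_compose[OF F]
  have "cbilinear (\<lambda>h a. F h \<otimes> i a)"
    by (simp add: lin)
  from rho_act_map[OF this, of _ b] show ?thesis
    by (simp add: fun_eq_iff conv_def M_def HT.tsum_left[symmetric] HT.tsum_right[symmetric] BB_tens
      i_mulB_tens HB.unit_right HB.unit_left)
qed

lemma R_M: "R \<star> M b = M b \<star> R"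
  unfolding R_def[abs_def] by (rule rho_act_conv) (simp add: lin)

lemma Rk_M: "Rk k \<star> M b = M b \<star> Rk k"
  unfolding Rk_def[abs_def] by (rule rho_act_conv) (simp add: lin)

text \<open>The factor \<open>i u\<close> passes \<open>J2\<close> unchanged and \<open>R\<close> at
  the cost of \<open>N u\<close>; \<open>i v\<close> passes \<open>J2\<close> at the cost of
  \<open>M v\<close>, which then commutes with \<open>R\<close>.\<close>

lemma D0_I2: "BB (D0 x) (I2 s) = (U s \<star> D0) x"
proof -
  have "BB (D0 x) (i u \<otimes> i v) = ((N u \<star> M v) \<star> D0) x" for u v
  proof -
    have "BB (D0 x) (i u \<otimes> i v) = BB (BB ((R \<star> J2) x) (i u \<otimes> eB)) (eB \<otimes> i v)"
      by (simp add: D0_def HT.assoc BB_tens HB.unit_left HB.unit_right)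
    also have "\<dots> = ((\<lambda>x. BB (R x) (i u \<otimes> eB)) \<star> (\<lambda>x. BB (J2 x) (eB \<otimes> i v))) x"
      by (simp add: HT.conv_mult_right[symmetric] HT.conv_mult_mid[symmetric] J2_i HT.assoc)
    also have "\<dots> = (N u \<star> (R \<star> M v) \<star> J2) x"
      by (simp add: j_i_rho J2_M HT.conv_assoc HT.clinear_conv clinear_T)
    also have "\<dots> = ((N u \<star> M v) \<star> D0) x"
      by (simp add: R_M D0_def HT.conv_assoc HT.clinear_conv clinear_T)
    finally show ?thesis .
  qed
  then show ?thesis
    by (simp add: I2_def U_def[abs_def] HT.conv_tsum_left HT.tsum_right[symmetric])
qed

lemma D_I2: "BB (D x) (I2 s) = (Ps \<star> (U s \<star> D0)) x"
  unfolding D_def HT.conv_mult_right[symmetric] D0_I2 ..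

lemma comul_act_conv: "(\<lambda>x. I2 (comul A (x \<triangleright> b))) \<star> Ps = Ps \<star> U (comul A b)"
proof
  fix x
  let ?G = "tmap (\<lambda>u. i u) (\<lambda>v. i v)"
  have G: "clinear ?G" "?G (u \<otimes> v) = i u \<otimes> i v" for u v
    by (simp_all add: clinear_tmap tmap_tens lin)
  have "((\<lambda>x. I2 (comul A (x \<triangleright> b))) \<star> Ps) x = sw2 H x (\<lambda>x1 x2. sw2 A (x1 \<triangleright> b) (\<lambda>p1 p2. tsum (\<psi> x2) (\<lambda>x2I x2II.
         i (p1 \<odot> x2I) \<otimes> i (p2 \<odot> x2II))))"
    by (simp add: conv_def I2_def Ps_def HT.tsum_left[symmetric] HT.tsum_right[symmetric] BB_tens i_mulB_tens
      sw2_def[of A] tsum_swap[where s = "\<psi> y" and t = "comul A z" for y z])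
  also have "\<dots> = sw3 H x (\<lambda>x1 x2 x3. sw2 A b (\<lambda>a1 a2. tsum (\<psi> x1) (\<lambda>x1I x1II. tsum (\<rho> x2) (\<lambda>x2H x2A.
         i (x1I \<odot> (x2H \<triangleright> a1)) \<otimes> i (x1II \<odot> x2A \<odot> (x3 \<triangleright> a2))))))"
    using arg_cong[OF comul_act[of x b], of ?G]
    by (simp add: sw2_map[OF G(1)] clinear_tsum_map[OF G(1)] G(2) sw3_def)
  also have "\<dots> = sw2 A b (\<lambda>a1 a2. (Ps \<star> (N a1 \<star> M a2)) x)"
    unfolding sw3_def sw2_swap[where D = A and y = b]
    by (simp add: conv_def Ps_def I2_def N_def M_def HT.tsum_left[symmetric] HT.tsum_right[symmetric]
      HT.sw2_right[symmetric] HT.sw2_left[symmetric] BB_tens i_mulB_tens HB.unit_left HB.unit_right A.mul_assoc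
      tsum_swap[where s = "\<psi> y" and t = "\<rho> z" for y z])
  also have "\<dots> = (Ps \<star> U (comul A b)) x"
    unfolding U_def[abs_def] HT.conv_tsum_right sw2_def ..
  finally show "((\<lambda>x. I2 (comul A (x \<triangleright> b))) \<star> Ps) x = (Ps \<star> U (comul A b)) x" .
qed

text \<open>Multiplicativity of the coproduct on j(x) i(b). Once \<open>i b\<close> has been moved
  through \<open>D0\<close>, what remains beside \<open>Ps\<close> is exactly the axiom
  \<open>comul_act\<close>.\<close>

lemma D_i: "BB (D x) (I2 (comul A b)) = ((\<lambda>x. I2 (comul A (x \<triangleright> b))) \<star> D) x"
proof -
  have "BB (D x) (I2 (comul A b)) = ((Ps \<star> U (comul A b)) \<star> D0) x"
    by (simp add: D_I2 HT.conv_assoc clinear_T)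
  also have "\<dots> = ((\<lambda>x. I2 (comul A (x \<triangleright> b))) \<star> D) x"
    by (simp add: comul_act_conv[symmetric] D_def HT.conv_assoc clinear_T lin)
  finally show ?thesis .
qed

lemma J2_R: "BB (J2 x) (R y) = ((\<lambda>x. Q x y) \<star> J2) x"
  by (simp add: J2_def R_def Q_def conv_def HT.tsum_left[symmetric] HT.tsum_right[symmetric] BB_tens
    HB.unit_left HB.unit_right)
    (simp add: j_i sw2_def tsum_swap[of "comul H x"] tsum_tens_right)

lemma J2_J2: "BB (J2 x) (J2 y) = (W \<star>\<^sub>2 (\<lambda>x y. J2 (x \<bullet> y))) x y"
  by (simp add: J2_def W_def conv2_def BB_tens HB.unit_left)
    (simp add: j_j sw2_map[where h = "\<lambda>z. _ \<otimes> z"] lin)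

lemma conv2_conv: "(f \<star>\<^sub>2 g) x y = sw2 H y (\<lambda>y1 y2. ((\<lambda>x. f x y1) \<star> (\<lambda>x. g x y2)) x)"
  unfolding conv2_def conv_def by (rule sw2_swap)

lemma conv2_mulH:
  "clinear f \<Longrightarrow> clinear g \<Longrightarrow> (\<lambda>x y. f (x \<bullet> y)) \<star>\<^sub>2 (\<lambda>x y. g (x \<bullet> y)) = (\<lambda>x y. (f \<star> g) (x \<bullet> y))"
  unfolding conv2_def conv_def by (simp add: fun_eq_iff H.sw2_mul lin clinear_compose[of f] clinear_compose[of g])

lemma R_j: "BB (R x) (j k \<otimes> eB) = sw2 H k (\<lambda>k1 k2. (Vk k1 \<star> Rk k2) x)"
proof -
  have "BB (R x) (j k \<otimes> eB) = tsum (\<rho> x) (\<lambda>h a. sw2 H h (\<lambda>h1 h2. sw2 H k (\<lambda>k1 k2.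
      (i (\<chi> h1 k1) \<diamondop> j (h2 \<bullet> k2)) \<otimes> i a)))"
    by (simp add: R_def HT.tsum_left[symmetric] BB_tens HB.unit_right j_j sw2_map[where h = "\<lambda>z. z \<otimes> _"] lin)
  also have "\<dots> = sw2 H x (\<lambda>x1 x2. tsum (\<rho> x1) (\<lambda>h a. tsum (\<rho> x2) (\<lambda>h' a'. sw2 H k (\<lambda>k1 k2.
      (i (\<chi> h k1) \<diamondop> j (h' \<bullet> k2)) \<otimes> i (a \<odot> a')))))"
    by (rule comul_rho_map) (simp_all add: lin)
  also have "\<dots> = sw2 H k (\<lambda>k1 k2. sw2 H x (\<lambda>x1 x2. tsum (\<rho> x1) (\<lambda>h a. tsum (\<rho> x2) (\<lambda>h' a'.
      (i (\<chi> h k1) \<diamondop> j (h' \<bullet> k2)) \<otimes> i (a \<odot> a')))))"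
    unfolding sw2_def tsum_swap[where t = "comul H k"] ..
  also have "\<dots> = sw2 H k (\<lambda>k1 k2. (Vk k1 \<star> Rk k2) x)"
    by (simp add: conv_def Vk_def Rk_def HT.tsum_left[symmetric])
      (simp add: HT.tsum_right[symmetric] BB_tens i_mulB_tens A.mul_unity_right)
  finally show ?thesis .
qed

lemma M_mul: "M (b \<odot> b') = M b \<star> M b'"
  by (simp add: fun_eq_iff M_def conv_def act_mul BB_tens HB.unit_left i_mulB_tens A.mul_unity_left
    sw2_map[where h = "\<lambda>z. eB \<otimes> i z"] lin)

text \<open>Splitting the second leg as a product of b and b' gives \<open>M b\<close> and
  \<open>M b'\<close>; the first of them commutes with \<open>Rk\<close>, which separates the factor
  \<open>V\<close> from the factor \<open>R'\<close>.\<close>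

lemma R_Q: "(R \<star> (\<lambda>x. Q x y)) x = (V \<star>\<^sub>2 R') x y"
proof -
  have "(R \<star> (\<lambda>x. Q x y)) x = tsum (\<rho> y) (\<lambda>k b. (R \<star> (\<lambda>x. BB (j k \<otimes> eB) (M b x))) x)"
    by (simp add: HT.conv_tsum_right[symmetric] Q_def M_def BB_tens HB.unit_right HB.unit_left)
  also have "\<dots> = tsum (\<rho> y) (\<lambda>k b. sw2 H k (\<lambda>k1 k2. ((Vk k1 \<star> Rk k2) \<star> M b) x))"
    by (simp add: HT.conv_mult_mid R_j HT.conv_sw2_left)
  also have "\<dots> = sw2 H y (\<lambda>y1 y2. tsum (\<rho> y1) (\<lambda>k b. tsum (\<rho> y2) (\<lambda>k' b'.
      ((Vk k \<star> Rk k') \<star> M (b \<odot> b')) x)))"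
    by (rule comul_rho_map) (simp_all add: lin)
  also have "(Vk k \<star> Rk k') \<star> M (b \<odot> b') = (Vk k \<star> M b) \<star> (Rk k' \<star> M b')" for k k' b b'
  proof -
    have "(Vk k \<star> Rk k') \<star> M (b \<odot> b') = Vk k \<star> (Rk k' \<star> M b) \<star> M b'"
      by (simp add: M_mul HT.conv_assoc HT.clinear_conv clinear_T)
    then show ?thesis
      by (simp add: Rk_M HT.conv_assoc HT.clinear_conv clinear_T)
  qed
  then have "sw2 H y (\<lambda>y1 y2. tsum (\<rho> y1) (\<lambda>k b. tsum (\<rho> y2) (\<lambda>k' b'.
      ((Vk k \<star> Rk k') \<star> M (b \<odot> b')) x))) = (V \<star>\<^sub>2 R') x y"
    by (simp add: conv2_conv V_def R'_def HT.conv_tsum_left HT.conv_tsum_right)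
  finally show ?thesis .
qed

lemma rho_mul_conv: "W \<star>\<^sub>2 (\<lambda>x y. R (x \<bullet> y)) = R' \<star>\<^sub>2 W"
proof (intro ext)
  fix x y
  let ?G = "tmap (\<lambda>u. j u) (\<lambda>v. i v)"
  have G: "clinear ?G" "?G (u \<otimes> v) = j u \<otimes> i v" for u v
    by (simp_all add: clinear_tmap tmap_tens lin)
  have "(W \<star>\<^sub>2 (\<lambda>x y. R (x \<bullet> y))) x y = sw2 H x (\<lambda>x1 x2. sw2 H y (\<lambda>y1 y2. tsum (\<rho> (x2 \<bullet> y2)) (\<lambda>pH pA.
         j pH \<otimes> i (\<chi> x1 y1 \<odot> pA))))"
    by (simp add: conv2_def W_def R_def HT.tsum_right[symmetric] BB_tens HB.unit_left i_mulB_tens A.mul_unity_left)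
  also have "\<dots> = sw3 H x (\<lambda>x1 x2 x3. sw2 H y (\<lambda>y1 y2. tsum (\<rho> x1) (\<lambda>x1H x1A. tsum (\<rho> y1) (\<lambda>y1H y1A.
           j (x1H \<bullet> y1H) \<otimes> i (x1A \<odot> (x2 \<triangleright> y1A) \<odot> \<chi> x3 y2)))))"
    using arg_cong[OF rho_mul[of x y], of ?G]
    by (simp add: sw2_map[OF G(1)] clinear_tsum_map[OF G(1)] G(2) sw3_def)
  also have "\<dots> = sw2 H y (\<lambda>y1 y2. tsum (\<rho> y1) (\<lambda>k b. (Rk k \<star> M b \<star> (\<lambda>x. W x y2)) x))"
  proof -
    have "sw3 H x (\<lambda>x1 x2 x3. tsum (\<rho> x1) (\<lambda>x1H x1A. tsum (\<rho> y1) (\<lambda>y1H y1A.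
           j (x1H \<bullet> y1H) \<otimes> i (x1A \<odot> (x2 \<triangleright> y1A) \<odot> \<chi> x3 y2)))) =
         tsum (\<rho> y1) (\<lambda>k b. (Rk k \<star> M b \<star> (\<lambda>x. W x y2)) x)" for y1 y2
      by (simp only: sw3_def sw2_def tsum_swap[where t = "\<rho> y1"])
        (simp add: conv_def Rk_def M_def W_def HT.tsum_right[symmetric] HT.tsum_left[symmetric] BB_tens
          HB.unit_left HB.unit_right i_mulB_tens A.mul_unity_left A.mul_assoc sw2_def
          tsum_swap[where s = "\<rho> z" and t = "comul H w" for z w])
    then show ?thesis
      by (simp add: sw3_def sw2_swap[where D = H and y = y])
  qed
  also have "\<dots> = (R' \<star>\<^sub>2 W) x y"
    by (simp add: conv2_conv R'_def HT.conv_tsum_left HT.conv_assoc lin)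
  finally show "(W \<star>\<^sub>2 (\<lambda>x y. R (x \<bullet> y))) x y = (R' \<star>\<^sub>2 W) x y" .
qed

text \<open>Moving the factors of \<open>D0 y\<close> through those of \<open>D0 x\<close> leaves
  \<open>V\<close>, \<open>R'\<close>, \<open>W\<close> and \<open>J2\<close> at the product of x
  and y. The axiom \<open>rho_mul\<close> replaces \<open>R'\<close> and \<open>W\<close> by
  \<open>W\<close> and \<open>R\<close> at the product, and this \<open>R\<close> recombines with
  \<open>J2\<close> to \<open>D0\<close>.\<close>

lemma D0_D0: "BB (D0 x) (D0 y) = (V \<star>\<^sub>2 W \<star>\<^sub>2 (\<lambda>x y. D0 (x \<bullet> y))) x y"
proof -
  have "BB (D0 x) (BB (R y1) (J2 y2)) =
      ((\<lambda>x. (V \<star>\<^sub>2 R') x y1) \<star> (\<lambda>x. (W \<star>\<^sub>2 (\<lambda>x y. J2 (x \<bullet> y))) x y2)) x" for y1 y2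
  proof -
    have "BB (D0 x) (R y1) = ((R \<star> (\<lambda>x. Q x y1)) \<star> J2) x"
      by (simp add: D0_def HT.conv_mult_right[symmetric] J2_R HT.conv_assoc lin)
    then have "BB (D0 x) (BB (R y1) (J2 y2)) = ((R \<star> (\<lambda>x. Q x y1)) \<star> (\<lambda>x. BB (J2 x) (J2 y2))) x"
      by (simp add: HT.assoc[symmetric] HT.conv_mult_right)
    moreover have "R \<star> (\<lambda>x. Q x y1) = (\<lambda>x. (V \<star>\<^sub>2 R') x y1)"
      by (rule ext) (rule R_Q)
    ultimately show ?thesis
      by (simp only: J2_J2)
  qed
  then have "BB (D0 x) (D0 y) = ((V \<star>\<^sub>2 R') \<star>\<^sub>2 (W \<star>\<^sub>2 (\<lambda>x y. J2 (x \<bullet> y)))) x y"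
    by (simp add: conv2_conv[of "V \<star>\<^sub>2 R'"] D0_def[THEN fun_cong, of y] conv_def[of H BB R J2 y] HT.sw2_right[symmetric])
  also have "\<dots> = (V \<star>\<^sub>2 (R' \<star>\<^sub>2 W) \<star>\<^sub>2 (\<lambda>x y. J2 (x \<bullet> y))) x y"
    by (simp add: HT.conv2_assoc HT.cbilinear_conv2 cbilinear_T lin)
  also have "\<dots> = (V \<star>\<^sub>2 W \<star>\<^sub>2 ((\<lambda>x y. R (x \<bullet> y)) \<star>\<^sub>2 (\<lambda>x y. J2 (x \<bullet> y)))) x y"
    unfolding rho_mul_conv[symmetric] by (simp add: HT.conv2_assoc HT.cbilinear_conv2 cbilinear_T lin)
  finally show ?thesis
    by (simp add: conv2_mulH clinear_T D0_def)
qed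

lemma sw3_swap: "sw2 C x (\<lambda>a b. sw3 E y (\<lambda>c d e. f a b c d e)) = sw3 E y (\<lambda>c d e. sw2 C x (\<lambda>a b. f a b c d e))"
  unfolding sw3_def by (subst sw2_swap) (simp only: sw2_swap[of C x])

lemma sw3_sw3_swap: "sw3 C x (\<lambda>a b k. sw3 E y (\<lambda>c d e. f a b k c d e)) = sw3 E y (\<lambda>c d e. sw3 C x (\<lambda>a b k. f a b k c d e))"
  by (simp only: sw3_def[of C] sw3_swap)

text \<open>The six legs of x and three legs of y in the axiom \<open>comul_chi\<close> are the
  successive factors of \<open>U'\<close>, \<open>V\<close> and \<open>W\<close>. The work lies in
  exchanging finite sums until each leg stands next to its own factor.\<close>

lemma comul_chi_conv: "IX \<star>\<^sub>2 (\<lambda>x y. Ps (x \<bullet> y)) = U' \<star>\<^sub>2 V \<star>\<^sub>2 W"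
proof (intro ext)
  fix x y
  let ?G = "tmap (\<lambda>u. i u) (\<lambda>v. i v)"
  have G: "clinear ?G" "?G (u \<otimes> v) = i u \<otimes> i v" for u v
    by (simp_all add: clinear_tmap tmap_tens lin)
  let ?t = "\<lambda>x1 x2 x3 x4 x5 x6 y1 y2 y3. tsum (\<psi> x1) (\<lambda>x1I x1II. tsum (\<rho> x2) (\<lambda>x2H x2A. tsum (\<rho> x4) (\<lambda>x4H x4A.
         tsum (\<psi> y1) (\<lambda>y1I y1II. tsum (\<rho> y2) (\<lambda>y2H y2A.
           i (x1I \<odot> (x2H \<triangleright> y1I) \<odot> \<chi> x4H y2H) \<otimes>
           i (x1II \<odot> x2A \<odot> (x3 \<triangleright> y1II) \<odot> x4A \<odot> (x5 \<triangleright> y2A) \<odot> \<chi> x6 y3))))))"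
  let ?s = "\<lambda>x1 x2 x3 x4 x5 x6 y1 y2 y3. tsum (\<psi> y1) (\<lambda>u v. tsum (\<rho> y2) (\<lambda>k b.
      BB (Ps x1) (BB (N u x2) (BB (M v x3) (BB (Vk k x4) (BB (M b x5) (W x6 y3)))))))"
  have "(IX \<star>\<^sub>2 (\<lambda>x y. Ps (x \<bullet> y))) x y = sw2 H x (\<lambda>x1 x2. sw2 H y (\<lambda>y1 y2. sw2 A (\<chi> x1 y1) (\<lambda>p1 p2.
         tsum (\<psi> (x2 \<bullet> y2)) (\<lambda>qI qII. i (p1 \<odot> qI) \<otimes> i (p2 \<odot> qII)))))"
    by (simp add: conv2_def IX_def I2_def Ps_def HT.tsum_left[symmetric] sw2_def[of A])
      (simp add: HT.tsum_right[symmetric] BB_tens i_mulB_tens)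
  also have "\<dots> = sw6 H x (\<lambda>x1 x2 x3 x4 x5 x6. sw3 H y (\<lambda>y1 y2 y3. ?t x1 x2 x3 x4 x5 x6 y1 y2 y3))"
    using arg_cong[OF comul_chi[of x y], of ?G]
    by (simp add: sw2_map[OF G(1)] clinear_tsum_map[OF G(1)] G(2) sw3_def sw4_def sw5_def sw6_def)
  also have "?t x1 x2 x3 x4 x5 x6 y1 y2 y3 = ?s x1 x2 x3 x4 x5 x6 y1 y2 y3" for x1 x2 x3 x4 x5 x6 y1 y2 y3
  proof -
    have "?t x1 x2 x3 x4 x5 x6 y1 y2 y3 = tsum (\<psi> y1) (\<lambda>y1I y1II. tsum (\<psi> x1) (\<lambda>x1I x1II. tsum (\<rho> x2) (\<lambda>x2H x2A. tsum (\<rho> x4) (\<lambda>x4H x4A.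
         tsum (\<rho> y2) (\<lambda>y2H y2A.
           i (x1I \<odot> (x2H \<triangleright> y1I) \<odot> \<chi> x4H y2H) \<otimes>
           i (x1II \<odot> x2A \<odot> (x3 \<triangleright> y1II) \<odot> x4A \<odot> (x5 \<triangleright> y2A) \<odot> \<chi> x6 y3))))))"
      by (simp only: tsum_swap[where t = "\<psi> y1"])
    also have "\<dots> = tsum (\<psi> y1) (\<lambda>y1I y1II. tsum (\<rho> y2) (\<lambda>y2H y2A. tsum (\<psi> x1) (\<lambda>x1I x1II. tsum (\<rho> x2) (\<lambda>x2H x2A. tsum (\<rho> x4) (\<lambda>x4H x4A.
           i (x1I \<odot> (x2H \<triangleright> y1I) \<odot> \<chi> x4H y2H) \<otimes>
           i (x1II \<odot> x2A \<odot> (x3 \<triangleright> y1II) \<odot> x4A \<odot> (x5 \<triangleright> y2A) \<odot> \<chi> x6 y3))))))"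
      by (simp only: tsum_swap[where s = "\<rho> x4" and t = "\<rho> y2"] tsum_swap[where s = "\<rho> x2" and t = "\<rho> y2"]
        tsum_swap[where s = "\<psi> x1" and t = "\<rho> y2"])
    also have "\<dots> = ?s x1 x2 x3 x4 x5 x6 y1 y2 y3"
      by (simp add: Ps_def I2_def N_def M_def Vk_def W_def HT.tsum_left[symmetric] HT.tsum_right[symmetric]
        BB_tens i_mulB_tens A.mul_assoc A.mul_unity_left HB.unit_left HB.unit_right
        tsum_swap[where s = "\<rho> x4" and t = "\<rho> x2"] tsum_swap[where s = "\<rho> x2" and t = "\<psi> x1"]
        tsum_swap[where s = "\<rho> x4" and t = "\<psi> x1"])
    finally show ?thesis .
  qed
  then have "sw6 H x (\<lambda>x1 x2 x3 x4 x5 x6. sw3 H y (\<lambda>y1 y2 y3. ?t x1 x2 x3 x4 x5 x6 y1 y2 y3)) =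
      sw6 H x (\<lambda>x1 x2 x3 x4 x5 x6. sw3 H y (\<lambda>y1 y2 y3. ?s x1 x2 x3 x4 x5 x6 y1 y2 y3))"
    by presburger
  also have "\<dots> = sw3 H y (\<lambda>y1 y2 y3. sw6 H x (\<lambda>x1 x2 x3 x4 x5 x6. ?s x1 x2 x3 x4 x5 x6 y1 y2 y3))"
    by (simp only: sw6_def sw5_def sw4_def sw3_sw3_swap[where E = H and y = y] sw3_swap[where E = H and y = y])
  also have "\<dots> = sw3 H y (\<lambda>y1 y2 y3. tsum (\<psi> y1) (\<lambda>u v. tsum (\<rho> y2) (\<lambda>k b. (Ps \<star> N u \<star> M v \<star> Vk k \<star> M b \<star> (\<lambda>x. W x y3)) x)))"
  proof -
    have "sw6 H x (\<lambda>x1 x2 x3 x4 x5 x6. ?s x1 x2 x3 x4 x5 x6 y1 y2 y3) =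
      tsum (\<psi> y1) (\<lambda>u v. tsum (\<rho> y2) (\<lambda>k b. (Ps \<star> N u \<star> M v \<star> Vk k \<star> M b \<star> (\<lambda>x. W x y3)) x))" for y1 y2 y3
      by (simp only: sw6_def sw5_def sw4_def sw3_def sw2_def tsum_swap[where t = "\<psi> y1"])
        (simp only: tsum_swap[where s = "comul H z" and t = "\<rho> y2" for z],
          simp only: conv_def HT.tsum_right sw2_def)
    then show ?thesis by simp
  qed
  also have "\<dots> = (U' \<star>\<^sub>2 V \<star>\<^sub>2 W) x y"
    by (simp add: conv2_conv U'_def U_def[abs_def] V_def HT.conv_tsum_left HT.conv_tsum_right HT.conv_sw2_right sw3_def)
      (simp add: HT.conv_assoc HT.clinear_conv clinear_T lin,
       simp only: sw2_def tsum_swap[where s = "\<psi> z" and t = "comul H w" for z w])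
  finally show "(IX \<star>\<^sub>2 (\<lambda>x y. Ps (x \<bullet> y))) x y = (U' \<star>\<^sub>2 V \<star>\<^sub>2 W) x y" .
qed

text \<open>Multiplicativity of the coproduct on j(x) j(y). Moving \<open>Ps y\<close> through
  \<open>D x\<close> gives \<open>U'\<close>, \<open>D0_D0\<close> supplies \<open>V\<close> and
  \<open>W\<close>, and \<open>comul_chi_conv\<close> trades these three for the coproduct of \<chi>
  followed by \<open>Ps\<close> at the product.\<close>

lemma D_D: "BB (D x) (D y) = (IX \<star>\<^sub>2 (\<lambda>x y. D (x \<bullet> y))) x y"
proof -
  have "BB (D x) (BB (Ps y1) (D0 y2)) = ((\<lambda>x. U' x y1) \<star> (\<lambda>x. (V \<star>\<^sub>2 W \<star>\<^sub>2 (\<lambda>x y. D0 (x \<bullet> y))) x y2)) x" for y1 y2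
  proof -
    have "BB (D x) (Ps y1) = ((Ps \<star> U (\<psi> y1)) \<star> D0) x"
      unfolding Ps_def[of y1] D_I2 by (simp add: HT.conv_assoc clinear_T)
    then show ?thesis
      by (simp add: HT.assoc[symmetric] HT.conv_mult_right[symmetric] U'_def D0_D0[symmetric])
  qed
  then have "BB (D x) (D y) = (U' \<star>\<^sub>2 (V \<star>\<^sub>2 W \<star>\<^sub>2 (\<lambda>x y. D0 (x \<bullet> y)))) x y"
    by (simp add: conv2_conv[of U'] D_def[THEN fun_cong, of y] conv_def[of H BB Ps D0 y] HT.sw2_right[symmetric])
  also have "\<dots> = ((IX \<star>\<^sub>2 (\<lambda>x y. Ps (x \<bullet> y))) \<star>\<^sub>2 (\<lambda>x y. D0 (x \<bullet> y))) x y"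
    unfolding comul_chi_conv by (simp add: HT.conv2_assoc HT.cbilinear_conv2 cbilinear_T lin)
  also have "\<dots> = (IX \<star>\<^sub>2 ((\<lambda>x y. Ps (x \<bullet> y)) \<star>\<^sub>2 (\<lambda>x y. D0 (x \<bullet> y)))) x y"
    by (simp add: HT.conv2_assoc HT.cbilinear_conv2 cbilinear_T lin)
  finally show ?thesis
    by (simp add: conv2_mulH clinear_T D_def)
qed

lemma clinear_comulB: "clinear (comul B)"
  unfolding bismash_def sw3_def by (simp add: lin)

lemmas lin_comulB [lin] = clinear_compose[OF clinear_comulB]

lemma I2_tmul: "I2 (tmul mulA mulA s t) = BB (I2 s) (I2 t)"
  unfolding tmul_def[of mulA] I2_def
  by (simp add: tsum_bil lin HT.tsum_left[symmetric])
    (simp add: HT.tsum_right[symmetric] BB_tens i_mulB_tens)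

lemma comulB_AH: "comul B (AH (i a) t) = BB (I2 (comul A a)) (comul B t)"
  by (rule tensor_ext[where t = t])
    (simp_all add: lin AH_tens H.mul_unity_left comulB_tens A.comul_mul_tmul I2_tmul HT.assoc)

lemma D_unity: "D \<one>\<^bsub>H\<^esub> = eB \<otimes> eB"
  unfolding D_def D0_def conv_def Ps_def R_def J2_def
  by (simp add: H.sw2_unity lin rho_unity psi_unity tsum_bil I2_tens HT.unit_left)

lemma comulB_i: "comul B (i a) = I2 (comul A a)"
  by (simp add: comulB_tens D_unity HT.unit_right)

lemma comulB_j: "comul B (j x) = D x"
  by (simp add: comulB_tens A.comul_unity I2_tens HT.unit_left)

lemma comulB_mul: "comul B (s \<diamondop> t) = BB (comul B s) (comul B t)"
proof (rule tensor_ext[where t = s])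
  fix a x
  show "comul B ((a \<otimes> x) \<diamondop> t) = BB (comul B (a \<otimes> x)) (comul B t)"
  proof (rule tensor_ext[where t = t])
    fix b y
    have K: "comul B (K x y) = BB (D x) (D y)" for x
      by (simp add: D_D K_def conv2_def sw2_map[OF clinear_comulB] comulB_tens IX_def)
    show "comul B ((a \<otimes> x) \<diamondop> (b \<otimes> y)) = BB (comul B (a \<otimes> x)) (comul B (b \<otimes> y))"
      by (simp add: tens_mulB J_tens comulB_AH sw2_map[OF clinear_comulB] K comulB_tens HT.assoc)
        (simp add: HT.assoc[symmetric] HT.sw2_left D_i conv_def)
  qed (simp_all add: lin)
qed (simp_all add: lin)

end

text \<open>The associativity isomorphism from (U \<otimes> V) \<otimes> W to U \<otimes> (V
  \<otimes> W), applied to t \<otimes> v.\<close>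

definition insert_last :: "'a::complex_vector \<otimes> 'b::complex_vector \<Rightarrow> 'c::complex_vector \<Rightarrow> 'a \<otimes> 'b \<otimes> 'c" where
  "insert_last t v = tsum t (\<lambda>p q. p \<otimes> q \<otimes> v)"

lemma insert_last_tens: "insert_last (p \<otimes> q) v = p \<otimes> q \<otimes> v"
  unfolding insert_last_def by (simp add: tsum_bil lin)

lemma lin_insert_last [lin]:
  "clinear f \<Longrightarrow> clinear (\<lambda>x. insert_last (f x) v)" "clinear g \<Longrightarrow> clinear (\<lambda>x. insert_last t (g x))"
  unfolding insert_last_def by (simp_all add: lin)

lemma insert_last_mul:
  assumes "algebra m1 e1" "algebra m2 e2" "algebra m3 e3"
  shows "insert_last (tmul m1 m2 s t) (m3 v w) =
    tmul m1 (tmul m2 m3) (insert_last s v) (insert_last t w)"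
proof -
  interpret m12: algebra "tmul m1 m2" "e1 \<otimes> e2"
    by (rule algebra_tmul[OF assms(1,2)])
  interpret m123: algebra "tmul m1 (tmul m2 m3)" "e1 \<otimes> e2 \<otimes> e3"
    by (rule algebra_tmul[OF assms(1) algebra_tmul[OF assms(2,3)]])
  show ?thesis
  proof (rule tensor_ext[where t = s])
    show "insert_last (tmul m1 m2 (p \<otimes> q) t) (m3 v w) =
        tmul m1 (tmul m2 m3) (insert_last (p \<otimes> q) v) (insert_last t w)" for p q
      by (rule tensor_ext[where t = t])
        (simp_all add: lin insert_last_tens tmul_tens[OF assms(1,2)] tmul_tens[OF assms(2,3)]
          tmul_tens[OF assms(1) algebra_tmul[OF assms(2,3)]])
  qed (simp_all add: lin)
qed

lemma (in convolution) conv_hom: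
  assumes "algebra_hom (\<odot>) n f"
  shows "f (conv C (\<odot>) g h x) = conv C n (\<lambda>x. f (g x)) (\<lambda>x. f (h x)) x"
  using assms unfolding conv_def algebra_hom_def by (simp add: sw2_map)

section \<open>The counit\<close>

context cocycle_linked_pair
begin

lemma counitB_tens: "counit B (a \<otimes> x) = \<epsilon>A a * \<epsilon>H x"
  unfolding bismash_def by (simp add: tsum_bil lin)

lemma clinear_counitB: "clinear (counit B)"
  unfolding bismash_def by (simp add: lin)

lemmas lin_counitB [lin] = clinear_compose[OF clinear_counitB]

lemma counitB_AH: "counit B (AH (i a) t) = \<epsilon>A a * counit B t"
  by (rule tensor_ext[where t = t])
    (simp_all add: lin AH_tens H.mul_unity_left counitB_tens A.counit_mul)

lemma counitB_mul: "counit B (s \<diamondop> t) = counit B s * counit B t"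
proof (rule tensor_ext[where t = s])
  fix a x
  show "counit B ((a \<otimes> x) \<diamondop> t) = counit B (a \<otimes> x) * counit B t"
  proof (rule tensor_ext[where t = t])
    fix b y
    have K: "counit B (K x y) = \<epsilon>H x * \<epsilon>H y" for x
    proof -
      have "counit B (K x y) = sw2 H x (\<lambda>x1 x2. sw2 H y (\<lambda>y1 y2. \<epsilon>H x1 *\<^sub>C \<epsilon>H y1 *\<^sub>C (\<epsilon>H x2 * \<epsilon>H y2)))"
        by (simp add: K_def sw2_map[OF clinear_counitB] counitB_tens counit_chi H.counit_mul scaleC_complex_def mult.assoc)
      also have "\<dots> = \<epsilon>H x * \<epsilon>H y"
        by (simp only: sw2_scale H.co.sw2_counit_left lin)
      finally show ?thesis .
    qed
    have "counit B ((a \<otimes> x) \<diamondop> (b \<otimes> y)) = \<epsilon>A a * sw2 H x (\<lambda>x1 x2. \<epsilon>H x1 *\<^sub>C (\<epsilon>A b * (\<epsilon>H x2 * \<epsilon>H y)))"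
      by (simp add: tens_mulB J_tens counitB_AH sw2_map[OF clinear_counitB] K counit_act scaleC_complex_def mult.assoc)
    also have "\<dots> = counit B (a \<otimes> x) * counit B (b \<otimes> y)"
      by (simp only: H.co.sw2_counit_left lin) (simp add: counitB_tens mult_ac)
    finally show "counit B ((a \<otimes> x) \<diamondop> (b \<otimes> y)) = counit B (a \<otimes> x) * counit B (b \<otimes> y)" .
  qed (simp_all add: lin)
qed (simp_all add: lin)

lemma counitB_unity: "counit B eB = 1"
  by (simp add: counitB_tens A.counit_unity H.counit_unity)

text \<open>Applying the counit of B to the first leg is an algebra homomorphism. It can therefore
  be evaluated on each factor of the coproduct separately, and every factor is settled by one counit
  axiom.\<close>

lemma comulB_counit_left: "sw2 B t (\<lambda>u v. counit B u *\<^sub>C v) = t"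
proof -
  define E where "E t = tsum t (\<lambda>u v. counit B u *\<^sub>C v)" for t :: "('a \<otimes> 'h) \<otimes> ('a \<otimes> 'h)"
  have E: "clinear E" "E (u \<otimes> v) = counit B u *\<^sub>C v" for u v
    unfolding E_def[abs_def] by (simp_all add: lin tsum_bil)
  note [lin] = clinear_compose[OF E(1)]
  have "E (BB s t) = E s \<diamondop> E t" for s t
  proof (rule tensor_ext[where t = s])
    show "E (BB (u \<otimes> v) t) = E (u \<otimes> v) \<diamondop> E t" for u v
      by (rule tensor_ext[where t = t])
        (simp_all add: lin BB_tens E(2) counitB_mul HB.scale_left HB.scale_right mult.commute)
  qed (simp_all add: lin)
  then have hom: "algebra_hom BB mulB E"
    by (simp add: algebra_hom_def E)
  have "E (comul B t) = t"
  proof (rule tensor_ext[where t = t and g = "\<lambda>t. t"])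
    fix a x
    have I: "E (I2 (comul A a)) = i a"
      using arg_cong[OF A.counit_left[of a, unfolded sw2_def], of "\<lambda>a. i a"]
      by (simp add: I2_def clinear_tsum_map[OF E(1)] E counitB_tens H.counit_unity
        clinear_tsum_map[where h = "\<lambda>a. i a"] lin tens_scale_left)
    have P: "E (Ps x) = \<epsilon>H x *\<^sub>C eB" for x
      using arg_cong[OF counit_psi_left[of x], of "\<lambda>a. i a"]
      by (simp add: Ps_def I2_def clinear_tsum_map[OF E(1)] E counitB_tens H.counit_unity
        clinear_tsum_map[where h = "\<lambda>a. i a"] lin tens_scale_left)
    have R: "E (R x) = \<epsilon>H x *\<^sub>C eB" for x
      using arg_cong[OF counit_rho[of x], of "\<lambda>a. i a"]
      by (simp add: R_def clinear_tsum_map[OF E(1)] E counitB_tens A.counit_unity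
        clinear_tsum_map[where h = "\<lambda>a. i a"] lin tens_scale_left)
    have "E (D x) = j x"
      by (simp add: D_def D0_def HT.conv_hom[OF hom] P R HB.conv_unit_left lin)
        (simp add: E J2_def counitB_unity)
    then show "E (comul B (a \<otimes> x)) = a \<otimes> x"
      using hom by (simp add: comulB_tens algebra_hom_def I i_mulB_tens A.mul_unity_right)
  qed (simp_all add: lin)
  then show ?thesis by (simp add: E_def sw2_def)
qed

lemma comulB_counit_right: "sw2 B t (\<lambda>u v. counit B v *\<^sub>C u) = t"
proof -
  define E where "E t = tsum t (\<lambda>u v. counit B v *\<^sub>C u)" for t :: "('a \<otimes> 'h) \<otimes> ('a \<otimes> 'h)"
  have E: "clinear E" "E (u \<otimes> v) = counit B v *\<^sub>C u" for u v
    unfolding E_def[abs_def] by (simp_all add: lin tsum_bil)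
  note [lin] = clinear_compose[OF E(1)]
  have "E (BB s t) = E s \<diamondop> E t" for s t
  proof (rule tensor_ext[where t = s])
    show "E (BB (u \<otimes> v) t) = E (u \<otimes> v) \<diamondop> E t" for u v
      by (rule tensor_ext[where t = t])
        (simp_all add: lin BB_tens E(2) counitB_mul HB.scale_left HB.scale_right mult.commute)
  qed (simp_all add: lin)
  then have hom: "algebra_hom BB mulB E"
    by (simp add: algebra_hom_def E)
  have "E (comul B t) = t"
  proof (rule tensor_ext[where t = t and g = "\<lambda>t. t"])
    fix a x
    have I: "E (I2 (comul A a)) = i a"
      using arg_cong[OF A.counit_right[of a, unfolded sw2_def], of "\<lambda>a. i a"]
      by (simp add: I2_def clinear_tsum_map[OF E(1)] E counitB_tens H.counit_unity
        clinear_tsum_map[where h = "\<lambda>a. i a"] lin tens_scale_left)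
    have P: "E (Ps x) = \<epsilon>H x *\<^sub>C eB" for x
      using arg_cong[OF counit_psi_right[of x], of "\<lambda>a. i a"]
      by (simp add: Ps_def I2_def clinear_tsum_map[OF E(1)] E counitB_tens H.counit_unity
        clinear_tsum_map[where h = "\<lambda>a. i a"] lin tens_scale_left)
    have R: "E (R x) = j x" for x
      using arg_cong[OF rho_counit[of x], of "\<lambda>a. j a"]
      by (simp add: R_def clinear_tsum_map[OF E(1)] E counitB_tens H.counit_unity
        clinear_tsum_map[where h = "\<lambda>a. j a"] lin tens_scale_right)
    have "E (D x) = j x"
      by (simp add: D_def D0_def HT.conv_hom[OF hom] P R HB.conv_unit_left lin)
        (simp add: E J2_def counitB_tens A.counit_unity HB.conv_unit_right lin)
    then show "E (comul B (a \<otimes> x)) = a \<otimes> x"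
      using hom by (simp add: comulB_tens algebra_hom_def I i_mulB_tens A.mul_unity_right)
  qed (simp_all add: lin)
  then show ?thesis by (simp add: E_def sw2_def)
qed

abbreviation "BBB \<equiv> tmul mulB BB"
abbreviation conv_T3 (infixr \<open>\<star>\<^sub>3\<close> 65) where "conv_T3 \<equiv> conv H BBB"

lemma BBB_tens: "BBB (s \<otimes> t) (s' \<otimes> t') = (s \<diamondop> s') \<otimes> BB t t'"
  by (rule tmul_tens[OF algebra_B HT.algebra_axioms])

end

sublocale cocycle_linked_pair \<subseteq>
    HT3: convolution H "tmul (mul B) (tmul (mul B) (mul B))"
      "(unity A \<otimes> unity H) \<otimes> (unity A \<otimes> unity H) \<otimes> (unity A \<otimes> unity H)"
  by (rule convolutionI[OF H.co.coalgebra_axioms algebra_tmul[OF algebra_B HT.algebra_axioms]])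

section \<open>Coassociativity\<close>

context cocycle_linked_pair
begin

definition "comul_fst t = tsum t (\<lambda>u v. insert_last (comul B u) v)"
definition "comul_snd t = tsum t (\<lambda>u v. u \<otimes> comul B v)"

lemma comul_fst_tens: "comul_fst (u \<otimes> v) = insert_last (comul B u) v"
  and comul_snd_tens: "comul_snd (u \<otimes> v) = u \<otimes> comul B v"
  and clinear_comul_fst: "clinear comul_fst" and clinear_comul_snd: "clinear comul_snd"
  unfolding comul_fst_def[abs_def] comul_snd_def[abs_def] by (simp_all add: lin tsum_bil)

lemma hom_comul_fst: "algebra_hom BB BBB comul_fst"
proof -
  note [lin] = clinear_compose[OF clinear_comul_fst]
  have "comul_fst (BB s t) = BBB (comul_fst s) (comul_fst t)" for s t
  proof (rule tensor_ext[where t = s])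
    show "comul_fst (BB (p \<otimes> q) t) = BBB (comul_fst (p \<otimes> q)) (comul_fst t)" for p q
      by (rule tensor_ext[where t = t])
        (simp_all add: lin comul_fst_tens BB_tens comulB_mul insert_last_mul[OF algebra_B algebra_B algebra_B])
  qed (simp_all add: lin)
  then show ?thesis by (simp add: algebra_hom_def clinear_comul_fst)
qed

lemma hom_comul_snd: "algebra_hom BB BBB comul_snd"
proof -
  note [lin] = clinear_compose[OF clinear_comul_snd]
  have "comul_snd (BB s t) = BBB (comul_snd s) (comul_snd t)" for s t
  proof (rule tensor_ext[where t = s])
    show "comul_snd (BB (p \<otimes> q) t) = BBB (comul_snd (p \<otimes> q)) (comul_snd t)" for p q
      by (rule tensor_ext[where t = t])
        (simp_all add: lin comul_snd_tens BB_tens comulB_mul BBB_tens)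
  qed (simp_all add: lin)
  then show ?thesis by (simp add: algebra_hom_def clinear_comul_snd)
qed

definition "I3 t = tsum t (\<lambda>u r. i u \<otimes> I2 r)"

lemma lin_I3 [lin]: "clinear f \<Longrightarrow> clinear (\<lambda>x. I3 (f x))"
  unfolding I3_def by (simp add: lin)

lemma I3_tens: "I3 (u \<otimes> v \<otimes> w) = i u \<otimes> i v \<otimes> i w"
  unfolding I3_def by (simp add: lin tsum_bil I2_tens)

lemma clinear_I3: "clinear I3"
  by (simp add: lin)

text \<open>By \<open>comul_rho\<close> the assignment F -> F(x_H) \<otimes> g(x_A) respects
  convolution products, as long as g is multiplicative. It is applied with g = \<open>i\<close> for
  B and with g the identity for A.\<close>

lemma rho_map_conv:
  assumes F: "clinear F" and G: "clinear G" and g: "algebra_hom mulA m3 g"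
    and m: "algebra m1 e1" "algebra m2 e2" "algebra m3 e3"
  shows "tsum (\<rho> x) (\<lambda>h a. insert_last (conv H (tmul m1 m2) F G h) (g a)) =
    conv H (tmul m1 (tmul m2 m3)) (\<lambda>x. tsum (\<rho> x) (\<lambda>h a. insert_last (F h) (g a)))
      (\<lambda>x. tsum (\<rho> x) (\<lambda>h a. insert_last (G h) (g a))) x"
proof -
  interpret m12: algebra "tmul m1 m2" "e1 \<otimes> e2"
    by (rule algebra_tmul[OF m(1,2)])
  interpret m123: algebra "tmul m1 (tmul m2 m3)" "e1 \<otimes> e2 \<otimes> e3"
    by (rule algebra_tmul[OF m(1) algebra_tmul[OF m(2,3)]])
  note [lin] = clinear_compose[OF F] clinear_compose[OF G] clinear_compose[of g]
  have g': "clinear g" "g (a \<odot> b) = m3 (g a) (g b)" for a b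
    using g by (simp_all add: algebra_hom_def)
  have "tsum (\<rho> x) (\<lambda>h a. insert_last (conv H (tmul m1 m2) F G h) (g a)) =
      tsum (\<rho> x) (\<lambda>h a. sw2 H h (\<lambda>h1 h2. insert_last (tmul m1 m2 (F h1) (G h2)) (g a)))"
    by (simp add: conv_def sw2_map[where h = "\<lambda>z. insert_last z _"] lin)
  also have "\<dots> = sw2 H x (\<lambda>x1 x2. tsum (\<rho> x1) (\<lambda>h a. tsum (\<rho> x2) (\<lambda>h' a'.
      insert_last (tmul m1 m2 (F h) (G h')) (g (a \<odot> a')))))"
    by (rule comul_rho_map) (simp_all add: lin g')
  finally show ?thesis
    by (simp add: conv_def g' insert_last_mul[OF m] m123.tsum_left m123.tsum_right)
qed

definition "rho_map F x = tsum (\<rho> x) (\<lambda>h a. insert_last (F h) (i a))"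

lemma rho_map_conv_B:
  "clinear F \<Longrightarrow> clinear G \<Longrightarrow> rho_map (F \<star> G) = rho_map F \<star>\<^sub>3 rho_map G"
  unfolding rho_map_def[abs_def]
  by (rule ext, rule rho_map_conv[OF _ _ _ algebra_B algebra_B algebra_B])
    (simp_all add: algebra_hom_def lin i_mulB_tens)

text \<open>Both iterated coproducts are algebra homomorphisms, so it suffices to compare them on
  the factors of \<open>D\<close>. There \<open>dual_cocycle\<close> and
  \<open>twisted_comodule\<close> each exchange two neighbouring factors.\<close>

lemma comulB_coassoc: "comul_fst (comul B t) = comul_snd (comul B t)"
proof (rule tensor_ext[where t = t])
  note [lin] = clinear_compose[OF clinear_comul_fst] clinear_compose[OF clinear_comul_snd]
  show "clinear (\<lambda>t. comul_fst (comul B t))" "clinear (\<lambda>t. comul_snd (comul B t))"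
    by (simp_all add: lin)
  have fst_I2: "comul_fst (I2 s) = I3 (tsum s (\<lambda>u v. sw2 A u (\<lambda>u1 u2. u1 \<otimes> u2 \<otimes> v)))" for s
    by (simp add: I2_def clinear_tsum_map[OF clinear_comul_fst] comul_fst_tens comulB_i
      clinear_tsum_map[OF clinear_I3] sw2_map[OF clinear_I3] I3_tens clinear_tsum_map[where h = "\<lambda>z. insert_last z _"]
      insert_last_tens lin sw2_def)
  have snd_I2: "comul_snd (I2 s) = I3 (tsum s (\<lambda>u v. sw2 A v (\<lambda>v1 v2. u \<otimes> v1 \<otimes> v2)))" for s
    by (simp add: I2_def clinear_tsum_map[OF clinear_comul_snd] comul_snd_tens comulB_i
      clinear_tsum_map[OF clinear_I3] sw2_map[OF clinear_I3] I3_tens sw2_def tsum_tens_right[symmetric])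
  have fst_Ps: "comul_fst (Ps x) = tsum (\<psi> x) (\<lambda>u v. tsum (comul A u) (\<lambda>u1 u2. i u1 \<otimes> i u2 \<otimes> i v))"
    and snd_Ps: "comul_snd (Ps x) = tsum (\<psi> x) (\<lambda>u v. tsum (comul A v) (\<lambda>v1 v2. i u \<otimes> i v1 \<otimes> i v2))" for x
    by (simp_all add: Ps_def fst_I2 snd_I2 clinear_tsum_map[OF clinear_I3] I3_tens sw2_def)
  define P23 R23 J3 where "P23 x = eB \<otimes> Ps x" and "R23 x = eB \<otimes> R x" and "J3 x = eB \<otimes> J2 x" for x
  have rho_map_Ps: "rho_map Ps x = tsum (\<rho> x) (\<lambda>h a. tsum (\<psi> h) (\<lambda>u v. i u \<otimes> i v \<otimes> i a))" for x
    by (simp add: rho_map_def Ps_def I2_def clinear_tsum_map[where h = "\<lambda>z. insert_last z _"] lin insert_last_tens)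
  have P23: "P23 x = tsum (\<psi> x) (\<lambda>u v. eB \<otimes> i u \<otimes> i v)" for x
    by (simp add: P23_def Ps_def I2_def tsum_tens_right)
  have lin3 [lin]: "clinear P23" "clinear R23" "clinear J3" "clinear (rho_map Ps)" "clinear (rho_map R)"
    unfolding P23_def[abs_def] R23_def[abs_def] J3_def[abs_def] rho_map_def[abs_def] by (simp_all add: lin)
  have fst_J: "comul_fst (J2 x) = J3 x" for x
    by (simp add: J2_def J3_def comul_fst_tens comulB_tens D_unity A.comul_unity I2_tens HT.unit_left insert_last_tens)
  have fst_R: "comul_fst (R x) = (rho_map Ps \<star>\<^sub>3 rho_map R \<star>\<^sub>3 R23) x" for x
  proof -
    have "comul_fst (R x) = rho_map D x"
      by (simp add: R_def clinear_tsum_map[OF clinear_comul_fst] comul_fst_tens comulB_j rho_map_def)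
    moreover have "rho_map J2 = R23"
      by (simp add: fun_eq_iff rho_map_def J2_def insert_last_tens R23_def R_def tsum_tens_right)
    ultimately show ?thesis
      by (simp add: D_def D0_def rho_map_conv_B lin)
  qed
  have snd_J: "comul_snd (J2 x) = (P23 \<star>\<^sub>3 R23 \<star>\<^sub>3 J3) x" for x
  proof -
    have "algebra_hom BB BBB (\<lambda>t. eB \<otimes> t)"
      by (simp add: algebra_hom_def lin BBB_tens HB.unit_left)
    from HT.conv_hom[OF this] show ?thesis
      by (simp add: J2_def comul_snd_tens comulB_j D_def D0_def P23_def[abs_def] R23_def[abs_def] J3_def[abs_def])
  qed
  have twisted: "P23 \<star>\<^sub>3 rho_map R = (\<lambda>x. comul_snd (R x)) \<star>\<^sub>3 P23"
  proof
    fix x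
    let ?G = "tmap (\<lambda>u. j u) I2"
    have G: "clinear ?G" "?G (u \<otimes> v \<otimes> w) = j u \<otimes> i v \<otimes> i w" for u v w
      by (simp_all add: clinear_tmap tmap_tens lin I2_tens)
    have "(P23 \<star>\<^sub>3 rho_map R) x = ?G (sw2 H x (\<lambda>x1 x2. tsum (\<psi> x1) (\<lambda>x1I x1II. tsum (\<rho> x2) (\<lambda>x2H x2A.
         tsum (\<rho> x2H) (\<lambda>x2HH x2HA. x2HH \<otimes> (x1I \<odot> x2HA) \<otimes> (x1II \<odot> x2A))))))"
      by (simp add: sw2_map[OF G(1)] clinear_tsum_map[OF G(1)] G(2) conv_def P23_def Ps_def I2_def
          tsum_tens_right[symmetric] HT3.tsum_left[symmetric] rho_map_def R_def
          clinear_tsum_map[where h = "\<lambda>z. insert_last z _"] lin insert_last_tens)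
        (simp add: HT3.tsum_right[symmetric] BBB_tens BB_tens HB.unit_left i_mulB_tens A.mul_unity_left)
    also have "\<dots> = ((\<lambda>x. comul_snd (R x)) \<star>\<^sub>3 P23) x"
      unfolding twisted_comodule
      by (simp add: sw2_map[OF G(1)] clinear_tsum_map[OF G(1)] G(2) conv_def P23_def Ps_def I2_def
          R_def clinear_tsum_map[OF clinear_comul_snd] comul_snd_tens comulB_i
          tsum_tens_right[symmetric] HT3.tsum_left[symmetric] sw2_def[of A])
        (simp add: HT3.tsum_right[symmetric] BBB_tens BB_tens HB.unit_right i_mulB_tens)
    finally show "(P23 \<star>\<^sub>3 rho_map R) x = ((\<lambda>x. comul_snd (R x)) \<star>\<^sub>3 P23) x" .
  qed
  have dual: "(\<lambda>x. comul_fst (Ps x)) \<star>\<^sub>3 rho_map Ps = (\<lambda>x. comul_snd (Ps x)) \<star>\<^sub>3 P23"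
  proof
    fix x
    note G = clinear_I3 I3_tens
    have "((\<lambda>x. comul_fst (Ps x)) \<star>\<^sub>3 rho_map Ps) x = I3 (sw2 H x (\<lambda>x1 x2. tsum (\<psi> x1) (\<lambda>x1I x1II. sw2 A x1I (\<lambda>x1I1 x1I2.
         tsum (\<rho> x2) (\<lambda>x2H x2A. tsum (\<psi> x2H) (\<lambda>x2HI x2HII.
           (x1I1 \<odot> x2HI) \<otimes> (x1I2 \<odot> x2HII) \<otimes> (x1II \<odot> x2A)))))))"
      by (simp add: sw2_map[OF G(1)] clinear_tsum_map[OF G(1)] G(2) conv_def fst_Ps rho_map_Ps sw2_def[of A]
          HT3.tsum_left[symmetric])
        (simp add: HT3.tsum_right[symmetric] BBB_tens BB_tens i_mulB_tens)
    also have "\<dots> = ((\<lambda>x. comul_snd (Ps x)) \<star>\<^sub>3 P23) x"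
      unfolding dual_cocycle
      by (simp add: sw2_map[OF G(1)] clinear_tsum_map[OF G(1)] G(2) conv_def snd_Ps P23 sw2_def[of A]
          HT3.tsum_left[symmetric])
        (simp add: HT3.tsum_right[symmetric] BBB_tens BB_tens HB.unit_right i_mulB_tens)
    finally show "((\<lambda>x. comul_fst (Ps x)) \<star>\<^sub>3 rho_map Ps) x = ((\<lambda>x. comul_snd (Ps x)) \<star>\<^sub>3 P23) x" .
  qed
  fix a x
  \<comment> \<open>Five factors occur. \<open>dual\<close> changes the first two into
    \<open>comul_snd\<close> of \<open>Ps\<close> and \<open>P23\<close>, \<open>twisted\<close>
    moves this \<open>P23\<close> behind \<open>comul_snd\<close> of \<open>R\<close>, and there it
    joins \<open>R23\<close> and \<open>J3\<close> to form \<open>comul_snd\<close> of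
    \<open>J2\<close>.\<close>
  have "comul_fst (D x) = (((\<lambda>x. comul_fst (Ps x)) \<star>\<^sub>3 rho_map Ps) \<star>\<^sub>3 rho_map R \<star>\<^sub>3 R23 \<star>\<^sub>3 J3) x"
    by (simp add: D_def D0_def HT.conv_hom[OF hom_comul_fst] fst_R fst_J HT3.conv_assoc HT3.clinear_conv lin
      del: HT3.lin_conv)
  also have "\<dots> = ((\<lambda>x. comul_snd (Ps x)) \<star>\<^sub>3 (P23 \<star>\<^sub>3 rho_map R) \<star>\<^sub>3 R23 \<star>\<^sub>3 J3) x"
    unfolding dual by (simp add: HT3.conv_assoc HT3.clinear_conv lin)
  also have "\<dots> = comul_snd (D x)"
    unfolding twisted
    by (simp add: D_def D0_def HT.conv_hom[OF hom_comul_snd] snd_J HT3.conv_assoc HT3.clinear_conv lin)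
  finally show "comul_fst (comul B (a \<otimes> x)) = comul_snd (comul B (a \<otimes> x))"
    using hom_comul_fst hom_comul_snd A.coassoc[of a]
    by (simp add: comulB_tens algebra_hom_def fst_I2 snd_I2 sw2_def)
qed

lemma bialgebra_B: "bialgebra B"
proof (rule bialgebra.intro)
  show "sw2 B t (\<lambda>x1 x2. sw2 B x1 (\<lambda>x11 x12. x11 \<otimes> x12 \<otimes> x2)) =
      sw2 B t (\<lambda>x1 x2. sw2 B x2 (\<lambda>x21 x22. x1 \<otimes> x21 \<otimes> x22))" for t
    using comulB_coassoc[of t]
    by (simp add: comul_fst_def comul_snd_def insert_last_def sw2_def tsum_tens_right tsum_tens_id)
  show "comul B (s \<diamondop> t) = sw2 B s (\<lambda>x1 x2. sw2 B t (\<lambda>y1 y2. (x1 \<diamondop> y1) \<otimes> (x2 \<diamondop> y2)))" for s t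
    by (simp add: comulB_mul tmul_def sw2_def)
  show "comul B (unity B) = unity B \<otimes> unity B"
    by (simp add: unityB comulB_tens D_unity HT.unit_right A.comul_unity I2_tens)
qed (unfold unityB, (rule HB.bilinear mulB_assoc HB.unit_left HB.unit_right clinear_comulB clinear_counitB
    comulB_counit_left comulB_counit_right counitB_mul counitB_unity)+)

lemma sw2_B_tens:
  assumes F: "cbilinear F"
  shows "sw2 B (a \<otimes> x) F = sw2 A a (\<lambda>a1 a2. sw2 H x (\<lambda>x1 r. sw2 H r (\<lambda>x2 x3.
    tsum (\<psi> x1) (\<lambda>x1I x1II. tsum (\<rho> x2) (\<lambda>x2H x2A.
      F ((a1 \<odot> x1I) \<otimes> x2H) ((a2 \<odot> x1II \<odot> x2A) \<otimes> x3))))))"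
  unfolding comulB_raw sw2_def[of B] sw3_def by (simp add: sw2_def tsum_bil F)

end

sublocale cocycle_linked_pair \<subseteq> bi: bialgebra "bismash A H act \<rho> \<chi> \<psi>"
  by (rule bialgebra_B)

section \<open>The antipode of the bismash product\<close>

context convolution
begin

lemma conv3_unit_left:
  assumes f: "ctrilinear f"
  shows "conv3 C (\<odot>) (\<lambda>x y z. (counit C x * (counit C y * counit C z)) *\<^sub>C e) f = f"
proof (intro ext)
  fix x y z
  note [lin] = f[unfolded ctrilinear_def, THEN conjunct1, rule_format]
    f[unfolded ctrilinear_def, THEN conjunct2, THEN conjunct1, rule_format]
    f[unfolded ctrilinear_def, THEN conjunct2, THEN conjunct2, rule_format]
  show "conv3 C (\<odot>) (\<lambda>x y z. (counit C x * (counit C y * counit C z)) *\<^sub>C e) f x y z = f x y z"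
    by (simp add: conv3_def conv2_def scale_left unit_left sw2_scale scaleC_scaleC[symmetric]
      sw2_counit_left lin del: cvec.scale_scale)
qed

lemma conv3_unit_right:
  assumes f: "ctrilinear f"
  shows "conv3 C (\<odot>) f (\<lambda>x y z. (counit C x * (counit C y * counit C z)) *\<^sub>C e) = f"
proof (intro ext)
  fix x y z
  note [lin] = f[unfolded ctrilinear_def, THEN conjunct1, rule_format]
    f[unfolded ctrilinear_def, THEN conjunct2, THEN conjunct1, rule_format]
    f[unfolded ctrilinear_def, THEN conjunct2, THEN conjunct2, rule_format]
  show "conv3 C (\<odot>) f (\<lambda>x y z. (counit C x * (counit C y * counit C z)) *\<^sub>C e) x y z = f x y z"
    by (simp add: conv3_def conv2_def scale_right unit_right sw2_scale scaleC_scaleC[symmetric]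
      sw2_counit_right lin del: cvec.scale_scale)
qed

lemma conv3_cross_inverse:
  assumes t: "ctrilinear f" "ctrilinear g" "ctrilinear h" "ctrilinear k" "ctrilinear f'" "ctrilinear k'"
    and "conv3 C (\<odot>) f g = conv3 C (\<odot>) h k"
    and "conv3 C (\<odot>) f' f = (\<lambda>x y z. (counit C x * (counit C y * counit C z)) *\<^sub>C e)"
    and "conv3 C (\<odot>) k k' = (\<lambda>x y z. (counit C x * (counit C y * counit C z)) *\<^sub>C e)"
  shows "conv3 C (\<odot>) f' h = conv3 C (\<odot>) g k'"
proof -
  have "conv3 C (\<odot>) f' h = conv3 C (\<odot>) f' (conv3 C (\<odot>) (conv3 C (\<odot>) h k) k')"
    by (simp add: conv3_assoc assms(1-6,8,9) conv3_unit_right)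
  also have "\<dots> = conv3 C (\<odot>) (conv3 C (\<odot>) f' f) (conv3 C (\<odot>) g k')"
    by (simp add: conv3_assoc assms(1-6) assms(7)[symmetric] ctrilinear_conv3)
  finally show ?thesis
    by (simp add: assms conv3_unit_left ctrilinear_conv3)
qed

end

locale invertible_linked_pair =
  cocycle_linked_pair A H act \<rho> \<chi> \<psi> + A: hopf_algebra A + H: hopf_algebra H
  for A :: "'a::complex_vector bialg" and H :: "'h::complex_vector bialg"
    and act (infixr \<open>\<triangleright>\<close> 72) and \<rho> \<chi> \<psi> +
  fixes \<chi>' :: "'h \<Rightarrow> 'h \<Rightarrow> 'a" and \<psi>' :: "'h \<Rightarrow> 'a \<otimes> 'a"
  assumes chi_inverse: "is_chi_inverse A H \<chi> \<chi>'"
    and psi_inverse: "is_psi_inverse A H \<psi> \<psi>'"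
begin

abbreviation "SA \<equiv> antipode A"
abbreviation "SH \<equiv> antipode H"

lemma cbilinear_chi': "cbilinear \<chi>'"
  and chi_chi': "sw2 H x (\<lambda>x1 x2. sw2 H y (\<lambda>y1 y2. \<chi> x1 y1 \<odot> \<chi>' x2 y2)) = (\<epsilon>H x * \<epsilon>H y) *\<^sub>C \<one>\<^bsub>A\<^esub>"
  and chi'_chi: "sw2 H x (\<lambda>x1 x2. sw2 H y (\<lambda>y1 y2. \<chi>' x1 y1 \<odot> \<chi> x2 y2)) = (\<epsilon>H x * \<epsilon>H y) *\<^sub>C \<one>\<^bsub>A\<^esub>"
  using chi_inverse by (simp_all add: is_chi_inverse_def)

lemma clinear_psi': "clinear \<psi>'"
  and psi_psi': "sw2 H x (\<lambda>x1 x2. tmul mulA mulA (\<psi> x1) (\<psi>' x2)) = \<epsilon>H x *\<^sub>C (\<one>\<^bsub>A\<^esub> \<otimes> \<one>\<^bsub>A\<^esub>)"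
  and psi'_psi: "sw2 H x (\<lambda>x1 x2. tmul mulA mulA (\<psi>' x1) (\<psi> x2)) = \<epsilon>H x *\<^sub>C (\<one>\<^bsub>A\<^esub> \<otimes> \<one>\<^bsub>A\<^esub>)"
  using psi_inverse by (simp_all add: is_psi_inverse_def tensor_mul_def tmul_def)

lemmas [lin] =
  clinear_compose[OF cbilinear_left[OF cbilinear_chi']]
  clinear_compose[OF cbilinear_right[OF cbilinear_chi']]
  clinear_compose[OF clinear_psi']

section \<open>The convolution inverse of \<open>j\<close>\<close>

lemma chi'_unity_left: "\<chi>' \<one>\<^bsub>H\<^esub> y = \<epsilon>H y *\<^sub>C \<one>\<^bsub>A\<^esub>"
  using chi_chi'[of "\<one>\<^bsub>H\<^esub>" y]
  by (simp add: H.sw2_unity lin chi_unity_left A.al.scale_left A.mul_unity_left H.co.sw2_counit_left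
    H.counit_unity)

text \<open>The cocycle identity with its outer factors carried across: the maps (x, y, z) -> x
  acting on \<chi>(y, z) and (x, y, z) -> \<chi>(xy, z) have the evident inverses built from
  \<chi>'.\<close>

lemma act_chi'_chi:
  "sw2 H x (\<lambda>x1 x2. sw2 H y (\<lambda>y1 y2. (x1 \<triangleright> \<chi>' y1 z) \<odot> \<chi> x2 y2)) =
    sw2 H x (\<lambda>x1 x2. sw2 H y (\<lambda>y1 y2. sw2 H z (\<lambda>z1 z2. \<chi> x1 (y1 \<bullet> z1) \<odot> \<chi>' (x2 \<bullet> y2) z2)))"
proof -
  let ?f = "\<lambda>x y z. x \<triangleright> \<chi> y z" and ?f' = "\<lambda>x y z. x \<triangleright> \<chi>' y z" and ?g = "\<lambda>x y z. \<chi> x (y \<bullet> z)"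
    and ?h = "\<lambda>x y z. \<epsilon>H z *\<^sub>C \<chi> x y" and ?k = "\<lambda>x y z. \<chi> (x \<bullet> y) z" and ?k' = "\<lambda>x y z. \<chi>' (x \<bullet> y) z"
  have "conv3 H mulA ?f' ?h = conv3 H mulA ?g ?k'"
  proof (rule HA.conv3_cross_inverse)
    show "conv3 H mulA ?f ?g = conv3 H mulA ?h ?k"
      by (simp add: fun_eq_iff conv3_def conv2_def cocycle A.al.scale_left H.co.sw2_counit_left lin)
    show "conv3 H mulA ?f' ?f = (\<lambda>x y z. (\<epsilon>H x * (\<epsilon>H y * \<epsilon>H z)) *\<^sub>C \<one>\<^bsub>A\<^esub>)"
    proof (intro ext)
      fix x y z
      have "conv3 H mulA ?f' ?f x y z = x \<triangleright> sw2 H y (\<lambda>y1 y2. sw2 H z (\<lambda>z1 z2. \<chi>' y1 z1 \<odot> \<chi> y2 z2))"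
        unfolding conv3_def conv2_def sw2_swap[of H x]
        by (simp add: act_mul sw2_map[where h = "\<lambda>a. x \<triangleright> a"] lin)
      then show "conv3 H mulA ?f' ?f x y z = (\<epsilon>H x * (\<epsilon>H y * \<epsilon>H z)) *\<^sub>C \<one>\<^bsub>A\<^esub>"
        by (simp add: chi'_chi clinear_scale[OF cbilinear_right[OF cbilinear_act]] act_unity mult_ac)
    qed
    show "conv3 H mulA ?k ?k' = (\<lambda>x y z. (\<epsilon>H x * (\<epsilon>H y * \<epsilon>H z)) *\<^sub>C \<one>\<^bsub>A\<^esub>)"
    proof (intro ext)
      fix x y z
      have "conv3 H mulA ?k ?k' x y z = sw2 H (x \<bullet> y) (\<lambda>u v. sw2 H z (\<lambda>z1 z2. \<chi> u z1 \<odot> \<chi>' v z2))"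
        by (simp add: conv3_def conv2_def H.sw2_mul lin)
      then show "conv3 H mulA ?k ?k' x y z = (\<epsilon>H x * (\<epsilon>H y * \<epsilon>H z)) *\<^sub>C \<one>\<^bsub>A\<^esub>"
        by (simp add: chi_chi' H.counit_mul mult_ac)
    qed
  qed (simp_all add: lin)
  then have "conv3 H mulA ?f' ?h x y z = conv3 H mulA ?g ?k' x y z"
    by (simp add: fun_eq_iff)
  then show ?thesis
    by (simp add: conv3_def conv2_def A.al.scale_right H.co.sw2_counit_right lin)
qed

text \<open>This is \<gamma> after the antipode (\<open>gamma_antipode\<close>). Written in this way
  it makes sense here, where no star is given from which the antipode could be shown to be
  bijective.\<close>

definition "g' x = sw2 H x (\<lambda>x1 x2. \<chi>' (SH x1) x2)"

lemma lin_g' [lin]: "clinear f \<Longrightarrow> clinear (\<lambda>x. g' (f x))"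
  unfolding g'_def by (simp add: lin)

text \<open>\<open>act_chi'_chi\<close> replaces the value of \<chi>' that is acted upon by a
  product of values of \<chi> and \<chi>' at products in H. In these products a leg meets the
  antipode of its neighbour and both collapse.\<close>

lemma act_g':
  "sw2 H x (\<lambda>p s. sw2 H s (\<lambda>t v. sw2 H t (\<lambda>q u. (p \<triangleright> g' v) \<odot> \<chi> q (SH u)))) = \<epsilon>H x *\<^sub>C \<one>\<^bsub>A\<^esub>"
proof -
  have "sw2 H x (\<lambda>p s. sw2 H s (\<lambda>t v. sw2 H t (\<lambda>q u. (p \<triangleright> g' v) \<odot> \<chi> q (SH u)))) =
      sw2 H x (\<lambda>p s. sw2 H s (\<lambda>t v. sw2 H t (\<lambda>q u. sw2 H v (\<lambda>w z. (p \<triangleright> \<chi>' (SH w) z) \<odot> \<chi> q (SH u)))))"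
    by (simp add: g'_def sw2_map[where h = "\<lambda>a. (_ \<triangleright> a) \<odot> _"] lin)
  also have "\<dots> = sw2 H x (\<lambda>p s. sw2 H s (\<lambda>q s. sw2 H s (\<lambda>u s. sw2 H s (\<lambda>w z. (p \<triangleright> \<chi>' (SH w) z) \<odot> \<chi> q (SH u)))))"
    by (simp add: H.co.sw2_assoc lin)
  also have "\<dots> = sw2 H x (\<lambda>y z. sw2 H y (\<lambda>p s. sw2 H s (\<lambda>q s. sw2 H s (\<lambda>u w. (p \<triangleright> \<chi>' (SH w) z) \<odot> \<chi> q (SH u)))))"
    by (simp add: H.co.sw2_assoc lin)
  \<comment> \<open>The antipode reverses the legs of b, so w and u become the two legs of
    \<open>SH b\<close> in the order that \<open>act_chi'_chi\<close> expects.\<close>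
  also have "\<dots> = sw2 H x (\<lambda>y z. sw2 H y (\<lambda>a b. sw2 H a (\<lambda>p q. sw2 H (SH b) (\<lambda>w u. (p \<triangleright> \<chi>' w z) \<odot> \<chi> q u))))"
    by (simp add: H.co.sw2_assoc lin H.sw2_antipode)
  also have "\<dots> = sw2 H x (\<lambda>y z. sw2 H y (\<lambda>a b. sw2 H a (\<lambda>p q. sw2 H (SH b) (\<lambda>w u. sw2 H z (\<lambda>z1 z2.
      \<chi> p (w \<bullet> z1) \<odot> \<chi>' (q \<bullet> u) z2)))))"
    by (simp only: act_chi'_chi)
  also have "\<dots> = sw2 H x (\<lambda>y z. sw2 H y (\<lambda>p s. sw2 H s (\<lambda>q s. sw2 H s (\<lambda>u w. sw2 H z (\<lambda>z1 z2.
      \<chi> p (SH w \<bullet> z1) \<odot> \<chi>' (q \<bullet> SH u) z2)))))"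
    by (simp add: H.co.sw2_assoc lin H.sw2_antipode)
  also have "\<dots> = sw2 H x (\<lambda>p s. sw2 H s (\<lambda>q s. sw2 H s (\<lambda>u s. sw2 H s (\<lambda>w z. sw2 H z (\<lambda>z1 z2.
      \<chi> p (SH w \<bullet> z1) \<odot> \<chi>' (q \<bullet> SH u) z2)))))"
    by (simp add: H.co.sw2_assoc lin)
  also have "\<dots> = sw2 H x (\<lambda>p s. sw2 H s (\<lambda>a z. sw2 H a (\<lambda>q u. sw2 H z (\<lambda>b z2. sw2 H b (\<lambda>w z1.
      \<chi> p (SH w \<bullet> z1) \<odot> \<chi>' (q \<bullet> SH u) z2)))))"
    by (simp add: H.co.sw2_assoc lin)
  \<comment> \<open>Each of S(w) z1 and q S(u) is now summed over a single coproduct, so the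
    antipode axiom reduces \<chi> and \<chi>' to their values at the unit.\<close>
  also have "\<dots> = sw2 H x (\<lambda>p s. sw2 H s (\<lambda>a z. sw2 H a (\<lambda>q u. sw2 H z (\<lambda>b z2.
      \<chi> p (sw2 H b (\<lambda>w z1. SH w \<bullet> z1)) \<odot> \<chi>' (q \<bullet> SH u) z2))))"
    by (simp add: sw2_map[where h = "\<lambda>a. \<chi> _ a \<odot> _"] lin)
  also have "\<dots> = sw2 H x (\<lambda>p s. sw2 H s (\<lambda>a z. \<epsilon>H p *\<^sub>C \<chi>' (sw2 H a (\<lambda>q u. q \<bullet> SH u)) z))"
    by (simp add: H.antipode_left clinear_scale[OF cbilinear_right[OF cbilinear_chi]] chi_unity_right A.al.scale_left
      A.mul_unity_left H.co.sw2_counit_left lin sw2_scale sw2_map[where h = "\<lambda>a. \<chi>' a _"] del: cvec.scale_scale)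
  also have "\<dots> = \<epsilon>H x *\<^sub>C \<one>\<^bsub>A\<^esub>"
    by (simp add: H.antipode_right clinear_scale[OF cbilinear_left[OF cbilinear_chi']] chi'_unity_left
      sw2_scale H.co.sw2_counit_left lin del: cvec.scale_scale)
  finally show ?thesis .
qed

text \<open>A two-sided convolution inverse of \<open>j\<close>. The candidate j(S x) fails, because
  its product with \<open>j\<close> leaves a value of the cocycle (\<open>j_j_antipode\<close>); the
  factor \<open>g'\<close> repairs this.\<close>

definition "j' x = sw2 H x (\<lambda>x1 x2. i (g' x2) \<diamondop> j (SH x1))"

lemma lin_j' [lin]: "clinear f \<Longrightarrow> clinear (\<lambda>x. j' (f x))"
  unfolding j'_def by (simp add: lin)

lemma j_j_antipode: "sw2 H x (\<lambda>x1 x2. j x1 \<diamondop> j (SH x2)) = sw2 H x (\<lambda>x1 x2. i (\<chi> x1 (SH x2)))"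
proof -
  have "sw2 H x (\<lambda>x1 x2. j x1 \<diamondop> j (SH x2)) =
      sw2 H x (\<lambda>x1 x2. sw2 H x1 (\<lambda>p q. sw2 H x2 (\<lambda>u v. \<chi> p (SH v) \<otimes> (q \<bullet> SH u))))"
    by (simp add: j_j H.sw2_antipode lin i_mulB_tens A.mul_unity_right)
  also have "\<dots> = sw2 H x (\<lambda>p s. sw2 H s (\<lambda>a v. sw2 H a (\<lambda>q u. \<chi> p (SH v) \<otimes> (q \<bullet> SH u))))"
    by (simp add: H.co.sw2_assoc lin)
  also have "\<dots> = sw2 H x (\<lambda>x1 x2. i (\<chi> x1 (SH x2)))"
    by (simp add: sw2_map[where h = "\<lambda>a. _ \<otimes> a", symmetric] H.antipode_right tens_scale_right
      H.co.sw2_counit_left[where f = "\<lambda>v. i (\<chi> _ (SH v))"] lin)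
  finally show ?thesis .
qed

lemma j_j': "sw2 H x (\<lambda>x1 x2. j x1 \<diamondop> j' x2) = \<epsilon>H x *\<^sub>C eB"
proof -
  have "j y \<diamondop> (i a \<diamondop> t) = sw2 H y (\<lambda>p q. i (p \<triangleright> a) \<diamondop> (j q \<diamondop> t))" for y a t
    by (simp add: HB.assoc[symmetric] j_i HB.sw2_left)
  then have "sw2 H x (\<lambda>x1 x2. j x1 \<diamondop> j' x2) = sw2 H x (\<lambda>x1 x2. sw2 H x2 (\<lambda>u v.
      sw2 H x1 (\<lambda>p q. i (p \<triangleright> g' v) \<diamondop> (j q \<diamondop> j (SH u)))))"
    by (simp add: j'_def HB.sw2_right[symmetric])
  also have "\<dots> = sw2 H x (\<lambda>x1 x2. sw2 H x1 (\<lambda>p q. sw2 H x2 (\<lambda>u v.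
      i (p \<triangleright> g' v) \<diamondop> (j q \<diamondop> j (SH u)))))"
    by (subst sw2_swap) rule
  also have "\<dots> = sw2 H x (\<lambda>p s. sw2 H s (\<lambda>t v. i (p \<triangleright> g' v) \<diamondop> sw2 H t (\<lambda>q u. j q \<diamondop> j (SH u))))"
    by (simp add: H.co.sw2_assoc lin HB.sw2_right[symmetric])
  also have "\<dots> = i (sw2 H x (\<lambda>p s. sw2 H s (\<lambda>t v. sw2 H t (\<lambda>q u. (p \<triangleright> g' v) \<odot> \<chi> q (SH u)))))"
    by (simp add: j_j_antipode HB.sw2_right[symmetric] i_mulB_tens sw2_map[where h = "\<lambda>a. i a"] lin)
  finally show ?thesis
    by (simp add: act_g' tens_scale_left)
qed

text \<open>On this side \<chi>' and \<chi> meet directly, evaluated on consecutive legs of one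
  element and of the antipode of another, and cancel. Only S(p) l is left to collapse.\<close>

lemma j'_j: "sw2 H x (\<lambda>x1 x2. j' x1 \<diamondop> j x2) = \<epsilon>H x *\<^sub>C eB"
proof -
  have "j' y \<diamondop> j w = sw2 H y (\<lambda>u v. sw2 H u (\<lambda>p q. sw2 H v (\<lambda>r s. sw2 H w (\<lambda>k l.
      (\<chi>' (SH r) s \<odot> \<chi> (SH q) k) \<otimes> (SH p \<bullet> l)))))" for y w
  proof -
    have jSj: "j (SH u) \<diamondop> j w = sw2 H u (\<lambda>p q. sw2 H w (\<lambda>k l. \<chi> (SH q) k \<otimes> (SH p \<bullet> l)))" for u
      by (simp add: j_j H.sw2_antipode lin i_mulB_tens A.mul_unity_right)
    have "j' y \<diamondop> j w = sw2 H y (\<lambda>u v. i (g' v) \<diamondop> (j (SH u) \<diamondop> j w))"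
      by (simp add: j'_def HB.sw2_left[symmetric] HB.assoc)
    also have "\<dots> = sw2 H y (\<lambda>u v. sw2 H u (\<lambda>p q. sw2 H w (\<lambda>k l. (g' v \<odot> \<chi> (SH q) k) \<otimes> (SH p \<bullet> l))))"
      by (simp only: jSj) (simp add: HB.sw2_right[symmetric] i_mulB_tens)
    also have "\<dots> = sw2 H y (\<lambda>u v. sw2 H u (\<lambda>p q. sw2 H w (\<lambda>k l. sw2 H v (\<lambda>r s.
        (\<chi>' (SH r) s \<odot> \<chi> (SH q) k) \<otimes> (SH p \<bullet> l)))))"
      by (simp add: g'_def sw2_map[where h = "\<lambda>z. (z \<odot> _) \<otimes> _"] lin)
    finally show ?thesis
      by (simp add: sw2_swap[where C = H and x = w])
  qed
  then have "sw2 H x (\<lambda>x1 x2. j' x1 \<diamondop> j x2) = sw2 H x (\<lambda>p a. sw2 H a (\<lambda>q a. sw2 H a (\<lambda>r a. sw2 H a (\<lambda>s a. sw2 H a (\<lambda>k l.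
      (\<chi>' (SH r) s \<odot> \<chi> (SH q) k) \<otimes> (SH p \<bullet> l))))))"
    by (simp add: H.co.sw2_assoc lin)
  also have "\<dots> = sw2 H x (\<lambda>p a. sw2 H a (\<lambda>y l. sw2 H y (\<lambda>u v. sw2 H (SH u) (\<lambda>r q. sw2 H v (\<lambda>s k.
      (\<chi>' r s \<odot> \<chi> q k) \<otimes> (SH p \<bullet> l)))))) "
    by (simp add: H.co.sw2_assoc lin H.sw2_antipode)
  also have "\<dots> = sw2 H x (\<lambda>p a. sw2 H a (\<lambda>y l. sw2 H y (\<lambda>u v. (\<epsilon>H (SH u) * \<epsilon>H v) *\<^sub>C (\<one>\<^bsub>A\<^esub> \<otimes> (SH p \<bullet> l)))))"
    by (simp add: sw2_map[where h = "\<lambda>z. z \<otimes> _", symmetric] lin chi'_chi tens_scale_left)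
  also have "\<dots> = \<epsilon>H x *\<^sub>C eB"
    by (simp add: H.counit_antipode scaleC_scaleC[symmetric] H.co.sw2_counit_left lin
       sw2_map[where h = "\<lambda>z. j z", symmetric] H.antipode_left tens_scale_right del: cvec.scale_scale)
  finally show ?thesis .
qed

section \<open>The inverse of the dual cocycle\<close>

lemma psi_psi'_map:
  assumes F: "cbilinear F"
  shows "sw2 H x (\<lambda>x1 x2. tsum (\<psi> x1) (\<lambda>p q. tsum (\<psi>' x2) (\<lambda>u v. F (p \<odot> u) (q \<odot> v)))) =
    \<epsilon>H x *\<^sub>C F \<one>\<^bsub>A\<^esub> \<one>\<^bsub>A\<^esub>"
proof -
  have l: "clinear (\<lambda>t. tsum t F)" by (rule clinear_tsum[OF F])
  show ?thesis
    using arg_cong[OF psi_psi'[of x], of "\<lambda>t. tsum t F"]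
    by (simp add: sw2_map[OF l] clinear_scale[OF l] tmul_def tsum_bil F)
qed

text \<open>Applying the counit to the second leg turns \<psi> into the convolution unit, hence
  turns its inverse into the unit as well.\<close>

lemma counit_psi'_right: "tsum (\<psi>' x) (\<lambda>u v. \<epsilon>A v *\<^sub>C u) = \<epsilon>H x *\<^sub>C \<one>\<^bsub>A\<^esub>"
proof -
  let ?f = "\<lambda>x. tsum (\<psi> x) (\<lambda>u v. \<epsilon>A v *\<^sub>C u)" and ?h = "\<lambda>x. tsum (\<psi>' x) (\<lambda>u v. \<epsilon>A v *\<^sub>C u)"
  have "conv H mulA ?f ?h x = \<epsilon>H x *\<^sub>C \<one>\<^bsub>A\<^esub>" for x
    using psi_psi'_map[of "\<lambda>u v. \<epsilon>A v *\<^sub>C u" x]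
    by (simp add: conv_def A.al.tsum_left[symmetric] lin A.counit_mul A.counit_unity)
      (simp add: A.al.tsum_right[symmetric] A.al.scale_left A.al.scale_right mult.commute)
  then have "conv H mulA ?f ?h = (\<lambda>x. \<epsilon>H x *\<^sub>C \<one>\<^bsub>A\<^esub>)" by (simp add: fun_eq_iff)
  moreover have "conv H mulA ?f ?h = ?h"
    unfolding counit_psi_right by (rule HA.conv_unit_left) (simp add: lin)
  ultimately show ?thesis by (simp add: fun_eq_iff)
qed

abbreviation "AA \<equiv> tmul mulA mulA"
abbreviation "AAA \<equiv> tmul mulA AA"

lemma AA_tens: "AA (a \<otimes> b) (c \<otimes> d) = (a \<odot> c) \<otimes> (b \<odot> d)"
  by (rule tmul_tens[OF A.al.algebra_axioms A.al.algebra_axioms])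

lemma AAA_tens: "AAA (a \<otimes> s) (b \<otimes> t) = (a \<odot> b) \<otimes> AA s t"
  by (rule tmul_tens[OF A.al.algebra_axioms A.algebra_tensor_square])

text \<open>Dual of \<open>act_chi'_chi\<close>: in \<open>dual_cocycle\<close> the factor with the
  coproduct in the second leg of \<psi> and the factor involving \<rho> are carried across. The
  first is inverted because id \<otimes> \<Delta> is multiplicative, the second by
  \<open>rho_map_conv\<close>.\<close>

lemma psi_comul_conv:
  "conv H AAA (\<lambda>x. tsum (\<psi>' x) (\<lambda>u v. u \<otimes> comul A v)) (\<lambda>x. tsum (\<psi> x) (\<lambda>u v. sw2 A u (\<lambda>u1 u2. u1 \<otimes> u2 \<otimes> v))) =
   conv H AAA (\<lambda>x. \<one>\<^bsub>A\<^esub> \<otimes> \<psi> x) (\<lambda>x. tsum (\<rho> x) (\<lambda>h a. insert_last (\<psi>' h) a))"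
proof -
  interpret AA: convolution H AA "\<one>\<^bsub>A\<^esub> \<otimes> \<one>\<^bsub>A\<^esub>"
    by (rule convolutionI[OF H.co.coalgebra_axioms A.algebra_tensor_square])
  interpret AAA: convolution H AAA "\<one>\<^bsub>A\<^esub> \<otimes> \<one>\<^bsub>A\<^esub> \<otimes> \<one>\<^bsub>A\<^esub>"
    by (rule convolutionI[OF H.co.coalgebra_axioms algebra_tmul[OF A.al.algebra_axioms A.algebra_tensor_square]])
  have comul: "a \<otimes> comul A b = tsum (comul A b) (\<lambda>b1 b2. a \<otimes> b1 \<otimes> b2)"
    and psi: "a \<otimes> \<psi> x = tsum (\<psi> x) (\<lambda>p q. a \<otimes> p \<otimes> q)" for a b x
    by (simp_all add: tsum_tens_right tsum_tens_id)
  let ?c = "conv H AAA"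
  let ?G = "\<lambda>t. tsum t (\<lambda>u v. u \<otimes> comul A v)"
  have G: "clinear ?G" "?G (u \<otimes> v) = u \<otimes> comul A v" for u v
    by (simp_all add: lin tsum_bil)
  note [lin] = clinear_compose[OF G(1)]
  let ?R = "\<lambda>x. ?G (\<psi> x)" and ?R' = "\<lambda>x. ?G (\<psi>' x)"
    and ?P = "\<lambda>x. tsum (\<psi> x) (\<lambda>u v. sw2 A u (\<lambda>u1 u2. u1 \<otimes> u2 \<otimes> v))"
    and ?T = "\<lambda>x. \<one>\<^bsub>A\<^esub> \<otimes> \<psi> x"
    and ?Q = "\<lambda>x. tsum (\<rho> x) (\<lambda>h a. insert_last (\<psi> h) a)"
    and ?Q' = "\<lambda>x. tsum (\<rho> x) (\<lambda>h a. insert_last (\<psi>' h) a)"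
  have hom: "algebra_hom AA AAA ?G"
  proof -
    have "?G (AA s t) = AAA (?G s) (?G t)" for s t
    proof (rule tensor_ext[where t = s])
      show "?G (AA (p \<otimes> q) t) = AAA (?G (p \<otimes> q)) (?G t)" for p q
        by (rule tensor_ext[where t = t])
          (simp_all add: lin G(2) AA_tens AAA_tens A.comul_mul_tmul)
    qed (simp_all add: lin)
    then show ?thesis by (simp add: algebra_hom_def G(1))
  qed
  show ?thesis
  proof (rule AAA.conv_cross_inverse[where f = ?R and k = ?Q])
    show "?c ?R ?T = ?c ?P ?Q"
    proof
      fix x
      have "?c ?P ?Q x = sw2 H x (\<lambda>x1 x2. tsum (\<psi> x1) (\<lambda>x1I x1II. sw2 A x1I (\<lambda>x1I1 x1I2.
         tsum (\<rho> x2) (\<lambda>x2H x2A. tsum (\<psi> x2H) (\<lambda>x2HI x2HII.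
           (x1I1 \<odot> x2HI) \<otimes> (x1I2 \<odot> x2HII) \<otimes> (x1II \<odot> x2A))))))"
        by (simp add: conv_def AAA.tsum_left[symmetric] sw2_def[of A] insert_last_def)
          (simp add: AAA.tsum_right[symmetric] AAA_tens AA_tens)
      also have "\<dots> = ?c ?R ?T x"
        unfolding dual_cocycle
        by (simp add: conv_def AAA.tsum_left[symmetric] sw2_def[of A] comul psi)
          (simp add: AAA.tsum_right[symmetric] AAA_tens AA_tens A.mul_unity_right)
      finally show "?c ?R ?T x = ?c ?P ?Q x" ..
    qed
    show "?c ?R' ?R = (\<lambda>x. \<epsilon>H x *\<^sub>C (\<one>\<^bsub>A\<^esub> \<otimes> \<one>\<^bsub>A\<^esub> \<otimes> \<one>\<^bsub>A\<^esub>))"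
    proof
      fix x
      have "?c ?R' ?R x = ?G (conv H AA \<psi>' \<psi> x)"
        by (rule AA.conv_hom[OF hom, symmetric])
      then show "?c ?R' ?R x = \<epsilon>H x *\<^sub>C (\<one>\<^bsub>A\<^esub> \<otimes> \<one>\<^bsub>A\<^esub> \<otimes> \<one>\<^bsub>A\<^esub>)"
        by (simp add: conv_def psi'_psi clinear_scale[OF G(1)] G(2) A.comul_unity)
    qed
    show "?c ?Q ?Q' = (\<lambda>x. \<epsilon>H x *\<^sub>C (\<one>\<^bsub>A\<^esub> \<otimes> \<one>\<^bsub>A\<^esub> \<otimes> \<one>\<^bsub>A\<^esub>))"
    proof
      fix x
      have "?c ?Q ?Q' x = tsum (\<rho> x) (\<lambda>h a. insert_last (conv H AA \<psi> \<psi>' h) a)"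
        by (rule rho_map_conv[OF clinear_psi clinear_psi' _ A.al.algebra_axioms A.al.algebra_axioms A.al.algebra_axioms,
          where g = "\<lambda>a. a", symmetric]) (simp add: algebra_hom_def lin)
      also have "\<dots> = insert_last (\<one>\<^bsub>A\<^esub> \<otimes> \<one>\<^bsub>A\<^esub>) (tsum (\<rho> x) (\<lambda>h a. \<epsilon>H h *\<^sub>C a))"
        by (simp add: conv_def psi_psi' insert_last_tens clinear_scale[where f = "\<lambda>z. insert_last z _"]
           lin tsum_tens_right[symmetric] tens_scale_right)
      also have "\<dots> = \<epsilon>H x *\<^sub>C (\<one>\<^bsub>A\<^esub> \<otimes> \<one>\<^bsub>A\<^esub> \<otimes> \<one>\<^bsub>A\<^esub>)"
        by (simp add: counit_rho insert_last_tens tens_scale_right)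
      finally show "?c ?Q ?Q' x = \<epsilon>H x *\<^sub>C (\<one>\<^bsub>A\<^esub> \<otimes> \<one>\<^bsub>A\<^esub> \<otimes> \<one>\<^bsub>A\<^esub>)" .
    qed
  qed (simp_all add: lin)
qed

text \<open>Apply the map u \<otimes> v \<otimes> w -> u S(v) w to both sides of
  \<open>psi_comul_conv\<close>; on one side two antipode sums collapse. The identity is the dual of
  \<open>act_g'\<close>.\<close>

lemma psi'_antipode_psi:
  "sw2 H x (\<lambda>x1 x2. tsum (\<psi> x1) (\<lambda>p q. tsum (\<rho> x2) (\<lambda>h a. tsum (\<psi>' h) (\<lambda>u v.
    u \<odot> (SA (p \<odot> v) \<odot> (q \<odot> a)))))) = \<epsilon>H x *\<^sub>C \<one>\<^bsub>A\<^esub>"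
proof -
  interpret AAA: convolution H AAA "\<one>\<^bsub>A\<^esub> \<otimes> \<one>\<^bsub>A\<^esub> \<otimes> \<one>\<^bsub>A\<^esub>"
    by (rule convolutionI[OF H.co.coalgebra_axioms algebra_tmul[OF A.al.algebra_axioms A.algebra_tensor_square]])
  let ?G = "\<lambda>t. tsum t (\<lambda>u s. tsum s (\<lambda>v w. u \<odot> (SA v \<odot> w)))"
  have G: "clinear ?G" "?G (u \<otimes> v \<otimes> w) = u \<odot> (SA v \<odot> w)" for u v w
    by (simp_all add: lin tsum_bil)
  have comul: "a \<otimes> comul A b = tsum (comul A b) (\<lambda>b1 b2. a \<otimes> b1 \<otimes> b2)"
    and psi: "a \<otimes> \<psi> x = tsum (\<psi> x) (\<lambda>p q. a \<otimes> p \<otimes> q)" for a b x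
    by (simp_all add: tsum_tens_right tsum_tens_id)
  \<comment> \<open>Since S reverses products, p1 and S(p2) become neighbours and cancel; the counit
    axiom of \<psi> then removes q, and S(v1) meets v2.\<close>
  have collapse: "sw2 A v (\<lambda>v1 v2. tsum (\<psi> y) (\<lambda>p q. sw2 A p (\<lambda>p1 p2. (u \<odot> p1) \<odot> (SA (v1 \<odot> p2) \<odot> (v2 \<odot> q))))) =
      \<epsilon>H y *\<^sub>C (\<epsilon>A v *\<^sub>C u)" for u v y
  proof -
    have "sw2 A p (\<lambda>p1 p2. (u \<odot> p1) \<odot> (SA (v1 \<odot> p2) \<odot> (v2 \<odot> q))) =
        u \<odot> (sw2 A p (\<lambda>p1 p2. p1 \<odot> SA p2) \<odot> (SA v1 \<odot> (v2 \<odot> q)))" for p v1 v2 q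
      by (simp add: A.antipode_mul A.mul_assoc sw2_map[where h = "\<lambda>z. u \<odot> (z \<odot> _)"] lin)
    then have "tsum (\<psi> y) (\<lambda>p q. sw2 A p (\<lambda>p1 p2. (u \<odot> p1) \<odot> (SA (v1 \<odot> p2) \<odot> (v2 \<odot> q)))) =
        u \<odot> (SA v1 \<odot> (v2 \<odot> tsum (\<psi> y) (\<lambda>p q. \<epsilon>A p *\<^sub>C q)))" for v1 v2
      by (simp add: A.antipode_right A.al.scale_left A.al.scale_right A.mul_unity_left A.al.tsum_right[symmetric])
    then have "sw2 A v (\<lambda>v1 v2. tsum (\<psi> y) (\<lambda>p q. sw2 A p (\<lambda>p1 p2. (u \<odot> p1) \<odot> (SA (v1 \<odot> p2) \<odot> (v2 \<odot> q))))) =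
        \<epsilon>H y *\<^sub>C (u \<odot> sw2 A v (\<lambda>v1 v2. SA v1 \<odot> v2))"
      by (simp add: counit_psi_left A.al.scale_right A.mul_unity_right sw2_scale sw2_map[where h = "\<lambda>z. u \<odot> z"] lin)
    then show ?thesis
      by (simp add: A.antipode_left A.al.scale_right A.mul_unity_right)
  qed
  have "sw2 H x (\<lambda>x1 x2. tsum (\<psi> x1) (\<lambda>p q. tsum (\<rho> x2) (\<lambda>h a. tsum (\<psi>' h) (\<lambda>u v.
    u \<odot> (SA (p \<odot> v) \<odot> (q \<odot> a)))))) = ?G (conv H AAA (\<lambda>x. \<one>\<^bsub>A\<^esub> \<otimes> \<psi> x)
      (\<lambda>x. tsum (\<rho> x) (\<lambda>h a. insert_last (\<psi>' h) a)) x)"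
    by (simp add: conv_def AAA.tsum_left[symmetric] insert_last_def psi)
      (simp add: AAA.tsum_right[symmetric] AAA_tens AA_tens A.mul_unity_left sw2_map[OF G(1)] clinear_tsum_map[OF G(1)] G(2))
  also have "\<dots> = ?G (conv H AAA (\<lambda>x. tsum (\<psi>' x) (\<lambda>u v. u \<otimes> comul A v)) (\<lambda>x. tsum (\<psi> x) (\<lambda>u v. sw2 A u (\<lambda>u1 u2. u1 \<otimes> u2 \<otimes> v))) x)"
    by (simp only: psi_comul_conv)
  also have "\<dots> = sw2 H x (\<lambda>x1 x2. tsum (\<psi>' x1) (\<lambda>u v. sw2 A v (\<lambda>v1 v2. tsum (\<psi> x2) (\<lambda>p q. sw2 A p (\<lambda>p1 p2.
      (u \<odot> p1) \<odot> (SA (v1 \<odot> p2) \<odot> (v2 \<odot> q)))))))"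
    by (simp add: conv_def AAA.tsum_left[symmetric] comul sw2_def[of A])
      (simp add: AAA.tsum_right[symmetric] AAA_tens AA_tens sw2_map[OF G(1)] clinear_tsum_map[OF G(1)] G(2))
  also have "\<dots> = \<epsilon>H x *\<^sub>C \<one>\<^bsub>A\<^esub>"
    by (simp only: collapse tsum_scale counit_psi'_right H.co.sw2_counit_right[where f = "\<lambda>x. \<epsilon>H x *\<^sub>C \<one>\<^bsub>A\<^esub>"] lin)
  finally show ?thesis .
qed

lemma rho_counit_left: "clinear f \<Longrightarrow> tsum (\<rho> x) (\<lambda>h a. \<epsilon>H h *\<^sub>C f a) = f (\<epsilon>H x *\<^sub>C \<one>\<^bsub>A\<^esub>)"
  using arg_cong[OF counit_rho[of x], of f] by (simp add: clinear_tsum_map clinear_scale)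

lemma rho_counit_right: "clinear f \<Longrightarrow> tsum (\<rho> x) (\<lambda>h a. \<epsilon>A a *\<^sub>C f h) = f x"
  using arg_cong[OF rho_counit[of x], of f] by (simp add: clinear_tsum_map clinear_scale)

lemma psi_counit_right: "clinear f \<Longrightarrow> tsum (\<psi> x) (\<lambda>u v. \<epsilon>A v *\<^sub>C f u) = f (\<epsilon>H x *\<^sub>C \<one>\<^bsub>A\<^esub>)"
  using arg_cong[OF counit_psi_right[of x], of f] by (simp add: clinear_tsum_map clinear_scale)

text \<open>The identity of $B$ is \<open>E\<close> convolved with \<open>j\<close> after \<open>pr\<close>, and \<open>E'\<close> is the convolution inverse of
  \<open>E\<close>.\<close>

definition "E t = tsum t (\<lambda>a x. \<epsilon>H x *\<^sub>C i a)"
definition "pr t = tsum t (\<lambda>a x. \<epsilon>A a *\<^sub>C x)"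
definition "E' t = tsum t (\<lambda>a x. i (tsum (\<psi>' x) (\<lambda>u v. u \<odot> SA (a \<odot> v))))"

section \<open>Factorisation of the identity and the antipode of B\<close>

lemma clinear_E: "clinear E" "clinear pr" "clinear E'"
  unfolding E_def[abs_def] pr_def[abs_def] E'_def[abs_def] by (simp_all add: lin)

lemmas lin_E [lin] = clinear_compose[OF clinear_E(1)] clinear_compose[OF clinear_E(2)] clinear_compose[OF clinear_E(3)]

lemma E_tens: "E (a \<otimes> x) = \<epsilon>H x *\<^sub>C i a" "pr (a \<otimes> x) = \<epsilon>A a *\<^sub>C x"
  "E' (a \<otimes> x) = i (tsum (\<psi>' x) (\<lambda>u v. u \<odot> SA (a \<odot> v)))"
  unfolding E_def pr_def E'_def by (simp_all add: tsum_bil lin)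

lemma counit_pr: "\<epsilon>H (pr t) = counit B t"
  by (rule tensor_ext[where t = t])
    (simp_all add: lin E_tens counitB_tens clinear_scale[OF H.clinear_counit] scaleC_complex_def)

text \<open>\<open>pr\<close> respects the coproducts of B and H, so convolution identities in
  Hom(H, B), such as those of \<open>j\<close> and \<open>j'\<close>, pull back along it to Hom(B,
  B).\<close>

lemma conv_pr:
  assumes f: "clinear f" and g: "clinear g"
  shows "conv B mulB (\<lambda>t. f (pr t)) (\<lambda>t. g (pr t)) t = conv H mulB f g (pr t)"
proof (rule tensor_ext[where t = t])
  note [lin] = clinear_compose[OF f] clinear_compose[OF g]
  note fg = clinear_scale[OF f] clinear_scale[OF g]
  fix a x
  have "conv B mulB (\<lambda>t. f (pr t)) (\<lambda>t. g (pr t)) (a \<otimes> x) = sw2 A a (\<lambda>a1 a2. sw2 H x (\<lambda>x1 r. sw2 H r (\<lambda>x2 x3.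
      tsum (\<psi> x1) (\<lambda>p q. tsum (\<rho> x2) (\<lambda>h b. \<epsilon>A b *\<^sub>C (\<epsilon>A a1 *\<^sub>C \<epsilon>A q *\<^sub>C \<epsilon>A p *\<^sub>C \<epsilon>A a2 *\<^sub>C (f h \<diamondop> g x3)))))))"
    unfolding conv_def
    by (subst sw2_B_tens)
      (simp_all add: lin E_tens fg A.counit_mul HB.scale_left HB.scale_right mult_ac)
  also have "\<dots> = sw2 A a (\<lambda>a1 a2. \<epsilon>A a1 *\<^sub>C sw2 H x (\<lambda>x1 r. \<epsilon>H x1 *\<^sub>C sw2 H r (\<lambda>x2 x3. \<epsilon>A a2 *\<^sub>C (f x2 \<diamondop> g x3))))"
    by (simp add: rho_counit_right psi_counit_right tsum_scale lin sw2_scale clinear_scale[OF A.clinear_counit]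
      A.counit_unity scaleC_complex_def del: cvec.scale_scale)
  also have "\<dots> = \<epsilon>A a *\<^sub>C conv H mulB f g x"
    by (simp only: H.co.sw2_counit_left A.co.sw2_counit_left lin sw2_scale conv_def)
  finally show "conv B mulB (\<lambda>t. f (pr t)) (\<lambda>t. g (pr t)) (a \<otimes> x) = conv H mulB f g (pr (a \<otimes> x))"
    by (simp add: E_tens clinear_scale[OF HB.clinear_conv[OF f g]])
qed (simp_all add: lin bi.id.clinear_conv HB.clinear_conv assms clinear_compose[OF f] clinear_compose[OF g])

lemma E_j: "conv B mulB E (\<lambda>t. j (pr t)) t = t"
proof (rule tensor_ext[where t = t and g = "\<lambda>t. t"])
  fix a x
  have "conv B mulB E (\<lambda>t. j (pr t)) (a \<otimes> x) = sw2 A a (\<lambda>a1 a2. sw2 H x (\<lambda>x1 r. sw2 H r (\<lambda>x2 x3.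
      tsum (\<psi> x1) (\<lambda>p q. tsum (\<rho> x2) (\<lambda>h b. \<epsilon>A b *\<^sub>C (\<epsilon>H h *\<^sub>C \<epsilon>A q *\<^sub>C \<epsilon>A a2 *\<^sub>C ((a1 \<odot> p) \<otimes> x3)))))))"
    unfolding conv_def
    by (subst sw2_B_tens)
      (simp_all add: lin E_tens A.counit_mul HB.scale_left HB.scale_right mult_ac tens_scale_right
        i_mulB_tens A.mul_unity_right)
  also have "\<dots> = a \<otimes> x"
    by (simp only: rho_counit_right psi_counit_right tsum_scale lin A.al.scale_right A.mul_unity_right tens_scale_left
      sw2_scale H.co.sw2_counit_left A.co.sw2_counit_right)
  finally show "conv B mulB E (\<lambda>t. j (pr t)) (a \<otimes> x) = a \<otimes> x" .
qed (simp_all add: lin bi.id.clinear_conv)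

lemma E_E': "conv B mulB E E' t = counit B t *\<^sub>C eB"
proof (rule tensor_ext[where t = t])
  fix a x
  have "conv B mulB E E' (a \<otimes> x) = sw2 A a (\<lambda>a1 a2. sw2 H x (\<lambda>x1 r. sw2 H r (\<lambda>x2 x3.
      tsum (\<psi> x1) (\<lambda>p q. tsum (\<rho> x2) (\<lambda>h b. \<epsilon>H h *\<^sub>C i ((a1 \<odot> p) \<odot> tsum (\<psi>' x3) (\<lambda>u v. u \<odot> SA (a2 \<odot> q \<odot> b \<odot> v))))))))"
    unfolding conv_def
    by (subst sw2_B_tens) (simp_all add: lin E_tens HB.scale_left i_mulB_tens)
  also have "\<dots> = sw2 A a (\<lambda>a1 a2. sw2 H x (\<lambda>x1 r. sw2 H r (\<lambda>x2 x3. \<epsilon>H x2 *\<^sub>C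
      tsum (\<psi> x1) (\<lambda>p q. i ((a1 \<odot> p) \<odot> tsum (\<psi>' x3) (\<lambda>u v. u \<odot> SA (a2 \<odot> q \<odot> v)))))))"
    by (simp add: rho_counit_left lin tsum_scale A.al.scale_left A.al.scale_right clinear_scale[OF A.clinear_antipode]
       A.mul_unity_right tens_scale_left)
  also have "\<dots> = sw2 A a (\<lambda>a1 a2. sw2 H x (\<lambda>x1 x2.
      tsum (\<psi> x1) (\<lambda>p q. tsum (\<psi>' x2) (\<lambda>u v. i (a1 \<odot> ((p \<odot> u) \<odot> SA (a2 \<odot> (q \<odot> v))))))))"
    by (simp add: H.co.sw2_counit_left lin A.al.tsum_right[symmetric] clinear_tsum_map[where h = "\<lambda>a. i a"] A.mul_assoc)
  also have "\<dots> = i (sw2 A a (\<lambda>a1 a2. \<epsilon>H x *\<^sub>C (a1 \<odot> SA a2)))"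
    by (simp add: psi_psi'_map[where F = "\<lambda>p q. i (_ \<odot> (p \<odot> SA (_ \<odot> q)))"] lin A.mul_unity_right A.mul_unity_left
      sw2_map[where h = "\<lambda>a. i a"] tens_scale_left)
  finally show "conv B mulB E E' (a \<otimes> x) = counit B (a \<otimes> x) *\<^sub>C eB"
    by (simp add: sw2_scale A.antipode_right counitB_tens tens_scale_left mult.commute)
qed (simp_all add: lin bi.id.clinear_conv)

text \<open>The legs of a can be brought together to S(a1) a2 inside the expression; what is left
  after they collapse is \<open>psi'_antipode_psi\<close>.\<close>

lemma E'_E: "conv B mulB E' E t = counit B t *\<^sub>C eB"
proof (rule tensor_ext[where t = t])
  fix a x
  have "conv B mulB E' E (a \<otimes> x) = sw2 A a (\<lambda>a1 a2. sw2 H x (\<lambda>x1 r. sw2 H r (\<lambda>x2 x3. \<epsilon>H x3 *\<^sub>C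
      tsum (\<psi> x1) (\<lambda>p q. tsum (\<rho> x2) (\<lambda>h b. i (tsum (\<psi>' h) (\<lambda>u v. u \<odot> SA (a1 \<odot> p \<odot> v)) \<odot> (a2 \<odot> q \<odot> b)))))))"
    unfolding conv_def
    by (subst sw2_B_tens) (simp_all add: lin E_tens HB.scale_right i_mulB_tens tsum_scale)
  also have "\<dots> = sw2 A a (\<lambda>a1 a2. sw2 H x (\<lambda>x1 x2. tsum (\<psi> x1) (\<lambda>p q. tsum (\<rho> x2) (\<lambda>h b. tsum (\<psi>' h) (\<lambda>u v.
      i (u \<odot> (SA (p \<odot> v) \<odot> ((SA a1 \<odot> a2) \<odot> (q \<odot> b)))))))))"
    by (simp add: H.co.sw2_counit_right lin A.al.tsum_left[symmetric] clinear_tsum_map[where h = "\<lambda>a. i a"]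
       A.mul_assoc A.antipode_mul)
  also have "\<dots> = sw2 H x (\<lambda>x1 x2. tsum (\<psi> x1) (\<lambda>p q. tsum (\<rho> x2) (\<lambda>h b. tsum (\<psi>' h) (\<lambda>u v.
      i (u \<odot> (SA (p \<odot> v) \<odot> (sw2 A a (\<lambda>a1 a2. SA a1 \<odot> a2) \<odot> (q \<odot> b))))))))"
    unfolding sw2_def[of A] tsum_swap[where s = "comul A a"]
    by (simp add: sw2_def tsum_swap[where s = "comul A a"] clinear_tsum_map[where h = "\<lambda>z. i (_ \<odot> (_ \<odot> (z \<odot> _)))"] lin)
  also have "\<dots> = \<epsilon>A a *\<^sub>C i (\<epsilon>H x *\<^sub>C \<one>\<^bsub>A\<^esub>)"
    unfolding psi'_antipode_psi[symmetric]
    by (simp add: A.antipode_left A.al.scale_left A.al.scale_right A.mul_unity_left tens_scale_left tsum_scale sw2_scale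
      sw2_map[where h = "\<lambda>a. i a"] clinear_tsum_map[where h = "\<lambda>a. i a"] lin)
  finally show "conv B mulB E' E (a \<otimes> x) = counit B (a \<otimes> x) *\<^sub>C eB"
    by (simp add: counitB_tens tens_scale_left)
qed (simp_all add: lin bi.id.clinear_conv)

text \<open>Inverses of the two factors of the identity are multiplied in the opposite order, so the
  antipode is \<open>j'\<close> after \<open>pr\<close>, convolved with \<open>E'\<close>.\<close>

lemma hopf_algebra_B: "hopf_algebra B"
proof
  let ?c = "conv B mulB" and ?j = "\<lambda>t. j (pr t)" and ?j' = "\<lambda>t. j' (pr t)" and ?u = "\<lambda>t. counit B t *\<^sub>C eB"
  have lins: "clinear E" "clinear E'" "clinear ?j" "clinear ?j'" by (simp_all add: lin)
  have unit: "conv B mulB ?u f = f" "conv B mulB f ?u = f" if "clinear f" for f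
    using bi.id.conv_unit_left[OF that] bi.id.conv_unit_right[OF that] by (simp_all add: unityB)
  have jj: "?c ?j ?j' = ?u" "?c ?j' ?j = ?u"
    using conv_pr[of j j'] conv_pr[of j' j]
    by (simp_all add: fun_eq_iff lin conv_def[of H] j_j' j'_j counit_pr)
  have EE: "?c E E' = ?u" "?c E' E = ?u" and id: "(\<lambda>t. t) = ?c E ?j"
    by (simp_all add: fun_eq_iff E_E' E'_E E_j)
  have "?c (?c ?j' E') (\<lambda>t. t) = ?c (?c ?j' E') (?c E ?j)"
    by (rule arg_cong[OF id])
  also have "\<dots> = ?c ?j' (?c (?c E' E) ?j)"
    by (simp add: bi.id.conv_assoc bi.id.clinear_conv lins)
  finally have left: "?c (?c ?j' E') (\<lambda>t. t) = ?u"
    by (simp add: EE jj unit lins)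
  have "?c (\<lambda>t. t) (?c ?j' E') = ?c (?c E ?j) (?c ?j' E')"
    by (rule arg_cong[OF id, of "\<lambda>f. ?c f (?c ?j' E')"])
  also have "\<dots> = ?c E (?c (?c ?j ?j') E')"
    by (simp add: bi.id.conv_assoc bi.id.clinear_conv lins)
  finally have right: "?c (\<lambda>t. t) (?c ?j' E') = ?u"
    by (simp add: EE jj unit lins)
  define S where "S = ?c ?j' E'"
  have "sw2 B t (\<lambda>u v. S u \<diamondop> v) = ?u t" "sw2 B t (\<lambda>u v. u \<diamondop> S v) = ?u t" for t
    using fun_cong[OF left, of t] fun_cong[OF right, of t] unfolding S_def[symmetric] conv_def[of B] by auto
  moreover have "clinear S"
    unfolding S_def by (rule bi.id.clinear_conv[OF lins(4,2)])
  ultimately have "is_antipode B S"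
    by (simp add: is_antipode_def unityB)
  then show "\<exists>S. is_antipode B S"
    by (rule exI[of "is_antipode B"])
qed

end

section \<open>The involution of the bismash product\<close>

text \<open>Every tensor is a sum of simple tensors, with scalars absorbed in the first factor; so
  this also applies to conjugate linear maps such as the star of B.\<close>

lemma tensor_ext_additive:
  assumes "\<And>s t. f (s + t) = f s + f t" "\<And>s t. g (s + t) = g s + g t" "\<And>u v. f (u \<otimes> v) = g (u \<otimes> v)"
  shows "f t = (g t :: _ :: ab_group_add)"
proof (induction t rule: tensor_induct)
  case zero
  show ?case using assms(1)[of 0 0] assms(2)[of 0 0] by simp
qed (simp add: assms)

lemma conj_linear_compose:
  "conj_linear f \<Longrightarrow> conj_linear g \<Longrightarrow> clinear (\<lambda>x. f (g x))"
  "clinear f' \<Longrightarrow> conj_linear g' \<Longrightarrow> conj_linear (\<lambda>x. f' (g' x))"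
  "conj_linear f'' \<Longrightarrow> clinear g'' \<Longrightarrow> conj_linear (\<lambda>x. f'' (g'' x))"
  by (simp_all add: conj_linear_def clinear_iff)

lemma balanced_tmap: "conj_linear f \<Longrightarrow> conj_linear g \<Longrightarrow> balanced (\<lambda>u v. f u \<otimes> g v)"
  by (simp add: balanced_def conj_linear_def tens_add_left tens_add_right tens_scale_left tens_scale_right)

lemma conj_linear_tmap:
  assumes "conj_linear f" "conj_linear g"
  shows "conj_linear (tmap f g)"
  using assms unfolding tmap_def conj_linear_def
  by (simp add: tsum_add[OF balanced_tmap[OF assms]] tsum_scaleC[OF balanced_tmap[OF assms]] tsum_scale
    tens_scale_left)

lemma tmap_tens_conj: "conj_linear f \<Longrightarrow> conj_linear g \<Longrightarrow> tmap f g (u \<otimes> v) = f u \<otimes> g v"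
  unfolding tmap_def by (simp add: tsum_tens balanced_tmap)

lemma (in bialgebra) sw3_mul:
  assumes F: "ctrilinear F"
  shows "sw3 K (x \<cdot> y) F = sw3 K x (\<lambda>x1 x2 x3. sw3 K y (\<lambda>y1 y2 y3. F (x1 \<cdot> y1) (x2 \<cdot> y2) (x3 \<cdot> y3)))"
proof -
  note [lin] = F[unfolded ctrilinear_def, THEN conjunct1, rule_format]
    F[unfolded ctrilinear_def, THEN conjunct2, THEN conjunct1, rule_format]
    F[unfolded ctrilinear_def, THEN conjunct2, THEN conjunct2, rule_format]
  have swap: "sw2 K y (\<lambda>p s. sw2 K r (\<lambda>v k. sw2 K s (\<lambda>q t. F (u \<cdot> p) (v \<cdot> q) (k \<cdot> t)))) =
      sw2 K r (\<lambda>v k. sw2 K y (\<lambda>p s. sw2 K s (\<lambda>q t. F (u \<cdot> p) (v \<cdot> q) (k \<cdot> t))))" for u r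
    by (rule sw2_swap)
  show ?thesis
    unfolding sw3_def by (simp add: sw2_mul lin swap)
qed

context star_hopf_algebra
begin

lemma sw2_of_star: "cbilinear G \<Longrightarrow> sw2 K x (\<lambda>u v. G (star u) (star v)) = sw2 K (star x) G"
  by (simp add: sw2_star cbilinear_imp_balanced)

lemma sw3_of_star:
  assumes G: "ctrilinear G"
  shows "sw3 K x (\<lambda>u v w. G (star u) (star v) (star w)) = sw3 K (star x) G"
proof -
  note [lin] = G[unfolded ctrilinear_def, THEN conjunct1, rule_format]
    G[unfolded ctrilinear_def, THEN conjunct2, THEN conjunct1, rule_format]
    G[unfolded ctrilinear_def, THEN conjunct2, THEN conjunct2, rule_format]
  show ?thesis
    unfolding sw3_def
    by (simp add: sw2_of_star[where G = "G _"] sw2_of_star[where G = "\<lambda>u r. sw2 K r (G u)"] lin)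
qed

end

locale star_linked_pair =
  invertible_linked_pair A H act \<rho> \<chi> \<psi> \<chi>' \<psi>' +
  A: star_hopf_algebra A starA + H: star_hopf_algebra H starH
  for A :: "'a::complex_vector bialg" and H :: "'h::complex_vector bialg"
    and act (infixr \<open>\<triangleright>\<close> 72) and \<rho> \<chi> \<psi> \<chi>' \<psi>' and starA starH +
  fixes \<gamma> :: "'h \<Rightarrow> 'a"
  assumes gamma: "\<gamma> x = sw2 H x (\<lambda>x1 x2. \<chi>' x2 (inv (antipode H) x1))"
    and cond_i: "
      sw3 H x (\<lambda>x1 x2 x3. \<gamma> (starH x2) \<cdot>\<^bsub>A\<^esub> (starH x3 \<triangleright> starA (\<gamma> x1))) =
      \<epsilon>\<^bsub>H\<^esub> (starH x) *\<^sub>C \<one>\<^bsub>A\<^esub>"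
    and cond_ii: "
      sw3 H x (\<lambda>x1 x2 x3. \<gamma> (starH x2) \<cdot>\<^bsub>A\<^esub> (starH x3 \<triangleright> starA (x1 \<triangleright> a))) =
      starA a \<cdot>\<^bsub>A\<^esub> \<gamma> (starH x)"
    and cond_iii: "
      sw2 H x (\<lambda>x1 x2. sw3 H y (\<lambda>y1 y2 y3.
        \<gamma> (starH y1) \<cdot>\<^bsub>A\<^esub> (starH y2 \<triangleright> \<gamma> (starH x1)) \<cdot>\<^bsub>A\<^esub> \<chi> (starH y3) (starH x2))) =
      sw3 H x (\<lambda>x1 x2 x3. sw3 H y (\<lambda>y1 y2 y3.
        \<gamma> (starH y2 \<cdot>\<^bsub>H\<^esub> starH x2) \<cdot>\<^bsub>A\<^esub>
        ((starH y3 \<cdot>\<^bsub>H\<^esub> starH x3) \<triangleright> starA (\<chi> x1 y1))))"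
    and cond_iv: "
      sw2 H x (\<lambda>x1 x2. tsum (\<rho> (starH x2)) (\<lambda>qH qA. qH \<otimes> (\<gamma> (starH x1) \<cdot>\<^bsub>A\<^esub> qA))) =
      sw3 H x (\<lambda>x1 x2 x3. tsum (\<rho> x1) (\<lambda>x1H x1A.
        starH x1H \<otimes> (\<gamma> (starH x2) \<cdot>\<^bsub>A\<^esub> (starH x3 \<triangleright> starA x1A))))"
    and cond_v: "
      sw2 H x (\<lambda>x1 x2. sw2 A (\<gamma> (starH x1)) (\<lambda>g1 g2. tsum (\<psi> (starH x2)) (\<lambda>qI qII.
        (g1 \<cdot>\<^bsub>A\<^esub> qI) \<otimes> (g2 \<cdot>\<^bsub>A\<^esub> qII)))) =
      sw5 H x (\<lambda>x1 x2 x3 x4 x5. tsum (\<psi> x1) (\<lambda>x1I x1II. tsum (\<rho> x2) (\<lambda>x2H x2A.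
        tsum (\<rho> x3) (\<lambda>x3H x3A.
          (\<gamma> (starH x2H) \<cdot>\<^bsub>A\<^esub> (starH x3H \<triangleright> starA x1I)) \<otimes>
          (\<gamma> (starH x4) \<cdot>\<^bsub>A\<^esub> (starH x5 \<triangleright> starA (x1II \<cdot>\<^bsub>A\<^esub> x2A \<cdot>\<^bsub>A\<^esub> x3A)))))))"
begin

lemma clinear_gamma: "clinear \<gamma>"
  unfolding gamma[abs_def] by (simp add: lin clinear_compose[OF H.clinear_inv_antipode])

lemmas lin_gamma [lin] = clinear_compose[OF clinear_gamma]

lemma gamma_antipode: "\<gamma> (SH x) = g' x"
  by (simp add: gamma g'_def H.sw2_antipode lin clinear_compose[OF H.clinear_inv_antipode]
    inv_f_f[OF bij_is_inj[OF H.bij_antipode]])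

lemma gamma_unity: "\<gamma> \<one>\<^bsub>H\<^esub> = \<one>\<^bsub>A\<^esub>"
  using gamma_antipode[of "\<one>\<^bsub>H\<^esub>"]
  by (simp add: H.antipode_unity g'_def H.sw2_unity lin chi'_unity_left H.counit_unity)

text \<open>The structure maps conjugated by the stars; with them the conditions (i) to (v) at $x = w^*$ become
  identities between maps that are linear in $w$.\<close>

definition "acts w b = starA (starH w \<triangleright> starA b)"
definition "chis w z = starA (\<chi> (starH w) (starH z))"
definition "gammas w = starA (\<gamma> (starH w))"
definition "rhos w = tmap starH starA (\<rho> (starH w))"
definition "psis w = tmap starA starA (\<psi> (starH w))"

lemma clinear_starred: "clinear (\<lambda>w. acts w b)" "clinear (\<lambda>b. acts w b)" "clinear (\<lambda>w. chis w z)"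
  "clinear (\<lambda>z. chis w z)" "clinear gammas" "clinear rhos" "clinear psis"
proof -
  note sA = A.conj_linear_star and sH = H.conj_linear_star
  show "clinear (\<lambda>w. acts w b)" "clinear (\<lambda>b. acts w b)" "clinear (\<lambda>w. chis w z)" "clinear (\<lambda>z. chis w z)"
    unfolding acts_def chis_def
    by (rule conj_linear_compose(1)[OF sA conj_linear_compose(2)[OF _ sH]]
        conj_linear_compose(1)[OF sA conj_linear_compose(2)[OF _ sA]]; simp add: lin)+
  show "clinear gammas" unfolding gammas_def[abs_def]
    by (rule conj_linear_compose(1)[OF sA conj_linear_compose(2)[OF clinear_gamma sH]])
  show "clinear rhos" "clinear psis"
    unfolding rhos_def[abs_def] psis_def[abs_def]
    by (rule conj_linear_compose(1)[OF conj_linear_tmap[OF sH sA] conj_linear_compose(2)[OF clinear_rho sH]]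
      conj_linear_compose(1)[OF conj_linear_tmap[OF sA sA] conj_linear_compose(2)[OF clinear_psi sH]])+
qed

lemmas lin_starred [lin] = clinear_starred[THEN clinear_compose]

lemma tsum_rhos: "cbilinear F \<Longrightarrow> tsum (rhos w) F = tsum (\<rho> (starH w)) (\<lambda>h a. F (starH h) (starA a))"
  and tsum_psis: "cbilinear G \<Longrightarrow> tsum (psis w) G = tsum (\<psi> (starH w)) (\<lambda>u v. G (starA u) (starA v))"
  unfolding rhos_def psis_def tmap_def by (simp_all add: tsum_bil)

lemma cond_i': "sw3 H w (\<lambda>w1 w2 w3. \<gamma> w2 \<odot> (w3 \<triangleright> gammas w1)) = \<epsilon>H w *\<^sub>C \<one>\<^bsub>A\<^esub>"
proof -
  have t: "ctrilinear (\<lambda>w1 w2 w3. \<gamma> w2 \<odot> (w3 \<triangleright> gammas w1))" by (simp add: lin)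
  show ?thesis
    using cond_i[of "starH w"] H.sw3_of_star[OF t, of "starH w"] by (simp add: H.star_star gammas_def)
qed

lemma cond_ii': "sw3 H w (\<lambda>w1 w2 w3. \<gamma> w2 \<odot> (w3 \<triangleright> acts w1 b)) = b \<odot> \<gamma> w"
proof -
  have t: "ctrilinear (\<lambda>w1 w2 w3. \<gamma> w2 \<odot> (w3 \<triangleright> acts w1 b))" by (simp add: lin)
  show ?thesis
    using cond_ii[of "starH w" "starA b"] H.sw3_of_star[OF t, of "starH w"]
    by (simp add: H.star_star A.star_star acts_def)
qed

lemma cond_iii': "sw2 H w (\<lambda>w1 w2. sw3 H z (\<lambda>z1 z2 z3. \<gamma> z1 \<odot> (z2 \<triangleright> \<gamma> w1) \<odot> \<chi> z3 w2)) =
   sw3 H w (\<lambda>w1 w2 w3. sw3 H z (\<lambda>z1 z2 z3. \<gamma> (z2 \<bullet> w2) \<odot> ((z3 \<bullet> w3) \<triangleright> chis w1 z1)))"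
proof -
  have l: "ctrilinear (\<lambda>z1 z2 z3. \<gamma> z1 \<odot> (z2 \<triangleright> \<gamma> w1) \<odot> \<chi> z3 w2)" for w1 w2
    by (simp add: lin)
  have r: "ctrilinear (\<lambda>z1 z2 z3. \<gamma> (z2 \<bullet> w2) \<odot> ((z3 \<bullet> w3) \<triangleright> chis w1 z1))" for w1 w2 w3
    by (simp add: lin)
  have L: "cbilinear (\<lambda>w1 w2. sw3 H z (\<lambda>z1 z2 z3. \<gamma> z1 \<odot> (z2 \<triangleright> \<gamma> w1) \<odot> \<chi> z3 w2))"
    and R: "ctrilinear (\<lambda>w1 w2 w3. sw3 H z (\<lambda>z1 z2 z3. \<gamma> (z2 \<bullet> w2) \<odot> ((z3 \<bullet> w3) \<triangleright> chis w1 z1)))"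
    unfolding sw3_def by (simp_all add: lin)
  have "sw2 H w (\<lambda>w1 w2. sw3 H z (\<lambda>z1 z2 z3. \<gamma> z1 \<odot> (z2 \<triangleright> \<gamma> w1) \<odot> \<chi> z3 w2)) =
     sw2 H (starH w) (\<lambda>x1 x2. sw3 H (starH z) (\<lambda>y1 y2 y3.
        \<gamma> (starH y1) \<odot> (starH y2 \<triangleright> \<gamma> (starH x1)) \<odot> \<chi> (starH y3) (starH x2)))"
    by (simp add: H.sw3_of_star[OF l] H.sw2_of_star[OF L] H.star_star)
  also have "\<dots> = sw3 H (starH w) (\<lambda>x1 x2 x3. sw3 H (starH z) (\<lambda>y1 y2 y3.
        \<gamma> (starH y2 \<bullet> starH x2) \<odot> ((starH y3 \<bullet> starH x3) \<triangleright> chis (starH x1) (starH y1))))"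
    unfolding cond_iii by (simp add: chis_def H.star_star)
  also have "\<dots> = sw3 H w (\<lambda>w1 w2 w3. sw3 H z (\<lambda>z1 z2 z3. \<gamma> (z2 \<bullet> w2) \<odot> ((z3 \<bullet> w3) \<triangleright> chis w1 z1)))"
    by (simp add: H.sw3_of_star[OF r] H.sw3_of_star[OF R] H.star_star)
  finally show ?thesis .
qed

lemma cond_iv': "sw2 H w (\<lambda>w1 w2. tsum (\<rho> w2) (\<lambda>h a. h \<otimes> (\<gamma> w1 \<odot> a))) =
   sw3 H w (\<lambda>w1 w2 w3. tsum (rhos w1) (\<lambda>h a. h \<otimes> (\<gamma> w2 \<odot> (w3 \<triangleright> a))))"
proof -
  have "sw2 H w (\<lambda>w1 w2. tsum (\<rho> w2) (\<lambda>h a. h \<otimes> (\<gamma> w1 \<odot> a))) =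
      sw2 H (starH w) (\<lambda>x1 x2. tsum (\<rho> (starH x2)) (\<lambda>h a. h \<otimes> (\<gamma> (starH x1) \<odot> a)))"
    by (subst H.sw2_of_star) (simp_all add: lin H.star_star)
  also have "\<dots> = sw3 H (starH w) (\<lambda>x1 x2 x3. tsum (rhos (starH x1)) (\<lambda>h a. h \<otimes> (\<gamma> (starH x2) \<odot> (starH x3 \<triangleright> a))))"
    unfolding cond_iv by (simp add: tsum_rhos lin H.star_star)
  also have "\<dots> = sw3 H w (\<lambda>w1 w2 w3. tsum (rhos w1) (\<lambda>h a. h \<otimes> (\<gamma> w2 \<odot> (w3 \<triangleright> a))))"
    by (subst H.sw3_of_star) (simp_all add: lin H.star_star)
  finally show ?thesis .
qed

lemma cond_v': "sw2 H w (\<lambda>w1 w2. sw2 A (\<gamma> w1) (\<lambda>g1 g2. tsum (\<psi> w2) (\<lambda>p q. (g1 \<odot> p) \<otimes> (g2 \<odot> q)))) =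
   sw2 H w (\<lambda>w1 r. sw2 H r (\<lambda>w2 r. sw2 H r (\<lambda>w3 r. sw2 H r (\<lambda>w4 w5.
     tsum (psis w1) (\<lambda>u v. tsum (rhos w2) (\<lambda>h a. tsum (rhos w3) (\<lambda>h' a'.
       (\<gamma> h \<odot> (h' \<triangleright> u)) \<otimes> (\<gamma> w4 \<odot> (w5 \<triangleright> (a' \<odot> (a \<odot> v)))))))))))"
proof -
  let ?F = "\<lambda>w1 w2 w3 w4 w5. tsum (psis w1) (\<lambda>u v. tsum (rhos w2) (\<lambda>h a. tsum (rhos w3) (\<lambda>h' a'.
       (\<gamma> h \<odot> (h' \<triangleright> u)) \<otimes> (\<gamma> w4 \<odot> (w5 \<triangleright> (a' \<odot> (a \<odot> v)))))))"
  have "sw2 H w (\<lambda>w1 w2. sw2 A (\<gamma> w1) (\<lambda>g1 g2. tsum (\<psi> w2) (\<lambda>p q. (g1 \<odot> p) \<otimes> (g2 \<odot> q)))) =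
    sw2 H (starH w) (\<lambda>x1 x2. sw2 A (\<gamma> (starH x1)) (\<lambda>g1 g2. tsum (\<psi> (starH x2)) (\<lambda>p q. (g1 \<odot> p) \<otimes> (g2 \<odot> q))))"
    by (subst H.sw2_of_star) (simp_all add: lin H.star_star)
  also have "\<dots> = sw5 H (starH w) (\<lambda>x1 x2 x3 x4 x5. ?F (starH x1) (starH x2) (starH x3) (starH x4) (starH x5))"
    unfolding cond_v by (simp add: tsum_rhos tsum_psis lin H.star_star A.star_mul A.mul_assoc)
  also have "\<dots> = sw2 H w (\<lambda>w1 r. sw2 H r (\<lambda>w2 r. sw2 H r (\<lambda>w3 r. sw2 H r (\<lambda>w4 w5. ?F w1 w2 w3 w4 w5))))"
    unfolding sw5_def sw4_def sw3_def
    by (simp add: H.sw2_of_star[where G = "?F _ _ _"] H.sw2_of_star[where G = "\<lambda>w3 r. sw2 H r (\<lambda>w4 w5. ?F _ _ w3 w4 w5)"]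
      H.sw2_of_star[where G = "\<lambda>w2 r. sw2 H r (\<lambda>w3 r. sw2 H r (\<lambda>w4 w5. ?F _ w2 w3 w4 w5))"]
      H.sw2_of_star[where G = "\<lambda>w1 r. sw2 H r (\<lambda>w2 r. sw2 H r (\<lambda>w3 r. sw2 H r (\<lambda>w4 w5. ?F w1 w2 w3 w4 w5)))"]
      lin H.star_star)
  finally show ?thesis .
qed

text \<open>Starred counterpart of \<open>comul_rho_map\<close>, with a' and a in reverse order
  because \<open>starA\<close> is antimultiplicative. The map F' is conjugate linear in each
  argument, so the axiom is evaluated with balanced in place of bilinear maps.\<close>

lemma comul_rhos_map:
  assumes F: "\<And>v w. clinear (\<lambda>u. F u v w)" "\<And>u w. clinear (\<lambda>v. F u v w)" "\<And>u v. clinear (\<lambda>w. F u v w)"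
  shows "tsum (rhos x) (\<lambda>h a. sw2 H h (\<lambda>h1 h2. F h1 h2 a)) =
    sw2 H x (\<lambda>x1 x2. tsum (rhos x1) (\<lambda>h a. tsum (rhos x2) (\<lambda>h' a'. F h h' (a' \<odot> a))))"
proof -
  note [lin] = F F[THEN clinear_compose]
  have F_add: "F (u + u') v w = F u v w + F u' v w" "F u (v + v') w = F u v w + F u v' w"
    "F u v (w + w') = F u v w + F u v w'" for u u' v v' w w'
    using clinear_add[OF F(1)] clinear_add[OF F(2)] clinear_add[OF F(3)] by simp_all
  have F_scale: "F (c *\<^sub>C u) v w = c *\<^sub>C F u v w" "F u (c *\<^sub>C v) w = c *\<^sub>C F u v w"
    "F u v (c *\<^sub>C w) = c *\<^sub>C F u v w" for c u v w
    using clinear_scale[OF F(1)] clinear_scale[OF F(2)] clinear_scale[OF F(3)] by simp_all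
  define F' where "F' u v w = F (starH u) (starH v) (starA w)" for u v w
  have bal2: "balanced (F' u)" for u
    by (simp add: balanced_def F'_def F_add F_scale H.star_add A.star_add H.star_scale A.star_scale)
  \<comment> \<open>Balancedness is all that \<open>tsum\<close> needs: a scalar on u is moved into
    the first factor of the inner tensor s, where it has the same conjugate linear effect.\<close>
  have bal3: "balanced (\<lambda>u s. tsum s (F' u))"
    unfolding balanced_def
  proof (intro conjI allI)
    have "F' (u + u') = (\<lambda>v w. F' u v w + F' u' v w)" for u u'
      by (simp add: fun_eq_iff F'_def F_add H.star_add)
    then show "tsum s (F' (u + u')) = tsum s (F' u) + tsum s (F' u')" for u u' s
      by (simp only: tsum_plus)
    show "tsum (s + s') (F' u) = tsum s (F' u) + tsum s' (F' u)" for u s s'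
      by (rule tsum_add[OF bal2])
    have "F' (c *\<^sub>C u) = (\<lambda>v w. F' u (c *\<^sub>C v) w)" for c u
      by (simp add: fun_eq_iff F'_def F_scale H.star_scale)
    then show "tsum s (F' (c *\<^sub>C u)) = tsum (c *\<^sub>C s) (F' u)" for c u s
      by (simp only: tsum_scaleC[OF bal2])
  qed
  define G where "G t = tsum t (\<lambda>u s. tsum s (F' u))" for t
  have G: "G (s + t) = G s + G t" "G (u \<otimes> v \<otimes> w) = F' u v w" for s t u v w
    unfolding G_def by (simp_all add: tsum_add[OF bal3] tsum_tens[OF bal3] tsum_tens[OF bal2])
  have "tsum (rhos x) (\<lambda>h a. sw2 H h (\<lambda>h1 h2. F h1 h2 a)) =
      tsum (\<rho> (starH x)) (\<lambda>h a. sw2 H h (\<lambda>h1 h2. F' h1 h2 a))"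
    by (simp add: tsum_rhos lin H.sw2_of_star[symmetric] F'_def)
  also have "\<dots> = G (tsum (\<rho> (starH x)) (\<lambda>xH xA. sw2 H xH (\<lambda>xH1 xH2. xH1 \<otimes> xH2 \<otimes> xA)))"
    by (simp add: additive_tsum[where h = G, OF G(1)] additive_sw2[where h = G, OF G(1)] G(2))
  also have "\<dots> = sw2 H (starH x) (\<lambda>x1 x2. tsum (rhos (starH x1)) (\<lambda>h a. tsum (rhos (starH x2)) (\<lambda>h' a'. F h h' (a' \<odot> a))))"
    unfolding comul_rho
    by (simp add: additive_tsum[where h = G, OF G(1)] additive_sw2[where h = G, OF G(1)] G(2) F'_def tsum_rhos lin
      A.star_mul H.star_star)
  also have "\<dots> = sw2 H x (\<lambda>x1 x2. tsum (rhos x1) (\<lambda>h a. tsum (rhos x2) (\<lambda>h' a'. F h h' (a' \<odot> a))))"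
    by (subst H.sw2_of_star) (simp_all add: lin H.star_star)
  finally show ?thesis .
qed

text \<open>In these terms $(1 \# x)^*$ is \<open>jh (starH x)\<close>.\<close>

definition "jh w = sw2 H w (\<lambda>w1 w2. i (\<gamma> w1) \<diamondop> j w2)"

lemma lin_jh [lin]: "clinear f \<Longrightarrow> clinear (\<lambda>x. jh (f x))"
  unfolding jh_def by (simp add: lin)

section \<open>The star of B is an antimultiplicative involution\<close>

abbreviation "starB \<equiv> bismash_star A starA H starH (\<triangleright>) \<gamma>"

lemma jh_i: "jh w \<diamondop> i b = sw2 H w (\<lambda>w1 r. sw2 H r (\<lambda>w2 w3. (\<gamma> w1 \<odot> (w2 \<triangleright> b)) \<otimes> w3))"
  by (simp add: jh_def HB.sw2_left[symmetric] HB.assoc j_i)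
    (simp add: HB.sw2_right[symmetric] i_mulB_tens A.mul_unity_right)

lemma starB_eq: "starB t = tsum t (\<lambda>a x. jh (starH x) \<diamondop> i (starA a))"
proof -
  have "sw3 H x (\<lambda>x1 x2 x3. (\<gamma> (starH x1) \<odot> (starH x2 \<triangleright> c)) \<otimes> starH x3) = jh (starH x) \<diamondop> i c" for x c
    by (subst H.sw3_of_star) (simp_all add: lin jh_i sw3_def)
  then show ?thesis
    by (simp add: bismash_star_def)
qed

lemma balanced_starB: "balanced (\<lambda>a x. jh (starH x) \<diamondop> i (starA a))"
  by (simp add: balanced_def A.star_add H.star_add A.star_scale H.star_scale tens_add_left tens_scale_left
    clinear_add[where f = jh] clinear_scale[where f = jh] lin HB.scale_left HB.scale_right
    clinear_add[where f = "\<lambda>t. t \<diamondop> _"] clinear_add[where f = "\<lambda>t. _ \<diamondop> t"])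

lemma starB_tens: "starB (a \<otimes> x) = jh (starH x) \<diamondop> i (starA a)"
  unfolding starB_eq by (rule tsum_tens[OF balanced_starB])

lemma starB_add: "starB (s + t) = starB s + starB t"
  unfolding starB_eq by (rule tsum_add[OF balanced_starB])

lemma conj_linear_starB: "conj_linear starB"
  unfolding conj_linear_def
proof (intro conjI allI)
  show "starB (c *\<^sub>C t) = cnj c *\<^sub>C starB t" for c t
    unfolding starB_eq tsum_scaleC[OF balanced_starB]
    by (simp add: A.star_scale tens_scale_left HB.scale_right tsum_scale)
qed (rule starB_add)

lemmas starB_sw2 = additive_sw2[where h = starB, OF starB_add]
  and starB_tsum = additive_tsum[where h = starB, OF starB_add]

lemma jh_unity: "jh \<one>\<^bsub>H\<^esub> = eB"
  by (simp add: jh_def H.sw2_unity lin gamma_unity HB.unit_left)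

lemma starB_i: "starB (i a) = i (starA a)"
  by (simp add: starB_tens H.star_unity jh_unity HB.unit_left)

lemma starB_j: "starB (j x) = jh (starH x)"
  by (simp add: starB_tens A.star_unity HB.unit_right)

text \<open>Condition (ii), read as the adjoint of the commutation rule \<open>j_i\<close>.\<close>

lemma jh_acts: "sw2 H w (\<lambda>w1 w2. jh w2 \<diamondop> i (acts w1 b)) = i b \<diamondop> jh w"
proof -
  have "sw2 H w (\<lambda>w1 w2. jh w2 \<diamondop> i (acts w1 b)) =
      sw2 H w (\<lambda>y s. sw3 H y (\<lambda>w1 w2 w3. \<gamma> w2 \<odot> (w3 \<triangleright> acts w1 b)) \<otimes> s)"
    by (simp add: jh_i sw3_def sw2_map[where h = "\<lambda>z. z \<otimes> _"] lin H.co.sw2_assoc)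
  also have "\<dots> = i b \<diamondop> jh w"
    by (simp add: cond_ii' jh_def HB.sw2_right[symmetric] i_mulB_tens A.mul_assoc A.mul_unity_right)
  finally show ?thesis .
qed

text \<open>Condition (i), in the form which shows that the star takes \<open>jh\<close> back to
  \<open>j\<close>.\<close>

lemma jh_gammas: "sw2 H w (\<lambda>w1 w2. jh w2 \<diamondop> i (gammas w1)) = j w"
proof -
  have "sw2 H w (\<lambda>w1 w2. jh w2 \<diamondop> i (gammas w1)) =
      sw2 H w (\<lambda>y s. sw3 H y (\<lambda>w1 w2 w3. \<gamma> w2 \<odot> (w3 \<triangleright> gammas w1)) \<otimes> s)"
    by (simp add: jh_i sw3_def sw2_map[where h = "\<lambda>z. z \<otimes> _"] lin H.co.sw2_assoc)
  also have "\<dots> = j w"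
    by (simp add: cond_i' tens_scale_left H.co.sw2_counit_left lin)
  finally show ?thesis .
qed

text \<open>Condition (iii), read as the adjoint of the rule \<open>j_j\<close>. The last legs of w
  and z stay apart while (iii) acts on all the others.\<close>

lemma jh_jh: "jh z \<diamondop> jh w = sw2 H w (\<lambda>w1 w2. sw2 H z (\<lambda>z1 z2. jh (z2 \<bullet> w2) \<diamondop> i (chis w1 z1)))"
proof -
  let ?L = "\<lambda>w1 w2 z1 z2 z3. \<gamma> z1 \<odot> (z2 \<triangleright> \<gamma> w1) \<odot> \<chi> z3 w2"
    and ?R = "\<lambda>w1 w2 w3 z1 z2 z3. \<gamma> (z2 \<bullet> w2) \<odot> ((z3 \<bullet> w3) \<triangleright> chis w1 z1)"
  have step: "i (\<gamma> z1) \<diamondop> ((j r \<diamondop> i (\<gamma> w1)) \<diamondop> j s) = sw2 H s (\<lambda>w2 w3. sw3 H r (\<lambda>z2 z3 z4. ?L w1 w2 z1 z2 z3 \<otimes> (z4 \<bullet> w3)))" for z1 w1 r s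
  proof -
    have "i (\<gamma> z1) \<diamondop> ((j r \<diamondop> i (\<gamma> w1)) \<diamondop> j s) = sw2 H r (\<lambda>z2 r. i (\<gamma> z1) \<diamondop> (i (z2 \<triangleright> \<gamma> w1) \<diamondop> (j r \<diamondop> j s)))"
      by (simp only: j_i HB.sw2_left[symmetric] HB.sw2_right[symmetric] HB.assoc)
    also have "\<dots> = sw3 H r (\<lambda>z2 z3 z4. sw2 H s (\<lambda>w2 w3. ?L w1 w2 z1 z2 z3 \<otimes> (z4 \<bullet> w3)))"
      by (simp add: j_j HB.sw2_right[symmetric] i_mulB_tens A.mul_assoc A.mul_unity_right sw3_def)
    finally show ?thesis
      by (simp only: sw3_swap)
  qed
  have "jh z \<diamondop> jh w = sw2 H z (\<lambda>z1 r. sw2 H w (\<lambda>w1 s. i (\<gamma> z1) \<diamondop> ((j r \<diamondop> i (\<gamma> w1)) \<diamondop> j s)))"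
    unfolding jh_def HB.sw2_left[symmetric] by (simp add: HB.sw2_right[symmetric] HB.assoc)
  also have "\<dots> = sw2 H z (\<lambda>z1 r. sw3 H w (\<lambda>w1 w2 w3. sw3 H r (\<lambda>z2 z3 z4. ?L w1 w2 z1 z2 z3 \<otimes> (z4 \<bullet> w3))))"
    by (simp only: step sw3_def[of H w])
  also have "\<dots> = sw3 H w (\<lambda>w1 w2 w3. sw2 H z (\<lambda>z1 r. sw3 H r (\<lambda>z2 z3 z4. ?L w1 w2 z1 z2 z3 \<otimes> (z4 \<bullet> w3))))"
    by (rule sw3_swap)
  \<comment> \<open>y now collects the two legs of w, and u the three legs of z, on which the left
    side of (iii) depends.\<close>
  also have "\<dots> = sw2 H w (\<lambda>y w3. sw2 H y (\<lambda>w1 w2. sw2 H z (\<lambda>u z4. sw3 H u (\<lambda>z1 z2 z3. ?L w1 w2 z1 z2 z3 \<otimes> (z4 \<bullet> w3)))))"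
    by (simp add: sw3_def H.co.sw2_assoc lin)
  also have "\<dots> = sw2 H z (\<lambda>u z4. sw2 H w (\<lambda>y w3. sw2 H y (\<lambda>w1 w2. sw3 H u (\<lambda>z1 z2 z3. ?L w1 w2 z1 z2 z3)) \<otimes> (z4 \<bullet> w3)))"
    by (simp add: sw2_swap[where D = H and y = z] sw2_map[where h = "\<lambda>a. a \<otimes> _"] sw3_def lin)
  also have "\<dots> = sw2 H z (\<lambda>u z4. sw2 H w (\<lambda>y w3. sw3 H y (\<lambda>w1 w2 w3. sw3 H u (\<lambda>z1 z2 z3. ?R w1 w2 w3 z1 z2 z3)) \<otimes> (z4 \<bullet> w3)))"
    by (simp only: cond_iii')
  also have "\<dots> = sw2 H w (\<lambda>y w4. sw3 H y (\<lambda>w1 w2 w3. sw2 H z (\<lambda>u z4. sw3 H u (\<lambda>z1 z2 z3. ?R w1 w2 w3 z1 z2 z3 \<otimes> (z4 \<bullet> w4)))))"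
    by (simp add: sw2_swap[where C = H and x = z] sw2_map[where h = "\<lambda>a. a \<otimes> _"] sw3_def lin)
  also have "\<dots> = sw2 H w (\<lambda>w1 w2. sw3 H w2 (\<lambda>w2 w3 w4. sw2 H z (\<lambda>z1 z2. sw3 H z2 (\<lambda>z2 z3 z4.
      ?R w1 w2 w3 z1 z2 z3 \<otimes> (z4 \<bullet> w4)))))"
    by (simp add: sw3_def H.co.sw2_assoc lin)
  also have "\<dots> = sw2 H w (\<lambda>w1 w2. sw2 H z (\<lambda>z1 z2. sw3 H z2 (\<lambda>z2 z3 z4. sw3 H w2 (\<lambda>w2 w3 w4.
      ?R w1 w2 w3 z1 z2 z3 \<otimes> (z4 \<bullet> w4)))))"
    unfolding sw3_swap[symmetric] by (subst sw3_sw3_swap) rule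
  also have "\<dots> = sw2 H w (\<lambda>w1 w2. sw2 H z (\<lambda>z1 z2. jh (z2 \<bullet> w2) \<diamondop> i (chis w1 z1)))"
    by (simp add: jh_i H.sw3_mul[unfolded sw3_def] sw3_def lin)
  finally show ?thesis .
qed

lemma starB_mul: "starB (s \<diamondop> t) = starB t \<diamondop> starB s"
proof (rule tensor_ext_additive[where t = s])
  note add = starB_add clinear_add[where f = "\<lambda>t. t \<diamondop> _"] clinear_add[where f = "\<lambda>t. _ \<diamondop> t"]
  fix a x
  show "starB ((a \<otimes> x) \<diamondop> t) = starB t \<diamondop> starB (a \<otimes> x)"
  proof (rule tensor_ext_additive[where t = t])
    fix b y
    let ?G = "\<lambda>w1 w2 w3 z1 z2. jh (z2 \<bullet> w3) \<diamondop> (i (chis w2 z1) \<diamondop> (i (acts w1 (starA b)) \<diamondop> i (starA a)))"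
    have "(a \<otimes> x) \<diamondop> (b \<otimes> y) = sw2 H x (\<lambda>x1 r. sw2 H r (\<lambda>x2 x3. sw2 H y (\<lambda>y1 y2.
        (a \<odot> ((x1 \<triangleright> b) \<odot> \<chi> x2 y1)) \<otimes> (x3 \<bullet> y2))))"
      by (simp add: tens_mulB J_tens K_def AH.sw2_right[symmetric] AH_tens H.mul_unity_left)
    then have "starB ((a \<otimes> x) \<diamondop> (b \<otimes> y)) = sw2 H x (\<lambda>x1 r. sw2 H r (\<lambda>x2 x3. sw2 H y (\<lambda>y1 y2.
        ?G (starH x1) (starH x2) (starH x3) (starH y1) (starH y2))))"
      by (simp add: starB_sw2 starB_tens A.star_mul H.star_mul chis_def acts_def H.star_star A.star_star
        i_mulB_tens A.mul_assoc)
    also have "\<dots> = sw2 H (starH x) (\<lambda>w1 r. sw2 H r (\<lambda>w2 w3. sw2 H (starH y) (\<lambda>z1 z2. ?G w1 w2 w3 z1 z2)))"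
      by (simp add: H.sw2_of_star[where G = "?G _ _ _"]
        H.sw2_of_star[where G = "\<lambda>w2 w3. sw2 H (starH y) (\<lambda>z1 z2. ?G _ w2 w3 z1 z2)"]
        H.sw2_of_star[where G = "\<lambda>w1 r. sw2 H r (\<lambda>w2 w3. sw2 H (starH y) (\<lambda>z1 z2. ?G w1 w2 w3 z1 z2))"] lin)
    also have "\<dots> = sw2 H (starH x) (\<lambda>w1 w2. (jh (starH y) \<diamondop> jh w2) \<diamondop> (i (acts w1 (starA b)) \<diamondop> i (starA a)))"
      by (simp only: jh_jh) (simp add: HB.sw2_left[symmetric] HB.assoc)
    also have "\<dots> = jh (starH y) \<diamondop> (sw2 H (starH x) (\<lambda>w1 w2. jh w2 \<diamondop> i (acts w1 (starA b))) \<diamondop> i (starA a))"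
      by (simp add: HB.sw2_left[symmetric] HB.sw2_right[symmetric] HB.assoc)
    also have "\<dots> = starB (b \<otimes> y) \<diamondop> starB (a \<otimes> x)"
      by (simp add: jh_acts starB_tens HB.assoc)
    finally show "starB ((a \<otimes> x) \<diamondop> (b \<otimes> y)) = starB (b \<otimes> y) \<diamondop> starB (a \<otimes> x)" .
  qed (simp_all add: add lin)
qed (simp_all add: starB_add clinear_add[where f = "\<lambda>t. t \<diamondop> _"] clinear_add[where f = "\<lambda>t. _ \<diamondop> t"] lin)

lemma starB_jh: "starB (jh w) = j (starH w)"
proof -
  have "starB (jh w) = sw2 H w (\<lambda>w1 w2. jh (starH w2) \<diamondop> i (gammas (starH w1)))"
    by (simp add: jh_def starB_sw2 starB_mul starB_i starB_j gammas_def H.star_star)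
  also have "\<dots> = j (starH w)"
    by (simp add: H.sw2_of_star[where G = "\<lambda>w1 w2. jh w2 \<diamondop> i (gammas w1)"] lin jh_gammas)
  finally show ?thesis .
qed

lemma starB_starB: "starB (starB t) = t"
proof (rule tensor_ext_additive[where t = t and g = "\<lambda>t. t"])
  fix a x
  have "starB (starB (a \<otimes> x)) = starB (i (starA a)) \<diamondop> starB (jh (starH x))"
    by (simp only: starB_tens[of a x] starB_mul)
  then show "starB (starB (a \<otimes> x)) = a \<otimes> x"
    by (simp only: starB_i starB_jh A.star_star H.star_star i_mulB_tens A.mul_unity_right)
qed (simp_all add: starB_add)

section \<open>The star of B is comultiplicative\<close>

definition "Jh w = eB \<otimes> jh w"
text \<open>At starH x the maps \<open>Jh\<close>, \<open>Rh\<close> and \<open>Psh\<close> are the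
  stars of \<open>J2 x\<close>, \<open>R x\<close> and \<open>Ps x\<close>, as verified in
  \<open>starT_D\<close>.\<close>

definition "Rh w = tsum (rhos w) (\<lambda>h a. jh h \<otimes> i a)"
definition "Psh w = I2 (psis w)"
definition "IG x = I2 (comul A (\<gamma> x))"
definition "Gm x = eB \<otimes> i (\<gamma> x)"

lemma lin_starred_T [lin]:
  "clinear f \<Longrightarrow> clinear (\<lambda>x. Jh (f x))" "clinear f \<Longrightarrow> clinear (\<lambda>x. Rh (f x))"
  "clinear f \<Longrightarrow> clinear (\<lambda>x. Psh (f x))" "clinear f \<Longrightarrow> clinear (\<lambda>x. IG (f x))"
  "clinear f \<Longrightarrow> clinear (\<lambda>x. Gm (f x))"
  unfolding Jh_def Rh_def Psh_def IG_def Gm_def by (simp_all add: lin)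

lemma clinear_starred_T: "clinear IG" "clinear Gm"
  by (simp_all add: lin)

text \<open>Merges two consecutive legs under \<open>rhos\<close> into one by
  \<open>comul_rhos_map\<close>, in the presence of a further leg w5 that is carried along.\<close>

lemma comul_rhos_tail:
  assumes [lin]: "\<And>b c d. clinear (\<lambda>a. F a b c d)" "\<And>a c d. clinear (\<lambda>b. F a b c d)"
    "\<And>a b d. clinear (\<lambda>c. F a b c d)" "\<And>a b c. clinear (\<lambda>d. F a b c d)"
  shows "sw2 H r (\<lambda>w3 s. tsum (rhos w3) (\<lambda>h a. sw2 H s (\<lambda>w4 w5. tsum (rhos w4) (\<lambda>h' a'. F h h' (a' \<odot> a) w5)))) =
    sw2 H r (\<lambda>y w5. tsum (rhos y) (\<lambda>h a. sw2 H h (\<lambda>h1 h2. F h1 h2 a w5)))"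
proof -
  note [lin] = assms[THEN clinear_compose]
  have "sw2 H r (\<lambda>w3 s. tsum (rhos w3) (\<lambda>h a. sw2 H s (\<lambda>w4 w5. tsum (rhos w4) (\<lambda>h' a'. F h h' (a' \<odot> a) w5)))) =
      sw2 H r (\<lambda>w3 s. sw2 H s (\<lambda>w4 w5. tsum (rhos w3) (\<lambda>h a. tsum (rhos w4) (\<lambda>h' a'. F h h' (a' \<odot> a) w5))))"
    unfolding sw2_def tsum_swap[where s = "rhos _" and t = "comul H _"] ..
  also have "\<dots> = sw2 H r (\<lambda>y w5. sw2 H y (\<lambda>w3 w4. tsum (rhos w3) (\<lambda>h a. tsum (rhos w4) (\<lambda>h' a'. F h h' (a' \<odot> a) w5))))"
    by (simp add: H.co.sw2_assoc lin)
  also have "\<dots> = sw2 H r (\<lambda>y w5. tsum (rhos y) (\<lambda>h a. sw2 H h (\<lambda>h1 h2. F h1 h2 a w5)))"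
    by (simp add: comul_rhos_map[where F = "\<lambda>u v w. F u v w _"] lin)
  finally show ?thesis .
qed

text \<open>Condition (v), with its last two legs recombined to a convolution product so that
  \<open>D0\<close> can be attached on the right.\<close>

lemma IG_Ps:
  "(IG \<star> Ps) w = sw2 H w (\<lambda>w1 r. sw2 H r (\<lambda>w2 r. sw2 H r (\<lambda>w3 r.
     tsum (psis w1) (\<lambda>u v. tsum (rhos w2) (\<lambda>h a. tsum (rhos w3) (\<lambda>h' a'.
       BB ((i (\<gamma> h) \<diamondop> i (h' \<triangleright> u)) \<otimes> eB) ((Gm \<star> M (a' \<odot> (a \<odot> v))) r)))))))"
proof -
  have I2: "clinear I2" by (simp add: lin)
  have "(IG \<star> Ps) w = I2 (sw2 H w (\<lambda>w1 w2. sw2 A (\<gamma> w1) (\<lambda>g1 g2. tsum (\<psi> w2) (\<lambda>p q. (g1 \<odot> p) \<otimes> (g2 \<odot> q)))))"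
    by (simp add: conv_def IG_def Ps_def I2_tmul[symmetric] tmul_def[of mulA mulA] sw2_def[of A] sw2_map[OF I2])
  also have "\<dots> = sw2 H w (\<lambda>w1 r. sw2 H r (\<lambda>w2 r. sw2 H r (\<lambda>w3 r. sw2 H r (\<lambda>w4 w5.
     tsum (psis w1) (\<lambda>u v. tsum (rhos w2) (\<lambda>h a. tsum (rhos w3) (\<lambda>h' a'.
       i (\<gamma> h \<odot> (h' \<triangleright> u)) \<otimes> i (\<gamma> w4 \<odot> (w5 \<triangleright> (a' \<odot> (a \<odot> v)))))))))))"
    unfolding cond_v' by (simp add: sw2_map[OF I2] clinear_tsum_map[OF I2] I2_tens)
  also have "\<dots> = sw2 H w (\<lambda>w1 r. sw2 H r (\<lambda>w2 r. sw2 H r (\<lambda>w3 r.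
     tsum (psis w1) (\<lambda>u v. tsum (rhos w2) (\<lambda>h a. tsum (rhos w3) (\<lambda>h' a'.
       BB ((i (\<gamma> h) \<diamondop> i (h' \<triangleright> u)) \<otimes> eB) ((Gm \<star> M (a' \<odot> (a \<odot> v))) r)))))))"
  proof -
    have "sw2 H r (\<lambda>w4 w5. tsum (psis w1) (\<lambda>u v. tsum (rhos w2) (\<lambda>h a. tsum (rhos w3) (\<lambda>h' a'.
       i (\<gamma> h \<odot> (h' \<triangleright> u)) \<otimes> i (\<gamma> w4 \<odot> (w5 \<triangleright> (a' \<odot> (a \<odot> v)))))))) =
     tsum (psis w1) (\<lambda>u v. tsum (rhos w2) (\<lambda>h a. tsum (rhos w3) (\<lambda>h' a'.
       BB ((i (\<gamma> h) \<diamondop> i (h' \<triangleright> u)) \<otimes> eB) ((Gm \<star> M (a' \<odot> (a \<odot> v))) r))))" for w1 w2 w3 r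
    by (simp only: sw2_def tsum_swap[where s = "comul H r"])
      (simp add: conv_def Gm_def M_def HT.tsum_right[symmetric] BB_tens HB.unit_left HB.unit_right i_mulB_tens sw2_def
        A.mul_unity_left)
    then show ?thesis by (simp only:)
  qed
  finally show ?thesis .
qed

text \<open>Condition (iv) rewrites \<gamma> in the second leg times \<open>R\<close>; the remaining
  factor \<open>J2\<close> then completes the second leg to \<open>jh\<close>.\<close>

lemma Gm_D0: "(Gm \<star> D0) r = sw2 H r (\<lambda>r1 r2. tsum (rhos r1) (\<lambda>h a. j h \<otimes> (jh r2 \<diamondop> i a)))"
proof -
  let ?G = "tmap (\<lambda>u. j u) (\<lambda>v. i v)"
  have G: "clinear ?G" "?G (u \<otimes> v) = j u \<otimes> i v" for u v
    by (simp_all add: clinear_tmap tmap_tens lin)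
  have R: "(Gm \<star> R) y = sw3 H y (\<lambda>w1 w2 w3. tsum (rhos w1) (\<lambda>h a. j h \<otimes> i (\<gamma> w2 \<odot> (w3 \<triangleright> a))))" for y
  proof -
    have "(Gm \<star> R) y = ?G (sw2 H y (\<lambda>w1 w2. tsum (\<rho> w2) (\<lambda>h a. h \<otimes> (\<gamma> w1 \<odot> a))))"
      by (simp add: sw2_map[OF G(1)] clinear_tsum_map[OF G(1)] G(2) conv_def Gm_def R_def HT.tsum_right[symmetric]
        BB_tens HB.unit_left i_mulB_tens A.mul_unity_left)
    then show ?thesis
      unfolding cond_iv' sw3_def by (simp add: sw2_map[OF G(1)] clinear_tsum_map[OF G(1)] G(2))
  qed
  have "(Gm \<star> D0) r = ((Gm \<star> R) \<star> J2) r"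
    by (simp add: D0_def HT.conv_assoc clinear_T clinear_starred_T)
  also have "\<dots> = sw2 H r (\<lambda>y s. sw3 H y (\<lambda>w1 w2 w3. tsum (rhos w1) (\<lambda>h a. j h \<otimes> ((\<gamma> w2 \<odot> (w3 \<triangleright> a)) \<otimes> s))))"
    by (simp add: conv_def[of H BB "Gm \<star> R"] R J2_def sw3_def HT.sw2_left[symmetric] HT.tsum_left[symmetric]
      BB_tens HB.unit_right i_mulB_tens A.mul_unity_right)
  also have "\<dots> = sw2 H r (\<lambda>w1 s. sw2 H s (\<lambda>w2 s. sw2 H s (\<lambda>w3 s. tsum (rhos w1) (\<lambda>h a. j h \<otimes> ((\<gamma> w2 \<odot> (w3 \<triangleright> a)) \<otimes> s)))))"
    by (simp add: sw3_def H.co.sw2_assoc lin)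
  also have "\<dots> = sw2 H r (\<lambda>r1 r2. tsum (rhos r1) (\<lambda>h a. j h \<otimes> (jh r2 \<diamondop> i a)))"
    unfolding sw2_def tsum_swap[where s = "comul H _" and t = "rhos _"]
    by (simp add: jh_i sw2_def tsum_tens_right)
  finally show ?thesis .
qed

text \<open>\<open>M c\<close> commutes with \<open>R\<close>, and its product with
  \<open>J2\<close> is \<open>J2\<close> multiplied by \<open>i c\<close> on the right. Thus c is
  carried to the far right.\<close>

lemma Gm_M_D0: "((Gm \<star> M c) \<star> D0) r = BB ((Gm \<star> D0) r) (eB \<otimes> i c)"
proof -
  have "(Gm \<star> M c) \<star> D0 = Gm \<star> R \<star> M c \<star> J2"
    by (simp add: D0_def HT.conv_assoc[symmetric] HT.clinear_conv clinear_T clinear_starred_T)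
      (simp add: HT.conv_assoc HT.clinear_conv clinear_T clinear_starred_T R_M)
  moreover have "M c \<star> J2 = (\<lambda>x. BB (J2 x) (eB \<otimes> i c))"
    by (simp add: fun_eq_iff J2_M)
  moreover have "R \<star> (\<lambda>x. BB (J2 x) (eB \<otimes> i c)) = (\<lambda>x. BB (D0 x) (eB \<otimes> i c))"
    by (simp add: fun_eq_iff HT.conv_mult_right D0_def)
  ultimately show ?thesis
    by (simp add: HT.conv_mult_right)
qed

text \<open>Comultiplicativity of the star on \<open>j x\<close>: the right side is the product of
  the starred factors of \<open>D\<close> in reverse order. Conditions (v) and (iv) produce three
  legs under \<open>rhos\<close>, which are merged into one in two steps.\<close>

lemma comulB_jh:
  "comul B (jh w) = sw2 H w (\<lambda>w1 q. sw2 H q (\<lambda>w2 w3. BB (BB (Jh w3) (Rh w2)) (Psh w1)))"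
proof -
  let ?Z = "\<lambda>u h h'. (i (\<gamma> h) \<diamondop> i (h' \<triangleright> u)) \<otimes> eB"
  have "comul B (jh w) = ((IG \<star> Ps) \<star> D0) w"
    by (simp add: jh_def sw2_map[OF clinear_comulB] comulB_mul comulB_i comulB_j IG_def[symmetric] HT.conv_assoc
      clinear_T clinear_starred_T) (simp add: conv_def D_def)
  also have "\<dots> = sw2 H w (\<lambda>y s. sw2 H y (\<lambda>w1 r. sw2 H r (\<lambda>w2 r. sw2 H r (\<lambda>w3 r.
     tsum (psis w1) (\<lambda>u v. tsum (rhos w2) (\<lambda>h a. tsum (rhos w3) (\<lambda>h' a'.
       BB (?Z u h h') (BB ((Gm \<star> M (a' \<odot> (a \<odot> v))) r) (D0 s)))))))))"
    by (simp add: conv_def[of H BB "IG \<star> Ps"] IG_Ps HT.sw2_left[symmetric] HT.tsum_left[symmetric] HT.assoc)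
  also have "\<dots> = sw2 H w (\<lambda>w1 r. sw2 H r (\<lambda>w2 r. sw2 H r (\<lambda>w3 r. sw2 H r (\<lambda>r s.
     tsum (psis w1) (\<lambda>u v. tsum (rhos w2) (\<lambda>h a. tsum (rhos w3) (\<lambda>h' a'.
       BB (?Z u h h') (BB ((Gm \<star> M (a' \<odot> (a \<odot> v))) r) (D0 s)))))))))"
    by (simp add: H.co.sw2_assoc lin)
  also have "\<dots> = sw2 H w (\<lambda>w1 r. sw2 H r (\<lambda>w2 r. sw2 H r (\<lambda>w3 r.
     tsum (psis w1) (\<lambda>u v. tsum (rhos w2) (\<lambda>h a. tsum (rhos w3) (\<lambda>h' a'.
       BB (?Z u h h') (((Gm \<star> M (a' \<odot> (a \<odot> v))) \<star> D0) r)))))))"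
  proof -
    have "sw2 H r (\<lambda>r s. tsum (psis w1) (\<lambda>u v. tsum (rhos w2) (\<lambda>h a. tsum (rhos w3) (\<lambda>h' a'.
       BB (?Z u h h') (BB ((Gm \<star> M (a' \<odot> (a \<odot> v))) r) (D0 s)))))) =
      tsum (psis w1) (\<lambda>u v. tsum (rhos w2) (\<lambda>h a. tsum (rhos w3) (\<lambda>h' a'.
       BB (?Z u h h') (((Gm \<star> M (a' \<odot> (a \<odot> v))) \<star> D0) r))))" for w1 w2 w3 r
      by (simp only: sw2_def tsum_swap[where s = "comul H r"] conv_def[where g = D0] HT.tsum_right)
    then show ?thesis by simp
  qed
  also have "\<dots> = sw2 H w (\<lambda>w1 r. sw2 H r (\<lambda>w2 r. sw2 H r (\<lambda>w3 r.
     tsum (psis w1) (\<lambda>u v. tsum (rhos w2) (\<lambda>h a. tsum (rhos w3) (\<lambda>h' a'. sw2 H r (\<lambda>w4 w5. tsum (rhos w4) (\<lambda>h'' a''.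
       (i (\<gamma> h) \<diamondop> (i (h' \<triangleright> u) \<diamondop> j h'')) \<otimes> (jh w5 \<diamondop> i (a'' \<odot> (a' \<odot> (a \<odot> v))))))))))))"
    by (simp add: Gm_M_D0 Gm_D0 HT.sw2_left[symmetric] HT.sw2_right[symmetric] HT.tsum_left[symmetric]
      HT.tsum_right[symmetric] BB_tens HB.unit_left HB.unit_right HB.assoc i_mulB_tens A.mul_assoc A.mul_unity_right)
  also have "\<dots> = sw2 H w (\<lambda>w1 r. tsum (psis w1) (\<lambda>u v. sw2 H r (\<lambda>w2 r. tsum (rhos w2) (\<lambda>h a. sw2 H r (\<lambda>w3 r.
     tsum (rhos w3) (\<lambda>h' a'. sw2 H r (\<lambda>w4 w5. tsum (rhos w4) (\<lambda>h'' a''.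
       (i (\<gamma> h) \<diamondop> (i (h' \<triangleright> u) \<diamondop> j h'')) \<otimes> (jh w5 \<diamondop> i (a'' \<odot> (a' \<odot> (a \<odot> v))))))))))))"
  proof -
    have "sw2 H r (\<lambda>w3 r. tsum (psis w1) (\<lambda>u v. tsum (rhos w2) (\<lambda>h a. G u v h a w3 r))) =
        tsum (psis w1) (\<lambda>u v. tsum (rhos w2) (\<lambda>h a. sw2 H r (\<lambda>w3 r. G u v h a w3 r)))"
      "sw2 H r (\<lambda>w2 r. tsum (psis w1) (\<lambda>u v. G' u v w2 r)) = tsum (psis w1) (\<lambda>u v. sw2 H r (\<lambda>w2 r. G' u v w2 r))"
      for w1 w2 r and G :: "_ \<Rightarrow> _ \<Rightarrow> _ \<Rightarrow> _ \<Rightarrow> _ \<Rightarrow> _ \<Rightarrow> ('a \<otimes> 'h) \<otimes> ('a \<otimes> 'h)"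
        and G' :: "_ \<Rightarrow> _ \<Rightarrow> _ \<Rightarrow> _ \<Rightarrow> ('a \<otimes> 'h) \<otimes> ('a \<otimes> 'h)"
      by (simp_all only: sw2_def tsum_swap[where s = "comul H r"])
    then show ?thesis by (simp only:)
  qed
  \<comment> \<open>The legs w3 and w4 merge; by \<open>j_i\<close> this turns the action on u
    followed by j(h'') into j(h') followed by i(u).\<close>
  also have "\<dots> = sw2 H w (\<lambda>w1 r. tsum (psis w1) (\<lambda>u v. sw2 H r (\<lambda>w2 r. tsum (rhos w2) (\<lambda>h a. sw2 H r (\<lambda>y w5.
     tsum (rhos y) (\<lambda>h' a'. (i (\<gamma> h) \<diamondop> (j h' \<diamondop> i u)) \<otimes> (jh w5 \<diamondop> i (a' \<odot> (a \<odot> v)))))))))"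
  proof -
    have "sw2 H r (\<lambda>w3 r. tsum (rhos w3) (\<lambda>h' a'. sw2 H r (\<lambda>w4 w5. tsum (rhos w4) (\<lambda>h'' a''.
       (i (\<gamma> h) \<diamondop> (i (h' \<triangleright> u) \<diamondop> j h'')) \<otimes> (jh w5 \<diamondop> i (a'' \<odot> (a' \<odot> (a \<odot> v)))))))) =
      sw2 H r (\<lambda>y w5. tsum (rhos y) (\<lambda>h' a'. (i (\<gamma> h) \<diamondop> (j h' \<diamondop> i u)) \<otimes> (jh w5 \<diamondop> i (a' \<odot> (a \<odot> v)))))" for r h u a v
      using comul_rhos_tail[where F = "\<lambda>h' h'' b w5. (i (\<gamma> h) \<diamondop> (i (h' \<triangleright> u) \<diamondop> j h'')) \<otimes> (jh w5 \<diamondop> i (b \<odot> (a \<odot> v)))" and r = r]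
      by (simp add: lin A.mul_assoc j_i sw2_map[where h = "\<lambda>z. (_ \<diamondop> z) \<otimes> _"])
    then show ?thesis by (simp only:)
  qed
  \<comment> \<open>The leg w2 merges with the leg just formed, and i(\<gamma> h) with j(h') becomes
    \<open>jh h\<close>.\<close>
  also have "\<dots> = sw2 H w (\<lambda>w1 r. tsum (psis w1) (\<lambda>u v. sw2 H r (\<lambda>y w5. tsum (rhos y) (\<lambda>h a.
     (jh h \<diamondop> i u) \<otimes> (jh w5 \<diamondop> i (a \<odot> v))))))"
  proof -
    have "sw2 H r (\<lambda>w2 r. tsum (rhos w2) (\<lambda>h a. sw2 H r (\<lambda>y w5. tsum (rhos y) (\<lambda>h' a'.
        (i (\<gamma> h) \<diamondop> (j h' \<diamondop> i u)) \<otimes> (jh w5 \<diamondop> i (a' \<odot> (a \<odot> v))))))) =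
      sw2 H r (\<lambda>y w5. tsum (rhos y) (\<lambda>h a. (jh h \<diamondop> i u) \<otimes> (jh w5 \<diamondop> i (a \<odot> v))))" for r u v
      using comul_rhos_tail[where F = "\<lambda>h h' b w5. (i (\<gamma> h) \<diamondop> (j h' \<diamondop> i u)) \<otimes> (jh w5 \<diamondop> i (b \<odot> v))" and r = r]
      by (simp add: lin A.mul_assoc jh_def[of "_ :: 'h"] HB.sw2_left[symmetric] HB.assoc sw2_map[where h = "\<lambda>z. z \<otimes> _"])
    then show ?thesis by (simp only:)
  qed
  also have "\<dots> = sw2 H w (\<lambda>w1 q. sw2 H q (\<lambda>w2 w3. BB (BB (Jh w3) (Rh w2)) (Psh w1)))"
  proof -
    have "BB (BB (Jh w3) (Rh w2)) (Psh w1) = tsum (psis w1) (\<lambda>u v. tsum (rhos w2) (\<lambda>h a.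
        (jh h \<diamondop> i u) \<otimes> (jh w3 \<diamondop> i (a \<odot> v))))" for w1 w2 w3
      unfolding Jh_def Rh_def Psh_def I2_def HT.tsum_right[symmetric]
      by (simp add: HT.tsum_right[symmetric] HT.tsum_left[symmetric] BB_tens HB.unit_left HB.assoc i_mulB_tens)
    moreover have "sw2 H r (\<lambda>w2 r. tsum (psis w1) (\<lambda>u v. G' u v w2 r)) = tsum (psis w1) (\<lambda>u v. sw2 H r (\<lambda>w2 r. G' u v w2 r))"
      for w1 r and G' :: "_ \<Rightarrow> _ \<Rightarrow> _ \<Rightarrow> _ \<Rightarrow> ('a \<otimes> 'h) \<otimes> ('a \<otimes> 'h)"
      by (simp only: sw2_def tsum_swap[where s = "comul H r"])
    ultimately show ?thesis by (simp only:)
  qed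
  finally show ?thesis .
qed

definition "starT = tmap starB starB"

lemma starT_tens: "starT (s \<otimes> t) = starB s \<otimes> starB t"
  and starT_add: "starT (p + q) = starT p + starT q"
  using conj_linear_add[OF conj_linear_tmap[OF conj_linear_starB conj_linear_starB]]
  by (simp_all add: starT_def tmap_tens_conj conj_linear_starB)

lemmas starT_tsum = additive_tsum[where h = starT, OF starT_add]
  and starT_sw2 = additive_sw2[where h = starT, OF starT_add]

lemma starT_mul: "starT (BB p q) = BB (starT q) (starT p)"
proof (rule tensor_ext_additive[where t = p])
  note add = starT_add clinear_add[where f = "\<lambda>t. BB t _"] clinear_add[where f = "\<lambda>t. BB _ t"]
  fix s t
  show "starT (BB (s \<otimes> t) q) = BB (starT q) (starT (s \<otimes> t))"
    by (rule tensor_ext_additive[where t = q]) (simp_all add: add lin BB_tens starT_tens starB_mul)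
qed (simp_all add: starT_add clinear_add[where f = "\<lambda>t. BB t _"] clinear_add[where f = "\<lambda>t. BB _ t"] lin)

lemma starT_I2: "starT (I2 s) = I2 (tmap starA starA s)"
  by (simp add: I2_def starT_tsum starT_tens starB_i tmap_def tsum_bil lin)

lemma starT_D: "starT (D x) = comul B (jh (starH x))"
proof -
  have P: "starT (Ps x) = Psh (starH x)" for x
    by (simp add: Ps_def starT_I2 Psh_def psis_def H.star_star)
  have R: "starT (R x) = Rh (starH x)" for x
    by (simp add: R_def Rh_def starT_tsum starT_tens starB_i starB_j tsum_rhos lin H.star_star)
  have J: "starT (J2 x) = Jh (starH x)" for x
    by (simp add: J2_def Jh_def starT_tens starB_j starB_i A.star_unity)
  have "starT (D x) = sw2 H x (\<lambda>x1 r. sw2 H r (\<lambda>x2 x3. BB (BB (Jh (starH x3)) (Rh (starH x2))) (Psh (starH x1))))"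
    by (simp add: D_def D0_def conv_def starT_sw2 starT_mul P R J HT.sw2_left)
  also have "\<dots> = comul B (jh (starH x))"
    unfolding comulB_jh
    by (simp add: H.sw2_of_star[where G = "\<lambda>w2 w3. BB (BB (Jh w3) (Rh w2)) (Psh _)"]
      H.sw2_of_star[where G = "\<lambda>w1 r. sw2 H r (\<lambda>w2 w3. BB (BB (Jh w3) (Rh w2)) (Psh w1))"] lin)
  finally show ?thesis .
qed

lemma comulB_starB: "comul B (starB t) = starT (comul B t)"
proof (rule tensor_ext_additive[where t = t])
  fix a x
  have "comul A (starA a) = tmap starA starA (comul A a)"
    by (simp add: A.comul_star sw2_def tmap_def)
  then show "comul B (starB (a \<otimes> x)) = starT (comul B (a \<otimes> x))"
    by (simp add: starB_tens comulB_mul comulB_tens D_unity HT.unit_right starT_mul starT_I2 starT_D)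
qed (simp_all add: starB_add starT_add clinear_add[OF clinear_comulB])

lemma star_hopf_algebra_B: "star_hopf_algebra B starB"
proof -
  interpret hopf_algebra B by (rule hopf_algebra_B)
  show ?thesis
    by unfold_locales
      (simp_all add: conj_linear_starB starB_starB starB_mul comulB_starB starT_def tmap_def sw2_def)
qed

end

section \<open>Inner products\<close>

locale inner_space =
  fixes ip :: "'v::complex_vector \<Rightarrow> 'v \<Rightarrow> complex"
  assumes inner_product: "inner_product ip"
begin

lemma lin_ip [lin]: "clinear f \<Longrightarrow> clinear (\<lambda>x. ip (f x) v)"
  using inner_product clinear_compose[of "\<lambda>u. ip u v" f] unfolding inner_product_def by blast

lemma ip_cnj: "ip v u = cnj (ip u v)"
  and ip_pos: "u \<noteq> 0 \<Longrightarrow> 0 < Re (ip u u)"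
  using inner_product unfolding inner_product_def by blast+

lemma ip_add_left: "ip (u + u') v = ip u v + ip u' v"
  and ip_scale_left: "ip (c *\<^sub>C u) v = c * ip u v"
  and ip_diff_left: "ip (u - u') v = ip u v - ip u' v"
  and ip_zero_left: "ip 0 v = 0"
  by (simp_all add: clinear_add[of "\<lambda>u. ip u v"] clinear_scale[of "\<lambda>u. ip u v"] clinear_diff[of "\<lambda>u. ip u v"]
    clinear_zero[of "\<lambda>u. ip u v"] lin scaleC_complex_def)

lemma ip_add_right: "ip u (v + v') = ip u v + ip u v'"
  and ip_scale_right: "ip u (c *\<^sub>C v) = cnj c * ip u v"
  and ip_zero_right: "ip u 0 = 0"
  by (simp_all only: ip_cnj[of u "v + v'"] ip_cnj[of u "c *\<^sub>C v"] ip_cnj[of u 0]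
      ip_cnj[of u v] ip_cnj[of u v'] ip_add_left ip_scale_left ip_diff_left ip_zero_left
      complex_cnj_add complex_cnj_mult complex_cnj_diff complex_cnj_zero)

lemma ip_sum_left: "ip (sum f A) v = (\<Sum>a\<in>A. ip (f a) v)"
  by (rule clinear_sum[of "\<lambda>u. ip u v"]) (simp add: lin)

lemma ip_self: "ip u u = of_real (Re (ip u u))"
  using arg_cong[OF ip_cnj[of u u], of Im] by (simp add: complex_eq_iff)

section \<open>Orthonormal sets and eigenvectors\<close>

definition orthonormal :: "'v set \<Rightarrow> bool" where
  "orthonormal E \<longleftrightarrow> (\<forall>u\<in>E. \<forall>v\<in>E. ip u v = (if u = v then 1 else 0))"

lemma orthonormal_expand:
  assumes "finite E" "orthonormal E" "v \<in> cvec.span E"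
  shows "v = (\<Sum>e\<in>E. ip v e *\<^sub>C e)"
proof -
  obtain c where v: "v = (\<Sum>a\<in>E. c a *\<^sub>C a)"
    using assms(1,3) by (auto simp: cvec.span_finite)
  have "ip v e = c e" if "e \<in> E" for e
  proof -
    have "ip v e = (\<Sum>a\<in>E. c a * ip a e)"
      by (simp add: v ip_sum_left ip_scale_left)
    also have "\<dots> = (\<Sum>a\<in>E. if a = e then c a else 0)"
      using assms(2) that by (intro sum.cong) (auto simp: orthonormal_def)
    finally show ?thesis using assms(1) that by simp
  qed
  then show ?thesis using v by simp
qed

lemma orthonormal_independent:
  assumes "finite E" "orthonormal E"
  shows "cvec.independent E"
  unfolding cvec.independent_explicit_finite_subsets
proof (intro allI impI ballI)
  fix F c a
  assume F: "F \<subseteq> E" "finite F" "(\<Sum>v\<in>F. c v *\<^sub>C v) = 0" "a \<in> F"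
  have "0 = ip (\<Sum>v\<in>F. c v *\<^sub>C v) a" by (simp add: F ip_zero_left)
  also have "\<dots> = (\<Sum>v\<in>F. c v * ip v a)" by (simp add: ip_sum_left ip_scale_left)
  also have "\<dots> = (\<Sum>v\<in>F. if v = a then c v else 0)"
    using assms(2) F(1,4) by (intro sum.cong) (auto simp: orthonormal_def subset_iff)
  finally show "c a = 0" using F by simp
qed

lemma orthonormal_insert:
  assumes "finite E" "orthonormal E" "b \<notin> cvec.span E"
  obtains e where "orthonormal (insert e E)" "e \<notin> E" "cvec.span (insert e E) = cvec.span (insert b E)"
proof -
  let ?s = "\<Sum>c\<in>E. ip b c *\<^sub>C c"
  define b' where "b' = b - ?s"
  define r where "r = complex_of_real (1 / sqrt (Re (ip b' b')))"
  have s: "?s \<in> cvec.span E"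
    by (intro cvec.span_sum cvec.span_scale cvec.span_base)
  then have b'0: "b' \<noteq> 0" using assms(3) by (auto simp: b'_def)
  have pos: "0 < Re (ip b' b')" by (rule ip_pos[OF b'0])
  have r0: "r \<noteq> 0" using pos by (simp add: r_def)
  have orth: "ip b' c = 0" if "c \<in> E" for c
  proof -
    have "(\<Sum>a\<in>E. ip b a * ip a c) = (\<Sum>a\<in>E. if a = c then ip b a else 0)"
      using assms(2) that by (intro sum.cong) (auto simp: orthonormal_def)
    then show ?thesis
      using assms(1) that by (simp add: b'_def ip_diff_left ip_sum_left ip_scale_left)
  qed
  have "ip (r *\<^sub>C b') (r *\<^sub>C b') = of_real ((1 / sqrt (Re (ip b' b'))) * (1 / sqrt (Re (ip b' b'))) * Re (ip b' b'))"
    by (subst ip_scale_left, subst ip_scale_right, subst ip_self)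
      (simp only: r_def complex_cnj_complex_of_real of_real_mult mult.assoc)
  also have "\<dots> = 1"
  proof -
    have "1 / sqrt r * (1 / sqrt r) * r = 1" if "0 < r" for r
      using that by (simp flip: power2_eq_square add: divide_simps)
    then show ?thesis by (simp only: pos of_real_1)
  qed
  finally have unit: "ip (r *\<^sub>C b') (r *\<^sub>C b') = 1" .
  have e_notin: "r *\<^sub>C b' \<notin> E"
  proof
    assume "r *\<^sub>C b' \<in> E"
    from orth[OF this] have "ip (r *\<^sub>C b') (r *\<^sub>C b') = 0" by (simp add: ip_scale_left)
    then show False by (simp add: unit)
  qed
  have "ip (r *\<^sub>C b') c = 0" "ip c (r *\<^sub>C b') = 0" if "c \<in> E" for c
    using orth[OF that] ip_cnj[of c "r *\<^sub>C b'"] by (simp_all add: ip_scale_left)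
  then have "orthonormal (insert (r *\<^sub>C b') E)"
    using assms(2) unit e_notin unfolding orthonormal_def by auto
  moreover have "cvec.span (insert (r *\<^sub>C b') E) = cvec.span (insert b E)"
    unfolding cvec.span_eq
  proof
    have "r *\<^sub>C b' \<in> cvec.span (insert b E)"
      unfolding b'_def using s cvec.span_mono[of E "insert b E"]
      by (intro cvec.span_scale cvec.span_diff) (auto intro: cvec.span_base)
    then show "insert (r *\<^sub>C b') E \<subseteq> cvec.span (insert b E)"
      by (auto intro: cvec.span_base)
    have "b = inverse r *\<^sub>C r *\<^sub>C b' + ?s"
      using r0 by (simp add: b'_def)
    also have "\<dots> \<in> cvec.span (insert (r *\<^sub>C b') E)"
      using s cvec.span_mono[of E "insert (r *\<^sub>C b') E"]
      by (intro cvec.span_add cvec.span_scale[of "r *\<^sub>C b'"]) (auto intro: cvec.span_base)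
    finally show "insert b E \<subseteq> cvec.span (insert (r *\<^sub>C b') E)"
      by (auto intro: cvec.span_base)
  qed
  ultimately show ?thesis using that e_notin by blast
qed

lemma gram_schmidt:
  assumes "finite F"
  obtains E where "finite E" "orthonormal E" "cvec.span E = cvec.span F"
proof -
  from assms have "\<exists>E. finite E \<and> orthonormal E \<and> cvec.span E = cvec.span F"
  proof (induction F rule: finite_induct)
    case empty
    then show ?case by (intro exI[of _ "{}"]) (simp add: orthonormal_def)
  next
    case (insert b F)
    then obtain E where E: "finite E" "orthonormal E" "cvec.span E = cvec.span F" by blast
    then have span: "cvec.span (insert b E) = cvec.span (insert b F)"
      by (simp add: cvec.span_insert)
    show ?case
    proof (cases "b \<in> cvec.span E")
      case True
      then show ?thesis using E span by (metis cvec.span_redundant)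
    next
      case False
      from orthonormal_insert[OF E(1,2) this] show ?thesis
        using E(1) span by (metis finite_insert)
    qed
  qed
  then show ?thesis using that by blast
qed

lemma finite_dimensional_orthonormal:
  assumes "finite F" "V \<subseteq> cvec.span F" "cvec.subspace V"
  obtains E where "finite E" "orthonormal E" "cvec.span E = V"
proof -
  obtain A where A: "A \<subseteq> V" "cvec.independent A" "V \<subseteq> cvec.span A"
    using cvec.maximal_independent_subset by blast
  have "finite A"
    using cvec.independent_span_bound[OF assms(1) A(2)] A(1) assms(2) by blast
  moreover have "cvec.span A = V"
    using A assms(3) by (simp add: cvec.span_minimal subset_antisym)
  ultimately show ?thesis
    using gram_schmidt that by metis
qed

text \<open>Take an orthonormal basis of the span of the finitely many second factors in a
  representative of t, and expand each of them. This makes the positivity of a tensor product of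
  inner products a one-line computation.\<close>

lemma tensor_orthonormal_right:
  fixes t :: "'a::complex_vector \<otimes> 'v"
  obtains E where "finite E" "orthonormal E" "t = (\<Sum>e\<in>E. tsum t (\<lambda>u v. ip v e *\<^sub>C u) \<otimes> e)"
proof -
  let ?K = "Poly_Mapping.keys (rep_tensor t)"
  obtain E where E: "finite E" "orthonormal E" "cvec.span E = cvec.span (snd ` ?K)"
    using gram_schmidt[of "snd ` ?K"] by auto
  have "snd k = (\<Sum>e\<in>E. ip (snd k) e *\<^sub>C e)" if "k \<in> ?K" for k
    using orthonormal_expand[OF E(1,2)] E(3) that cvec.span_base[of "snd k" "snd ` ?K"] by simp
  then have "t = (\<Sum>k\<in>?K. \<Sum>e\<in>E. (Poly_Mapping.lookup (rep_tensor t) k *\<^sub>C fst k) \<otimes> (ip (snd k) e *\<^sub>C e))"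
    by (subst tsum_tens_id[of t, symmetric], unfold tsum_def)
      (rule sum.cong, simp_all add: clinear_sum[of "\<lambda>z. _ \<otimes> z", symmetric] lin)
  also have "\<dots> = (\<Sum>e\<in>E. tsum t (\<lambda>u v. ip v e *\<^sub>C u) \<otimes> e)"
    unfolding tsum_def
    by (subst sum.swap) (simp add: clinear_sum[of "\<lambda>z. z \<otimes> _"] lin tens_scale_left tens_scale_right mult.commute)
  finally show ?thesis using that E by blast
qed

text \<open>A nonzero polynomial of minimal degree annihilating a vector splits off a linear factor,
  and the cofactor yields an eigenvector.\<close>

lemma eigenvector_exists:
  assumes T: "clinear T" and F: "finite F" and V: "V \<subseteq> cvec.span F" "\<And>u. u \<in> V \<Longrightarrow> T u \<in> V"
    and "cvec.subspace V" and v: "v \<in> V" "v \<noteq> 0"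
  obtains l u where "u \<in> V" "u \<noteq> 0" "T u = l *\<^sub>C u"
proof -
  \<comment> \<open>\<open>act p\<close> is p(T) v, evaluated by Horner's scheme.\<close>
  define act where "act p = fold_coeffs (\<lambda>c r. c *\<^sub>C v + T r) p 0" for p
  note T_simps = clinear_add[OF T] clinear_scale[OF T] clinear_zero[OF T]
  have act_0: "act 0 = 0" by (simp add: act_def)
  have act_pCons: "act (pCons c p) = c *\<^sub>C v + T (act p)" for c p
    by (cases "p = 0 \<and> c = 0") (auto simp: act_def T_simps fold_coeffs_pCons_not_0_0_eq
      fold_coeffs_pCons_coeff_not_0_eq)
  have act_add: "act (p + q) = act p + act q" for p q
  proof (induction p arbitrary: q rule: pCons_induct)
    case (pCons a p)
    then show ?case by (cases q) (simp add: act_pCons T_simps scaleC_add_left)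
  qed (simp add: act_0)
  have act_smult: "act (smult c p) = c *\<^sub>C act p" for c p
    by (induction p rule: pCons_induct) (simp_all add: act_0 act_pCons T_simps scaleC_add_right)
  have act_diff: "act (p - q) = act p - act q" for p q
    using act_add[of "p - q" q] by simp
  have act_V: "act p \<in> V" for p
    using assms(5) v V(2)
    by (induction p rule: pCons_induct)
      (auto simp: act_0 act_pCons cvec.subspace_def)
  have act_sum: "act (sum f A) = (\<Sum>a\<in>A. act (f a))" for f :: "nat \<Rightarrow> complex poly" and A
    by (induction A rule: infinite_finite_induct) (simp_all add: act_0 act_add)
  have "\<exists>p. p \<noteq> 0 \<and> act p = 0"
  proof (rule ccontr)
    assume "\<nexists>p. p \<noteq> 0 \<and> act p = 0"
    then have inj: "p = 0" if "act p = 0" for p using that by blast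
    \<comment> \<open>The index set has card F + 1 elements, one more than an independent subset of
      the span of F can have.\<close>
    let ?x = "\<lambda>k. act (monom 1 k)" and ?N = "{..card F}"
    have inj_on: "inj_on ?x ?N"
    proof (rule inj_onI)
      fix k l assume "?x k = ?x l"
      then have "monom 1 k - monom (1::complex) l = 0" by (intro inj) (simp add: act_diff)
      then show "k = l" by (metis coeff_monom eq_iff_diff_eq_0 one_neq_zero)
    qed
    have "cvec.independent (?x ` ?N)"
      unfolding cvec.dependent_finite[OF finite_imageI[OF finite_atMost]]
    proof
      assume "\<exists>c. (\<exists>w\<in>?x ` ?N. c w \<noteq> 0) \<and> (\<Sum>w\<in>?x ` ?N. c w *\<^sub>C w) = 0"
      then obtain c k where k: "k \<in> ?N" "c (?x k) \<noteq> 0" and 0: "(\<Sum>w\<in>?x ` ?N. c w *\<^sub>C w) = 0"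
        by blast
      let ?p = "\<Sum>l\<in>?N. smult (c (?x l)) (monom 1 l)"
      have "act ?p = 0" using 0 by (simp only: act_sum act_smult sum.reindex[OF inj_on] o_def)
      then have "coeff ?p k = 0" using inj[of ?p] by (simp only: coeff_0)
      then show False using k by (simp add: coeff_sum smult_monom when_def if_distrib cong: if_cong)
    qed
    moreover have "?x ` ?N \<subseteq> cvec.span F" using act_V V(1) by blast
    ultimately have "card (?x ` ?N) \<le> card F"
      using cvec.independent_span_bound[OF F] by blast
    then show False by (simp add: card_image[OF inj_on])
  qed
  then obtain p where p: "p \<noteq> 0" "act p = 0"
    and min: "\<And>g. g \<noteq> 0 \<and> act g = 0 \<Longrightarrow> degree p \<le> degree g"
    using exists_least_iff[of "\<lambda>n. \<exists>p. degree p = n \<and> p \<noteq> 0 \<and> act p = 0"]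
    by (metis linorder_not_less)
  have "degree p \<noteq> 0"
  proof
    assume "degree p = 0"
    then obtain c where "p = [:c:]" by (metis degree_eq_zeroE)
    then show False using p v by (simp add: act_pCons act_0 T_simps)
  qed
  then have "\<not> constant (poly p)"
    by (simp add: constant_degree)
  then obtain l where "poly p l = 0"
    using fundamental_theorem_of_algebra by blast
  then obtain g where g: "p = [:- l, 1:] * g"
    by (metis dvdE poly_eq_0_iff_dvd)
  have "g \<noteq> 0" using g p(1) by auto
  moreover have "degree g < degree p"
    using g \<open>g \<noteq> 0\<close> by (simp add: degree_mult_eq del: mult_pCons_left)
  ultimately have "act g \<noteq> 0" using min[of g] by auto
  moreover have "T (act g) - l *\<^sub>C act g = act p"
    by (simp add: g act_diff act_smult act_pCons)
  ultimately show ?thesis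
    using that[of "act g" l] act_V p(2) by simp
qed

end

lemma inner_product_exists: "\<exists>ip :: 'v::complex_vector \<Rightarrow> 'v \<Rightarrow> complex. inner_product ip"
proof -
  obtain B :: "'v set" where B: "cvec.independent B" "cvec.span B = UNIV"
    using cvec.independent_extend_basis[OF cvec.independent_empty]
      cvec.span_extend_basis[OF cvec.independent_empty] by blast
  define r where "r v b = cvec.representation B v b" for v b
  have r_add: "r (u + v) b = r u b + r v b" and r_scale: "r (c *\<^sub>C u) b = c * r u b" for u v b c
    using B by (simp_all add: r_def cvec.representation_add cvec.representation_scale)
  define supp where "supp v = {b. r v b \<noteq> 0}" for v
  have fin: "finite (supp v)" for v
    unfolding supp_def r_def by (rule cvec.finite_representation)
  define ip where "ip u v = (\<Sum>b\<in>supp u. r u b * cnj (r v b))" for u v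
  \<comment> \<open>The sum may run over any finite set that contains the support of the first
    argument, so linearity and symmetry can be checked on a common index set.\<close>
  have ip: "ip u v = (\<Sum>b\<in>F. r u b * cnj (r v b))" if "finite F" "supp u \<subseteq> F" for F u v
    unfolding ip_def using that by (intro sum.mono_neutral_left) (auto simp: supp_def)
  have add: "ip (u + u') v = ip u v + ip u' v" for u u' v
    using fin by (subst (1 2 3) ip[where F = "supp u \<union> supp u' \<union> supp (u + u')"])
      (auto simp: r_add distrib_right sum.distrib)
  have scale: "ip (c *\<^sub>C u) v = c * ip u v" for c u v
    using fin by (subst (1 2) ip[where F = "supp u \<union> supp (c *\<^sub>C u)"])
      (auto simp: r_scale sum_distrib_left mult.assoc)
  have herm: "ip v u = cnj (ip u v)" for u v
    using fin by (subst (1 2) ip[where F = "supp u \<union> supp v"]) (auto simp: mult.commute)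
  have pos: "0 < Re (ip u u)" if "u \<noteq> 0" for u
  proof -
    have "supp u \<noteq> {}"
    proof
      assume "supp u = {}"
      then have "{b. cvec.representation B u b \<noteq> 0} = {}" by (simp only: supp_def r_def)
      then show False
        using cvec.sum_nonzero_representation_eq[OF B(1), of u] B(2) that by (metis sum.empty UNIV_I)
    qed
    then have "0 < (\<Sum>b\<in>supp u. (cmod (r u b))\<^sup>2)"
      using fin by (intro sum_pos) (auto simp: supp_def)
    then show ?thesis by (simp add: ip_def complex_norm_square[symmetric] flip: of_real_power of_real_sum)
  qed
  have "inner_product ip"
    unfolding inner_product_def clinear_iff scaleC_complex_def
    by (intro conjI allI impI add scale herm pos)
  then show ?thesis by blast
qed

definition tensor_ip :: "('u::complex_vector \<Rightarrow> 'u \<Rightarrow> complex) \<Rightarrow> ('w::complex_vector \<Rightarrow> 'w \<Rightarrow> complex) \<Rightarrow>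
    'u \<otimes> 'w \<Rightarrow> 'u \<otimes> 'w \<Rightarrow> complex"
  where "tensor_ip p q s t = tsum s (\<lambda>u w. tsum t (\<lambda>u' w'. p u u' * q w w'))"

text \<open>Writing t as a sum of c(e) \<otimes> e with e orthonormal for q, the value at (t, t)
  becomes the sum of p(c(e), c(e)), and some c(e) is nonzero.\<close>

lemma inner_product_tensor:
  assumes "inner_product p" "inner_product q"
  shows "inner_product (tensor_ip p q)"
proof -
  interpret p: inner_space p by unfold_locales (rule assms)
  interpret q: inner_space q by unfold_locales (rule assms)
  have lin_t: "clinear (\<lambda>s. tensor_ip p q s t)" for t
    unfolding tensor_ip_def by (simp add: lin)
  have herm: "tensor_ip p q t s = cnj (tensor_ip p q s t)" for s t
    unfolding tensor_ip_def
    by (subst tsum_swap) (simp only: additive_tsum[of cnj] complex_cnj_add complex_cnj_mult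
      p.ip_cnj[symmetric] q.ip_cnj[symmetric])
  have "balanced (\<lambda>u' w'. p u u' * q w w')" for u w
    by (simp add: balanced_def p.ip_add_right q.ip_add_right p.ip_scale_right q.ip_scale_right algebra_simps)
  then have tens: "tensor_ip p q (u \<otimes> w) (u' \<otimes> w') = p u u' * q w w'" for u w u' w'
    unfolding tensor_ip_def by (simp add: tsum_bil tsum_tens lin)
  have sum_left: "tensor_ip p q (sum f E) t = (\<Sum>e\<in>E. tensor_ip p q (f e) t)" for f t and E :: "'b set"
    by (rule clinear_sum[OF lin_t])
  have sum_right: "tensor_ip p q s (sum f E) = (\<Sum>e\<in>E. tensor_ip p q s (f e))" for f s and E :: "'b set"
    by (simp add: herm[of s] sum_left)
  have "0 < Re (tensor_ip p q t t)" if "t \<noteq> 0" for t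
  proof -
    obtain E where E: "finite E" "q.orthonormal E" "t = (\<Sum>e\<in>E. tsum t (\<lambda>u v. q v e *\<^sub>C u) \<otimes> e)"
      by (rule q.tensor_orthonormal_right)
    define c where "c e = tsum t (\<lambda>u v. q v e *\<^sub>C u)" for e
    have t: "t = (\<Sum>e\<in>E. c e \<otimes> e)" using E(3) by (simp add: c_def)
    have "tensor_ip p q t t = (\<Sum>e\<in>E. \<Sum>e'\<in>E. p (c e) (c e') * q e e')"
      by (simp add: t sum_left sum_right tens) (rule sum.swap)
    also have "\<dots> = (\<Sum>e\<in>E. p (c e) (c e))"
    proof (rule sum.cong[OF refl])
      fix e assume e: "e \<in> E"
      have "(\<Sum>e'\<in>E. p (c e) (c e') * q e e') = (\<Sum>e'\<in>E. if e = e' then p (c e) (c e') else 0)"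
        using E(2) e by (intro sum.cong) (auto simp: q.orthonormal_def)
      then show "(\<Sum>e'\<in>E. p (c e) (c e') * q e e') = p (c e) (c e)" using E(1) e by simp
    qed
    finally have eq: "Re (tensor_ip p q t t) = (\<Sum>e\<in>E. Re (p (c e) (c e)))" by simp
    obtain e where "e \<in> E" "c e \<noteq> 0"
    proof (rule ccontr)
      assume "\<not> thesis"
      then have "c e = 0" if "e \<in> E" for e
        using that \<open>\<And>e. e \<in> E \<Longrightarrow> c e \<noteq> 0 \<Longrightarrow> thesis\<close> by blast
      then have "c e \<otimes> e = 0" if "e \<in> E" for e
        using that clinear_zero[of "\<lambda>u. u \<otimes> e"] by (simp add: lin)
      then show False using t \<open>t \<noteq> 0\<close> by simp
    qed
    moreover have "0 \<le> Re (p u u)" for u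
      using p.ip_pos[of u] by (cases "u = 0") (auto simp: p.ip_zero_left intro: less_imp_le)
    ultimately show ?thesis
      unfolding eq using E(1) p.ip_pos by (intro sum_pos2[of _ e]) auto
  qed
  then show ?thesis
    unfolding inner_product_def using lin_t herm by blast
qed

section \<open>Integrals\<close>

text \<open>The two halves of \<open>normal_integral\<close> are separated, and normalisation is
  left out, because for B one half is computed and the other is deduced from it.\<close>

definition right_integral :: "'k::complex_vector bialg \<Rightarrow> ('k \<Rightarrow> complex) \<Rightarrow> bool" where
  "right_integral K \<phi> \<longleftrightarrow> clinear \<phi> \<and> (\<forall>x. sw2 K x (\<lambda>x1 x2. \<phi> x1 *\<^sub>C x2) = \<phi> x *\<^sub>C \<one>\<^bsub>K\<^esub>)"

definition left_integral :: "'k::complex_vector bialg \<Rightarrow> ('k \<Rightarrow> complex) \<Rightarrow> bool" where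
  "left_integral K \<phi> \<longleftrightarrow> clinear \<phi> \<and> (\<forall>x. sw2 K x (\<lambda>x1 x2. \<phi> x2 *\<^sub>C x1) = \<phi> x *\<^sub>C \<one>\<^bsub>K\<^esub>)"

text \<open>Evaluate \<omega> \<otimes> \<phi> on the coproduct of x in two ways.\<close>

lemma integral_unique:
  assumes "right_integral K \<omega>" "left_integral K \<phi>" "\<omega> \<one>\<^bsub>K\<^esub> = 1" "\<phi> \<one>\<^bsub>K\<^esub> = 1"
  shows "\<omega> = \<phi>"
proof
  fix x
  have w: "clinear \<omega>" and f: "clinear \<phi>" using assms by (simp_all add: right_integral_def left_integral_def)
  have "\<omega> x = \<phi> (sw2 K x (\<lambda>x1 x2. \<omega> x1 *\<^sub>C x2))"
    using assms by (simp add: right_integral_def clinear_scale[OF f] scaleC_complex_def)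
  also have "\<dots> = \<omega> (sw2 K x (\<lambda>x1 x2. \<phi> x2 *\<^sub>C x1))"
    by (simp add: sw2_map w f clinear_scale[OF f] clinear_scale[OF w] scaleC_complex_def mult.commute)
  also have "\<dots> = \<phi> x"
    using assms by (simp add: left_integral_def clinear_scale[OF w] scaleC_complex_def)
  finally show "\<omega> x = \<phi> x" .
qed

context hopf_algebra
begin

text \<open>Strong invariance: invariance is applied to the product u y1, multiplied by S(y2), and
  then the last legs of y cancel.\<close>

lemma right_integral_mul_right:
  assumes "right_integral K \<phi>"
  shows "sw2 K u (\<lambda>u1 u2. \<phi> (u1 \<cdot> y) *\<^sub>C u2) = sw2 K y (\<lambda>y1 y2. \<phi> (u \<cdot> y1) *\<^sub>C S y2)"
proof -
  from assms have f: "clinear \<phi>" and int: "\<And>x. sw2 K x (\<lambda>x1 x2. \<phi> x1 *\<^sub>C x2) = \<phi> x *\<^sub>C \<one>"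
    by (simp_all add: right_integral_def)
  note [lin] = clinear_compose[OF f]
  have "sw2 K y (\<lambda>y1 y2. \<phi> (u \<cdot> y1) *\<^sub>C S y2)
      = sw2 K y (\<lambda>y1 y2. sw2 K (u \<cdot> y1) (\<lambda>p1 p2. \<phi> p1 *\<^sub>C p2) \<cdot> S y2)"
    by (simp add: int al.scale_left mul_unity_left)
  also have "\<dots> = sw2 K y (\<lambda>y1 y2. sw2 K u (\<lambda>u1 u2. sw2 K y1 (\<lambda>z1 z2. \<phi> (u1 \<cdot> z1) *\<^sub>C (u2 \<cdot> (z2 \<cdot> S y2)))))"
    by (simp add: sw2_mul lin id.sw2_left[symmetric] al.scale_left mul_assoc)
  also have "\<dots> = sw2 K u (\<lambda>u1 u2. sw2 K y (\<lambda>y1 y2. \<phi> (u1 \<cdot> y1) *\<^sub>C (u2 \<cdot> sw2 K y2 (\<lambda>y2 y3. y2 \<cdot> S y3))))"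
    by (subst sw2_swap) (simp add: co.sw2_assoc lin id.sw2_right[symmetric] sw2_scale)
  also have "\<dots> = sw2 K u (\<lambda>u1 u2. sw2 K y (\<lambda>y1 y2. \<epsilon> y2 *\<^sub>C \<phi> (u1 \<cdot> y1) *\<^sub>C u2))"
    by (simp add: antipode_right al.scale_right mul_unity_right mult.commute)
  also have "\<dots> = sw2 K u (\<lambda>u1 u2. \<phi> (u1 \<cdot> y) *\<^sub>C u2)"
    by (simp only: co.sw2_counit_right[where f = "\<lambda>y. \<phi> (_ \<cdot> y) *\<^sub>C _"] lin)
  finally show ?thesis ..
qed

lemma right_integral_mul_left:
  assumes "right_integral K \<phi>"
  shows "sw2 K u (\<lambda>u1 u2. \<phi> (y \<cdot> u1) *\<^sub>C S u2) = sw2 K y (\<lambda>y1 y2. \<phi> (y1 \<cdot> u) *\<^sub>C y2)"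
  by (rule right_integral_mul_right[OF assms, symmetric])

lemma left_integral_mul_left:
  assumes "left_integral K \<phi>"
  shows "sw2 K y (\<lambda>y1 y2. \<phi> (x \<cdot> y2) *\<^sub>C y1) = sw2 K x (\<lambda>x1 x2. \<phi> (x2 \<cdot> y) *\<^sub>C S x1)"
proof -
  from assms have f: "clinear \<phi>" and int: "\<And>x. sw2 K x (\<lambda>x1 x2. \<phi> x2 *\<^sub>C x1) = \<phi> x *\<^sub>C \<one>"
    by (simp_all add: left_integral_def)
  note [lin] = clinear_compose[OF f]
  have "sw2 K x (\<lambda>x1 x2. \<phi> (x2 \<cdot> y) *\<^sub>C S x1)
      = sw2 K x (\<lambda>x1 x2. S x1 \<cdot> sw2 K (x2 \<cdot> y) (\<lambda>p1 p2. \<phi> p2 *\<^sub>C p1))"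
    by (simp add: int al.scale_right mul_unity_right)
  also have "\<dots> = sw2 K x (\<lambda>x1 x2. sw2 K x2 (\<lambda>x2 x3. sw2 K y (\<lambda>y1 y2. \<phi> (x3 \<cdot> y2) *\<^sub>C ((S x1 \<cdot> x2) \<cdot> y1))))"
    by (simp add: sw2_mul lin id.sw2_right[symmetric] al.scale_right mul_assoc)
  also have "\<dots> = sw2 K x (\<lambda>x1 x3. sw2 K x1 (\<lambda>x1 x2. sw2 K y (\<lambda>y1 y2. \<phi> (x3 \<cdot> y2) *\<^sub>C ((S x1 \<cdot> x2) \<cdot> y1))))"
    by (simp add: co.sw2_assoc lin)
  also have "\<dots> = sw2 K y (\<lambda>y1 y2. sw2 K x (\<lambda>x1 x3. \<phi> (x3 \<cdot> y2) *\<^sub>C (sw2 K x1 (\<lambda>x1 x2. S x1 \<cdot> x2) \<cdot> y1)))"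
    by (simp add: id.sw2_left[symmetric] sw2_scale[symmetric] sw2_swap[where x = y])
  also have "\<dots> = sw2 K y (\<lambda>y1 y2. sw2 K x (\<lambda>x1 x2. \<epsilon> x1 *\<^sub>C \<phi> (x2 \<cdot> y2) *\<^sub>C y1))"
    by (simp add: antipode_left al.scale_left mul_unity_left mult.commute)
  also have "\<dots> = sw2 K y (\<lambda>y1 y2. \<phi> (x \<cdot> y2) *\<^sub>C y1)"
    by (simp only: co.sw2_counit_left[where f = "\<lambda>x. \<phi> (x \<cdot> _) *\<^sub>C _"] lin)
  finally show ?thesis ..
qed

end

text \<open>The averaged form is the sum of p(u0, v0) \<phi>(star v1 u1), that is, the pullback
  along \<delta> of the tensor product of p with the form of \<phi>. Strong invariance of \<phi>
  yields its invariance under the coaction.\<close>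

theorem (in star_hopf_algebra) compact_quantum_group_criterion:
  assumes int: "right_integral K \<phi>" and F: "inner_product (\<lambda>u v. \<phi> (star v \<cdot> u))"
  shows "compact_quantum_group TYPE('v::complex_vector) K star"
  unfolding compact_quantum_group_def
proof (intro conjI allI impI)
  show "star_hopf_algebra K star" ..
  fix \<delta> :: "'v \<Rightarrow> 'v \<otimes> 'k"
  assume "right_comodule K \<delta>"
  then have d: "clinear \<delta>"
    and d_coassoc: "tsum (\<delta> v) (\<lambda>v0 v1. tsum (\<delta> v0) (\<lambda>v00 v01. v00 \<otimes> v01 \<otimes> v1)) =
      tsum (\<delta> v) (\<lambda>v0 v1. sw2 K v1 (\<lambda>v11 v12. v0 \<otimes> v11 \<otimes> v12))"
    and d_counit: "tsum (\<delta> v) (\<lambda>v0 v1. \<epsilon>\<^bsub>K\<^esub> v1 *\<^sub>C v0) = v" for v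
    unfolding right_comodule_def by blast+
  note [lin] = clinear_compose[OF d]
  have f: "clinear \<phi>" using int by (simp add: right_integral_def)
  note [lin] = clinear_compose[OF f]
  interpret F: inner_space "\<lambda>u v. \<phi> (star v \<cdot> u)" by unfold_locales (rule F)
  obtain p :: "'v \<Rightarrow> 'v \<Rightarrow> complex" where p: "inner_product p" using inner_product_exists by blast
  interpret p: inner_space p by unfold_locales (rule p)
  let ?T = "tensor_ip p (\<lambda>u v. \<phi> (star v \<cdot> u))"
  interpret T: inner_space ?T by unfold_locales (rule inner_product_tensor[OF p F])
  have coassoc': "tsum (\<delta> v) (\<lambda>v0 w. tsum (\<delta> v0) (\<lambda>u v. G u v w)) = tsum (\<delta> v) (\<lambda>u y. sw2 K y (G u))"
    if [lin]: "\<And>v w. clinear (\<lambda>u. G u v w)" "\<And>u w. clinear (\<lambda>v. G u v w)" "\<And>u v. clinear (G u v)"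
    for v and G :: "'v \<Rightarrow> 'k \<Rightarrow> 'k \<Rightarrow> 'k"
  proof -
    define h where "h t = tsum t (\<lambda>u r. tsum r (\<lambda>v w. G u v w))" for t
    have h: "clinear h" unfolding h_def by (simp add: lin)
    have ht: "h (u \<otimes> v \<otimes> w) = G u v w" for u v w
      unfolding h_def by (simp add: tsum_bil lin)
    show ?thesis
      using arg_cong[OF d_coassoc, of h v] by (simp add: clinear_tsum_map[OF h] sw2_map[OF h] ht)
  qed
  \<comment> \<open>The counit recovers u from \<open>\<delta> u\<close>, so the coaction is
    injective and the pulled back form stays definite.\<close>
  have \<delta>0: "\<delta> u \<noteq> 0" if "u \<noteq> 0" for u
    using d_counit[of u] that tsum_zero[of "\<lambda>v0 v1. \<epsilon>\<^bsub>K\<^esub> v1 *\<^sub>C v0"]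
    by (auto simp: lin cbilinear_imp_balanced)
  have "inner_product (\<lambda>u v. ?T (\<delta> u) (\<delta> v))"
    unfolding inner_product_def by (intro conjI allI impI T.lin_ip d T.ip_cnj T.ip_pos \<delta>0)
  moreover have "tsum (\<delta> u) (\<lambda>u0 u1. ?T (\<delta> u0) (\<delta> v) *\<^sub>C S u1) =
      tsum (\<delta> v) (\<lambda>v0 v1. ?T (\<delta> u) (\<delta> v0) *\<^sub>C star v1)" for u v
  proof -
    have "tsum (\<delta> u) (\<lambda>u0 u1. ?T (\<delta> u0) (\<delta> v) *\<^sub>C S u1)
        = tsum (\<delta> u) (\<lambda>u0 u1. tsum (\<delta> u0) (\<lambda>u00 u01. tsum (\<delta> v) (\<lambda>v0 v1. (p u00 v0 * \<phi> (star v1 \<cdot> u01)) *\<^sub>C S u1)))"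
      unfolding tensor_ip_def by (simp add: clinear_tsum_map[where h = "\<lambda>c. c *\<^sub>C _"] lin)
    also have "\<dots> = tsum (\<delta> u) (\<lambda>u0 u1. sw2 K u1 (\<lambda>u11 u12. tsum (\<delta> v) (\<lambda>v0 v1. (p u0 v0 * \<phi> (star v1 \<cdot> u11)) *\<^sub>C S u12)))"
      by (rule coassoc') (simp_all add: lin)
    also have "\<dots> = tsum (\<delta> u) (\<lambda>u0 u1. tsum (\<delta> v) (\<lambda>v0 v1. p u0 v0 *\<^sub>C sw2 K u1 (\<lambda>u11 u12. \<phi> (star v1 \<cdot> u11) *\<^sub>C S u12)))"
      unfolding sw2_def by (simp only: tsum_swap[where t = "\<delta> v"] tsum_scale[symmetric] scaleC_scaleC)
    also have "\<dots> = tsum (\<delta> u) (\<lambda>u0 u1. tsum (\<delta> v) (\<lambda>v0 v1. p u0 v0 *\<^sub>C sw2 K v1 (\<lambda>y1 y2. \<phi> (star y1 \<cdot> u1) *\<^sub>C star y2)))"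
      by (simp add: right_integral_mul_left[OF int] sw2_star cbilinear_imp_balanced lin)
    finally have 1: "tsum (\<delta> u) (\<lambda>u0 u1. ?T (\<delta> u0) (\<delta> v) *\<^sub>C S u1) = \<dots>" .
    \<comment> \<open>This side is conjugate linear in both legs of \<open>\<delta> v\<close>. Under
      the star it becomes linear, and \<open>coassoc'\<close> applies.\<close>
    have "star (tsum (\<delta> v) (\<lambda>v0 v1. ?T (\<delta> u) (\<delta> v0) *\<^sub>C star v1))
        = tsum (\<delta> v) (\<lambda>v0 v1. ?T (\<delta> v0) (\<delta> u) *\<^sub>C v1)"
      by (simp only: star_tsum star_scale star_star T.ip_cnj[symmetric])
    also have "\<dots> = tsum (\<delta> v) (\<lambda>v0 v1. tsum (\<delta> v0) (\<lambda>v00 v01. tsum (\<delta> u) (\<lambda>u0 u1. (p v00 u0 * \<phi> (star u1 \<cdot> v01)) *\<^sub>C v1)))"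
      unfolding tensor_ip_def by (simp add: clinear_tsum_map[where h = "\<lambda>c. c *\<^sub>C _"] lin)
    also have "\<dots> = tsum (\<delta> v) (\<lambda>v0 v1. sw2 K v1 (\<lambda>v11 v12. tsum (\<delta> u) (\<lambda>u0 u1. (p v0 u0 * \<phi> (star u1 \<cdot> v11)) *\<^sub>C v12)))"
      by (rule coassoc') (simp_all add: lin)
    finally have "tsum (\<delta> v) (\<lambda>v0 v1. ?T (\<delta> u) (\<delta> v0) *\<^sub>C star v1)
        = star (tsum (\<delta> v) (\<lambda>v0 v1. sw2 K v1 (\<lambda>v11 v12. tsum (\<delta> u) (\<lambda>u0 u1. (p v0 u0 * \<phi> (star u1 \<cdot> v11)) *\<^sub>C v12))))"
      by (metis star_star)
    also have "\<dots> = tsum (\<delta> v) (\<lambda>v0 v1. sw2 K v1 (\<lambda>v11 v12. tsum (\<delta> u) (\<lambda>u0 u1. (p u0 v0 * \<phi> (star v11 \<cdot> u1)) *\<^sub>C star v12)))"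
      by (simp only: star_tsum star_sw2 star_scale complex_cnj_mult p.ip_cnj[symmetric] F.ip_cnj[symmetric])
    also have "\<dots> = tsum (\<delta> u) (\<lambda>u0 u1. tsum (\<delta> v) (\<lambda>v0 v1. p u0 v0 *\<^sub>C sw2 K v1 (\<lambda>y1 y2. \<phi> (star y1 \<cdot> u1) *\<^sub>C star y2)))"
      unfolding sw2_def by (simp only: tsum_swap[where t = "\<delta> u"] tsum_scale[symmetric] scaleC_scaleC)
    finally show ?thesis using 1 by simp
  qed
  ultimately show "\<exists>ip. invariant_inner_product K star \<delta> ip"
    unfolding invariant_inner_product_def by blast
qed

lemma (in inner_space) orthogonal_projection:
  assumes "finite E" "orthonormal E"
  obtains w where "w \<in> cvec.span E" "\<And>v. v \<in> cvec.span E \<Longrightarrow> ip (u - w) v = 0"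
proof
  let ?w = "\<Sum>e\<in>E. ip u e *\<^sub>C e"
  show "?w \<in> cvec.span E" by (intro cvec.span_sum cvec.span_scale cvec.span_base)
  have "ip ?w e = ip u e" if "e \<in> E" for e
  proof -
    have "ip ?w e = (\<Sum>a\<in>E. if a = e then ip u a else 0)"
      unfolding ip_sum_left ip_scale_left using assms(2) that
      by (intro sum.cong) (auto simp: orthonormal_def)
    then show ?thesis using assms(1) that by simp
  qed
  then have base: "ip (u - ?w) e = 0" if "e \<in> E" for e
    using that by (simp add: ip_diff_left)
  show "ip (u - ?w) v = 0" if "v \<in> cvec.span E" for v
    using that
    by (induction rule: cvec.span_induct_alt) (simp_all add: base ip_zero_right ip_add_right ip_scale_right)
qed

section \<open>Positivity of the integral\<close>

text \<open>\<open>p\<close> is an invariant inner product on K regarded as a comodule over itself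
  by its coproduct, as provided by the definition of a compact quantum group.\<close>

locale haar = star_hopf_algebra K star
  for K :: "'k::complex_vector bialg" (structure) and star +
  fixes \<phi> :: "'k \<Rightarrow> complex" and p :: "'k \<Rightarrow> 'k \<Rightarrow> complex"
  assumes normal: "normal_integral K \<phi>"
    and inner_p: "inner_product p"
    and inv_p: "sw2 K u (\<lambda>u1 u2. p u1 v *\<^sub>C S u2) = sw2 K v (\<lambda>v1 v2. p u v1 *\<^sub>C star v2)"
begin

sublocale p: inner_space p
  by unfold_locales (rule inner_p)

lemma clinear_integral: "clinear \<phi>"
  and integral_unity: "\<phi> \<one> = 1"
  and right_integral: "right_integral K \<phi>"
  and left_integral: "left_integral K \<phi>"
  using normal unfolding normal_integral_def right_integral_def left_integral_def by blast+

lemma lin_integral [lin]: "clinear f \<Longrightarrow> clinear (\<lambda>x. \<phi> (f x))"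
  by (rule clinear_compose[OF clinear_integral])

text \<open>The map x -> cnj (\<phi> (star x)) is again a right integral with value 1 at the unit,
  so uniqueness applies.\<close>

lemma integral_star: "\<phi> (star x) = cnj (\<phi> x)"
proof -
  have [lin]: "clinear (\<lambda>x. cnj (\<phi> (star x)))"
    by (simp add: clinear_iff star_add star_scale clinear_add[OF clinear_integral]
      clinear_scale[OF clinear_integral] scaleC_complex_def)
  have "sw2 K x (\<lambda>x1 x2. cnj (\<phi> (star x1)) *\<^sub>C x2) = cnj (\<phi> (star x)) *\<^sub>C \<one>" for x
  proof -
    have "sw2 K x (\<lambda>x1 x2. cnj (\<phi> (star x1)) *\<^sub>C x2) = star (sw2 K x (\<lambda>x1 x2. \<phi> (star x1) *\<^sub>C star x2))"
      by (simp add: star_sw2 star_scale star_star)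
    also have "\<dots> = star (sw2 K (star x) (\<lambda>x1 x2. \<phi> x1 *\<^sub>C x2))"
      by (simp add: sw2_star cbilinear_imp_balanced lin)
    finally show ?thesis
      using right_integral by (simp add: right_integral_def star_scale star_unity)
  qed
  then have "right_integral K (\<lambda>x. cnj (\<phi> (star x)))"
    by (simp add: right_integral_def lin)
  from fun_cong[OF integral_unique[OF this left_integral]]
  have "cnj (\<phi> (star x)) = \<phi> x" by (simp add: star_unity integral_unity)
  then show ?thesis by (metis complex_cnj_cnj)
qed

text \<open>Transporting the invariant inner product \<open>p\<close> along the star turns its invariance into the
  invariance satisfied by \<open>r\<close>, so that the two forms can be compared.\<close>

definition q :: "'k \<Rightarrow> 'k \<Rightarrow> complex" where "q u v = p (star v) (star u)"

definition r :: "'k \<Rightarrow> 'k \<Rightarrow> complex" where "r u v = \<phi> (u \<cdot> star v)"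

lemma inner_q: "inner_product q"
  unfolding inner_product_def
proof (intro conjI allI impI)
  show "clinear (\<lambda>u. q u v)" for v
    by (simp add: clinear_iff q_def star_add star_scale p.ip_add_right p.ip_scale_right scaleC_complex_def)
  show "q v u = cnj (q u v)" for u v unfolding q_def by (rule p.ip_cnj)
  show "0 < Re (q u u)" if "u \<noteq> 0" for u
    using that star_inject[of u 0] unfolding q_def by (intro p.ip_pos) (simp add: star_zero)
qed

sublocale q: inner_space q
  by unfold_locales (rule inner_q)

lemma r_cnj: "r v u = cnj (r u v)"
  by (simp add: r_def integral_star[symmetric] star_mul star_star)

lemma lin_r [lin]: "clinear f \<Longrightarrow> clinear (\<lambda>x. r (f x) v)"
  unfolding r_def by (simp add: lin)

lemma r_add_left: "r (u + u') v = r u v + r u' v"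
  and r_scale_left: "r (c *\<^sub>C u) v = c * r u v"
  by (simp_all add: clinear_add[of "\<lambda>u. r u v"] clinear_scale[of "\<lambda>u. r u v"] lin scaleC_complex_def)

lemma r_add_right: "r u (v + v') = r u v + r u v'"
  and r_scale_right: "r u (c *\<^sub>C v) = cnj c * r u v"
  by (simp_all only: r_cnj[of u "v + v'"] r_cnj[of u "c *\<^sub>C v"] r_cnj[of u v] r_cnj[of u v']
    r_add_left r_scale_left complex_cnj_add complex_cnj_mult)

lemma r_sum_right: "r u (sum f A) = (\<Sum>a\<in>A. r u (f a))"
proof (induction A rule: infinite_finite_induct)
  case (infinite A)
  then show ?case using r_scale_right[of u 0 0] by simp
next
  case empty
  then show ?case using r_scale_right[of u 0 0] by simp
qed (simp add: r_add_right)

text \<open>A class of sesquilinear forms that contains both \<open>q\<close> and \<open>r\<close>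
  and, since positivity is not demanded, also \<open>r\<close> minus a multiple of \<open>q\<close>.
  This makes eigenspaces accessible as orthogonal spaces.\<close>

definition invariant_form :: "('k \<Rightarrow> 'k \<Rightarrow> complex) \<Rightarrow> bool" where
  "invariant_form N \<longleftrightarrow> (\<forall>v. clinear (\<lambda>u. N u v)) \<and> (\<forall>u. conj_linear (N u)) \<and>
    (\<forall>u v. sw2 K u (\<lambda>u1 u2. N u1 v *\<^sub>C u2) = sw2 K v (\<lambda>v1 v2. N u v1 *\<^sub>C S (star v2)))"

lemma invariant_form_q: "invariant_form q"
proof -
  have "sw2 K v (\<lambda>v1 v2. q u v1 *\<^sub>C S (star v2)) = sw2 K (star v) (\<lambda>v1 v2. p v1 (star u) *\<^sub>C S v2)" for u v
    by (simp add: sw2_star cbilinear_imp_balanced lin q_def)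
  moreover have "sw2 K (star u) (\<lambda>u1 u2. p (star v) u1 *\<^sub>C star u2) = sw2 K u (\<lambda>u1 u2. q u1 v *\<^sub>C u2)" for u v
    by (subst sw2_star) (simp_all add: balanced_def star_add star_scale p.ip_add_right p.ip_scale_right
      scaleC_add_left scaleC_add_right scaleC_scaleC mult.commute q_def star_star)
  ultimately show ?thesis
    unfolding invariant_form_def conj_linear_def
    by (simp add: inv_p lin q.ip_add_right q.ip_scale_right scaleC_complex_def)
qed

lemma invariant_form_r: "invariant_form r"
proof -
  have "sw2 K v (\<lambda>v1 v2. r u v1 *\<^sub>C S (star v2)) = sw2 K (star v) (\<lambda>v1 v2. \<phi> (u \<cdot> v1) *\<^sub>C S v2)" for u v
    by (simp add: sw2_star cbilinear_imp_balanced lin r_def)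
  then show ?thesis
    unfolding invariant_form_def conj_linear_def
    by (simp add: right_integral_mul_right[OF right_integral, symmetric] lin r_add_right r_scale_right scaleC_complex_def)
      (simp add: r_def)
qed

lemma invariant_form_diff: "invariant_form N \<Longrightarrow> invariant_form (\<lambda>u v. r u v - l * N u v)"
  using invariant_form_r unfolding invariant_form_def conj_linear_def
  by (auto simp: lin cvec.scale_left_diff_distrib algebra_simps sw2_def tsum_def sum_subtractf scaleC_complex_def
      scaleC_scaleC[symmetric] cvec.scale_sum_right[symmetric] simp del: cvec.scale_scale)

text \<open>A right subcomodule: the coproduct maps V into V \<otimes> K. Testing the second leg by
  functionals avoids speaking of subspaces of a tensor product.\<close>

definition coideal :: "'k set \<Rightarrow> bool" where
  "coideal V \<longleftrightarrow> cvec.subspace V \<and>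
    (\<forall>u f. u \<in> V \<longrightarrow> clinear f \<longrightarrow> sw2 K u (\<lambda>u1 u2. f u2 *\<^sub>C u1) \<in> V)"

text \<open>Invariance turns slicing u by a functional f into slicing w by the functional y -> cnj
  (f (S (star y))), under which W is stable.\<close>

lemma coideal_orthogonal:
  assumes N: "invariant_form N" and V: "coideal V" "coideal W"
  shows "coideal {u \<in> V. \<forall>w\<in>W. N u w = 0}" (is "coideal ?X")
proof -
  have Nl: "clinear (\<lambda>u. N u v)" and Nr: "conj_linear (N u)"
    and inv: "sw2 K u (\<lambda>u1 u2. N u1 v *\<^sub>C u2) = sw2 K v (\<lambda>v1 v2. N u v1 *\<^sub>C S (star v2))" for u v
    using N unfolding invariant_form_def by blast+
  note [lin] = clinear_compose[OF Nl]
  have "cvec.subspace ?X"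
    using V(1) by (auto simp: coideal_def cvec.subspace_def clinear_zero[OF Nl]
      clinear_add[OF Nl] clinear_scale[OF Nl])
  moreover have "sw2 K u (\<lambda>u1 u2. f u2 *\<^sub>C u1) \<in> ?X" if u: "u \<in> ?X" and f: "clinear f" for u f
  proof -
    note [lin] = clinear_compose[OF f]
    define g where "g y = cnj (f (S (star y)))" for y
    have g: "clinear g"
      by (simp add: g_def clinear_iff star_add star_scale clinear_add[OF clinear_antipode]
        clinear_scale[OF clinear_antipode] clinear_add[OF f] clinear_scale[OF f] scaleC_complex_def)
    have "N (sw2 K u (\<lambda>u1 u2. f u2 *\<^sub>C u1)) w = 0" if "w \<in> W" for w
    proof -
      have "N (sw2 K u (\<lambda>u1 u2. f u2 *\<^sub>C u1)) w = f (sw2 K u (\<lambda>u1 u2. N u1 w *\<^sub>C u2))"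
        by (simp add: sw2_map[OF Nl] sw2_map[OF f] clinear_scale[OF Nl] clinear_scale[OF f] scaleC_complex_def mult.commute)
      also have "\<dots> = sw2 K w (\<lambda>w1 w2. N u w1 * f (S (star w2)))"
        by (simp add: inv sw2_map[OF f] clinear_scale[OF f] scaleC_complex_def)
      also have "\<dots> = N u (sw2 K w (\<lambda>w1 w2. g w2 *\<^sub>C w1))"
        by (simp add: additive_sw2[of "N u", OF conj_linear_add[OF Nr]] conj_linear_scale[OF Nr]
          g_def scaleC_complex_def mult.commute)
      also have "\<dots> = 0"
        using u V(2) g that unfolding coideal_def by blast
      finally show ?thesis .
    qed
    then show ?thesis using u V(1) f unfolding coideal_def by blast
  qed
  ultimately show ?thesis unfolding coideal_def by blast
qed

text \<open>Finiteness of comodules: V consists of all slices of the coproduct of a by functionals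
  on the second leg. It is spanned by the finitely many first legs, and slicing by the counit
  returns a.\<close>

lemma coideal_generated:
  obtains V F where "coideal V" "a \<in> V" "finite F" "V \<subseteq> cvec.span F"
proof
  let ?V = "{sw2 K a (\<lambda>a1 a2. f a2 *\<^sub>C a1) |f. clinear f}"
  let ?F = "fst ` Poly_Mapping.keys (rep_tensor (comul K a))"
  show "finite ?F" by simp
  show "?V \<subseteq> cvec.span ?F"
    by (auto simp: sw2_def tsum_def intro!: cvec.span_sum cvec.span_scale intro: cvec.span_base)
  show "a \<in> ?V"
    using clinear_counit by (auto intro!: exI[of _ "counit K"] simp: co.counit_right)
  show "coideal ?V"
    unfolding coideal_def
  proof (intro conjI allI impI)
    show "cvec.subspace ?V"
      unfolding cvec.subspace_def
    proof (intro conjI ballI allI)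
      show "0 \<in> ?V" by (auto intro!: exI[of _ "\<lambda>x. 0"] simp: lin sw2_def tsum_const_zero)
      fix u v c assume "u \<in> ?V"
      then obtain f where f: "clinear f" "u = sw2 K a (\<lambda>a1 a2. f a2 *\<^sub>C a1)" by blast
      then show "c *\<^sub>C u \<in> ?V"
        by (auto intro!: exI[of _ "\<lambda>x. c * f x"] simp: lin sw2_scale[symmetric] scaleC_scaleC)
      assume "v \<in> ?V"
      then obtain g where "clinear g" "v = sw2 K a (\<lambda>a1 a2. g a2 *\<^sub>C a1)" by blast
      then show "u + v \<in> ?V"
        using f by (auto intro!: exI[of _ "\<lambda>x. f x + g x"] simp: lin sw2_def tsum_plus scaleC_add_left)
    qed
    fix u and g :: "'k \<Rightarrow> complex" assume "u \<in> ?V" and g: "clinear g"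
    then obtain f where f: "clinear f" "u = sw2 K a (\<lambda>a1 a2. f a2 *\<^sub>C a1)" by blast
    note [lin] = clinear_compose[OF f(1)] clinear_compose[OF g]
    \<comment> \<open>Slicing first by f and then by g is slicing by the convolution product of g
      and f.\<close>
    define h where "h y = sw2 K y (\<lambda>y1 y2. g y1 * f y2)" for y
    have "clinear h" unfolding h_def by (simp add: lin)
    have [lin]: "clinear (\<lambda>u. sw2 K u (\<lambda>u1 u2. g u2 *\<^sub>C u1))" by (simp add: lin)
    have "sw2 K u (\<lambda>u1 u2. g u2 *\<^sub>C u1) = sw2 K a (\<lambda>a1 a3. sw2 K a1 (\<lambda>a1 a2. (g a2 * f a3) *\<^sub>C a1))"
      by (simp add: f(2) sw2_map[where h = "\<lambda>u. sw2 K u (\<lambda>u1 u2. g u2 *\<^sub>C u1)"] lin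
        clinear_scale[where f = "\<lambda>u. sw2 K u (\<lambda>u1 u2. g u2 *\<^sub>C u1)"] sw2_scale[symmetric] mult.commute)
    also have "\<dots> = sw2 K a (\<lambda>a1 a2. h a2 *\<^sub>C a1)"
      by (simp add: co.sw2_assoc lin h_def sw2_map[where h = "\<lambda>c. c *\<^sub>C _"])
    finally show "sw2 K u (\<lambda>u1 u2. g u2 *\<^sub>C u1) \<in> ?V" using \<open>clinear h\<close> by blast
  qed
qed

text \<open>The matrix coefficients of \<open>W\<close> in a \<open>p\<close>-orthonormal basis form a unitary matrix, so that the sum of
  $r(e, e)$ over the basis is $\sum |\varepsilon(e)|^2$.\<close>

lemma coideal_eigenvalue_positive:
  assumes W: "coideal W" and E: "finite E" "p.orthonormal E" "cvec.span E = W"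
    and w: "w \<in> W" "w \<noteq> 0" and eig: "\<And>u v. u \<in> W \<Longrightarrow> v \<in> W \<Longrightarrow> r u v = l * q u v"
  obtains c where "0 < c" "l = complex_of_real c"
proof -
  \<comment> \<open>For e running over E these are the matrix coefficients: \<open>comul_W\<close>
    shows that they are the second legs that belong to e in the coproduct.\<close>
  define m where "m a u = sw2 K u (\<lambda>u1 u2. p u1 a *\<^sub>C u2)" for a u
  have E_W: "e \<in> W" if "e \<in> E" for e using that E(3) cvec.span_base by blast
  have comul_W: "comul K u = (\<Sum>e\<in>E. e \<otimes> m e u)" if u: "u \<in> W" for u
  proof -
    \<comment> \<open>D only serves to separate the second legs. The corresponding first legs
      \<open>v d\<close> lie in W, because W is a coideal, and can then be expanded in E.\<close>
    obtain D where D: "finite D" "p.orthonormal D"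
      "comul K u = (\<Sum>d\<in>D. tsum (comul K u) (\<lambda>x y. p y d *\<^sub>C x) \<otimes> d)"
      by (rule p.tensor_orthonormal_right)
    define v where "v d = sw2 K u (\<lambda>x y. p y d *\<^sub>C x)" for d
    have u_eq: "comul K u = (\<Sum>d\<in>D. v d \<otimes> d)" using D(3) by (simp add: v_def sw2_def)
    have "v d \<in> W" for d
      using W u by (simp add: coideal_def v_def lin)
    then have v: "v d = (\<Sum>e\<in>E. p (v d) e *\<^sub>C e)" for d
      using p.orthonormal_expand[OF E(1,2)] E(3) by blast
    have m: "m e u = (\<Sum>d\<in>D. p (v d) e *\<^sub>C d)" for e
      unfolding m_def sw2_def
      by (simp add: u_eq tsum_sum_left cbilinear_imp_balanced lin tsum_tens)
    have "(\<Sum>e\<in>E. e \<otimes> m e u) = (\<Sum>e\<in>E. \<Sum>d\<in>D. p (v d) e *\<^sub>C (e \<otimes> d))"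
      by (simp add: m clinear_sum[where h = "\<lambda>y. _ \<otimes> y"] lin tens_scale_right)
    also have "\<dots> = (\<Sum>d\<in>D. (\<Sum>e\<in>E. p (v d) e *\<^sub>C e) \<otimes> d)"
      by (subst sum.swap) (simp add: clinear_sum[where h = "\<lambda>x. x \<otimes> _"] lin tens_scale_left)
    finally show ?thesis by (simp add: u_eq flip: v)
  qed
  have sw2_W: "sw2 K u F = (\<Sum>e\<in>E. F e (m e u))" if "u \<in> W" "cbilinear F" for u F
    unfolding sw2_def using that
    by (simp add: comul_W tsum_sum_left cbilinear_imp_balanced tsum_tens)
  have expand: "u = (\<Sum>e\<in>E. \<epsilon> e *\<^sub>C m e u)" if "u \<in> W" for u
    using co.counit_left[of u] by (simp add: sw2_W that lin)
  \<comment> \<open>Invariance of \<open>p\<close> says that the antipode takes the coefficient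
    matrix to its adjoint; with the antipode axiom this yields the unitarity relation
    \<open>orth\<close>.\<close>
  have S_m: "S (m a u) = star (m u a)" for a u
    by (simp add: m_def sw2_map[OF clinear_antipode] clinear_scale[OF clinear_antipode] inv_p
      star_sw2 star_scale p.ip_cnj[symmetric])
  have orth: "(\<Sum>e\<in>E. m a e \<cdot> star (m b e)) = p b a *\<^sub>C \<one>" if b: "b \<in> W" for a b
  proof -
    have "(\<Sum>e\<in>E. m a e \<cdot> star (m b e)) = (\<Sum>e\<in>E. sw2 K e (\<lambda>x y. p x a *\<^sub>C (y \<cdot> S (m e b))))"
      by (simp add: S_m) (simp add: m_def id.sw2_left[symmetric] al.scale_left)
    also have "\<dots> = sw2 K b (\<lambda>x z. sw2 K x (\<lambda>x y. p x a *\<^sub>C (y \<cdot> S z)))"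
      by (subst sw2_W[OF b]) (simp_all add: lin)
    also have "\<dots> = sw2 K b (\<lambda>x y. p x a *\<^sub>C sw2 K y (\<lambda>y z. y \<cdot> S z))"
      by (simp add: co.sw2_assoc lin sw2_scale)
    also have "\<dots> = sw2 K b (\<lambda>x y. \<epsilon> y *\<^sub>C p x a *\<^sub>C \<one>)"
      by (simp add: antipode_right mult.commute)
    also have "\<dots> = p b a *\<^sub>C \<one>"
      by (rule co.sw2_counit_right[where f = "\<lambda>x. p x a *\<^sub>C \<one>"]) (simp add: lin)
    finally show ?thesis .
  qed
  have "(\<Sum>e\<in>E. e \<cdot> star e) = (\<Sum>a\<in>E. \<Sum>b\<in>E. (\<epsilon> a * cnj (\<epsilon> b)) *\<^sub>C (\<Sum>e\<in>E. m a e \<cdot> star (m b e)))"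
  proof -
    have star_sum: "star (sum f A) = (\<Sum>a\<in>A. star (f a))" for f and A :: "'k set"
      by (induction A rule: infinite_finite_induct) (simp_all add: star_zero star_add)
    have sum_left: "sum f A \<cdot> y = (\<Sum>a\<in>A. f a \<cdot> y)"
      and sum_right: "y \<cdot> sum f A = (\<Sum>a\<in>A. y \<cdot> f a)" for f y and A :: "'k set"
      by (simp_all add: clinear_sum[where h = "\<lambda>x. x \<cdot> y"] clinear_sum[where h = "\<lambda>x. y \<cdot> x"] lin)
    have "e \<cdot> star e = (\<Sum>a\<in>E. \<Sum>b\<in>E. (\<epsilon> a * cnj (\<epsilon> b)) *\<^sub>C (m a e \<cdot> star (m b e)))" if e: "e \<in> E" for e
    proof -
      have "e \<cdot> star e = (\<Sum>a\<in>E. \<epsilon> a *\<^sub>C m a e) \<cdot> star (\<Sum>b\<in>E. \<epsilon> b *\<^sub>C m b e)"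
        using expand[OF E_W[OF e]] by simp
      also have "\<dots> = (\<Sum>a\<in>E. \<Sum>b\<in>E. (\<epsilon> a *\<^sub>C m a e) \<cdot> (cnj (\<epsilon> b) *\<^sub>C star (m b e)))"
        by (simp add: star_sum star_scale sum_left sum_right) (rule sum.swap)
      finally show ?thesis by (simp add: al.scale_left al.scale_right scaleC_scaleC mult.commute)
    qed
    then have "(\<Sum>e\<in>E. e \<cdot> star e) = (\<Sum>e\<in>E. \<Sum>a\<in>E. \<Sum>b\<in>E. (\<epsilon> a * cnj (\<epsilon> b)) *\<^sub>C (m a e \<cdot> star (m b e)))"
      by simp
    also have "\<dots> = (\<Sum>a\<in>E. \<Sum>b\<in>E. \<Sum>e\<in>E. (\<epsilon> a * cnj (\<epsilon> b)) *\<^sub>C (m a e \<cdot> star (m b e)))"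
      by (subst sum.swap) (intro sum.cong refl sum.swap)
    finally show ?thesis by (simp add: cvec.scale_sum_right)
  qed
  also have "\<dots> = (\<Sum>a\<in>E. of_real ((cmod (\<epsilon> a))\<^sup>2) *\<^sub>C \<one>)"
  proof (rule sum.cong[OF refl])
    fix a assume a: "a \<in> E"
    have "(\<Sum>b\<in>E. (\<epsilon> a * cnj (\<epsilon> b)) *\<^sub>C (\<Sum>e\<in>E. m a e \<cdot> star (m b e)))
        = (\<Sum>b\<in>E. if b = a then (\<epsilon> a * cnj (\<epsilon> b)) *\<^sub>C \<one> else 0)"
      using E(2) a by (intro sum.cong) (auto simp: orth E_W p.orthonormal_def scaleC_one)
    then show "(\<Sum>b\<in>E. (\<epsilon> a * cnj (\<epsilon> b)) *\<^sub>C (\<Sum>e\<in>E. m a e \<cdot> star (m b e)))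
        = of_real ((cmod (\<epsilon> a))\<^sup>2) *\<^sub>C \<one>"
      using E(1) a by (simp add: complex_norm_square[symmetric])
  qed
  finally have "\<phi> (\<Sum>e\<in>E. e \<cdot> star e) = (\<Sum>a\<in>E. of_real ((cmod (\<epsilon> a))\<^sup>2))"
    by (simp add: clinear_sum[OF clinear_integral] clinear_scale[OF clinear_integral] integral_unity scaleC_complex_def)
  moreover have "\<phi> (\<Sum>e\<in>E. e \<cdot> star e) = (\<Sum>e\<in>E. l * q e e)"
    by (simp add: clinear_sum[OF clinear_integral] r_def[symmetric] eig E_W)
  \<comment> \<open>The integral of the sum of e times \<open>star e\<close> is evaluated once by
    unitarity and once by the eigenvalue equation. Both real sums are positive, so l is their
    quotient.\<close>
  ultimately have eq: "of_real (\<Sum>a\<in>E. (cmod (\<epsilon> a))\<^sup>2) = l * of_real (\<Sum>e\<in>E. Re (q e e))"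
    using q.ip_self by (simp add: sum_distrib_left)
  have "0 < (\<Sum>a\<in>E. (cmod (\<epsilon> a))\<^sup>2)"
  proof (rule ccontr)
    assume "\<not> 0 < (\<Sum>a\<in>E. (cmod (\<epsilon> a))\<^sup>2)"
    then have "(\<Sum>a\<in>E. (cmod (\<epsilon> a))\<^sup>2) = 0"
      using sum_nonneg[of E "\<lambda>a. (cmod (\<epsilon> a))\<^sup>2"] by simp
    then have "\<epsilon> a = 0" if "a \<in> E" for a
      using that E(1) by (simp add: sum_nonneg_eq_0_iff)
    then show False using expand[OF w(1)] w(2) by simp
  qed
  moreover have "0 < (\<Sum>e\<in>E. Re (q e e))"
  proof (rule sum_pos[OF E(1)])
    show "E \<noteq> {}" using w E(3) by auto
    fix e assume "e \<in> E"
    then have "e \<noteq> 0" using E(2) p.ip_zero_left[of e] by (auto simp: p.orthonormal_def)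
    then show "0 < Re (q e e)" by (rule q.ip_pos)
  qed
  moreover have "l = of_real ((\<Sum>a\<in>E. (cmod (\<epsilon> a))\<^sup>2) / (\<Sum>e\<in>E. Re (q e e)))"
    unfolding of_real_divide using eq calculation(2)
    by (metis less_numeral_extra(3) nonzero_mult_div_cancel_right of_real_eq_0_iff)
  ultimately show ?thesis using that divide_pos_pos by blast
qed

text \<open>An eigenspace of \<open>r\<close> relative to \<open>q\<close> is a coideal, and so is its orthogonal complement, of smaller
  dimension.\<close>

lemma positive_on_coideal:
  assumes "finite E" "q.orthonormal E" "coideal (cvec.span E)" "u \<in> cvec.span E" "u \<noteq> 0"
  shows "0 < Re (r u u)"
  using assms
proof (induction "card E" arbitrary: E u rule: less_induct)
  case less
  define V where "V = cvec.span E"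
  \<comment> \<open>T represents \<open>r\<close> on V with respect to \<open>q\<close>: r(x, v) =
    q(T x, v) for v in V, so eigenvectors of T solve the eigenvalue equation of the two
    forms.\<close>
  define T where "T x = (\<Sum>e\<in>E. r x e *\<^sub>C e)" for x
  have E: "finite E" "q.orthonormal E" and V: "coideal V" "V \<subseteq> cvec.span E" and u: "u \<in> V" "u \<noteq> 0"
    using less.prems by (simp_all add: V_def)
  have "clinear T"
    by (simp add: T_def clinear_iff r_add_left r_scale_left scaleC_add_left sum.distrib
        cvec.scale_sum_right)
  moreover have T_V: "T x \<in> V" for x
    unfolding T_def V_def by (intro cvec.span_sum cvec.span_scale cvec.span_base)
  moreover have "cvec.subspace V" using V(1) by (simp add: coideal_def)
  ultimately obtain l w where w: "w \<in> V" "w \<noteq> 0" "T w = l *\<^sub>C w"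
    using u by (elim q.eigenvector_exists[OF _ E(1) V(2)]) auto
  have rw: "r w v = l * q w v" if "v \<in> V" for v
  proof -
    have v: "v = (\<Sum>e\<in>E. q v e *\<^sub>C e)"
      using q.orthonormal_expand[OF E] that by (simp add: V_def)
    have "r w v = (\<Sum>e\<in>E. cnj (q v e) * r w e)"
      by (subst v) (simp add: r_sum_right r_scale_right)
    also have "\<dots> = q (T w) v"
      by (simp add: T_def q.ip_sum_left q.ip_scale_left q.ip_cnj[symmetric] mult.commute)
    finally show ?thesis by (simp add: w q.ip_scale_left)
  qed
  define W where "W = {u \<in> V. \<forall>v\<in>V. r u v - l * q u v = 0}"
  define X where "X = {u \<in> V. \<forall>v\<in>W. q u v = 0}"
  have W: "coideal W" unfolding W_def
    by (rule coideal_orthogonal[OF invariant_form_diff[OF invariant_form_q] V(1) V(1)])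
  have X: "coideal X" unfolding X_def
    by (rule coideal_orthogonal[OF invariant_form_q V(1) W])
  have sub: "W \<subseteq> cvec.span E" "X \<subseteq> cvec.span E" "cvec.subspace W" "cvec.subspace X"
    using W X V(2) by (auto simp: W_def X_def coideal_def)
  have wW: "w \<in> W" using w rw by (simp add: W_def)
  have eig: "r x v = l * q x v" if "x \<in> W" "v \<in> V" for x v using that by (simp add: W_def)
  obtain D where D: "finite D" "p.orthonormal D" "cvec.span D = W"
    by (rule p.finite_dimensional_orthonormal[OF E(1) sub(1,3)])
  obtain c where c: "0 < c" "l = complex_of_real c"
    by (rule coideal_eigenvalue_positive[OF W D wW w(2), of l]) (use W_def eig in blast)+
  obtain E' where E': "finite E'" "q.orthonormal E'" "cvec.span E' = X"
    by (rule q.finite_dimensional_orthonormal[OF E(1) sub(2,4)])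
  \<comment> \<open>The eigenvector w lies in W and is not orthogonal to itself. Adding it to a
    basis of X therefore gives a larger independent set, and the dimension drops from V to
    X.\<close>
  have "w \<notin> X" using wW q.ip_pos[OF w(2)] by (force simp: X_def)
  then have wE': "w \<notin> cvec.span E'" by (simp add: E')
  then have "cvec.independent (insert w E')"
    using q.orthonormal_independent[OF E'(1,2)] by (simp add: cvec.independent_insert)
  moreover have "insert w E' \<subseteq> cvec.span E"
    using w V(2) E'(3) sub(2) cvec.span_base[of _ E'] by blast
  ultimately have "card (insert w E') \<le> card E"
    using cvec.independent_span_bound[OF E(1)] by blast
  then have card: "card E' < card E"
    using E'(1) wE' cvec.span_base[of w E'] by (auto simp: card_insert_if split: if_splits)
  have IH: "0 < Re (r x x)" if "x \<in> X" "x \<noteq> 0" for x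
    using less.hyps[OF card E'(1,2)] E'(3) X that by simp
  \<comment> \<open>A second basis of W is needed: D is orthonormal for \<open>p\<close>, as the
    unitarity argument requires, whereas the projection of u is orthogonal for
    \<open>q\<close>.\<close>
  obtain D' where D': "finite D'" "q.orthonormal D'" "cvec.span D' = W"
    by (rule q.finite_dimensional_orthonormal[OF E(1) sub(1,3)])
  obtain y where y: "y \<in> W" "\<And>v. v \<in> W \<Longrightarrow> q (u - y) v = 0"
    using q.orthogonal_projection[OF D'(1,2), of u] D'(3) by metis
  have yV: "y \<in> V" using y by (simp add: W_def)
  define x where "x = u - y"
  have x: "x \<in> X"
    using y u yV \<open>cvec.subspace V\<close> by (simp add: x_def X_def cvec.subspace_diff)
  then have xV: "x \<in> V" by (simp add: X_def)
  have "q x y = 0" using x y by (simp add: X_def)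
  \<comment> \<open>Since y lies in the eigenspace, orthogonality for \<open>q\<close> implies
    orthogonality for \<open>r\<close>. Hence the mixed terms vanish in the expansion of r(u,
    u).\<close>
  then have yx: "r y x = 0" using eig[OF y(1) xV] q.ip_cnj[of x y] by simp
  then have xy: "r x y = 0" using r_cnj[of y x] by simp
  have "u = x + y" by (simp add: x_def)
  then have "r u u = r x x + r y y"
    using xy yx by (simp add: r_add_left r_add_right)
  moreover have "Re (r y y) = c * Re (q y y)"
    using eig[OF y(1) yV] c by simp
  moreover have "0 \<le> Re (q y y)"
    using q.ip_pos[of y] by (cases "y = 0") (auto simp: q.ip_zero_left)
  moreover have "0 \<le> Re (r x x)"
    using IH[OF x] r_scale_left[of 0 x x] by (cases "x = 0") auto
  moreover have "0 < Re (r x x) \<or> 0 < Re (q y y)"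
    using IH[OF x] q.ip_pos[of y] u(2) \<open>u = x + y\<close> by (cases "x = 0") auto
  ultimately show ?case using c(1)
    by (smt (verit) mult_nonneg_nonneg mult_pos_pos plus_complex.sel(1))
qed

theorem inner_product_integral: "inner_product (\<lambda>u v. \<phi> (u \<cdot> star v))"
proof -
  have "0 < Re (r u u)" if "u \<noteq> 0" for u
  proof -
    obtain V F where V: "coideal V" "u \<in> V" and F: "finite F" "V \<subseteq> cvec.span F"
      by (rule coideal_generated)
    then have "cvec.subspace V" by (simp add: coideal_def)
    then obtain E where "finite E" "q.orthonormal E" "cvec.span E = V"
      using q.finite_dimensional_orthonormal[OF F] by blast
    then show ?thesis using positive_on_coideal V that by blast
  qed
  then have "inner_product r"
    unfolding inner_product_def by (intro conjI allI impI r_cnj) (simp_all add: lin)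
  then show ?thesis unfolding r_def[abs_def] .
qed

end

section \<open>The integral of the bismash product\<close>

theorem compact_quantum_group_inner_product:
  fixes K :: "'k::complex_vector bialg"
  assumes "compact_quantum_group TYPE('k) K star" "normal_integral K \<phi>"
  shows "inner_product (\<lambda>u v. \<phi> (u \<cdot>\<^bsub>K\<^esub> star v))"
proof -
  interpret star_hopf_algebra K star
    using assms(1) by (simp add: compact_quantum_group_def)
  have "right_comodule K (comul K)"
    using coassoc counit_right clinear_comul by (simp add: right_comodule_def sw2_def)
  with assms(1) obtain p where "invariant_inner_product K star (comul K) p"
    unfolding compact_quantum_group_def by blast
  then interpret haar K star \<phi> p
    by unfold_locales (use assms(2) in \<open>auto simp: invariant_inner_product_def sw2_def\<close>)
  show ?thesis by (rule inner_product_integral)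
qed

text \<open>\<phi> after S is a right integral, because S reverses the coproduct and is injective,
  and by uniqueness it coincides with \<phi>.\<close>

lemma (in star_hopf_algebra) left_integral_imp_right_integral:
  assumes "left_integral K \<phi>" "\<phi> \<one> = 1"
  shows "right_integral K \<phi>"
proof -
  have f: "clinear \<phi>" and int: "sw2 K x (\<lambda>x1 x2. \<phi> x2 *\<^sub>C x1) = \<phi> x *\<^sub>C \<one>" for x
    using assms(1) by (simp_all add: left_integral_def)
  note [lin] = clinear_compose[OF f]
  have "sw2 K x (\<lambda>x1 x2. \<phi> (S x1) *\<^sub>C x2) = \<phi> (S x) *\<^sub>C \<one>" for x
  proof -
    have "S (sw2 K x (\<lambda>x1 x2. \<phi> (S x1) *\<^sub>C x2)) = sw2 K (S x) (\<lambda>x1 x2. \<phi> x2 *\<^sub>C x1)"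
      by (simp add: sw2_map[OF clinear_antipode] clinear_scale[OF clinear_antipode] sw2_antipode lin)
    also have "\<dots> = S (\<phi> (S x) *\<^sub>C \<one>)"
      by (simp add: int clinear_scale[OF clinear_antipode] antipode_unity)
    finally show ?thesis by (rule injD[OF bij_is_inj[OF bij_antipode]])
  qed
  then have right: "right_integral K (\<lambda>x. \<phi> (S x))"
    by (simp add: right_integral_def lin)
  moreover have "(\<lambda>x. \<phi> (S x)) = \<phi>"
    by (rule integral_unique[OF right assms(1)]) (simp_all add: antipode_unity assms(2))
  ultimately show ?thesis by simp
qed

text \<open>Positivity of the integrals of A and H is an assumption here;
  \<open>compact_quantum_group_inner_product\<close> discharges it when the locale is
  interpreted.\<close>

locale central_linked_pair =
  star_linked_pair A H act \<rho> \<chi> \<psi> \<chi>' \<psi>' starA starH \<gamma>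
  for A :: "'a::complex_vector bialg" and H :: "'h::complex_vector bialg"
    and act (infixr \<open>\<triangleright>\<close> 72) and \<rho> \<chi> \<psi> \<chi>' \<psi>' starA starH \<gamma> +
  fixes \<phi>A \<phi>H
  assumes normal_A: "normal_integral A \<phi>A"
    and normal_H: "normal_integral H \<phi>H"
    and positive_A: "inner_product (\<lambda>a b. \<phi>A (a \<odot> starA b))"
    and positive_H: "inner_product (\<lambda>x y. \<phi>H (x \<bullet> starH y))"
    and central: "bismash_integral \<phi>A \<phi>H ((a \<otimes> x) \<diamondop> (b \<otimes> y)) = bismash_integral \<phi>A \<phi>H ((b \<otimes> y) \<diamondop> (a \<otimes> x))"
begin

abbreviation "\<Phi> \<equiv> bismash_integral \<phi>A \<phi>H"

lemma integrals: "clinear \<phi>A" "clinear \<phi>H" "left_integral A \<phi>A" "left_integral H \<phi>H"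
  and integral_unity: "\<phi>A \<one>\<^bsub>A\<^esub> = 1" "\<phi>H \<one>\<^bsub>H\<^esub> = 1"
  using normal_A normal_H unfolding normal_integral_def left_integral_def by blast+

lemmas [lin] = clinear_compose[OF integrals(1)] clinear_compose[OF integrals(2)]

lemma clinear_Phi: "clinear \<Phi>"
  unfolding bismash_integral_def[abs_def] by (simp add: lin)

lemmas [lin] = clinear_compose[OF clinear_Phi]

lemma Phi_tens: "\<Phi> (a \<otimes> x) = \<phi>A a * \<phi>H x"
  unfolding bismash_integral_def by (simp add: tsum_bil lin)

lemma Phi_i: "\<Phi> (i a) = \<phi>A a"
  by (simp add: Phi_tens integral_unity)

lemma sw2_left_integral_H: "clinear f \<Longrightarrow> sw2 H x (\<lambda>x1 x2. \<phi>H x2 *\<^sub>C f x1) = \<phi>H x *\<^sub>C f \<one>\<^bsub>H\<^esub>"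
  using integrals(4) sw2_map[of f H x "\<lambda>x1 x2. \<phi>H x2 *\<^sub>C x1"]
  by (simp add: left_integral_def clinear_scale)

lemma sw2_left_integral_A: "clinear f \<Longrightarrow> sw2 A a (\<lambda>a1 a2. \<phi>A a2 *\<^sub>C f a1) = \<phi>A a *\<^sub>C f \<one>\<^bsub>A\<^esub>"
  using integrals(3) sw2_map[of f A a "\<lambda>x1 x2. \<phi>A x2 *\<^sub>C x1"]
  by (simp add: left_integral_def clinear_scale)

text \<open>In the coproduct of a # x the leg x3 stands alone in the second factor. Integrating it
  replaces the other legs of x by the unit, where \<psi> and \<rho> are trivial, and invariance on A
  remains.\<close>

lemma left_integral_Phi: "left_integral B \<Phi>"
proof -
  define L where "L a1 a2 x1 x2 = tsum (\<psi> x1) (\<lambda>p q. tsum (\<rho> x2) (\<lambda>h c. \<phi>A (a2 \<odot> q \<odot> c) *\<^sub>C ((a1 \<odot> p) \<otimes> h)))"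
    for a1 a2 x1 x2
  have [lin]: "clinear (L a1 a2 x1)" "clinear (\<lambda>x1. L a1 a2 x1 x2)" for a1 a2 x1 x2
    unfolding L_def by (simp_all add: lin)
  have L_unity: "L a1 a2 \<one>\<^bsub>H\<^esub> \<one>\<^bsub>H\<^esub> = \<phi>A a2 *\<^sub>C i a1" for a1 a2
    by (simp add: L_def psi_unity rho_unity tsum_bil lin A.mul_unity_right)
  have "sw2 B t (\<lambda>u v. \<Phi> v *\<^sub>C u) = \<Phi> t *\<^sub>C eB" for t
  proof (rule tensor_ext[where t = t])
    fix a x
    have "sw2 B (a \<otimes> x) (\<lambda>u v. \<Phi> v *\<^sub>C u)
        = sw2 A a (\<lambda>a1 a2. sw2 H x (\<lambda>x1 r. sw2 H r (\<lambda>x2 x3. \<phi>H x3 *\<^sub>C L a1 a2 x1 x2)))"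
      by (simp add: sw2_B_tens lin Phi_tens L_def tsum_scale[symmetric] mult.commute)
    also have "\<dots> = sw2 A a (\<lambda>a1 a2. \<phi>H x *\<^sub>C \<phi>A a2 *\<^sub>C i a1)"
      by (simp only: sw2_left_integral_H[where f = "L _ _ _"] sw2_left_integral_H[where f = "\<lambda>x. L _ _ x _"] lin L_unity)
    also have "\<dots> = \<Phi> (a \<otimes> x) *\<^sub>C eB"
      by (simp only: sw2_scale sw2_left_integral_A[where f = "\<lambda>a. i a"] lin)
        (simp add: Phi_tens mult.commute)
    finally show "sw2 B (a \<otimes> x) (\<lambda>u v. \<Phi> v *\<^sub>C u) = \<Phi> (a \<otimes> x) *\<^sub>C eB" .
  qed (simp_all add: lin)
  then show ?thesis by (simp add: left_integral_def clinear_Phi unityB)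
qed

lemma Phi_central: "\<Phi> (s \<diamondop> t) = \<Phi> (t \<diamondop> s)"
proof (rule tensor_ext[where t = s])
  show "\<Phi> ((a \<otimes> x) \<diamondop> t) = \<Phi> (t \<diamondop> (a \<otimes> x))" for a x
    by (rule tensor_ext[where t = t]) (simp_all add: lin central)
qed (simp_all add: lin)

lemma phi_central: "\<phi>A (a \<odot> b) = \<phi>A (b \<odot> a)"
  using central[of a "\<one>\<^bsub>H\<^esub>" b "\<one>\<^bsub>H\<^esub>"] by (simp add: i_mulB_tens Phi_i)

text \<open>The coefficient in $j(x) j(z^*)^* = \sum i(G(x_1, z_1)) j(x_2 z_2)$.\<close>

definition G where "G x z = sw2 H x (\<lambda>x1 x2. sw2 H z (\<lambda>z1 z2. (x1 \<triangleright> \<gamma> z1) \<odot> \<chi> x2 z2))"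

lemma lin_G [lin]: "clinear f \<Longrightarrow> clinear (\<lambda>x. G (f x) z)" "clinear f \<Longrightarrow> clinear (\<lambda>z. G x (f z))"
  unfolding G_def by (simp_all add: lin)

text \<open>As \<gamma> after the antipode is \<open>g'\<close>, this is \<open>act_g'\<close> with
  its legs regrouped.\<close>

lemma G_antipode: "sw2 H x (\<lambda>x1 x2. G x1 (SH x2)) = \<epsilon>H x *\<^sub>C \<one>\<^bsub>A\<^esub>"
proof -
  have "sw2 H x (\<lambda>x1 x2. G x1 (SH x2)) =
      sw2 H x (\<lambda>r s. sw2 H r (\<lambda>p q. sw2 H s (\<lambda>u v. (p \<triangleright> g' v) \<odot> \<chi> q (SH u))))"
    by (simp add: G_def H.sw2_antipode lin gamma_antipode)
  also have "\<dots> = sw2 H x (\<lambda>p s. sw2 H s (\<lambda>t v. sw2 H t (\<lambda>q u. (p \<triangleright> g' v) \<odot> \<chi> q (SH u))))"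
    by (simp add: H.co.sw2_assoc lin)
  finally show ?thesis by (simp add: act_g')
qed

text \<open>Invariance of \<open>\<phi>H\<close> trades the leg z1 inside \<open>G x1 z1\<close> for
  the antipode of the next leg of x, and then \<open>G_antipode\<close> removes \<gamma> and \<chi>
  together.\<close>

lemma Phi_j_jh: "\<Phi> (i c \<diamondop> (j x \<diamondop> jh z)) = \<phi>A c * \<phi>H (x \<bullet> z)"
proof -
  have "j x \<diamondop> jh z = sw2 H z (\<lambda>z1 z2. (j x \<diamondop> i (\<gamma> z1)) \<diamondop> j z2)"
    by (simp add: jh_def HB.sw2_right[symmetric] HB.assoc)
  also have "\<dots> = sw2 H z (\<lambda>z1 z2. sw2 H x (\<lambda>x1 x2. i (x1 \<triangleright> \<gamma> z1) \<diamondop> (j x2 \<diamondop> j z2)))"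
    by (simp only: j_i HB.sw2_left[symmetric] HB.assoc)
  also have "\<dots> = sw2 H z (\<lambda>z1 z2. sw2 H x (\<lambda>x1 x2. sw2 H x2 (\<lambda>x2 x3. sw2 H z2 (\<lambda>z2 z3.
      ((x1 \<triangleright> \<gamma> z1) \<odot> \<chi> x2 z2) \<otimes> (x3 \<bullet> z3)))))"
    by (simp add: j_j HB.sw2_right[symmetric] i_mulB_tens A.mul_unity_right)
  also have "\<dots> = sw2 H x (\<lambda>x1 x2. sw2 H x2 (\<lambda>x2 x3. sw2 H z (\<lambda>z1 z2. sw2 H z2 (\<lambda>z2 z3.
      ((x1 \<triangleright> \<gamma> z1) \<odot> \<chi> x2 z2) \<otimes> (x3 \<bullet> z3)))))"
    by (simp only: sw2_swap[where x = z])
  also have "\<dots> = sw2 H x (\<lambda>r x3. sw2 H r (\<lambda>x1 x2. sw2 H z (\<lambda>s z3. sw2 H s (\<lambda>z1 z2.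
      ((x1 \<triangleright> \<gamma> z1) \<odot> \<chi> x2 z2) \<otimes> (x3 \<bullet> z3)))))"
    by (simp add: H.co.sw2_assoc lin)
  also have "\<dots> = sw2 H x (\<lambda>x1 x2. sw2 H z (\<lambda>z1 z2. G x1 z1 \<otimes> (x2 \<bullet> z2)))"
    by (simp add: G_def sw2_map[where h = "\<lambda>u. u \<otimes> _"] lin sw2_swap[where x = z])
  finally have "\<Phi> (i c \<diamondop> (j x \<diamondop> jh z)) = sw2 H x (\<lambda>x1 x2. sw2 H z (\<lambda>z1 z2. \<phi>A (c \<odot> G x1 z1) * \<phi>H (x2 \<bullet> z2)))"
    by (simp add: HB.sw2_right[symmetric] i_mulB_tens sw2_map[OF clinear_Phi] Phi_tens)
  also have "\<dots> = sw2 H x (\<lambda>x1 x2. \<phi>A (c \<odot> G x1 (sw2 H z (\<lambda>z1 z2. \<phi>H (x2 \<bullet> z2) *\<^sub>C z1))))"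
    by (simp add: sw2_map[where h = "\<lambda>z. \<phi>A (c \<odot> G _ z)"] clinear_scale[where f = "\<lambda>z. \<phi>A (c \<odot> G _ z)"] lin
      scaleC_complex_def mult.commute)
  \<comment> \<open>Strong left invariance: the slice of z by x2 becomes a slice of x2 by z, with an
    antipode on the free leg.\<close>
  also have "\<dots> = sw2 H x (\<lambda>x1 r. \<phi>A (c \<odot> G x1 (sw2 H r (\<lambda>x2 x3. \<phi>H (x3 \<bullet> z) *\<^sub>C SH x2))))"
    by (simp only: H.left_integral_mul_left[OF integrals(4)])
  also have "\<dots> = sw2 H x (\<lambda>x1 r. sw2 H r (\<lambda>x2 x3. \<phi>A (c \<odot> G x1 (SH x2)) * \<phi>H (x3 \<bullet> z)))"
    by (simp add: sw2_map[where h = "\<lambda>z. \<phi>A (c \<odot> G _ z)"] clinear_scale[where f = "\<lambda>z. \<phi>A (c \<odot> G _ z)"] lin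
      scaleC_complex_def mult.commute)
  also have "\<dots> = sw2 H x (\<lambda>r x3. sw2 H r (\<lambda>x1 x2. \<phi>A (c \<odot> G x1 (SH x2)) * \<phi>H (x3 \<bullet> z)))"
    by (simp add: H.co.sw2_assoc lin)
  also have "\<dots> = sw2 H x (\<lambda>r x3. \<phi>A (c \<odot> sw2 H r (\<lambda>x1 x2. G x1 (SH x2))) * \<phi>H (x3 \<bullet> z))"
    by (simp add: sw2_map[where h = "\<lambda>y. \<phi>A (c \<odot> y) * _"] lin)
  also have "\<dots> = sw2 H x (\<lambda>r x3. \<epsilon>H r *\<^sub>C (\<phi>A c * \<phi>H (x3 \<bullet> z)))"
    by (simp add: G_antipode A.al.scale_right A.mul_unity_right clinear_scale[OF integrals(1)] scaleC_complex_def mult.assoc)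
  also have "\<dots> = \<phi>A c * \<phi>H (x \<bullet> z)"
    by (rule H.co.sw2_counit_left) (simp add: lin)
  finally show ?thesis .
qed

text \<open>The star of b # y ends with i(starA b). Centrality of \<Phi> brings this factor to the
  front, where \<open>Phi_j_jh\<close> applies, and the trace property of \<open>\<phi>A\<close>
  restores the order.\<close>

lemma Phi_starB:
  "\<Phi> (s \<diamondop> starB t) = tensor_ip (\<lambda>a b. \<phi>A (a \<odot> starA b)) (\<lambda>x y. \<phi>H (x \<bullet> starH y)) s t"
proof -
  let ?T = "tensor_ip (\<lambda>a b. \<phi>A (a \<odot> starA b)) (\<lambda>x y. \<phi>H (x \<bullet> starH y))"
  interpret T: inner_space ?T
    by unfold_locales (rule inner_product_tensor[OF positive_A positive_H])
  have "\<Phi> ((a \<otimes> x) \<diamondop> starB (b \<otimes> y)) = \<phi>A (a \<odot> starA b) * \<phi>H (x \<bullet> starH y)" for a b x y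
  proof -
    have "(a \<otimes> x) \<diamondop> starB (b \<otimes> y) = (i a \<diamondop> (j x \<diamondop> jh (starH y))) \<diamondop> i (starA b)"
      by (simp add: starB_tens i_mulB_tens A.mul_unity_right HB.assoc flip: HB.assoc[of "i a" "j x"])
    then have "\<Phi> ((a \<otimes> x) \<diamondop> starB (b \<otimes> y)) = \<Phi> (i (starA b) \<diamondop> (i a \<diamondop> (j x \<diamondop> jh (starH y))))"
      by (simp add: Phi_central)
    also have "\<dots> = \<Phi> (i (starA b \<odot> a) \<diamondop> (j x \<diamondop> jh (starH y)))"
      by (simp add: HB.assoc[symmetric] i_mulB_tens A.mul_unity_right)
    finally show ?thesis by (simp add: Phi_j_jh phi_central[of "starA b"])
  qed
  moreover have "balanced (\<lambda>b y. \<phi>A (a \<odot> starA b) * \<phi>H (x \<bullet> starH y))" for a x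
    by (simp add: balanced_def A.star_add A.star_scale H.star_add H.star_scale clinear_add[OF integrals(1)]
      clinear_add[OF integrals(2)] clinear_scale[OF integrals(1)] clinear_scale[OF integrals(2)]
      clinear_add[OF cbilinear_right[OF A.cbilinear_mul]] clinear_add[OF cbilinear_right[OF H.cbilinear_mul]]
      A.al.scale_right H.al.scale_right scaleC_complex_def algebra_simps)
  ultimately have tens: "\<Phi> ((a \<otimes> x) \<diamondop> starB (b \<otimes> y)) = ?T (a \<otimes> x) (b \<otimes> y)" for a b x y
    unfolding tensor_ip_def by (simp add: tsum_bil lin tsum_tens)
  show ?thesis
  proof (rule tensor_ext_additive[where t = t])
    show "\<Phi> (s \<diamondop> starB (b \<otimes> y)) = ?T s (b \<otimes> y)" for b y
      by (rule tensor_ext[where t = s]) (simp_all add: lin tens)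
    show "\<Phi> (s \<diamondop> starB (t + t')) = \<Phi> (s \<diamondop> starB t) + \<Phi> (s \<diamondop> starB t')" for t t'
      by (simp add: starB_add clinear_add[of "\<lambda>t. \<Phi> (s \<diamondop> t)"] lin)
  qed (rule T.ip_add_right)
qed

theorem compact_quantum_group_B: "compact_quantum_group TYPE('v::complex_vector) B starB"
proof (rule star_hopf_algebra.compact_quantum_group_criterion[OF star_hopf_algebra_B])
  show "right_integral B \<Phi>"
    by (rule star_hopf_algebra.left_integral_imp_right_integral[OF star_hopf_algebra_B left_integral_Phi])
      (simp add: unityB Phi_tens integral_unity)
  \<comment> \<open>Centrality again: the criterion has the starred factor on the left, the computed
    form has it on the right.\<close>
  have "(\<lambda>u v. \<Phi> (starB v \<diamondop> u)) = tensor_ip (\<lambda>a b. \<phi>A (a \<odot> starA b)) (\<lambda>x y. \<phi>H (x \<bullet> starH y))"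
    by (simp add: fun_eq_iff Phi_starB Phi_central[of "starB _"])
  then show "inner_product (\<lambda>u v. \<Phi> (starB v \<diamondop> u))"
    by (simp add: inner_product_tensor positive_A positive_H)
qed

end

theorem theorem5p10:
  fixes A :: "'a::complex_vector bialg" and H :: "'h::complex_vector bialg"
    and act :: "'h \<Rightarrow> 'a \<Rightarrow> 'a" (infixr \<open>\<triangleright>\<close> 72)
    and \<rho> :: "'h \<Rightarrow> 'h \<otimes> 'a" and \<chi> :: "'h \<Rightarrow> 'h \<Rightarrow> 'a" and \<psi> :: "'h \<Rightarrow> 'a \<otimes> 'a"
    and starA :: "'a \<Rightarrow> 'a" and starH :: "'h \<Rightarrow> 'h"
    and \<gamma> :: "'h \<Rightarrow> 'a"
    and \<phi>A :: "'a \<Rightarrow> complex" and \<phi>H :: "'h \<Rightarrow> complex" and \<Phi> :: "'a \<otimes> 'h \<Rightarrow> complex"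
  assumes linked: "cocycle_linked_pair A H act \<rho> \<chi> \<psi>"
    and cqg_A: "compact_quantum_group TYPE('a) A starA"
    and cqg_H: "compact_quantum_group TYPE('h) H starH"
    and inv_chi: "chi_invertible A H \<chi>"
    and inv_psi: "psi_invertible A H \<psi>"
    and gamma: "\<gamma> = gamma_map A H \<chi>"
    and int_A: "normal_integral A \<phi>A"
    and int_H: "normal_integral H \<phi>H"
    and Phi: "\<Phi> = bismash_integral \<phi>A \<phi>H"
    and central: "\<And>a b x y.
      \<Phi> ((a \<otimes> x) \<cdot>\<^bsub>bismash A H act \<rho> \<chi> \<psi>\<^esub> (b \<otimes> y)) =
      \<Phi> ((b \<otimes> y) \<cdot>\<^bsub>bismash A H act \<rho> \<chi> \<psi>\<^esub> (a \<otimes> x))"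
    and cond_i: "\<And>x.
      sw3 H x (\<lambda>x1 x2 x3. \<gamma> (starH x2) \<cdot>\<^bsub>A\<^esub> (starH x3 \<triangleright> starA (\<gamma> x1))) =
      \<epsilon>\<^bsub>H\<^esub> (starH x) *\<^sub>C \<one>\<^bsub>A\<^esub>"
    and cond_ii: "\<And>a x.
      sw3 H x (\<lambda>x1 x2 x3. \<gamma> (starH x2) \<cdot>\<^bsub>A\<^esub> (starH x3 \<triangleright> starA (x1 \<triangleright> a))) =
      starA a \<cdot>\<^bsub>A\<^esub> \<gamma> (starH x)"
    and cond_iii: "\<And>x y.
      sw2 H x (\<lambda>x1 x2. sw3 H y (\<lambda>y1 y2 y3.
        \<gamma> (starH y1) \<cdot>\<^bsub>A\<^esub> (starH y2 \<triangleright> \<gamma> (starH x1)) \<cdot>\<^bsub>A\<^esub> \<chi> (starH y3) (starH x2))) =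
      sw3 H x (\<lambda>x1 x2 x3. sw3 H y (\<lambda>y1 y2 y3.
        \<gamma> (starH y2 \<cdot>\<^bsub>H\<^esub> starH x2) \<cdot>\<^bsub>A\<^esub>
        ((starH y3 \<cdot>\<^bsub>H\<^esub> starH x3) \<triangleright> starA (\<chi> x1 y1))))"
    and cond_iv: "\<And>x.
      sw2 H x (\<lambda>x1 x2. tsum (\<rho> (starH x2)) (\<lambda>qH qA. qH \<otimes> (\<gamma> (starH x1) \<cdot>\<^bsub>A\<^esub> qA))) =
      sw3 H x (\<lambda>x1 x2 x3. tsum (\<rho> x1) (\<lambda>x1H x1A.
        starH x1H \<otimes> (\<gamma> (starH x2) \<cdot>\<^bsub>A\<^esub> (starH x3 \<triangleright> starA x1A))))"
    and cond_v: "\<And>x.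
      sw2 H x (\<lambda>x1 x2. sw2 A (\<gamma> (starH x1)) (\<lambda>g1 g2. tsum (\<psi> (starH x2)) (\<lambda>qI qII.
        (g1 \<cdot>\<^bsub>A\<^esub> qI) \<otimes> (g2 \<cdot>\<^bsub>A\<^esub> qII)))) =
      sw5 H x (\<lambda>x1 x2 x3 x4 x5. tsum (\<psi> x1) (\<lambda>x1I x1II. tsum (\<rho> x2) (\<lambda>x2H x2A.
        tsum (\<rho> x3) (\<lambda>x3H x3A.
          (\<gamma> (starH x2H) \<cdot>\<^bsub>A\<^esub> (starH x3H \<triangleright> starA x1I)) \<otimes>
          (\<gamma> (starH x4) \<cdot>\<^bsub>A\<^esub> (starH x5 \<triangleright> starA (x1II \<cdot>\<^bsub>A\<^esub> x2A \<cdot>\<^bsub>A\<^esub> x3A)))))))"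
  shows "compact_quantum_group TYPE('v::complex_vector)
    (bismash A H act \<rho> \<chi> \<psi>) (bismash_star A starA H starH act \<gamma>)"
proof -
  interpret cocycle_linked_pair A H act \<rho> \<chi> \<psi> by (rule linked)
  have hopf: "star_hopf_algebra A starA" "star_hopf_algebra H starH"
    using cqg_A cqg_H by (simp_all add: compact_quantum_group_def)
  \<comment> \<open>\<gamma> is built from \<open>chi_inverse\<close>, so this particular inverse
    has to instantiate \<chi>'. For \<psi>' an arbitrary inverse is chosen.\<close>
  from inv_chi have chi': "is_chi_inverse A H \<chi> (chi_inverse A H \<chi>)"
    unfolding chi_invertible_def chi_inverse_def by (rule someI_ex)
  from inv_psi obtain \<psi>' where psi': "is_psi_inverse A H \<psi> \<psi>'"
    unfolding psi_invertible_def by blast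
  interpret A: star_hopf_algebra A starA by (rule hopf)
  interpret H: star_hopf_algebra H starH by (rule hopf)
  interpret star_linked_pair A H act \<rho> \<chi> \<psi> "chi_inverse A H \<chi>" \<psi>' starA starH \<gamma>
    by unfold_locales
      (fact chi' psi' cond_i cond_ii cond_iii cond_iv cond_v | simp add: gamma gamma_map_def)+
  interpret central_linked_pair A H act \<rho> \<chi> \<psi> "chi_inverse A H \<chi>" \<psi>' starA starH \<gamma> \<phi>A \<phi>H
    by unfold_locales (fact int_A int_H compact_quantum_group_inner_product[OF cqg_A int_A]
      compact_quantum_group_inner_product[OF cqg_H int_H] central[unfolded Phi])+
  show ?thesis by (rule compact_quantum_group_B)
qed

end
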